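(* Let $\mathcal{U}$ be a free ultrafilter on $\mathbb{N}$. There exists a sequence $(\mathcal{M}_n)_{n\in\mathbb{N}}$ of factorial $W^*$-bundles (over compact Hausdorff spaces $K_n$) whose tracial ultraproduct $\prod^{\mathcal{U}}\mathcal{M}_n$, as a $W^*$-bundle over the ultracoproduct $\sum^{\mathcal{U}}K_n$, is not factorial.
   Context: $T(A)$ denotes the set of all tracial states of a unital $C^*$-algebra $A$, with the weak$^*$ topology. A $W^*$-bundle over a compact Hausdorff space $K$ is a unital $C^*$-algebra $\mathcal{M}$ with a unital embedding of $C(K)$ in the center of $\mathcal{M}$ and a faithful unital conditional expectation $E\colon\mathcal{M}\to C(K)$ such that (1) $E(ab)=E(ba)$ for all $a,b\in\mathcal{M}$, and (2) the $C^*$-norm unit ball of $\mathcal{M}$ is complete with respect to the norm $\|a\|_{2,K}=\|E(a^*a)\|^{1/2}$. For a regular Borel probability measure $\mu\in\mathrm{Prob}(K)$, set $\tau_\mu(a)=\int_K E(a)\,d\mu$. The $W^*$-bundle $\mathcal{M}$ is factorial if $\{\tau_\mu:\mu\in\mathrm{Prob}(K)\}$ is a closed face of $T(\mathcal{M})$. Given $W^*$-bundles $\mathcal{M}_n$ over $K_n$ with conditional expectations $E_n$, the tracial ultraproduct is $$\prod\nolimits^{\mathcal{U}}\mathcal{M}_n=\Big(\prod_{n\in\mathbb{N}}\mathcal{M}_n\Big)\Big/\Big\{(a_n)_{n\in\mathbb{N}}:\lim_{n\to\mathcal{U}}\|a_n\|_{2,K_n}=0\Big\},$$ where $\prod_{n}\mathcal{M}_n$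 is the $C^*$-algebra of norm-bounded sequences. The ultracoproduct $\sum^{\mathcal{U}}K_n$ is the compact Hausdorff space with $C(\sum^{\mathcal{U}}K_n)\cong\prod_{\mathcal{U}}C(K_n)$, the latter being the $C^*$-norm ultraproduct (bounded sequences modulo those with $\lim_{n\to\mathcal{U}}\|f_n\|=0$). The tracial ultraproduct is a $W^*$-bundle over $\sum^{\mathcal{U}}K_n$ with the conditional expectation $E^{\mathcal{U}}((a_n)_n)=(E_n(a_n))_n$. *)

theory Defs
  imports "HOL-Probability.Probability" "HOL-Algebra.QuotRing" "HOL-Algebra.Module"
begin

section \<open>Unital C*-algebras with explicit carriers\<close>

definition complex_ring :: "complex ring" where
  "complex_ring = \<lparr>carrier = UNIV, mult = (*), one = 1, zero = 0, add = (+)\<rparr>"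

record 'a cstar = "(complex, 'a) module" +
  star :: "'a \<Rightarrow> 'a"
  cnorm :: "'a \<Rightarrow> real"

definition complete_in :: "('a, 'm) ring_scheme \<Rightarrow> ('a \<Rightarrow> real) \<Rightarrow> 'a set \<Rightarrow> bool" where
  "complete_in A \<nu> S \<longleftrightarrow>
     (\<forall>s :: nat \<Rightarrow> 'a. (\<forall>n. s n \<in> S) \<and>
        (\<forall>e>0. \<exists>N. \<forall>m\<ge>N. \<forall>n\<ge>N. \<nu> (s m \<ominus>\<^bsub>A\<^esub> s n) < e) \<longrightarrow>
        (\<exists>a\<in>S. (\<lambda>n. \<nu> (s n \<ominus>\<^bsub>A\<^esub> a)) \<longlonglongrightarrow> 0))"

locale cstar_algebra = ring A + module complex_ring A for A :: "('a, 'm) cstar_scheme" (structure) +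
  assumes smult_mult_left:
      "\<lbrakk>a \<in> carrier A; b \<in> carrier A\<rbrakk> \<Longrightarrow> (c \<odot> a) \<otimes> b = c \<odot> (a \<otimes> b)"
    and smult_mult_right:
      "\<lbrakk>a \<in> carrier A; b \<in> carrier A\<rbrakk> \<Longrightarrow> a \<otimes> (c \<odot> b) = c \<odot> (a \<otimes> b)"
    and star_closed: "a \<in> carrier A \<Longrightarrow> star A a \<in> carrier A"
    and star_star: "a \<in> carrier A \<Longrightarrow> star A (star A a) = a"
    and star_add:
      "\<lbrakk>a \<in> carrier A; b \<in> carrier A\<rbrakk> \<Longrightarrow> star A (a \<oplus> b) = star A a \<oplus> star A b"
    and star_smult: "a \<in> carrier A \<Longrightarrow> star A (c \<odot> a) = cnj c \<odot> star A a"
    and star_mult: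
      "\<lbrakk>a \<in> carrier A; b \<in> carrier A\<rbrakk> \<Longrightarrow> star A (a \<otimes> b) = star A b \<otimes> star A a"
    and cnorm_nonneg: "a \<in> carrier A \<Longrightarrow> 0 \<le> cnorm A a"
    and cnorm_eq_0: "a \<in> carrier A \<Longrightarrow> cnorm A a = 0 \<longleftrightarrow> a = \<zero>"
    and cnorm_triangle:
      "\<lbrakk>a \<in> carrier A; b \<in> carrier A\<rbrakk> \<Longrightarrow> cnorm A (a \<oplus> b) \<le> cnorm A a + cnorm A b"
    and cnorm_smult: "a \<in> carrier A \<Longrightarrow> cnorm A (c \<odot> a) = cmod c * cnorm A a"
    and cnorm_mult:
      "\<lbrakk>a \<in> carrier A; b \<in> carrier A\<rbrakk> \<Longrightarrow> cnorm A (a \<otimes> b) \<le> cnorm A a * cnorm A b"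
    and cstar_identity: "a \<in> carrier A \<Longrightarrow> cnorm A (star A a \<otimes> a) = (cnorm A a)\<^sup>2"
    and complete: "complete_in A (cnorm A) (carrier A)"

definition star_hom ::
  "('a, 'm) cstar_scheme \<Rightarrow> ('b, 'n) cstar_scheme \<Rightarrow> ('a \<Rightarrow> 'b) \<Rightarrow> bool" where
  "star_hom A B \<phi> \<longleftrightarrow> \<phi> \<in> ring_hom A B \<and>
     (\<forall>a\<in>carrier A. \<forall>c. \<phi> (c \<odot>\<^bsub>A\<^esub> a) = c \<odot>\<^bsub>B\<^esub> \<phi> a) \<and>
     (\<forall>a\<in>carrier A. \<phi> (star A a) = star B (\<phi> a))"

text \<open>Elements of the algebra of continuous functions on \<open>K\<close> are normalised to be \<open>0\<close> outside the
  space. Therefore the supremum over the whole type is the supremum norm (also when \<open>K\<close> is empty).\<close>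

definition cfun_algebra :: "'k topology \<Rightarrow> ('k \<Rightarrow> complex) cstar" where
  "cfun_algebra K =
    \<lparr>carrier = {f. continuous_map K euclidean f \<and> (\<forall>x. x \<notin> topspace K \<longrightarrow> f x = 0)},
     mult = (\<lambda>f g x. f x * g x),
     one = (\<lambda>x. if x \<in> topspace K then 1 else 0),
     zero = (\<lambda>x. 0),
     add = (\<lambda>f g x. f x + g x),
     smult = (\<lambda>c f x. c * f x),
     star = (\<lambda>f x. cnj (f x)),
     cnorm = (\<lambda>f. SUP x. cmod (f x))\<rparr>"

section \<open>Tracial states\<close>

text \<open>Functionals on \<open>A\<close> are normalised to be \<open>0\<close> outside the carrier, so that they are determined
  by their values on the carrier.\<close>

definition tracial_states :: "('a, 'm) cstar_scheme \<Rightarrow> ('a \<Rightarrow> complex) set" where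
  "tracial_states A = {\<tau>.
     (\<forall>a. a \<notin> carrier A \<longrightarrow> \<tau> a = 0) \<and>
     (\<forall>a\<in>carrier A. \<forall>b\<in>carrier A. \<tau> (a \<oplus>\<^bsub>A\<^esub> b) = \<tau> a + \<tau> b) \<and>
     (\<forall>a\<in>carrier A. \<forall>c. \<tau> (c \<odot>\<^bsub>A\<^esub> a) = c * \<tau> a) \<and>
     (\<forall>a\<in>carrier A. \<tau> (star A a \<otimes>\<^bsub>A\<^esub> a) \<in> \<real>\<^sub>\<ge>\<^sub>0) \<and>
     \<tau> \<one>\<^bsub>A\<^esub> = 1 \<and>
     (\<forall>a\<in>carrier A. \<forall>b\<in>carrier A. \<tau> (a \<otimes>\<^bsub>A\<^esub> b) = \<tau> (b \<otimes>\<^bsub>A\<^esub> a))}"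

text \<open>The library's \<open>face_of\<close> needs a real vector space type, which \<open>'a \<Rightarrow> complex\<close> is not.\<close>

definition mix :: "real \<Rightarrow> ('a \<Rightarrow> complex) \<Rightarrow> ('a \<Rightarrow> complex) \<Rightarrow> 'a \<Rightarrow> complex" where
  "mix t \<sigma> \<rho> = (\<lambda>a. of_real t * \<sigma> a + of_real (1 - t) * \<rho> a)"

definition is_face :: "('a \<Rightarrow> complex) set \<Rightarrow> ('a \<Rightarrow> complex) set \<Rightarrow> bool" where
  "is_face T F \<longleftrightarrow> F \<subseteq> T \<and>
     (\<forall>\<sigma>\<in>F. \<forall>\<rho>\<in>F. \<forall>t. 0 \<le> t \<and> t \<le> 1 \<longrightarrow> mix t \<sigma> \<rho> \<in> F) \<and>
     (\<forall>\<sigma>\<in>T. \<forall>\<rho>\<in>T. \<forall>t. 0 < t \<and> t < 1 \<and> mix t \<sigma> \<rho> \<in> F \<longrightarrow> \<sigma> \<in> F \<and> \<rho> \<in> F)"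

section \<open>W*-bundles\<close>

record ('a, 'k) wbundle =
  bundle_alg :: "'a cstar"
  base_space :: "'k topology"
  embed :: "('k \<Rightarrow> complex) \<Rightarrow> 'a"
  expect :: "'a \<Rightarrow> ('k \<Rightarrow> complex)"

definition two_norm :: "('a, 'k) wbundle \<Rightarrow> 'a \<Rightarrow> real" where
  "two_norm M a =
     sqrt (cnorm (cfun_algebra (base_space M)) (expect M (star (bundle_alg M) a \<otimes>\<^bsub>bundle_alg M\<^esub> a)))"

text \<open>Complete positivity is not listed among the properties of a conditional expectation: for a
  commutative target it is the same as positivity.\<close>

definition conditional_expectation :: "('a, 'k) wbundle \<Rightarrow> bool" where
  "conditional_expectation M \<longleftrightarrow>
     (let A = bundle_alg M; C = cfun_algebra (base_space M); E = expect M in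
      E \<in> carrier A \<rightarrow> carrier C \<and>
      (\<forall>a\<in>carrier A. \<forall>b\<in>carrier A. E (a \<oplus>\<^bsub>A\<^esub> b) = E a \<oplus>\<^bsub>C\<^esub> E b) \<and>
      (\<forall>a\<in>carrier A. \<forall>c. E (c \<odot>\<^bsub>A\<^esub> a) = c \<odot>\<^bsub>C\<^esub> E a) \<and>
      (\<forall>a\<in>carrier A. \<forall>x\<in>topspace (base_space M). E (star A a \<otimes>\<^bsub>A\<^esub> a) x \<in> \<real>\<^sub>\<ge>\<^sub>0) \<and>
      (\<forall>a\<in>carrier A. cnorm C (E a) \<le> cnorm A a) \<and>
      (\<forall>f\<in>carrier C. E (embed M f) = f) \<and>
      (\<forall>f\<in>carrier C. \<forall>a\<in>carrier A.
         E (embed M f \<otimes>\<^bsub>A\<^esub> a) = f \<otimes>\<^bsub>C\<^esub> E a \<and> E (a \<otimes>\<^bsub>A\<^esub> embed M f) = E a \<otimes>\<^bsub>C\<^esub> f))"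

definition wstar_bundle :: "('a, 'k) wbundle \<Rightarrow> bool" where
  "wstar_bundle M \<longleftrightarrow>
     (let A = bundle_alg M; C = cfun_algebra (base_space M); E = expect M in
      cstar_algebra A \<and>
      compact_space (base_space M) \<and> Hausdorff_space (base_space M) \<and>
      star_hom C A (embed M) \<and> inj_on (embed M) (carrier C) \<and>
      (\<forall>f\<in>carrier C. \<forall>a\<in>carrier A. embed M f \<otimes>\<^bsub>A\<^esub> a = a \<otimes>\<^bsub>A\<^esub> embed M f) \<and>
      conditional_expectation M \<and>
      E \<one>\<^bsub>A\<^esub> = \<one>\<^bsub>C\<^esub> \<and>
      (\<forall>a\<in>carrier A. E (star A a \<otimes>\<^bsub>A\<^esub> a) = \<zero>\<^bsub>C\<^esub> \<longrightarrow> a = \<zero>\<^bsub>A\<^esub>) \<and>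
      (\<forall>a\<in>carrier A. \<forall>b\<in>carrier A. E (a \<otimes>\<^bsub>A\<^esub> b) = E (b \<otimes>\<^bsub>A\<^esub> a)) \<and>
      complete_in A (two_norm M) {a \<in> carrier A. cnorm A a \<le> 1})"

definition regular_prob_measures :: "'k topology \<Rightarrow> 'k measure set" where
  "regular_prob_measures K = {\<mu>. prob_space \<mu> \<and> space \<mu> = topspace K \<and>
     sets \<mu> = sigma_sets (topspace K) {V. openin K V} \<and>
     (\<forall>B\<in>sets \<mu>.
        emeasure \<mu> B = (SUP L\<in>{L. L \<subseteq> B \<and> compactin K L \<and> L \<in> sets \<mu>}. emeasure \<mu> L) \<and>
        emeasure \<mu> B = (INF V\<in>{V. B \<subseteq> V \<and> openin K V}. emeasure \<mu> V))}"

definition bundle_trace :: "('a, 'k) wbundle \<Rightarrow> 'k measure \<Rightarrow> 'a \<Rightarrow> complex" where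
  "bundle_trace M \<mu> = (\<lambda>a. if a \<in> carrier (bundle_alg M) then (LINT x|\<mu>. expect M a x) else 0)"

text \<open>The topology on a set of functionals is induced by the topology of pointwise convergence on the
  function type; since functionals vanish outside the carrier, this is the weak* topology.\<close>

definition factorial_bundle :: "('a, 'k) wbundle \<Rightarrow> bool" where
  "factorial_bundle M \<longleftrightarrow>
     (let T = tracial_states (bundle_alg M); F = bundle_trace M ` regular_prob_measures (base_space M) in
      is_face T F \<and> closedin (top_of_set T) F)"

section \<open>Ultraproducts\<close>

definition free_ultrafilter :: "'i filter \<Rightarrow> bool" where
  "free_ultrafilter U \<longleftrightarrow> U \<noteq> bot \<and>
     (\<forall>P. eventually P U \<or> eventually (\<lambda>i. \<not> P i) U) \<and>
     (\<forall>i. eventually (\<lambda>j. j \<noteq> i) U)"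

definition bounded_product :: "(nat \<Rightarrow> 'a cstar) \<Rightarrow> (nat \<Rightarrow> 'a) cstar" where
  "bounded_product A =
    \<lparr>carrier = {a. (\<forall>n. a n \<in> carrier (A n)) \<and> bdd_above (range (\<lambda>n. cnorm (A n) (a n)))},
     mult = (\<lambda>a b n. a n \<otimes>\<^bsub>A n\<^esub> b n),
     one = (\<lambda>n. \<one>\<^bsub>A n\<^esub>),
     zero = (\<lambda>n. \<zero>\<^bsub>A n\<^esub>),
     add = (\<lambda>a b n. a n \<oplus>\<^bsub>A n\<^esub> b n),
     smult = (\<lambda>c a n. c \<odot>\<^bsub>A n\<^esub> a n),
     star = (\<lambda>a n. star (A n) (a n)),
     cnorm = (\<lambda>a. SUP n. cnorm (A n) (a n))\<rparr>"

text \<open>The map on cosets of \<open>J\<close> (or of another ideal) induced by a map \<open>f\<close> into \<open>A\<close>: if \<open>f\<close> respects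
  the ideals, then all the cosets in the union coincide.\<close>

definition coset_map ::
  "('a, 'm) ring_scheme \<Rightarrow> 'a set \<Rightarrow> ('b \<Rightarrow> 'a) \<Rightarrow> 'b set \<Rightarrow> 'a set" where
  "coset_map A J f X = (\<Union>x\<in>X. J +>\<^bsub>A\<^esub> f x)"

definition quotient_cstar :: "'a cstar \<Rightarrow> 'a set \<Rightarrow> 'a set cstar" where
  "quotient_cstar A J =
    \<lparr>carrier = carrier (A Quot J),
     mult = mult (A Quot J),
     one = one (A Quot J),
     zero = zero (A Quot J),
     add = add (A Quot J),
     smult = (\<lambda>c. coset_map A J (smult A c)),
     star = coset_map A J (star A),
     cnorm = (\<lambda>X. INF a\<in>X. cnorm A a)\<rparr>"

definition norm_null :: "nat filter \<Rightarrow> (nat \<Rightarrow> 'a cstar) \<Rightarrow> (nat \<Rightarrow> 'a) set" where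
  "norm_null U A =
     {a \<in> carrier (bounded_product A). ((\<lambda>n. cnorm (A n) (a n)) \<longlongrightarrow> 0) U}"

definition norm_ultraproduct :: "nat filter \<Rightarrow> (nat \<Rightarrow> 'a cstar) \<Rightarrow> (nat \<Rightarrow> 'a) set cstar" where
  "norm_ultraproduct U A = quotient_cstar (bounded_product A) (norm_null U A)"

definition characters :: "('a, 'm) cstar_scheme \<Rightarrow> ('a \<Rightarrow> complex) set" where
  "characters A = {h. h \<in> ring_hom A complex_ring \<and>
     (\<forall>a\<in>carrier A. \<forall>c. h (c \<odot>\<^bsub>A\<^esub> a) = c * h a) \<and>
     (\<forall>a. a \<notin> carrier A \<longrightarrow> h a = 0)}"

definition gelfand :: "('a, 'm) cstar_scheme \<Rightarrow> 'a \<Rightarrow> ('a \<Rightarrow> complex) \<Rightarrow> complex" where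
  "gelfand A a = (\<lambda>h. if h \<in> characters A then h a else 0)"

text \<open>The ultracoproduct is realised as the character space, with the weak* topology, of the norm
  ultraproduct of the algebras of continuous functions. The isomorphism of that ultraproduct with
  the algebra of continuous functions on the ultracoproduct is then the Gelfand transform.\<close>

definition cfun_ultraproduct ::
  "nat filter \<Rightarrow> (nat \<Rightarrow> 'k topology) \<Rightarrow> (nat \<Rightarrow> 'k \<Rightarrow> complex) set cstar" where
  "cfun_ultraproduct U K = norm_ultraproduct U (\<lambda>n. cfun_algebra (K n))"

definition ultracoproduct ::
  "nat filter \<Rightarrow> (nat \<Rightarrow> 'k topology) \<Rightarrow> ((nat \<Rightarrow> 'k \<Rightarrow> complex) set \<Rightarrow> complex) topology" where
  "ultracoproduct U K = top_of_set (characters (cfun_ultraproduct U K))"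

definition tracial_null :: "nat filter \<Rightarrow> (nat \<Rightarrow> ('a, 'k) wbundle) \<Rightarrow> (nat \<Rightarrow> 'a) set" where
  "tracial_null U M =
     {a \<in> carrier (bounded_product (\<lambda>n. bundle_alg (M n))). ((\<lambda>n. two_norm (M n) (a n)) \<longlongrightarrow> 0) U}"

definition tracial_ultraproduct ::
  "nat filter \<Rightarrow> (nat \<Rightarrow> ('a, 'k) wbundle) \<Rightarrow>
     ((nat \<Rightarrow> 'a) set, (nat \<Rightarrow> 'k \<Rightarrow> complex) set \<Rightarrow> complex) wbundle" where
  "tracial_ultraproduct U M =
     (let P = bounded_product (\<lambda>n. bundle_alg (M n));
          K = (\<lambda>n. base_space (M n));
          C = cfun_ultraproduct U K
      in
    \<lparr>bundle_alg = quotient_cstar P (tracial_null U M),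
     base_space = ultracoproduct U K,
     embed = (\<lambda>f. coset_map P (tracial_null U M) (\<lambda>g n. embed (M n) (g n))
                    (inv_into (carrier C) (gelfand C) f)),
     expect = (\<lambda>X. gelfand C
                    (coset_map (bounded_product (\<lambda>n. cfun_algebra (K n)))
                       (norm_null U (\<lambda>n. cfun_algebra (K n))) (\<lambda>a n. expect (M n) (a n)) X))\<rparr>)"

text \<open>HOL cannot quantify existentially over types, so the bundles live in fixed universes: the
  points of the base spaces are taken from the type \<open>point\<close> of infinite complex matrices and the
  elements of the algebras from the type of matrix-valued functions on it. The topologies and the
  algebraic operations are arbitrary, so only the cardinalities of the two types matter.\<close>

type_synonym point = "nat \<Rightarrow> nat \<Rightarrow> complex"
type_synonym element = "point \<Rightarrow> nat \<Rightarrow> nat \<Rightarrow> complex"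

end

theory Submission
  imports Defs "HOL-Homology.Homology" "HOL-Library.Z2"
begin


text \<open>Let \<open>L\<close> be the complexified tautological line bundle over the real projective space of dimension
  \<open>n\<close>, and let \<open>M n\<close> be the algebra of sections of \<open>End(1 + L)\<close> with the normalised fibrewise trace as
  \<open>E\<close>. Sections of \<open>L\<close> are odd functions on the sphere. The odd coordinate functions \<open>s i\<close> satisfy
  \<open>\<Sum>i. (s i)\<^sup>2 = 1\<close>, so every trace \<open>\<tau>\<close> takes the same value on the two diagonal entries; hence
  \<open>\<tau> = \<tau> \<circ> E\<close>, and \<open>\<tau>\<close> comes from a measure by the Riesz representation theorem: \<open>M n\<close> is factorial.

  On \<open>M n\<close> the C*-norm is at most \<open>sqrt 2\<close> times the uniform 2-norm, so the tracial ultraproduct is the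
  norm ultraproduct. By the Borsuk-Ulam theorem, finitely many sections of \<open>L\<close> have a common zero as soon
  as \<open>n\<close> is large. By compactness there is a point \<open>h\<close> of the ultracoproduct at which all the (sequences
  of) sections of \<open>L\<close> vanish. The fibre of the ultraproduct over \<open>h\<close> is then diagonal, the trace
  \<open>a \<mapsto> E a h\<close> is the average of the two diagonal entries at \<open>h\<close>, which are traces themselves, and these
  two traces are not integrals of \<open>E\<close>: they differ on the diagonal projection \<open>p\<close>, where \<open>E p = 1 / 2\<close>.\<close>

section \<open>Common zeros of odd functions\<close>

text \<open>For a single \<open>n\<close> the exchange of the two diagonal corners is a sum of
  \<open>n + 1\<close> commutators, one for each coordinate function. A bounded number of uniformly
  bounded commutators would survive in the ultraproduct, so the construction must force this number
  to grow. Borsuk-Ulam does so: \<open>k\<close> complex sections of \<open>L\<close> are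
  \<open>2 * k\<close> real odd functions and vanish together somewhere as soon as
  \<open>n \<ge> 2 * k\<close>. Hence the dimension of the base grows along the sequence while the
  fibres stay 2 x 2. The fixed fibre size in turn gives one norm constant for all \<open>n\<close>:
  \<open>E\<close> of \<open>star a\<close> times \<open>a\<close> is half of the squared Frobenius
  norm, which dominates the squared operator norm; this is the origin of \<open>sqrt 2\<close>. With
  it no sequence is killed in the tracial ultraproduct that is not already null in norm, and
  evaluation at a point of the ultracoproduct can be handled by characters. The property refuted at
  the end is the face property: the point trace at \<open>h\<close> is the midpoint of two traces
  that are no integrals of \<open>E\<close>.\<close>

lemma bit_add_self [simp]: "x + x = (0::bit)"
  by (metis mult_2 bit_2_eq_0 mult_zero_left)

lemma bit_minus [simp]: "- x = (x::bit)"
  by (metis add_eq_0_iff bit_add_self)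

section \<open>Cup products of coboundaries of 0-cochains, with coefficients mod 2\<close>

definition skip :: "nat \<Rightarrow> nat \<Rightarrow> nat" where
  "skip i j = (if j < i then j else Suc j)"

text \<open>The Alexander-Whitney product of the coboundaries of \<open>e k\<close>, ...,
  \<open>e (k + p - 1)\<close>, evaluated on a simplex with ordered vertices \<open>x 0\<close>,
  ..., \<open>x p\<close>. Working with vertex sequences keeps this algebra apart from singular
  simplices; precomposition with \<open>skip i\<close> is the passage to the i-th face.\<close>

primrec cup :: "(nat \<Rightarrow> 'a \<Rightarrow> bit) \<Rightarrow> nat \<Rightarrow> nat \<Rightarrow> (nat \<Rightarrow> 'a) \<Rightarrow> bit" where
  "cup e k 0 x = 1"
| "cup e k (Suc p) x = (e k (x 0) + e k (x 1)) * cup e (Suc k) p (x \<circ> Suc)"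

lemma skip_0: "x \<circ> skip 0 = x \<circ> Suc"
  by (auto simp: skip_def)

lemma skip_Suc_Suc: "x \<circ> skip (Suc i) \<circ> Suc = (x \<circ> Suc) \<circ> skip i"
  by (auto simp: skip_def)

lemma skip_1: "x \<circ> skip (Suc 0) \<circ> Suc = (x \<circ> Suc) \<circ> Suc"
  by (auto simp: skip_def)

text \<open>Faces 0 and 1 have the same tail, and their leading factors add up, mod 2, to the factor
  of the edge from \<open>x 0\<close> to \<open>x 1\<close>. All other faces contain that edge. So
  this factor splits off and the cocycle identity for the tail remains.\<close>

lemma cup_cocycle: "(\<Sum>i\<le>Suc p. cup e k p (x \<circ> skip i)) = 0"
proof (induction p arbitrary: k x)
  case (Suc p)
  let ?y = "x \<circ> Suc"
  have *: "cup e k (Suc p) (x \<circ> skip (Suc (Suc i)))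
      = (e k (x 0) + e k (x 1)) * cup e (Suc k) p (?y \<circ> skip (Suc i))" for i
    by (simp add: skip_Suc_Suc) (simp add: skip_def)
  have "(\<Sum>i\<le>Suc (Suc p). cup e k (Suc p) (x \<circ> skip i))
    = cup e k (Suc p) (x \<circ> skip 0) + cup e k (Suc p) (x \<circ> skip (Suc 0))
        + (\<Sum>i\<le>p. cup e k (Suc p) (x \<circ> skip (Suc (Suc i))))"
    by (simp only: sum.atMost_Suc_shift add.assoc)
  also have "cup e k (Suc p) (x \<circ> skip 0) + cup e k (Suc p) (x \<circ> skip (Suc 0))
     = (e k (x 0) + e k (x 1)) * cup e (Suc k) p (?y \<circ> skip 0) + (e k (x 2) + e k (x 2)) * cup e (Suc k) p (?y \<circ> skip 0)"
  proof -
    have "cup e k (Suc p) (x \<circ> skip 0) = (e k (x 1) + e k (x 2)) * cup e (Suc k) p (?y \<circ> skip 0)"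
      by (simp only: cup.simps skip_0) (simp only: o_def One_nat_def numeral_2_eq_2)
    moreover have "cup e k (Suc p) (x \<circ> skip (Suc 0)) = (e k (x 0) + e k (x 2)) * cup e (Suc k) p (?y \<circ> skip 0)"
      by (simp only: cup.simps skip_0 skip_1) (simp only: o_def One_nat_def numeral_2_eq_2 skip_def
          zero_less_Suc if_True less_irrefl if_False)
    moreover have "(b + c) * w + (a + c) * w = (a + b) * w + (c + c) * w" for a b c w :: bit
      by (simp only: algebra_simps)
    ultimately show ?thesis by simp
  qed
  also have "\<dots> + (\<Sum>i\<le>p. cup e k (Suc p) (x \<circ> skip (Suc (Suc i))))
      = (e k (x 0) + e k (x 1)) * (\<Sum>i\<le>Suc p. cup e (Suc k) p (?y \<circ> skip i))"
    by (simp only: * bit_add_self mult_zero_left add_0_right sum.atMost_Suc_shift distrib_left sum_distrib_left)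
  also have "\<dots> = 0"
    by (simp only: Suc.IH mult_zero_right)
  finally show ?case .
qed (simp)

text \<open>The Leibniz rule: the remaining factors form a cocycle, so only the coboundary of
  \<open>e k\<close> survives. This exhibits the product as the coboundary of \<open>e k\<close>
  times the rest.\<close>

lemma cup_coboundary:
  "(\<Sum>i\<le>Suc p. e k ((x \<circ> skip i) 0) * cup e (Suc k) p (x \<circ> skip i)) = cup e k (Suc p) x"
proof -
  let ?c = "\<lambda>i. cup e (Suc k) p (x \<circ> skip i)"
  have 1: "(\<Sum>i\<le>p. ?c (Suc i)) = ?c 0"
    using cup_cocycle[of e "Suc k" p x] by (simp only: sum.atMost_Suc_shift) (metis add_eq_0_iff bit_minus)
  have "(\<Sum>i\<le>Suc p. e k ((x \<circ> skip i) 0) * ?c i)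
     = e k (x 1) * ?c 0 + (\<Sum>i\<le>p. e k (x 0) * ?c (Suc i))"
    by (simp only: sum.atMost_Suc_shift) (simp add: skip_def)
  also have "\<dots> = (e k (x 0) + e k (x 1)) * ?c 0"
    by (simp only: 1 flip: sum_distrib_left) (simp only: algebra_simps)
  finally show ?thesis by (simp add: skip_0)
qed

text \<open>Each factor is a sum of two values, both of which change by 1. So the product is
  invariant under \<open>T\<close> although no single \<open>e i\<close> is.\<close>

lemma cup_flip:
  assumes "\<And>i j. j \<le> p \<Longrightarrow> e i (T (x j)) = e i (x j) + 1"
  shows "cup e k p (T \<circ> x) = cup e k p x"
  using assms
proof (induction p arbitrary: k x)
  case (Suc p)
  have "e k (T (x 0)) + e k (T (x 1)) = e k (x 0) + e k (x 1) + (1 + 1)"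
    using Suc.prems[of 0 k] Suc.prems[of 1 k] by (simp only: algebra_simps)
  moreover have "cup e (Suc k) p (T \<circ> (x \<circ> Suc)) = cup e (Suc k) p (x \<circ> Suc)"
    by (rule Suc.IH) (simp add: Suc.prems)
  ultimately show ?case
    by (simp only: cup.simps comp_assoc bit_add_self add_0_right) (simp only: comp_apply)
qed simp

lemma cup_eq_0:
  assumes "i < p" "e (k + i) (x i) = e (k + i) (x (Suc i))"
  shows "cup e k p x = 0"
  using assms
proof (induction p arbitrary: k x i)
  case (Suc p)
  then show ?case by (cases i) auto
qed simp

section \<open>Mod 2 cochains evaluated on integral singular chains\<close>

definition pair :: "('b \<Rightarrow> bit) \<Rightarrow> ('b \<Rightarrow>\<^sub>0 int) \<Rightarrow> bit" where
  "pair \<phi> c = (\<Sum>\<sigma>\<in>Poly_Mapping.keys c. of_int (Poly_Mapping.lookup c \<sigma>) * \<phi> \<sigma>)"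

lemma pair_superset:
  "finite S \<Longrightarrow> Poly_Mapping.keys c \<subseteq> S \<Longrightarrow>
    pair \<phi> c = (\<Sum>\<sigma>\<in>S. of_int (Poly_Mapping.lookup c \<sigma>) * \<phi> \<sigma>)"
  unfolding pair_def by (rule sum.mono_neutral_left) (auto simp: in_keys_iff)

lemma pair_0 [simp]: "pair \<phi> 0 = 0"
  by (simp add: pair_def)

lemma pair_of [simp]: "pair \<phi> (frag_of x) = \<phi> x"
  unfolding pair_def by (simp only: keys_frag_of lookup_frag_of sum.insert finite.emptyI empty_iff not_False_eq_True sum.empty)
    (simp only: of_int_1 mult_1_left add_0_right refl if_True)

lemma pair_diff: "pair \<phi> (a - b) = pair \<phi> a - pair \<phi> b"
proof -
  let ?S = "Poly_Mapping.keys a \<union> Poly_Mapping.keys b"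
  have "pair \<phi> (a - b) = (\<Sum>\<sigma>\<in>?S. of_int (Poly_Mapping.lookup (a - b) \<sigma>) * \<phi> \<sigma>)"
    by (rule pair_superset) (auto simp: keys_diff)
  moreover have "pair \<phi> a = (\<Sum>\<sigma>\<in>?S. of_int (Poly_Mapping.lookup a \<sigma>) * \<phi> \<sigma>)"
    by (rule pair_superset) auto
  moreover have "pair \<phi> b = (\<Sum>\<sigma>\<in>?S. of_int (Poly_Mapping.lookup b \<sigma>) * \<phi> \<sigma>)"
    by (rule pair_superset) auto
  ultimately show ?thesis
    by (simp only: lookup_minus of_int_diff left_diff_distrib sum_subtractf)
qed

lemma pair_add: "pair \<phi> (a + b) = pair \<phi> a + pair \<phi> b"
  using pair_diff[of \<phi> "a" "0 - b"] pair_diff[of \<phi> 0 b] by simp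

lemma pair_sum: "finite I \<Longrightarrow> pair \<phi> (sum f I) = (\<Sum>i\<in>I. pair \<phi> (f i))"
  by (induction I rule: finite_induct) (auto simp: pair_add)

lemma pair_sign: "pair \<phi> (frag_cmul ((-1) ^ n) c) = pair \<phi> c"
proof (cases "even n")
  case False
  have "pair \<phi> (- c) = pair \<phi> c"
    using pair_diff[of \<phi> 0 c] by simp
  with False show ?thesis by simp
qed simp

lemma pair_cong:
  "(\<And>\<sigma>. \<sigma> \<in> Poly_Mapping.keys c \<Longrightarrow> \<phi> \<sigma> = \<psi> \<sigma>) \<Longrightarrow> pair \<phi> c = pair \<psi> c"
  by (simp add: pair_def)

lemma pair_fun_add: "pair (\<lambda>\<sigma>. \<phi> \<sigma> + \<psi> \<sigma>) c = pair \<phi> c + pair \<psi> c"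
  by (simp only: pair_def distrib_left sum.distrib)

text \<open>Boundary and coboundary are transposes of each other. The alternating signs disappear
  mod 2, which leaves a plain sum over the faces.\<close>

lemma pair_chain_boundary:
  "pair \<phi> (chain_boundary (Suc p) c) = pair (\<lambda>\<sigma>. \<Sum>k\<le>Suc p. \<phi> (singular_face (Suc p) k \<sigma>)) c"
proof (rule frag_induction[of c UNIV])
  fix \<sigma> :: "(nat \<Rightarrow> real) \<Rightarrow> 'a"
  show "pair \<phi> (chain_boundary (Suc p) (frag_of \<sigma>))
      = pair (\<lambda>\<sigma>. \<Sum>k\<le>Suc p. \<phi> (singular_face (Suc p) k \<sigma>)) (frag_of \<sigma>)"
    by (simp add: chain_boundary_def pair_sum pair_sign pair_add del: sum.atMost_Suc)
qed (auto simp: chain_boundary_diff pair_diff)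

lemma pair_chain_map: "pair \<phi> (chain_map p g c) = pair (\<phi> \<circ> simplex_map p g) c"
  by (rule frag_induction[of c UNIV]) (auto simp: chain_map_diff pair_diff)

section \<open>Cup products on singular simplices, and chains modelled on hemispheres\<close>

definition vert :: "nat \<Rightarrow> nat \<Rightarrow> real" where
  "vert j = (\<lambda>i. if i = j then 1 else 0)"

lemma vert_in: "j \<le> p \<Longrightarrow> vert j \<in> standard_simplex p"
  unfolding vert_def by (simp add: basis_in_standard_simplex)

lemma face_vert: "simplical_face k (vert j) = vert (skip k j)"
  by (auto simp: simplical_face_def vert_def skip_def fun_eq_iff)

lemma cup_cong:
  "(\<And>j. j \<le> p \<Longrightarrow> x j = y j) \<Longrightarrow> cup e k p x = cup e k p y"
proof (induction p arbitrary: k x y)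
  case (Suc p)
  have "cup e (Suc k) p (x \<circ> Suc) = cup e (Suc k) p (y \<circ> Suc)"
    by (rule Suc.IH) (simp add: Suc.prems)
  then show ?case using Suc.prems[of 0] Suc.prems[of 1] by simp
qed simp

definition cupsx :: "(nat \<Rightarrow> 'a \<Rightarrow> bit) \<Rightarrow> nat \<Rightarrow> nat \<Rightarrow> ((nat \<Rightarrow> real) \<Rightarrow> 'a) \<Rightarrow> bit" where
  "cupsx e k p \<sigma> = cup e k p (\<sigma> \<circ> vert)"

lemma cupsx_face:
  "i \<le> Suc p \<Longrightarrow> cupsx e k p (singular_face (Suc p) i \<sigma>) = cup e k p (\<sigma> \<circ> vert \<circ> skip i)"
  unfolding cupsx_def by (rule cup_cong) (simp add: singular_face_def vert_in face_vert)

lemma singular_simplex_vert: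
  "singular_simplex p X \<sigma> \<Longrightarrow> j \<le> p \<Longrightarrow> \<sigma> (vert j) \<in> topspace X"
  using vert_in[of j p] by (auto simp: singular_simplex_def continuous_map_def Pi_iff)

lemma cupsx_map:
  assumes "\<And>i x. x \<in> topspace X \<Longrightarrow> e i (T x) = e i x + 1" and "singular_simplex p X \<sigma>"
  shows "cupsx e k p (simplex_map p T \<sigma>) = cupsx e k p \<sigma>"
proof -
  have "cupsx e k p (simplex_map p T \<sigma>) = cup e k p (T \<circ> (\<sigma> \<circ> vert))"
    unfolding cupsx_def by (rule cup_cong) (simp add: simplex_map_def vert_in)
  also have "\<dots> = cup e k p (\<sigma> \<circ> vert)"
    by (rule cup_flip) (simp add: assms(1) singular_simplex_vert[OF assms(2)])
  finally show ?thesis by (simp only: cupsx_def)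
qed

text \<open>The model is the cell structure of a sphere with two cells in each dimension:
  \<open>d p\<close> is a hemisphere of dimension \<open>p\<close>, and the boundary of the next one
  is the sphere made of \<open>d p\<close> and its image under \<open>T\<close>. The sign
  \<open>(-1) ^ Suc p\<close> makes that sum a cycle. The single simplex in degree 0 is what makes
  the later count equal to 1 mod 2.\<close>

definition flip_chains :: "'a topology \<Rightarrow> ('a \<Rightarrow> 'a) \<Rightarrow> nat \<Rightarrow> (nat \<Rightarrow> 'a chain) \<Rightarrow> bool" where
  "flip_chains X T n d \<longleftrightarrow> (\<forall>p\<le>n. singular_chain p X (d p)) \<and> (\<exists>\<sigma>. d 0 = frag_of \<sigma>) \<and>
    (\<forall>p<n. chain_boundary (Suc p) (d (Suc p)) = d p + frag_cmul ((-1) ^ Suc p) (chain_map p T (d p)))"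

text \<open>The cup product of the cocycles \<open>\<delta>(e k)\<close>, which are invariant under \<open>T\<close>, is the coboundary of
  \<open>e k\<close> times the remaining factors, and the values of \<open>e k\<close> at \<open>x\<close> and \<open>T x\<close> add up to \<open>1\<close>.\<close>

lemma pair_flip_chains:
  assumes e: "\<And>i x. x \<in> topspace X \<Longrightarrow> e i (T x) = e i x + 1" and d: "flip_chains X T n d" and "p \<le> n"
  shows "pair (cupsx e k p) (d p) = 1"
  using \<open>p \<le> n\<close>
proof (induction p arbitrary: k)
  case 0
  from d obtain \<sigma> where "d 0 = frag_of \<sigma>" by (auto simp: flip_chains_def)
  then show ?case by (simp add: cupsx_def)
next
  case (Suc p)
  define \<psi> where "\<psi> \<tau> = e k (\<tau> (vert 0)) * cupsx e (Suc k) p \<tau>" for \<tau>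
  have face: "\<psi> (singular_face (Suc p) i \<sigma>)
      = e k ((\<sigma> \<circ> vert \<circ> skip i) 0) * cup e (Suc k) p (\<sigma> \<circ> vert \<circ> skip i)" if "i \<le> Suc p" for i \<sigma>
    using that by (simp add: \<psi>_def cupsx_face) (simp add: singular_face_def vert_in face_vert)
  have "cupsx e k (Suc p) \<sigma> = (\<Sum>i\<le>Suc p. \<psi> (singular_face (Suc p) i \<sigma>))" for \<sigma>
  proof -
    have "(\<Sum>i\<le>Suc p. \<psi> (singular_face (Suc p) i \<sigma>))
       = (\<Sum>i\<le>Suc p. e k ((\<sigma> \<circ> vert \<circ> skip i) 0) * cup e (Suc k) p (\<sigma> \<circ> vert \<circ> skip i))"
      by (rule sum.cong) (auto simp: face)
    then show ?thesis by (simp only: cup_coboundary cupsx_def)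
  qed
  then have "pair (cupsx e k (Suc p)) (d (Suc p)) = pair \<psi> (chain_boundary (Suc p) (d (Suc p)))"
    by (simp add: pair_chain_boundary del: sum.atMost_Suc cong: pair_cong)
  also have "\<dots> = pair \<psi> (d p) + pair (\<psi> \<circ> simplex_map p T) (d p)"
    using d Suc.prems by (simp only: flip_chains_def Suc_le_eq pair_add pair_sign pair_chain_map)
  also have "\<dots> = pair (\<lambda>\<sigma>. \<psi> \<sigma> + (\<psi> \<circ> simplex_map p T) \<sigma>) (d p)"
    by (simp only: pair_fun_add)
  also have "\<dots> = pair (cupsx e (Suc k) p) (d p)"
  proof (rule pair_cong)
    fix \<sigma> assume "\<sigma> \<in> Poly_Mapping.keys (d p)"
    moreover have "singular_chain p X (d p)"
      using d Suc.prems unfolding flip_chains_def by simp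
    ultimately have \<sigma>: "singular_simplex p X \<sigma>"
      by (auto simp: singular_chain_def)
    have "simplex_map p T \<sigma> (vert 0) = T (\<sigma> (vert 0))"
      by (simp add: simplex_map_def vert_in)
    moreover have "e k (T (\<sigma> (vert 0))) = e k (\<sigma> (vert 0)) + 1"
      by (rule e[OF singular_simplex_vert[OF \<sigma> le0]])
    moreover have "cupsx e (Suc k) p (simplex_map p T \<sigma>) = cupsx e (Suc k) p \<sigma>"
      by (rule cupsx_map[where X=X]) (use e \<sigma> in blast)+
    ultimately have "\<psi> \<sigma> + (\<psi> \<circ> simplex_map p T) \<sigma>
        = (e k (\<sigma> (vert 0)) + e k (\<sigma> (vert 0)) + 1) * cupsx e (Suc k) p \<sigma>"
      by (simp only: \<psi>_def algebra_simps o_apply)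
    then show "\<psi> \<sigma> + (\<psi> \<circ> simplex_map p T) \<sigma> = cupsx e (Suc k) p \<sigma>"
      by (simp only: bit_add_self mult_1_left add_0_left)
  qed
  also have "pair (cupsx e (Suc k) p) (d p) = 1"
    using Suc by simp
  finally show ?case .
qed

text \<open>Barycentric subdivision is a natural chain map, which preserves the boundary relation,
  and it fixes 0-chains, which keeps \<open>d 0\<close> a single simplex.\<close>

lemma flip_chains_subdivision:
  assumes "flip_chains X T n d" and "continuous_map X X T"
  shows "flip_chains X T n (\<lambda>p. singular_subdivision p (d p))"
  unfolding flip_chains_def
proof (intro conjI allI impI)
  show "singular_chain p X (singular_subdivision p (d p))" if "p \<le> n" for p
    using assms that by (auto simp: flip_chains_def singular_chain_singular_subdivision)
  show "\<exists>\<sigma>. singular_subdivision 0 (d 0) = frag_of \<sigma>"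
    using assms(1) singular_subdivision_zero[of X "d 0"] by (auto simp: flip_chains_def)
  show "chain_boundary (Suc p) (singular_subdivision (Suc p) (d (Suc p)))
      = singular_subdivision p (d p)
        + frag_cmul ((- 1) ^ Suc p) (chain_map p T (singular_subdivision p (d p)))" if "p < n" for p
  proof -
    have "singular_chain (Suc p) X (d (Suc p))" and dp: "singular_chain p X (d p)"
      using assms that by (auto simp: flip_chains_def)
    then have "chain_boundary (Suc p) (singular_subdivision (Suc p) (d (Suc p)))
       = singular_subdivision p (d p + frag_cmul ((-1) ^ Suc p) (chain_map p T (d p)))"
      using assms(1) that by (simp add: chain_boundary_singular_subdivision[of _ X] flip_chains_def del: power_Suc)
    also have "\<dots> = singular_subdivision p (d p)
        + frag_cmul ((- 1) ^ Suc p) (singular_subdivision p (chain_map p T (d p)))"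
      by (simp add: singular_subdivision_def frag_extend_add frag_extend_cmul)
    also have "singular_subdivision p (chain_map p T (d p)) = chain_map p T (singular_subdivision p (d p))"
      using naturality_singular_subdivision[OF dp] .
    finally show ?thesis .
  qed
qed

text \<open>Since \<open>T\<close> is an involution, \<open>d n\<close> plus its signed image is a
  cycle \<open>z\<close>; vanishing of the reduced homology in degree \<open>n\<close> fills it, and
  the filling is the next chain.\<close>

lemma flip_chains_exist:
  assumes T: "continuous_map X X T" and TT: "\<And>x. x \<in> topspace X \<Longrightarrow> T (T x) = x"
    and ne: "topspace X \<noteq> {}" and triv: "\<And>p. p < n \<Longrightarrow> trivial_group (reduced_homology_group (int p) X)"
  shows "\<exists>d. flip_chains X T n d"
  using triv
proof (induction n)
  case 0
  obtain x0 where x0: "x0 \<in> topspace X" using ne by blast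
  have "singular_simplex 0 X (\<lambda>v\<in>standard_simplex 0. x0)"
    using x0 by (simp add: singular_simplex_def)
  then have "flip_chains X T 0 (\<lambda>_. frag_of (\<lambda>v\<in>standard_simplex 0. x0))"
    by (auto simp: flip_chains_def singular_chain_of)
  then show ?case by blast
next
  case (Suc n)
  then obtain d where d: "flip_chains X T n d" by auto
  define z where "z = d n + frag_cmul ((-1) ^ Suc n) (chain_map n T (d n))"
  have dn: "singular_chain n X (d n)" using d by (auto simp: flip_chains_def)
  have Tdn: "singular_chain n X (chain_map n T (d n))"
    by (rule singular_chain_chain_map[OF dn T])
  have z: "singular_chain n X z"
    unfolding z_def by (intro singular_chain_add singular_chain_cmul dn Tdn)
  have TTc: "chain_map p T (chain_map p T c) = c" if "singular_chain p X c" for p c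
  proof -
    have "chain_map p T (chain_map p T c) = chain_map p (T \<circ> T) c"
      by (simp add: chain_map_compose)
    also have "\<dots> = c" using chain_map_id_gen[OF that, of "T \<circ> T"] TT by simp
    finally show ?thesis .
  qed
  have "chain_boundary n z = 0"
  proof (cases n)
    case 0
    then show ?thesis by (simp add: chain_boundary_def)
  next
    case (Suc m)
    have bd: "chain_boundary n (d n) = d m + frag_cmul ((-1) ^ n) (chain_map m T (d m))"
      using d Suc by (auto simp: flip_chains_def)
    have dm: "singular_chain m X (d m)" using d Suc by (auto simp: flip_chains_def)
    have "chain_boundary n z = chain_boundary n (d n)
        + frag_cmul ((-1) ^ Suc n) (chain_map m T (chain_boundary n (d n)))"
      using chain_boundary_chain_map[OF dn, of T] Suc
      by (simp add: z_def chain_boundary_add chain_boundary_cmul)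
    also have "\<dots> = 0"
      by (cases "even n") (simp_all add: bd chain_map_add chain_map_cmul chain_map_diff TTc[OF dm])
    finally show ?thesis .
  qed
  then have cyc: "singular_relcycle n X {} z" by (simp add: singular_cycle z)
  have cmU: "continuous_map X (discrete_topology {()}) (\<lambda>x. ())" by simp
  \<comment> \<open>Reduced homology is the kernel of the map induced by \<open>X\<close> to a
    point, so the image of \<open>z\<close> has to bound there. In degree 0 the two simplices of
    \<open>z\<close> become equal and cancel; in positive degree every cycle of a one-point space is
    a boundary.\<close>
  have bz: "singular_relboundary n (discrete_topology {()}) {} (chain_map n (\<lambda>x. ()) z)"
  proof (cases "n = 0")
    case True
    obtain \<sigma> where "d 0 = frag_of \<sigma>" using d by (auto simp: flip_chains_def)
    then have "chain_map n (\<lambda>x. ()) z = 0"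
      using True by (simp add: z_def chain_map_add chain_map_diff simplex_map_def o_def)
    then show ?thesis by simp
  next
    case False
    have "singular_relcycle n (discrete_topology {()}) {} (chain_map n (\<lambda>x. ()) z)"
      using singular_relcycle_chain_map[OF cyc cmU] by simp
    then show ?thesis using singular_boundary_eq_cycle_singleton[of "discrete_topology {()}" "()" n] False by simp
  qed
  have "homologous_rel_set n X {} z \<in> carrier (reduced_homology_group (int n) X)"
    using cyc bz cmU
    by (auto simp: carrier_reduced_homology_group kernel_def carrier_relative_homology_group
        hom_induced_chain_map homologous_rel_set_eq_relboundary)
  moreover have "trivial_group (reduced_homology_group (int n) X)" using Suc.prems by simp
  ultimately have "homologous_rel_set n X {} z = singular_relboundary_set n X {}"
    by (auto simp: trivial_group_def one_reduced_homology_group)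
  then have "singular_relboundary n X {} z" by (simp only: homologous_rel_set_eq_relboundary)
  then obtain c where c: "singular_chain (Suc n) X c" "chain_boundary (Suc n) c = z"
    by (auto simp: singular_boundary)
  have "flip_chains X T (Suc n) (d(Suc n := c))"
    using d c by (auto simp: flip_chains_def le_Suc_eq less_Suc_eq z_def)
  then show ?case by blast
qed

text \<open>A form of the Borsuk-Ulam theorem. If there were no common zero, the signs of the
  \<open>f i\<close> could be completed to functions \<open>e i\<close> that change under
  \<open>T\<close> everywhere. Their cup product pairs to 1 with the top flip chain. After fine
  subdivision every simplex carries some \<open>f i\<close> of constant sign, so one factor, hence
  the product, vanishes on it. The \<open>e i\<close> are not continuous; this does no harm because
  the cochains read vertices only.\<close>

theorem odd_functions_common_zero:
  fixes f :: "nat \<Rightarrow> 'a \<Rightarrow> real"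
  assumes T: "continuous_map X X T" and TT: "\<And>x. x \<in> topspace X \<Longrightarrow> T (T x) = x"
    and ne: "topspace X \<noteq> {}" and triv: "\<And>p. p < n \<Longrightarrow> trivial_group (reduced_homology_group (int p) X)"
    and f: "\<And>i. i < n \<Longrightarrow> continuous_map X euclideanreal (f i)"
    and odd: "\<And>i x. i < n \<Longrightarrow> x \<in> topspace X \<Longrightarrow> f i (T x) = - f i x"
  shows "\<exists>x\<in>topspace X. \<forall>i<n. f i x = 0"
proof (rule ccontr)
  assume no: "\<not> ?thesis"
  \<comment> \<open>The least index of a nonvanishing function depends only on the pattern of zeros,
    which \<open>T\<close> preserves. So a sign borrowed from \<open>f (l x)\<close> is again
    odd.\<close>
  define l where "l x = (LEAST i. i < n \<and> f i x \<noteq> 0)" for x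
  have l: "l x < n \<and> f (l x) x \<noteq> 0" if "x \<in> topspace X" for x
    unfolding l_def by (rule LeastI_ex) (use no that in auto)
  have lT: "l (T x) = l x" if "x \<in> topspace X" for x
    unfolding l_def by (rule arg_cong[of _ _ Least]) (use odd that in auto)
  text \<open>Where \<open>f i\<close> vanishes, an arbitrary equivariant choice of a sign is needed.\<close>
  define g where "g i x = (if i < n \<and> f i x \<noteq> 0 then f i x else f (l x) x)" for i x
  have g0: "g i x \<noteq> 0" and gT: "g i (T x) = - g i x" if "x \<in> topspace X" for i x
    using l[OF that] lT[OF that] odd that by (auto simp: g_def)
  define e :: "nat \<Rightarrow> 'a \<Rightarrow> bit" where "e i x = (if g i x > 0 then 1 else 0)" for i x
  have eT: "e i (T x) = e i x + 1" if "x \<in> topspace X" for i x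
    using g0[OF that, of i] gT[OF that, of i] by (auto simp: e_def)
  obtain d0 where d0: "flip_chains X T n d0"
    using flip_chains_exist[OF T TT ne triv] by auto
  \<comment> \<open>Each member fixes one strict sign of one \<open>f i\<close>. Because there is no
    common zero the members cover the space, and iterated subdivision puts every simplex into one of
    them.\<close>
  define \<C> where "\<C> = (\<Union>i<n. {{x \<in> topspace X. f i x \<in> {0<..}}, {x \<in> topspace X. f i x \<in> {..<0}}})"
  have op: "openin X V" if V: "V \<in> \<C>" for V
  proof -
    obtain i where "i < n" "V = {x \<in> topspace X. f i x \<in> {0<..}} \<or> V = {x \<in> topspace X. f i x \<in> {..<0}}"
      using V unfolding \<C>_def by blast
    moreover have "openin X {x \<in> topspace X. f i x \<in> W}" if "open W" for W
      using openin_continuous_map_preimage[OF f[OF \<open>i < n\<close>], of W] that by simp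
    ultimately show ?thesis by (metis open_greaterThan open_lessThan)
  qed
  have cov: "topspace X \<subseteq> \<Union>\<C>"
  proof
    fix x assume x: "x \<in> topspace X"
    have "f (l x) x > 0 \<or> f (l x) x < 0" using l[OF x] by linarith
    then show "x \<in> \<Union>\<C>" using l[OF x] x unfolding \<C>_def by blast
  qed
  have sc: "singular_chain n X (d0 n)" using d0 by (auto simp: flip_chains_def)
  obtain N where N: "\<And>\<sigma>. \<sigma> \<in> Poly_Mapping.keys ((singular_subdivision n ^^ N) (d0 n))
      \<Longrightarrow> \<exists>V\<in>\<C>. \<sigma> \<in> standard_simplex n \<rightarrow> V"
    by (rule sufficient_iterated_singular_subdivision_exists[OF op cov sc]) blast+
  have "flip_chains X T n (\<lambda>p. (singular_subdivision p ^^ m) (d0 p))" for m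
  proof (induction m)
    case (Suc m)
    then show ?case using flip_chains_subdivision[OF Suc T] by (simp only: funpow.simps o_apply)
  qed (simp add: d0)
  then have d: "flip_chains X T n (\<lambda>p. (singular_subdivision p ^^ N) (d0 p))" .
  have "pair (cupsx e 0 n) ((singular_subdivision n ^^ N) (d0 n)) = pair (\<lambda>_. 0) ((singular_subdivision n ^^ N) (d0 n))"
  proof (rule pair_cong)
    fix \<sigma> assume "\<sigma> \<in> Poly_Mapping.keys ((singular_subdivision n ^^ N) (d0 n))"
    then obtain V where "V \<in> \<C>" and V: "\<sigma> \<in> standard_simplex n \<rightarrow> V" using N by blast
    then obtain i where i: "i < n" "V = {x \<in> topspace X. f i x \<in> {0<..}} \<or> V = {x \<in> topspace X. f i x \<in> {..<0}}"
      unfolding \<C>_def by blast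
    \<comment> \<open>The index of the function with constant sign is also the number of the edge,
      hence of the factor, that is inspected; \<open>i < n\<close> ensures that vertex
      \<open>Suc i\<close> exists.\<close>
    have "\<sigma> (vert i) \<in> V" "\<sigma> (vert (Suc i)) \<in> V"
      using V i(1) by (auto intro!: vert_in simp: Pi_iff)
    then have "e i (\<sigma> (vert i)) = e i (\<sigma> (vert (Suc i)))"
      using i by (auto simp: e_def g_def)
    then show "cupsx e 0 n \<sigma> = 0"
      unfolding cupsx_def using cup_eq_0[of i n e 0 "\<sigma> \<circ> vert"] i(1) by simp
  qed
  moreover have "pair (cupsx e 0 n) ((singular_subdivision n ^^ N) (d0 n)) = 1"
    using pair_flip_chains[where X=X and T=T and e=e and k=0, OF _ d order_refl] eT by simp
  ultimately have "pair (\<lambda>_. 0) ((singular_subdivision n ^^ N) (d0 n)) = 1" by (rule trans[OF sym])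
  then show False by (simp add: pair_def)
qed

section \<open>C*-algebras and their norm ultraproducts\<close>

lemma complex_ring_simps [simp]:
  "carrier complex_ring = UNIV" "mult complex_ring = (*)" "one complex_ring = 1"
  "\<zero>\<^bsub>complex_ring\<^esub> = 0" "add complex_ring = (+)"
  by (simp_all add: complex_ring_def)

lemma cring_complex_ring: "cring complex_ring"
proof (rule cringI)
  have "\<exists>y. y + x = 0" for x :: complex
    by (rule exI[of _ "- x"]) simp
  then show "abelian_group complex_ring"
    by (intro abelian_groupI) (auto simp: algebra_simps)
  show "comm_monoid complex_ring"
    by (intro comm_monoidI) (auto simp: algebra_simps)
qed (auto simp: algebra_simps)

lemma complex_ring_minus: "\<ominus>\<^bsub>complex_ring\<^esub> x = - x"
proof -
  interpret cring complex_ring by (rule cring_complex_ring)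
  have "\<ominus>\<^bsub>complex_ring\<^esub> x + x = 0"
    using l_neg[of x] by simp
  then show ?thesis by (simp add: eq_neg_iff_add_eq_0)
qed

lemma cstar_algebraI:
  fixes A (structure)
  assumes "ring A"
    and "\<And>c a. a \<in> carrier A \<Longrightarrow> c \<odot> a \<in> carrier A"
    and "\<And>c d a. a \<in> carrier A \<Longrightarrow> (c + d) \<odot> a = c \<odot> a \<oplus> d \<odot> a"
    and "\<And>c a b. a \<in> carrier A \<Longrightarrow> b \<in> carrier A \<Longrightarrow> c \<odot> (a \<oplus> b) = c \<odot> a \<oplus> c \<odot> b"
    and "\<And>c d a. a \<in> carrier A \<Longrightarrow> (c * d) \<odot> a = c \<odot> (d \<odot> a)"
    and "\<And>a. a \<in> carrier A \<Longrightarrow> 1 \<odot> a = a"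
    and "cstar_algebra_axioms A"
  shows "cstar_algebra A"
  unfolding cstar_algebra_def
  by (intro conjI moduleI) (use assms cring_complex_ring in \<open>auto simp: ring.is_abelian_group\<close>)

context cstar_algebra
begin

lemma ring_A: "ring A"
  using cstar_algebra.axioms(1)[OF cstar_algebra_axioms] .

lemmas A_simps = ring.ring_simprules[OF ring_A]
lemmas A_monoid = ring.is_monoid[OF ring_A]

lemma csmult_closed [simp, intro]: "a \<in> carrier A \<Longrightarrow> c \<odot> a \<in> carrier A"
  by (rule smult_closed) simp_all

lemma csmult_l_distr: "a \<in> carrier A \<Longrightarrow> (c + d) \<odot> a = c \<odot> a \<oplus> d \<odot> a"
  using smult_l_distr[of c d a] by simp

lemma csmult_r_distr: "a \<in> carrier A \<Longrightarrow> b \<in> carrier A \<Longrightarrow> c \<odot> (a \<oplus> b) = c \<odot> a \<oplus> c \<odot> b"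
  by (rule smult_r_distr) simp_all

lemma csmult_assoc: "a \<in> carrier A \<Longrightarrow> (c * d) \<odot> a = c \<odot> (d \<odot> a)"
  using smult_assoc1[of c d a] by simp

lemma csmult_one: "a \<in> carrier A \<Longrightarrow> 1 \<odot> a = a"
  using smult_one[of a] by simp

lemma csmult_minus_one: "a \<in> carrier A \<Longrightarrow> (-1) \<odot> a = \<ominus> a"
  using smult_l_minus[of 1 a] csmult_one[of a] by (simp add: complex_ring_minus)

lemma cnorm_zero [simp]: "cnorm A \<zero> = 0"
  by (simp add: cnorm_eq_0)

lemma cnorm_uminus: "a \<in> carrier A \<Longrightarrow> cnorm A (\<ominus> a) = cnorm A a"
  using cnorm_smult[of a "-1"] by (simp add: csmult_minus_one)

lemma minus_add_cancel: "a \<in> carrier A \<Longrightarrow> b \<in> carrier A \<Longrightarrow> (a \<ominus> b) \<oplus> b = a"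
  by (simp add: A_simps)

lemma cnorm_triangle_minus:
  assumes "a \<in> carrier A" "b \<in> carrier A"
  shows "\<bar>cnorm A a - cnorm A b\<bar> \<le> cnorm A (a \<ominus> b)"
proof -
  have 1: "cnorm A a \<le> cnorm A (a \<ominus> b) + cnorm A b" if "a \<in> carrier A" "b \<in> carrier A" for a b
    using cnorm_triangle[of "a \<ominus> b" b] that by (simp add: minus_add_cancel)
  have "\<ominus> (a \<ominus> b) = b \<ominus> a"
    using assms by (simp add: A_simps)
  then have "cnorm A (b \<ominus> a) = cnorm A (a \<ominus> b)"
    using cnorm_uminus[of "a \<ominus> b"] assms by simp
  then show ?thesis using 1[of a b] 1[of b a] assms by simp
qed

lemma cnorm_minus_commute: "a \<in> carrier A \<Longrightarrow> b \<in> carrier A \<Longrightarrow> cnorm A (a \<ominus> b) = cnorm A (b \<ominus> a)"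
  using cnorm_uminus[of "a \<ominus> b"] by (simp add: A_simps)

lemma cnorm_minus_triangle:
  assumes "a \<in> carrier A" "b \<in> carrier A" "c \<in> carrier A"
  shows "cnorm A (a \<ominus> c) \<le> cnorm A (a \<ominus> b) + cnorm A (b \<ominus> c)"
proof -
  have "a \<ominus> c = (a \<ominus> b) \<oplus> (b \<ominus> c)"
    using assms by (simp add: A_simps)
  then show ?thesis using cnorm_triangle[of "a \<ominus> b" "b \<ominus> c"] assms by simp
qed

lemma minus_eq_zero: "a \<in> carrier A \<Longrightarrow> b \<in> carrier A \<Longrightarrow> a \<ominus> b = \<zero> \<longleftrightarrow> a = b"
proof
  assume "a \<in> carrier A" "b \<in> carrier A" "a \<ominus> b = \<zero>"
  then show "a = b" using minus_add_cancel[of a b] A_simps(8)[of b] by simp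
qed (simp add: A_simps)

text \<open>The C*-identity and submultiplicativity bound the square of the norm of \<open>a\<close>
  by the product of the norms of \<open>star a\<close> and \<open>a\<close>; cancelling gives one
  inequality, and \<open>star a\<close> in place of \<open>a\<close> the other.\<close>

lemma cnorm_star: "a \<in> carrier A \<Longrightarrow> cnorm A (star A a) = cnorm A a"
proof -
  have 1: "cnorm A a \<le> cnorm A (star A a)" if a: "a \<in> carrier A" for a
  proof (cases "cnorm A a = 0")
    case True then show ?thesis using cnorm_nonneg star_closed a by simp
  next
    case False
    have "cnorm A a * cnorm A a \<le> cnorm A (star A a) * cnorm A a"
      using cnorm_mult[of "star A a" a] cstar_identity[OF a] star_closed[OF a] a by (simp add: power2_eq_square)
    then show ?thesis using False cnorm_nonneg[OF a] by (simp add: mult_le_cancel_right)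
  qed
  assume a: "a \<in> carrier A"
  show ?thesis using 1[OF a] 1[OF star_closed[OF a]] star_star[OF a] by simp
qed

lemma star_one: "star A \<one> = \<one>"
proof -
  have 1: "\<one> \<in> carrier A" by (rule A_simps)
  have "star A (star A \<one> \<otimes> \<one>) = star A \<one> \<otimes> star A (star A \<one>)"
    by (intro star_mult star_closed 1)
  then show ?thesis using 1 star_closed[OF 1] by (simp add: star_star A_simps monoid.r_one[OF A_monoid])
qed

text \<open>By the C*-identity the norm of the unit equals its own square, so it is 0 or 1. The
  value 0 belongs to the zero algebra, which the axioms admit; hence an inequality.\<close>

lemma cnorm_one_le: "cnorm A \<one> \<le> 1"
proof (rule ccontr)
  assume "\<not> ?thesis"
  then have "cnorm A \<one> * 1 < cnorm A \<one> * cnorm A \<one>" by (intro mult_strict_left_mono) auto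
  moreover have "cnorm A \<one> * cnorm A \<one> = cnorm A \<one>"
    using cstar_identity[of \<one>] star_one ring.ring_simprules(6)[OF ring_A] by (simp add: power2_eq_square)
  ultimately show False by simp
qed

lemma star_uminus: "a \<in> carrier A \<Longrightarrow> star A (\<ominus> a) = \<ominus> star A a"
  using star_smult[of a "-1"] by (simp add: csmult_minus_one star_closed)

lemma star_minus: "a \<in> carrier A \<Longrightarrow> b \<in> carrier A \<Longrightarrow> star A (a \<ominus> b) = star A a \<ominus> star A b"
  by (simp add: a_minus_def star_add star_uminus)

lemma csmult_minus: "a \<in> carrier A \<Longrightarrow> b \<in> carrier A \<Longrightarrow> c \<odot> (a \<ominus> b) = c \<odot> a \<ominus> c \<odot> b"
  using smult_r_minus[of c b] by (simp add: a_minus_def csmult_r_distr)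

end

subsection \<open>Limits along an ultrafilter\<close>

locale ultra =
  fixes U :: "nat filter"
  assumes free_U: "free_ultrafilter U"
begin

lemma U_nonbot [simp]: "U \<noteq> bot"
  using free_U by (simp add: free_ultrafilter_def)

lemma U_cases: "eventually P U \<or> eventually (\<lambda>i. \<not> P i) U"
  using free_U by (simp add: free_ultrafilter_def)

lemma U_ge: "eventually (\<lambda>i. i \<ge> n) U"
proof -
  have "eventually (\<lambda>i. \<forall>j\<in>{..<n}. i \<noteq> j) U"
    using free_U by (intro eventually_ball_finite) (auto simp: free_ultrafilter_def)
  then show ?thesis by (rule eventually_mono) auto
qed

text \<open>Compactness yields a cluster point of the image filter. An ultrafilter that does not
  eventually enter a neighbourhood eventually avoids it, so the cluster point is a limit.\<close>

lemma U_compact_limit: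
  fixes f :: "nat \<Rightarrow> 'b::topological_space"
  assumes "compact S" and S: "eventually (\<lambda>i. f i \<in> S) U"
  shows "\<exists>l\<in>S. (f \<longlongrightarrow> l) U"
proof -
  have "filtermap f U \<noteq> bot" by (simp add: filtermap_bot_iff)
  moreover have "eventually (\<lambda>x. x \<in> S) (filtermap f U)" using S by (simp add: eventually_filtermap)
  ultimately obtain l where l: "l \<in> S" "inf (nhds l) (filtermap f U) \<noteq> bot"
    using \<open>compact S\<close> unfolding compact_filter by blast
  have "(f \<longlongrightarrow> l) U"
  proof (rule topological_tendstoI)
    fix V assume V: "open V" "l \<in> V"
    show "eventually (\<lambda>x. f x \<in> V) U"
    proof (rule ccontr)
      assume "\<not> ?thesis"
      then have "eventually (\<lambda>x. f x \<notin> V) U" using U_cases by blast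
      then have 2: "eventually (\<lambda>x. x \<notin> V) (filtermap f U)" by (simp add: eventually_filtermap)
      have 1: "eventually (\<lambda>x. x \<in> V) (nhds l)" using V by (rule eventually_nhds_in_open)
      have "eventually (\<lambda>x. False) (inf (nhds l) (filtermap f U))"
        unfolding eventually_inf using 1 2 by blast
      then show False using l(2) by (simp add: eventually_False)
    qed
  qed
  then show ?thesis using l by blast
qed

definition ulim :: "(nat \<Rightarrow> 'b::t2_space) \<Rightarrow> 'b" where
  "ulim f = Lim U f"

lemma ulim_eq: "(f \<longlongrightarrow> l) U \<Longrightarrow> ulim f = l"
  unfolding ulim_def by (rule tendsto_Lim) simp_all

lemma ulim_tendsto:
  fixes f :: "nat \<Rightarrow> 'b::heine_borel"
  assumes "bounded (range f)"
  shows "(f \<longlongrightarrow> ulim f) U"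
proof -
  have "compact (closure (range f))" using assms by (simp add: compact_closure)
  moreover have "eventually (\<lambda>i. f i \<in> closure (range f)) U"
    using closure_subset[of "range f"] by (intro always_eventually) auto
  ultimately obtain l where "(f \<longlongrightarrow> l) U" using U_compact_limit by blast
  then show ?thesis using ulim_eq by blast
qed

end

subsection \<open>Bounded products\<close>

lemma bounded_product_simps [simp]:
  "mult (bounded_product A) a b = (\<lambda>n. a n \<otimes>\<^bsub>A n\<^esub> b n)"
  "one (bounded_product A) = (\<lambda>n. \<one>\<^bsub>A n\<^esub>)"
  "\<zero>\<^bsub>bounded_product A\<^esub> = (\<lambda>n. \<zero>\<^bsub>A n\<^esub>)"
  "add (bounded_product A) a b = (\<lambda>n. a n \<oplus>\<^bsub>A n\<^esub> b n)"
  "smult (bounded_product A) c a = (\<lambda>n. c \<odot>\<^bsub>A n\<^esub> a n)"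
  "star (bounded_product A) a = (\<lambda>n. star (A n) (a n))"
  "cnorm (bounded_product A) a = (SUP n. cnorm (A n) (a n))"
  by (simp_all add: bounded_product_def)

lemma carrier_bounded_product:
  "a \<in> carrier (bounded_product A) \<longleftrightarrow>
    (\<forall>n. a n \<in> carrier (A n)) \<and> bdd_above (range (\<lambda>n. cnorm (A n) (a n)))"
  by (simp add: bounded_product_def)

locale cstar_family =
  fixes A :: "nat \<Rightarrow> 'a cstar"
  assumes cstar: "cstar_algebra (A n)"
begin

abbreviation "P \<equiv> bounded_product A"

lemma P_comp: "a \<in> carrier P \<Longrightarrow> a n \<in> carrier (A n)"
  by (simp add: carrier_bounded_product)

lemma P_norm_le: "a \<in> carrier P \<Longrightarrow> cnorm (A n) (a n) \<le> cnorm P a"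
  by (auto simp: carrier_bounded_product intro: cSUP_upper)

lemma PI: "(\<And>n. a n \<in> carrier (A n)) \<Longrightarrow> (\<And>n. cnorm (A n) (a n) \<le> B) \<Longrightarrow> a \<in> carrier P"
  by (auto simp: carrier_bounded_product intro!: bdd_aboveI2[where M=B])

lemma P_norm_leI: "(\<And>n. cnorm (A n) (a n) \<le> B) \<Longrightarrow> cnorm P a \<le> B"
  by (auto intro: cSUP_least)

lemma P_norm_nonneg: "a \<in> carrier P \<Longrightarrow> 0 \<le> cnorm P a"
  using P_norm_le[of a 0] cstar_algebra.cnorm_nonneg[OF cstar P_comp, of a 0] by linarith

lemma P_mult: "a \<in> carrier P \<Longrightarrow> b \<in> carrier P \<Longrightarrow> a \<otimes>\<^bsub>P\<^esub> b \<in> carrier P \<and> cnorm P (a \<otimes>\<^bsub>P\<^esub> b) \<le> cnorm P a * cnorm P b"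
proof -
  assume a: "a \<in> carrier P" and b: "b \<in> carrier P"
  have *: "a n \<otimes>\<^bsub>A n\<^esub> b n \<in> carrier (A n)" "cnorm (A n) (a n \<otimes>\<^bsub>A n\<^esub> b n) \<le> cnorm P a * cnorm P b" for n
  proof -
    interpret cstar_algebra "A n" by (rule cstar)
    show "a n \<otimes>\<^bsub>A n\<^esub> b n \<in> carrier (A n)" using P_comp a b by blast
    have "cnorm (A n) (a n \<otimes>\<^bsub>A n\<^esub> b n) \<le> cnorm (A n) (a n) * cnorm (A n) (b n)"
      by (intro cnorm_mult P_comp a b)
    also have "\<dots> \<le> cnorm P a * cnorm P b"
      by (intro mult_mono P_norm_le a b cnorm_nonneg P_comp P_norm_nonneg)
    finally show "cnorm (A n) (a n \<otimes>\<^bsub>A n\<^esub> b n) \<le> cnorm P a * cnorm P b" .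
  qed
  show ?thesis using PI[of "a \<otimes>\<^bsub>P\<^esub> b" "cnorm P a * cnorm P b"] P_norm_leI[of "a \<otimes>\<^bsub>P\<^esub> b" "cnorm P a * cnorm P b"] *
    by (simp del: bounded_product_simps(7))
qed

lemma P_add: "a \<in> carrier P \<Longrightarrow> b \<in> carrier P \<Longrightarrow> a \<oplus>\<^bsub>P\<^esub> b \<in> carrier P \<and> cnorm P (a \<oplus>\<^bsub>P\<^esub> b) \<le> cnorm P a + cnorm P b"
proof -
  assume a: "a \<in> carrier P" and b: "b \<in> carrier P"
  have *: "a n \<oplus>\<^bsub>A n\<^esub> b n \<in> carrier (A n)" "cnorm (A n) (a n \<oplus>\<^bsub>A n\<^esub> b n) \<le> cnorm P a + cnorm P b" for n
  proof -
    interpret cstar_algebra "A n" by (rule cstar)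
    show "a n \<oplus>\<^bsub>A n\<^esub> b n \<in> carrier (A n)" using P_comp a b by blast
    have "cnorm (A n) (a n \<oplus>\<^bsub>A n\<^esub> b n) \<le> cnorm (A n) (a n) + cnorm (A n) (b n)"
      by (intro cnorm_triangle P_comp a b)
    also have "\<dots> \<le> cnorm P a + cnorm P b"
      by (intro add_mono P_norm_le a b)
    finally show "cnorm (A n) (a n \<oplus>\<^bsub>A n\<^esub> b n) \<le> cnorm P a + cnorm P b" .
  qed
  show ?thesis using PI[of "a \<oplus>\<^bsub>P\<^esub> b" "cnorm P a + cnorm P b"] P_norm_leI[of "a \<oplus>\<^bsub>P\<^esub> b" "cnorm P a + cnorm P b"] *
    by (simp del: bounded_product_simps(7))
qed

lemma P_smult: "a \<in> carrier P \<Longrightarrow> c \<odot>\<^bsub>P\<^esub> a \<in> carrier P \<and> cnorm P (c \<odot>\<^bsub>P\<^esub> a) = cmod c * cnorm P a"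
proof -
  assume a: "a \<in> carrier P"
  have n: "cnorm (A n) (c \<odot>\<^bsub>A n\<^esub> a n) = cmod c * cnorm (A n) (a n)" for n c
    by (intro cstar_algebra.cnorm_smult[OF cstar] P_comp a)
  have le: "c \<odot>\<^bsub>P\<^esub> a \<in> carrier P" "cnorm P (c \<odot>\<^bsub>P\<^esub> a) \<le> cmod c * cnorm P a" for c
    using n P_norm_le[OF a] cstar_algebra.csmult_closed[OF cstar P_comp[OF a]]
    by (auto intro!: PI[of _ "cmod c * cnorm P a"] P_norm_leI mult_left_mono simp del: bounded_product_simps(7))
  have "cmod c * cnorm P a \<le> cnorm P (c \<odot>\<^bsub>P\<^esub> a)"
  proof (cases "c = 0")
    case True then show ?thesis using P_norm_nonneg[OF le(1)] by simp
  next
    case False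
    have "cnorm P a \<le> cnorm P (c \<odot>\<^bsub>P\<^esub> a) / cmod c"
    proof (rule P_norm_leI)
      fix n show "cnorm (A n) (a n) \<le> cnorm P (c \<odot>\<^bsub>P\<^esub> a) / cmod c"
        using P_norm_le[OF le(1)[of c], of n] n[where n=n and c=c] False
        by (simp add: pos_le_divide_eq mult.commute del: bounded_product_simps(7))
    qed
    then show ?thesis using False by (simp add: pos_le_divide_eq mult.commute del: bounded_product_simps(7))
  qed
  then show ?thesis using le[of c] by (simp add: order_antisym del: bounded_product_simps)
qed

lemma P_star: "a \<in> carrier P \<Longrightarrow> star P a \<in> carrier P"
  using cstar_algebra.cnorm_star[OF cstar P_comp] P_norm_le
  by (intro PI[of _ "cnorm P a"]) (auto intro: cstar_algebra.star_closed[OF cstar] P_comp simp del: bounded_product_simps(7))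

lemma ring_P: "ring P"
proof (rule ringI)
  note r = cstar_algebra.axioms(1)[OF cstar]
  show "abelian_group P"
  proof (rule abelian_groupI)
    show "\<zero>\<^bsub>P\<^esub> \<in> carrier P"
      by (rule PI[of _ 0]) (use r ring.ring_simprules(2) cstar_algebra.cnorm_zero[OF cstar] in auto)
    fix x assume x: "x \<in> carrier P"
    show "\<exists>y\<in>carrier P. y \<oplus>\<^bsub>P\<^esub> x = \<zero>\<^bsub>P\<^esub>"
    proof (rule bexI[of _ "(-1) \<odot>\<^bsub>P\<^esub> x"])
      show "(-1) \<odot>\<^bsub>P\<^esub> x \<oplus>\<^bsub>P\<^esub> x = \<zero>\<^bsub>P\<^esub>"
        using x by (auto simp: fun_eq_iff cstar_algebra.csmult_minus_one[OF cstar P_comp] ring.ring_simprules[OF r] P_comp)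
    qed (use P_smult x in blast)
  qed (auto simp: P_comp ring.ring_simprules[OF r] fun_eq_iff P_add[simplified] simp del: bounded_product_simps(7))
  show "monoid P"
  proof (rule monoidI)
    show "\<one>\<^bsub>P\<^esub> \<in> carrier P"
      by (rule PI[of _ 1]) (use r ring.ring_simprules(6) cstar_algebra.cnorm_one_le[OF cstar] in auto)
  qed (auto simp: P_comp ring.ring_simprules[OF r] monoid.l_one[OF ring.is_monoid[OF r]] monoid.r_one[OF ring.is_monoid[OF r]] fun_eq_iff P_mult[simplified] simp del: bounded_product_simps(7))
qed (auto simp: P_comp ring.ring_simprules[OF cstar_algebra.axioms(1)[OF cstar]] fun_eq_iff)

lemma P_uminus: "a \<in> carrier P \<Longrightarrow> \<ominus>\<^bsub>P\<^esub> a = (\<lambda>n. \<ominus>\<^bsub>A n\<^esub> a n)"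
proof -
  assume a: "a \<in> carrier P"
  interpret P: ring P by (rule ring_P)
  have m: "(-1) \<odot>\<^bsub>P\<^esub> a \<in> carrier P" using P_smult a by blast
  have "(-1) \<odot>\<^bsub>P\<^esub> a \<oplus>\<^bsub>P\<^esub> a = \<zero>\<^bsub>P\<^esub>"
    using a by (auto simp: fun_eq_iff cstar_algebra.csmult_minus_one[OF cstar P_comp] P_comp
        ring.ring_simprules[OF cstar_algebra.axioms(1)[OF cstar]])
  then have "\<ominus>\<^bsub>P\<^esub> a = (-1) \<odot>\<^bsub>P\<^esub> a"
    using P.minus_equality[OF _ a m] by simp
  then show ?thesis using a by (auto simp: fun_eq_iff cstar_algebra.csmult_minus_one[OF cstar P_comp])
qed

lemma P_minus: "a \<in> carrier P \<Longrightarrow> b \<in> carrier P \<Longrightarrow> a \<ominus>\<^bsub>P\<^esub> b = (\<lambda>n. a n \<ominus>\<^bsub>A n\<^esub> b n)"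
  by (simp add: a_minus_def P_uminus)

lemma P_minus_closed: "a \<in> carrier P \<Longrightarrow> b \<in> carrier P \<Longrightarrow> a \<ominus>\<^bsub>P\<^esub> b \<in> carrier P"
  using ring.ring_simprules(4)[OF ring_P] .


text \<open>Limits are taken coordinate by coordinate. The Cauchy estimate is uniform in the
  coordinate, so it passes to the limit and gives convergence in the supremum norm.\<close>

lemma P_complete: "complete_in P (cnorm P) (carrier P)"
  unfolding complete_in_def
proof (intro allI impI, elim conjE)
  fix s :: "nat \<Rightarrow> nat \<Rightarrow> 'a"
  assume s: "\<forall>k. s k \<in> carrier P"
    and Cau: "\<forall>e>0. \<exists>N. \<forall>m\<ge>N. \<forall>n\<ge>N. cnorm P (s m \<ominus>\<^bsub>P\<^esub> s n) < e"
  have le: "cnorm (A i) (s m i \<ominus>\<^bsub>A i\<^esub> s n i) \<le> cnorm P (s m \<ominus>\<^bsub>P\<^esub> s n)" for m n i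
    using P_norm_le[OF P_minus_closed[of "s m" "s n"], of i] s by (simp add: P_minus)
  have "\<exists>a. \<forall>i. a i \<in> carrier (A i) \<and> (\<lambda>n. cnorm (A i) (s n i \<ominus>\<^bsub>A i\<^esub> a i)) \<longlonglongrightarrow> 0"
  proof (rule choice, rule allI)
    fix i
    have "\<forall>e>0. \<exists>N. \<forall>m\<ge>N. \<forall>n\<ge>N. cnorm (A i) (s m i \<ominus>\<^bsub>A i\<^esub> s n i) < e"
      using Cau le by (meson order_le_less_trans)
    then show "\<exists>a. a \<in> carrier (A i) \<and> (\<lambda>n. cnorm (A i) (s n i \<ominus>\<^bsub>A i\<^esub> a)) \<longlonglongrightarrow> 0"
      using cstar_algebra.complete[OF cstar, of i, unfolded complete_in_def, rule_format, of "\<lambda>n. s n i"] s P_comp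
      by blast
  qed
  then obtain a where a: "\<And>i. a i \<in> carrier (A i)"
    and lim: "\<And>i. (\<lambda>n. cnorm (A i) (s n i \<ominus>\<^bsub>A i\<^esub> a i)) \<longlonglongrightarrow> 0" by blast
  have bound: "cnorm (A i) (s m i \<ominus>\<^bsub>A i\<^esub> a i) \<le> e"
    if N: "\<forall>m\<ge>N. \<forall>n\<ge>N. cnorm P (s m \<ominus>\<^bsub>P\<^esub> s n) < e" and m: "m \<ge> N" for N e m i
  proof -
    interpret cstar_algebra "A i" by (rule cstar)
    have "(\<lambda>n. e + cnorm (A i) (s n i \<ominus>\<^bsub>A i\<^esub> a i)) \<longlonglongrightarrow> e + 0"
      by (intro tendsto_add tendsto_const lim)
    moreover have "eventually (\<lambda>n. cnorm (A i) (s m i \<ominus>\<^bsub>A i\<^esub> a i) \<le> e + cnorm (A i) (s n i \<ominus>\<^bsub>A i\<^esub> a i)) sequentially"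
      unfolding eventually_sequentially
    proof (intro exI[of _ N] allI impI)
      fix n assume "n \<ge> N"
      then have "cnorm (A i) (s m i \<ominus>\<^bsub>A i\<^esub> s n i) < e" using le[of i m n] N m by force
      then show "cnorm (A i) (s m i \<ominus>\<^bsub>A i\<^esub> a i) \<le> e + cnorm (A i) (s n i \<ominus>\<^bsub>A i\<^esub> a i)"
        using cnorm_minus_triangle[of "s m i" "s n i" "a i"] a s P_comp by force
    qed
    ultimately show ?thesis using tendsto_lowerbound[of _ "e + 0" sequentially] by force
  qed
  obtain N where N: "\<forall>m\<ge>N. \<forall>n\<ge>N. cnorm P (s m \<ominus>\<^bsub>P\<^esub> s n) < 1"
    using Cau by (meson zero_less_one)
  have "a \<in> carrier P"
  proof (rule PI[OF a])
    fix i
    interpret cstar_algebra "A i" by (rule cstar)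
    have sN: "s N i \<in> carrier (A i)" using s P_comp by blast
    have "cnorm (A i) (a i) \<le> cnorm (A i) (s N i) + cnorm (A i) (s N i \<ominus>\<^bsub>A i\<^esub> a i)"
      using cnorm_triangle_minus[OF sN a] by linarith
    also have "\<dots> \<le> cnorm P (s N) + 1"
      using bound[OF N order_refl] P_norm_le s by (intro add_mono) blast+
    finally show "cnorm (A i) (a i) \<le> cnorm P (s N) + 1" .
  qed
  moreover have "(\<lambda>n. cnorm P (s n \<ominus>\<^bsub>P\<^esub> a)) \<longlonglongrightarrow> 0"
  proof (rule LIMSEQ_I)
    fix e :: real assume "0 < e"
    then obtain N where N: "\<forall>m\<ge>N. \<forall>n\<ge>N. cnorm P (s m \<ominus>\<^bsub>P\<^esub> s n) < e / 2"
      using Cau half_gt_zero by blast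
    have "norm (cnorm P (s n \<ominus>\<^bsub>P\<^esub> a) - 0) < e" if "n \<ge> N" for n
    proof -
      have c: "s n \<ominus>\<^bsub>P\<^esub> a \<in> carrier P" using P_minus_closed s \<open>a \<in> carrier P\<close> by blast
      have "cnorm P (s n \<ominus>\<^bsub>P\<^esub> a) \<le> e / 2"
        using bound[OF N that] s \<open>a \<in> carrier P\<close> by (intro P_norm_leI) (simp add: P_minus)
      then show ?thesis using P_norm_nonneg[OF c] \<open>0 < e\<close> by simp
    qed
    then show "\<exists>no. \<forall>n\<ge>no. norm (cnorm P (s n \<ominus>\<^bsub>P\<^esub> a) - 0) < e" by blast
  qed
  ultimately show "\<exists>a\<in>carrier P. (\<lambda>n. cnorm P (s n \<ominus>\<^bsub>P\<^esub> a)) \<longlonglongrightarrow> 0" by blast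
qed

end

subsection \<open>Norm ultraproducts\<close>

lemma squeeze_0:
  fixes f g :: "'a \<Rightarrow> real"
  assumes "(g \<longlongrightarrow> 0) F" "\<And>n. 0 \<le> f n" "\<And>n. f n \<le> g n"
  shows "(f \<longlongrightarrow> 0) F"
  by (rule Lim_null_comparison[OF always_eventually assms(1)]) (use assms in simp)

lemma coset_map_coset:
  assumes "X \<noteq> {}" "\<And>x. x \<in> X \<Longrightarrow> J +>\<^bsub>A\<^esub> f x = Y"
  shows "coset_map A J f X = Y"
  using assms by (auto simp: coset_map_def)

locale cstar_ultra = cstar_family A + ultra U for A :: "nat \<Rightarrow> 'a cstar" and U
begin

abbreviation "J \<equiv> norm_null U A"
abbreviation "Q \<equiv> norm_ultraproduct U A"
definition cls :: "(nat \<Rightarrow> 'a) \<Rightarrow> (nat \<Rightarrow> 'a) set" where "cls a = J +>\<^bsub>P\<^esub> a"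

lemma norm_limit: "a \<in> carrier P \<Longrightarrow> ((\<lambda>n. cnorm (A n) (a n)) \<longlongrightarrow> ulim (\<lambda>n. cnorm (A n) (a n))) U"
proof (rule ulim_tendsto)
  assume a: "a \<in> carrier P"
  show "bounded (range (\<lambda>n. cnorm (A n) (a n)))"
    unfolding bounded_iff
    using P_norm_le[OF a] cstar_algebra.cnorm_nonneg[OF cstar P_comp[OF a]]
    by (intro exI[of _ "cnorm P a"]) (simp del: bounded_product_simps(7))
qed

lemma ideal_J: "ideal J P"
proof (rule idealI[OF ring_P])
  interpret P: ring P by (rule ring_P)
  have zero: "\<zero>\<^bsub>P\<^esub> \<in> J"
    using P.zero_closed cstar_algebra.cnorm_zero[OF cstar] by (simp add: norm_null_def)
  have add: "a \<oplus>\<^bsub>P\<^esub> b \<in> J" if "a \<in> J" "b \<in> J" for a b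
  proof -
    have ab: "a \<in> carrier P" "b \<in> carrier P" using that by (auto simp: norm_null_def)
    have "((\<lambda>n. cnorm (A n) (a n) + cnorm (A n) (b n)) \<longlongrightarrow> 0) U"
      using that by (intro tendsto_add_zero) (auto simp: norm_null_def)
    then have "((\<lambda>n. cnorm (A n) (a n \<oplus>\<^bsub>A n\<^esub> b n)) \<longlongrightarrow> 0) U"
    proof (rule squeeze_0)
      fix n
      show "cnorm (A n) (a n \<oplus>\<^bsub>A n\<^esub> b n) \<le> cnorm (A n) (a n) + cnorm (A n) (b n)"
        by (intro cstar_algebra.cnorm_triangle[OF cstar] P_comp ab)
      show "0 \<le> cnorm (A n) (a n \<oplus>\<^bsub>A n\<^esub> b n)"
        by (intro cstar_algebra.cnorm_nonneg[OF cstar] ring.ring_simprules(1)[OF cstar_algebra.ring_A[OF cstar]] P_comp ab)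
    qed
    then show ?thesis using P.a_closed[OF ab] by (simp add: norm_null_def)
  qed
  have minus: "\<ominus>\<^bsub>P\<^esub> a \<in> J" if "a \<in> J" for a
  proof -
    have a: "a \<in> carrier P" using that by (auto simp: norm_null_def)
    have "cnorm (A n) (\<ominus>\<^bsub>A n\<^esub> a n) = cnorm (A n) (a n)" for n
      by (intro cstar_algebra.cnorm_uminus[OF cstar] P_comp a)
    then show ?thesis using that P.a_inv_closed[OF a] by (simp add: norm_null_def P_uminus)
  qed
  show "subgroup J (add_monoid P)"
  proof (rule group.subgroupI)
    show "Group.group (add_monoid P)" using P.a_group .
    show "J \<subseteq> carrier (add_monoid P)" by (auto simp: norm_null_def)
    show "J \<noteq> {}" using zero by blast
    show "inv\<^bsub>add_monoid P\<^esub> a \<in> J" if "a \<in> J" for a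
      using minus[OF that] by (simp add: a_inv_def)
    show "a \<otimes>\<^bsub>add_monoid P\<^esub> b \<in> J" if "a \<in> J" "b \<in> J" for a b
      using add[OF that] by simp
  qed
  fix a x assume aJ: "a \<in> J" and x: "x \<in> carrier P"
  have a: "a \<in> carrier P" using aJ by (auto simp: norm_null_def)
  have l: "((\<lambda>n. cnorm P x * cnorm (A n) (a n)) \<longlongrightarrow> cnorm P x * 0) U"
    using aJ by (intro tendsto_mult tendsto_const) (auto simp: norm_null_def)
  have bd: "cnorm (A n) (x n) * cnorm (A n) (a n) \<le> cnorm P x * cnorm (A n) (a n)" for n
    by (intro mult_right_mono P_norm_le x cstar_algebra.cnorm_nonneg[OF cstar] P_comp a)
  have 1: "cnorm (A n) (x n \<otimes>\<^bsub>A n\<^esub> a n) \<le> cnorm P x * cnorm (A n) (a n)"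
    and 2: "cnorm (A n) (a n \<otimes>\<^bsub>A n\<^esub> x n) \<le> cnorm P x * cnorm (A n) (a n)"
    and 3: "x n \<otimes>\<^bsub>A n\<^esub> a n \<in> carrier (A n)" "a n \<otimes>\<^bsub>A n\<^esub> x n \<in> carrier (A n)" for n
    using cstar_algebra.cnorm_mult[OF cstar, of "x n" n "a n"] cstar_algebra.cnorm_mult[OF cstar, of "a n" n "x n"]
      bd[of n] P_comp[OF a] P_comp[OF x] ring.ring_simprules(5)[OF cstar_algebra.ring_A[OF cstar]]
    by (simp_all add: mult.commute del: bounded_product_simps(7))
  have z: "((\<lambda>n. cnorm (A n) (y n)) \<longlongrightarrow> 0) U"
    if "\<And>n. y n \<in> carrier (A n)" "\<And>n. cnorm (A n) (y n) \<le> cnorm P x * cnorm (A n) (a n)" for y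
    by (rule squeeze_0[OF l[unfolded mult_zero_right]]) (use that cstar_algebra.cnorm_nonneg[OF cstar] in blast)+
  show "x \<otimes>\<^bsub>P\<^esub> a \<in> J" "a \<otimes>\<^bsub>P\<^esub> x \<in> J"
    using P.m_closed[OF x a] P.m_closed[OF a x] z[OF 3(1) 1] z[OF 3(2) 2]
    by (simp_all add: norm_null_def)
qed

lemma cls_memI: "a \<in> carrier P \<Longrightarrow> a \<in> cls a"
  unfolding cls_def
  by (rule abelian_subgroup.a_rcos_self[OF abelian_subgroupI3[OF ideal.axioms(1)[OF ideal_J] ring.is_abelian_group[OF ring_P]]])

lemma add_minus_P: "x \<in> carrier P \<Longrightarrow> y \<in> carrier P \<Longrightarrow> (x \<oplus>\<^bsub>P\<^esub> y) \<ominus>\<^bsub>P\<^esub> y = x"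
  by (simp add: ring.ring_simprules[OF ring_P] del: bounded_product_simps)

lemma minus_add_P: "x \<in> carrier P \<Longrightarrow> y \<in> carrier P \<Longrightarrow> (x \<ominus>\<^bsub>P\<^esub> y) \<oplus>\<^bsub>P\<^esub> y = x"
  by (simp add: ring.ring_simprules[OF ring_P] del: bounded_product_simps)

lemma cls_mem:
  assumes "a \<in> carrier P"
  shows "x \<in> cls a \<longleftrightarrow> x \<in> carrier P \<and> ((\<lambda>n. cnorm (A n) (x n \<ominus>\<^bsub>A n\<^esub> a n)) \<longlongrightarrow> 0) U"
proof -
  interpret P: ring P by (rule ring_P)
  interpret J: ideal J P by (rule ideal_J)
  have "x \<in> cls a \<longleftrightarrow> (\<exists>j\<in>J. x = j \<oplus>\<^bsub>P\<^esub> a)"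
    by (auto simp: cls_def a_r_coset_def r_coset_def)
  also have "\<dots> \<longleftrightarrow> x \<in> carrier P \<and> x \<ominus>\<^bsub>P\<^esub> a \<in> J"
  proof safe
    fix j assume j: "j \<in> J"
    then have jc: "j \<in> carrier P" by (rule J.a_Hcarr)
    show "j \<oplus>\<^bsub>P\<^esub> a \<in> carrier P" using P.a_closed[OF jc assms] .
    show "j \<oplus>\<^bsub>P\<^esub> a \<ominus>\<^bsub>P\<^esub> a \<in> J"
      unfolding add_minus_P[OF jc assms] by (rule j)
  next
    assume x: "x \<in> carrier P" "x \<ominus>\<^bsub>P\<^esub> a \<in> J"
    then show "\<exists>j\<in>J. x = j \<oplus>\<^bsub>P\<^esub> a" using minus_add_P[OF x(1) assms] by (metis x(2))
  qed
  also have "\<dots> \<longleftrightarrow> x \<in> carrier P \<and> ((\<lambda>n. cnorm (A n) (x n \<ominus>\<^bsub>A n\<^esub> a n)) \<longlongrightarrow> 0) U"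
    using P_minus_closed[of x a] P_minus[of x a] assms unfolding norm_null_def by auto
  finally show ?thesis .
qed

lemma carrier_Q: "X \<in> carrier Q \<longleftrightarrow> (\<exists>a\<in>carrier P. X = cls a)"
  by (auto simp: norm_ultraproduct_def quotient_cstar_def FactRing_def A_RCOSETS_def' cls_def)

lemma cls_closed [simp, intro]: "a \<in> carrier P \<Longrightarrow> cls a \<in> carrier Q"
  by (auto simp: carrier_Q)

lemma cls_eq:
  assumes "a \<in> carrier P" "b \<in> carrier P"
  shows "cls a = cls b \<longleftrightarrow> ((\<lambda>n. cnorm (A n) (a n \<ominus>\<^bsub>A n\<^esub> b n)) \<longlongrightarrow> 0) U"
proof
  assume "cls a = cls b"
  then show "((\<lambda>n. cnorm (A n) (a n \<ominus>\<^bsub>A n\<^esub> b n)) \<longlongrightarrow> 0) U"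
    using cls_memI[OF assms(1)] cls_mem[OF assms(2), of a] by simp
next
  interpret P: ring P by (rule ring_P)
  interpret J: ideal J P by (rule ideal_J)
  assume "((\<lambda>n. cnorm (A n) (a n \<ominus>\<^bsub>A n\<^esub> b n)) \<longlongrightarrow> 0) U"
  then have "a \<in> cls b" using cls_mem[OF assms(2)] assms(1) by simp
  then show "cls a = cls b"
    using P.a_repr_independence[OF _ assms(2) J.a_subgroup, of a] unfolding cls_def by simp
qed

lemma Q_mult: "a \<in> carrier P \<Longrightarrow> b \<in> carrier P \<Longrightarrow> cls a \<otimes>\<^bsub>Q\<^esub> cls b = cls (\<lambda>n. a n \<otimes>\<^bsub>A n\<^esub> b n)"
  using ideal.rcoset_mult_add[OF ideal_J, of a b]
  by (simp add: norm_ultraproduct_def quotient_cstar_def FactRing_def cls_def)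

lemma Q_add: "a \<in> carrier P \<Longrightarrow> b \<in> carrier P \<Longrightarrow> cls a \<oplus>\<^bsub>Q\<^esub> cls b = cls (\<lambda>n. a n \<oplus>\<^bsub>A n\<^esub> b n)"
  using ideal.a_rcos_sum[OF ideal_J, of a b]
  by (simp add: norm_ultraproduct_def quotient_cstar_def FactRing_def cls_def)

lemma Q_one: "\<one>\<^bsub>Q\<^esub> = cls (\<lambda>n. \<one>\<^bsub>A n\<^esub>)"
  by (simp add: norm_ultraproduct_def quotient_cstar_def FactRing_def cls_def)

lemma Q_zero: "\<zero>\<^bsub>Q\<^esub> = cls (\<lambda>n. \<zero>\<^bsub>A n\<^esub>)"
proof -
  interpret P: ring P by (rule ring_P)
  have "J \<subseteq> carrier P" by (auto simp: norm_null_def)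
  then show ?thesis
    using P.a_coset_add_zero[of J] by (simp add: norm_ultraproduct_def quotient_cstar_def FactRing_def cls_def)
qed

lemma Q_smult: "a \<in> carrier P \<Longrightarrow> c \<odot>\<^bsub>Q\<^esub> cls a = cls (\<lambda>n. c \<odot>\<^bsub>A n\<^esub> a n)"
proof -
  assume a: "a \<in> carrier P"
  have "coset_map P J (smult P c) (cls a) = cls (smult P c a)"
  proof (rule coset_map_coset)
    show "cls a \<noteq> {}" using cls_memI[OF a] by blast
    fix x assume "x \<in> cls a"
    then have x: "x \<in> carrier P" "((\<lambda>n. cnorm (A n) (x n \<ominus>\<^bsub>A n\<^esub> a n)) \<longlongrightarrow> 0) U" using cls_mem[OF a] by auto
    have eq: "cnorm (A n) (smult P c x n \<ominus>\<^bsub>A n\<^esub> smult P c a n) = cmod c * cnorm (A n) (x n \<ominus>\<^bsub>A n\<^esub> a n)" for n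
    proof -
      interpret cstar_algebra "A n" by (rule cstar)
      show ?thesis using csmult_minus[of "x n" "a n" c] cnorm_smult[of "x n \<ominus>\<^bsub>A n\<^esub> a n" c] P_comp x(1) a A_simps(4) by simp
    qed
    have "((\<lambda>n. cmod c * cnorm (A n) (x n \<ominus>\<^bsub>A n\<^esub> a n)) \<longlongrightarrow> cmod c * 0) U"
      by (intro tendsto_mult tendsto_const x)
    then have "cls (smult P c x) = cls (smult P c a)"
      using P_smult x(1) a by (subst cls_eq) (simp_all add: eq del: bounded_product_simps)
    then show "J +>\<^bsub>P\<^esub> (smult P c x) = cls (smult P c a)" by (simp add: cls_def)
  qed
  then show ?thesis by (simp add: norm_ultraproduct_def quotient_cstar_def)
qed

lemma Q_star: "a \<in> carrier P \<Longrightarrow> star Q (cls a) = cls (\<lambda>n. star (A n) (a n))"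
proof -
  assume a: "a \<in> carrier P"
  have "coset_map P J (star P) (cls a) = cls (star P a)"
  proof (rule coset_map_coset)
    show "cls a \<noteq> {}" using cls_memI[OF a] by blast
    fix x assume "x \<in> cls a"
    then have x: "x \<in> carrier P" "((\<lambda>n. cnorm (A n) (x n \<ominus>\<^bsub>A n\<^esub> a n)) \<longlongrightarrow> 0) U" using cls_mem[OF a] by auto
    have eq: "cnorm (A n) (star P x n \<ominus>\<^bsub>A n\<^esub> star P a n) = cnorm (A n) (x n \<ominus>\<^bsub>A n\<^esub> a n)" for n
    proof -
      interpret cstar_algebra "A n" by (rule cstar)
      show ?thesis using star_minus[of "x n" "a n"] cnorm_star[of "x n \<ominus>\<^bsub>A n\<^esub> a n"] P_comp x(1) a A_simps(4) by simp
    qed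
    have "cls (star P x) = cls (star P a)"
      using P_star x a by (subst cls_eq) (simp_all add: eq del: bounded_product_simps)
    then show "J +>\<^bsub>P\<^esub> (star P x) = cls (star P a)" by (simp add: cls_def)
  qed
  then show ?thesis by (simp add: norm_ultraproduct_def quotient_cstar_def)
qed

lemma norm_limit_cong:
  assumes a: "a \<in> carrier P" and x: "x \<in> cls a"
  shows "ulim (\<lambda>n. cnorm (A n) (x n)) = ulim (\<lambda>n. cnorm (A n) (a n))"
proof -
  have xP: "x \<in> carrier P" and lim: "((\<lambda>n. cnorm (A n) (x n \<ominus>\<^bsub>A n\<^esub> a n)) \<longlongrightarrow> 0) U"
    using x cls_mem[OF a] by auto
  have "((\<lambda>n. cnorm (A n) (x n) - cnorm (A n) (a n)) \<longlongrightarrow> 0) U"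
  proof (rule Lim_null_comparison[OF always_eventually lim], rule allI)
    show "norm (cnorm (A n) (x n) - cnorm (A n) (a n)) \<le> cnorm (A n) (x n \<ominus>\<^bsub>A n\<^esub> a n)" for n
      using cstar_algebra.cnorm_triangle_minus[OF cstar P_comp[OF xP] P_comp[OF a]] by simp
  qed
  from tendsto_add[OF this norm_limit[OF a]] show ?thesis by (intro ulim_eq) simp
qed

text \<open>The limit of the norms along \<open>U\<close> is the same for all representatives and
  lies below each of their supremum norms. Conversely, coordinates whose norm exceeds the limit by
  more than \<open>e\<close> form a set that \<open>U\<close> ignores; setting them to zero gives a
  representative that almost attains the infimum.\<close>

lemma Q_norm: "a \<in> carrier P \<Longrightarrow> cnorm Q (cls a) = ulim (\<lambda>n. cnorm (A n) (a n))"
proof -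
  assume a: "a \<in> carrier P"
  let ?L = "ulim (\<lambda>n. cnorm (A n) (a n))"
  have low: "?L \<le> cnorm P x" if "x \<in> cls a" for x
  proof -
    have x: "x \<in> carrier P" using that cls_mem[OF a] by auto
    show ?thesis
      using tendsto_upperbound[OF norm_limit[OF x] always_eventually U_nonbot, of "cnorm P x"]
        P_norm_le[OF x] norm_limit_cong[OF a that] by (simp del: bounded_product_simps)
  qed
  have L0: "0 \<le> ?L"
    by (rule tendsto_lowerbound[OF norm_limit[OF a] always_eventually U_nonbot])
       (use cstar_algebra.cnorm_nonneg[OF cstar P_comp[OF a]] in blast)
  have up: "\<exists>x\<in>cls a. cnorm P x \<le> ?L + e" if e: "e > 0" for e
  proof -
    \<comment> \<open>The truncated representative: it agrees with \<open>a\<close> eventually along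
      \<open>U\<close>, and its norm is at most \<open>?L + e\<close> in every coordinate.\<close>
    define x where "x n = (if cnorm (A n) (a n) \<le> ?L + e then a n else \<zero>\<^bsub>A n\<^esub>)" for n
    have z: "\<zero>\<^bsub>A n\<^esub> \<in> carrier (A n)" for n
      by (rule ring.ring_simprules(2)[OF cstar_algebra.ring_A[OF cstar]])
    have le: "cnorm (A n) (x n) \<le> ?L + e" for n
      using L0 e by (simp add: x_def cstar_algebra.cnorm_zero[OF cstar])
    have x: "x \<in> carrier P"
      by (rule PI[OF _ le]) (use P_comp[OF a] z in \<open>simp add: x_def\<close>)
    have "eventually (\<lambda>n. cnorm (A n) (a n) < ?L + e) U"
      using order_tendstoD(2)[OF norm_limit[OF a], of "?L + e"] e by simp
    then have "eventually (\<lambda>n. cnorm (A n) (x n \<ominus>\<^bsub>A n\<^esub> a n) = 0) U"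
    proof (rule eventually_mono)
      fix n assume "cnorm (A n) (a n) < ?L + e"
      then show "cnorm (A n) (x n \<ominus>\<^bsub>A n\<^esub> a n) = 0"
        using cstar_algebra.minus_eq_zero[OF cstar P_comp[OF a] P_comp[OF a], of n] cstar_algebra.cnorm_zero[OF cstar]
        by (simp add: x_def)
    qed
    then have "((\<lambda>n. cnorm (A n) (x n \<ominus>\<^bsub>A n\<^esub> a n)) \<longlongrightarrow> 0) U" by (rule tendsto_eventually)
    then have "x \<in> cls a" using cls_mem[OF a] x by simp
    then show ?thesis using P_norm_leI[OF le] by blast
  qed
  have bdd: "bdd_below (cnorm P ` cls a)" by (rule bdd_belowI2[OF low])
  have "(INF x\<in>cls a. cnorm P x) = ?L"
  proof (rule antisym)
    show "(INF x\<in>cls a. cnorm P x) \<le> ?L"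
    proof (rule field_le_epsilon)
      fix e :: real assume "e > 0"
      from up[OF this] show "(INF x\<in>cls a. cnorm P x) \<le> ?L + e"
        using cINF_lower2[OF bdd] by blast
    qed
    show "?L \<le> (INF x\<in>cls a. cnorm P x)"
      by (rule cINF_greatest[OF _ low]) (use cls_memI[OF a] in blast)
  qed
  then show ?thesis by (simp add: norm_ultraproduct_def quotient_cstar_def del: bounded_product_simps)
qed

lemma Q_norm_tendsto: "a \<in> carrier P \<Longrightarrow> ((\<lambda>n. cnorm (A n) (a n)) \<longlongrightarrow> cnorm Q (cls a)) U"
  using norm_limit Q_norm by simp

lemma Q_norm_le: "a \<in> carrier P \<Longrightarrow> cnorm Q (cls a) \<le> cnorm P a"
  using tendsto_upperbound[OF Q_norm_tendsto always_eventually U_nonbot, of a "cnorm P a"] P_norm_le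
  by (simp del: bounded_product_simps)

text \<open>The quotient norm is an infimum over the class, so a strict bound passes to some
  representative, in all coordinates at once and not merely along \<open>U\<close>.\<close>

lemma Q_norm_lift:
  assumes "X \<in> carrier Q" "cnorm Q X < e"
  shows "\<exists>a\<in>carrier P. X = cls a \<and> cnorm P a < e"
proof -
  obtain a where a: "a \<in> carrier P" "X = cls a" using assms carrier_Q by blast
  have "(INF x\<in>cls a. cnorm P x) < e"
    using assms a by (simp add: norm_ultraproduct_def quotient_cstar_def del: bounded_product_simps)
  then obtain x where x: "x \<in> cls a" "cnorm P x < e"
    using cInf_lessD[of "cnorm P ` cls a" e] cls_memI[OF a(1)] by blast
  then have "x \<in> carrier P" "cls x = cls a" using cls_mem[OF a(1), of x] cls_eq[OF _ a(1), of x] by auto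
  then show ?thesis using x a by metis
qed

lemma ring_Q: "ring Q"
proof -
  interpret PQ: ring "P Quot J" by (rule ideal.quotient_is_ring[OF ideal_J])
  have eq: "carrier Q = carrier (P Quot J)" "add Q = add (P Quot J)" "mult Q = mult (P Quot J)"
    "one Q = one (P Quot J)" "\<zero>\<^bsub>Q\<^esub> = \<zero>\<^bsub>P Quot J\<^esub>"
    by (simp_all add: norm_ultraproduct_def quotient_cstar_def)
  show ?thesis
  proof (rule ringI)
    show "abelian_group Q"
    proof (rule abelian_groupI)
      show "\<exists>y\<in>carrier Q. y \<oplus>\<^bsub>Q\<^esub> x = \<zero>\<^bsub>Q\<^esub>" if "x \<in> carrier Q" for x
        using that by (intro bexI[of _ "\<ominus>\<^bsub>P Quot J\<^esub> x"]) (auto simp: eq PQ.ring_simprules)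
    qed (auto simp: eq PQ.ring_simprules)
    show "monoid Q"
      by (rule monoidI) (auto simp: eq PQ.m_assoc)
  qed (auto simp: eq PQ.ring_simprules)
qed

lemma Q_minus: "a \<in> carrier P \<Longrightarrow> b \<in> carrier P \<Longrightarrow> cls a \<ominus>\<^bsub>Q\<^esub> cls b = cls (\<lambda>n. a n \<ominus>\<^bsub>A n\<^esub> b n)"
proof -
  assume a: "a \<in> carrier P" and b: "b \<in> carrier P"
  interpret Q: ring Q by (rule ring_Q)
  have c: "(\<lambda>n. a n \<ominus>\<^bsub>A n\<^esub> b n) \<in> carrier P" using P_minus_closed[OF a b] P_minus[OF a b] by simp
  have "cls (\<lambda>n. a n \<ominus>\<^bsub>A n\<^esub> b n) \<oplus>\<^bsub>Q\<^esub> cls b = cls a"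
    using cstar_algebra.minus_add_cancel[OF cstar P_comp[OF a] P_comp[OF b]] by (simp add: Q_add[OF c b])
  then have "cls a \<ominus>\<^bsub>Q\<^esub> cls b = (cls (\<lambda>n. a n \<ominus>\<^bsub>A n\<^esub> b n) \<oplus>\<^bsub>Q\<^esub> cls b) \<ominus>\<^bsub>Q\<^esub> cls b" by simp
  also have "\<dots> = cls (\<lambda>n. a n \<ominus>\<^bsub>A n\<^esub> b n)"
    using cls_closed[OF c] cls_closed[OF b] by (simp add: a_minus_def Q.add.m_assoc Q.r_neg)
  finally show ?thesis .
qed

text \<open>Along a fast subsequence the successive differences lift to elements of \<open>P\<close>
  with geometrically decreasing norms. Adding them one by one gives a Cauchy sequence of
  representatives, whose limit in \<open>P\<close> represents the limit sought.\<close>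

lemma Q_complete: "complete_in Q (cnorm Q) (carrier Q)"
  unfolding complete_in_def
proof (intro allI impI, elim conjE)
  fix s :: "nat \<Rightarrow> (nat \<Rightarrow> 'a) set"
  assume s: "\<forall>k. s k \<in> carrier Q"
    and Cau: "\<forall>e>0. \<exists>N. \<forall>m\<ge>N. \<forall>n\<ge>N. cnorm Q (s m \<ominus>\<^bsub>Q\<^esub> s n) < e"
  interpret Q: ring Q by (rule ring_Q)
  have "\<exists>N. \<forall>k. \<forall>m\<ge>N k. \<forall>n\<ge>N k. cnorm Q (s m \<ominus>\<^bsub>Q\<^esub> s n) < (1/2)^k"
    by (rule choice) (use Cau in auto)
  then obtain N where N: "\<And>k m n. m \<ge> N k \<Longrightarrow> n \<ge> N k \<Longrightarrow> cnorm Q (s m \<ominus>\<^bsub>Q\<^esub> s n) < (1/2)^k" by blast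
  \<comment> \<open>Partial sums make \<open>r\<close> increasing and keep
    \<open>r k \<ge> N k\<close>.\<close>
  define r where "r k = (\<Sum>i\<le>k. N i)" for k
  have rN: "N k \<le> r k" "r k \<le> r (Suc k)" for k
    unfolding r_def by (auto intro: member_le_sum)
  have step: "\<exists>y. (y \<in> carrier P \<and> s (r (Suc k)) = cls y) \<and> cnorm P (y \<ominus>\<^bsub>P\<^esub> x) < (1/2)^k"
    if x: "x \<in> carrier P \<and> s (r k) = cls x" for k x
  proof -
    obtain y0 where y0: "y0 \<in> carrier P" "s (r (Suc k)) = cls y0" using s carrier_Q by blast
    have "cnorm Q (s (r (Suc k)) \<ominus>\<^bsub>Q\<^esub> s (r k)) < (1/2)^k" using N[of k] rN[of k] by (meson order_trans)
    then obtain d where d: "d \<in> carrier P" "s (r (Suc k)) \<ominus>\<^bsub>Q\<^esub> s (r k) = cls d" "cnorm P d < (1/2)^k"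
      using Q_norm_lift s Q.minus_closed by metis
    define y where "y n = d n \<oplus>\<^bsub>A n\<^esub> x n" for n
    have y: "y \<in> carrier P" using P_add[of d x] d(1) x by (simp add: y_def[abs_def])
    have "cls y = (cls y0 \<ominus>\<^bsub>Q\<^esub> cls x) \<oplus>\<^bsub>Q\<^esub> cls x"
      using d x y0 by (simp add: y_def[abs_def] flip: Q_add)
    also have "\<dots> = cls y0"
      using x y0 by (simp add: a_minus_def Q.add.m_assoc Q.l_neg)
    finally have "s (r (Suc k)) = cls y" using y0 by simp
    moreover have "y \<ominus>\<^bsub>P\<^esub> x = d"
    proof -
      interpret P: ring P by (rule ring_P)
      have "y = d \<oplus>\<^bsub>P\<^esub> x" by (simp add: y_def fun_eq_iff)
      then have "y \<ominus>\<^bsub>P\<^esub> x = (d \<oplus>\<^bsub>P\<^esub> x) \<ominus>\<^bsub>P\<^esub> x" by (rule arg_cong)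
      also have "\<dots> = d"
        using x d(1) by (intro add_minus_P) auto
      finally show ?thesis .
    qed
    ultimately show ?thesis using y d(3) by metis
  qed
  have "\<exists>x. x \<in> carrier P \<and> s (r 0) = cls x" using s carrier_Q by blast
  from dependent_nat_choice[of "\<lambda>k x. x \<in> carrier P \<and> s (r k) = cls x"
      "\<lambda>k x y. cnorm P (y \<ominus>\<^bsub>P\<^esub> x) < (1/2)^k", OF this step]
  obtain b where b: "\<And>k. b k \<in> carrier P" "\<And>k. s (r k) = cls (b k)"
    and bs: "\<And>k. cnorm P (b (Suc k) \<ominus>\<^bsub>P\<^esub> b k) < (1/2)^k" by blast
  have tri: "cnorm P (x \<ominus>\<^bsub>P\<^esub> z) \<le> cnorm P (x \<ominus>\<^bsub>P\<^esub> y) + cnorm P (y \<ominus>\<^bsub>P\<^esub> z)"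
    if "x \<in> carrier P" "y \<in> carrier P" "z \<in> carrier P" for x y z
  proof -
    interpret P: ring P by (rule ring_P)
    have "x \<ominus>\<^bsub>P\<^esub> z = (x \<ominus>\<^bsub>P\<^esub> y) \<oplus>\<^bsub>P\<^esub> (y \<ominus>\<^bsub>P\<^esub> z)"
      using that by (simp add: ring.ring_simprules[OF ring_P] del: bounded_product_simps)
    then show ?thesis using P_add[of "x \<ominus>\<^bsub>P\<^esub> y" "y \<ominus>\<^bsub>P\<^esub> z"] that P.minus_closed by metis
  qed
  have sym: "cnorm P (x \<ominus>\<^bsub>P\<^esub> y) = cnorm P (y \<ominus>\<^bsub>P\<^esub> x)" if "x \<in> carrier P" "y \<in> carrier P" for x y
    using cstar_algebra.cnorm_minus_commute[OF cstar P_comp[OF that(1)] P_comp[OF that(2)]] that by (simp add: P_minus)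
  have geo: "cnorm P (b (k + j) \<ominus>\<^bsub>P\<^esub> b k) \<le> 2 * (1/2)^k - 2 * (1/2)^(k + j)" for k j
  proof (induction j)
    case 0
    have "cnorm P (b k \<ominus>\<^bsub>P\<^esub> b k) = 0"
      using cstar_algebra.minus_eq_zero[OF cstar P_comp[OF b(1)[of k]] P_comp[OF b(1)[of k]]] b(1)
      by (simp add: P_minus cstar_algebra.cnorm_zero[OF cstar])
    then show ?case by (simp del: bounded_product_simps)
  next
    case (Suc j)
    have "cnorm P (b (k + Suc j) \<ominus>\<^bsub>P\<^esub> b k) \<le> cnorm P (b (Suc (k + j)) \<ominus>\<^bsub>P\<^esub> b (k+j)) + cnorm P (b (k + j) \<ominus>\<^bsub>P\<^esub> b k)"
      using tri[of "b (Suc (k + j))" "b (k+j)" "b k"] b(1) by (simp del: bounded_product_simps)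
    then show ?case using Suc bs[of "k+j"] by (simp del: bounded_product_simps)
  qed
  have "\<forall>e>0. \<exists>M. \<forall>m\<ge>M. \<forall>n\<ge>M. cnorm P (b m \<ominus>\<^bsub>P\<^esub> b n) < e"
  proof (intro allI impI)
    fix e :: real assume "e > 0"
    then obtain M where M: "(1/2)^M < e / 4" using real_arch_pow_inv[of "e/4" "1/2"] by auto
    have half: "cnorm P (b m \<ominus>\<^bsub>P\<^esub> b M) < e / 2" if "m \<ge> M" for m
    proof -
      have "cnorm P (b m \<ominus>\<^bsub>P\<^esub> b M) \<le> 2 * (1/2)^M - 2 * (1/2)^m"
        using geo[of M "m - M"] that by (simp del: bounded_product_simps)
      then show ?thesis using M zero_less_power[of "1/2::real" m] by linarith
    qed
    have "cnorm P (b m \<ominus>\<^bsub>P\<^esub> b n) < e" if "m \<ge> M" "n \<ge> M" for m n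
    proof -
      have "cnorm P (b m \<ominus>\<^bsub>P\<^esub> b n) \<le> cnorm P (b m \<ominus>\<^bsub>P\<^esub> b M) + cnorm P (b M \<ominus>\<^bsub>P\<^esub> b n)"
        using tri b(1) by blast
      also have "cnorm P (b M \<ominus>\<^bsub>P\<^esub> b n) = cnorm P (b n \<ominus>\<^bsub>P\<^esub> b M)"
        using sym b(1) by blast
      finally show ?thesis using half[OF that(1)] half[OF that(2)] by linarith
    qed
    then show "\<exists>M. \<forall>m\<ge>M. \<forall>n\<ge>M. cnorm P (b m \<ominus>\<^bsub>P\<^esub> b n) < e" by blast
  qed
  then obtain a where a: "a \<in> carrier P" and lim: "(\<lambda>k. cnorm P (b k \<ominus>\<^bsub>P\<^esub> a)) \<longlonglongrightarrow> 0"
    using P_complete b(1) unfolding complete_in_def by blast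
  have norm0: "0 \<le> cnorm Q X" if "X \<in> carrier Q" for X
  proof -
    obtain x where x: "x \<in> carrier P" "X = cls x" using \<open>X \<in> carrier Q\<close> carrier_Q by blast
    show ?thesis unfolding x(2)
      by (rule tendsto_lowerbound[OF Q_norm_tendsto[OF x(1)] always_eventually U_nonbot])
         (use cstar_algebra.cnorm_nonneg[OF cstar P_comp[OF x(1)]] in blast)
  qed
  have Qtri: "cnorm Q (X \<ominus>\<^bsub>Q\<^esub> Z) \<le> cnorm Q (X \<ominus>\<^bsub>Q\<^esub> Y) + cnorm Q (Y \<ominus>\<^bsub>Q\<^esub> Z)"
    if XYZ: "X \<in> carrier Q" "Y \<in> carrier Q" "Z \<in> carrier Q" for X Y Z
  proof -
    obtain x y z where x: "x \<in> carrier P" "X = cls x" and y: "y \<in> carrier P" "Y = cls y" and z: "z \<in> carrier P" "Z = cls z"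
      using XYZ carrier_Q by metis
    have cl: "(\<lambda>n. v n \<ominus>\<^bsub>A n\<^esub> w n) \<in> carrier P" if "v \<in> carrier P" "w \<in> carrier P" for v w
      using P_minus_closed[OF that] P_minus[OF that] by simp
    show ?thesis
      unfolding x(2) y(2) z(2) Q_minus[OF x(1) y(1)] Q_minus[OF x(1) z(1)] Q_minus[OF y(1) z(1)]
      by (rule tendsto_le[OF U_nonbot tendsto_add[OF Q_norm_tendsto Q_norm_tendsto] Q_norm_tendsto always_eventually])
         (use cl x y z cstar_algebra.cnorm_minus_triangle[OF cstar P_comp[OF x(1)] P_comp[OF y(1)] P_comp[OF z(1)]] in blast)+
  qed
  have "(\<lambda>n. cnorm Q (s n \<ominus>\<^bsub>Q\<^esub> cls a)) \<longlonglongrightarrow> 0"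
  proof (rule LIMSEQ_I)
    fix e :: real assume e: "e > 0"
    then obtain k0 where k0: "(1/2)^k0 < e / 2" using real_arch_pow_inv[of "e/2" "1/2"] by auto
    have "eventually (\<lambda>k. cnorm P (b k \<ominus>\<^bsub>P\<^esub> a) < e / 2) sequentially"
      using order_tendstoD(2)[OF lim] e half_gt_zero by blast
    then obtain k1 where k1: "\<And>k. k \<ge> k1 \<Longrightarrow> cnorm P (b k \<ominus>\<^bsub>P\<^esub> a) < e / 2"
      unfolding eventually_sequentially by blast
    define k where "k = max k0 k1"
    have pk: "(1/2::real)^k \<le> (1/2)^k0" unfolding k_def by (intro power_decreasing) auto
    have "cnorm Q (s n \<ominus>\<^bsub>Q\<^esub> cls a) < e" if n: "n \<ge> r k" for n
    proof -
      have "cnorm Q (s n \<ominus>\<^bsub>Q\<^esub> s (r k)) < (1/2)^k" using N[of k n "r k"] rN[of k] n by linarith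
      moreover have "cnorm Q (s (r k) \<ominus>\<^bsub>Q\<^esub> cls a) < e / 2"
        using Q_norm_le[OF P_minus_closed[OF b(1) a], of k] k1[of k] Q_minus[OF b(1) a, of k] P_minus[OF b(1) a, of k]
        by (simp add: b(2) k_def del: bounded_product_simps)
      moreover have "cnorm Q (s n \<ominus>\<^bsub>Q\<^esub> cls a) \<le> cnorm Q (s n \<ominus>\<^bsub>Q\<^esub> s (r k)) + cnorm Q (s (r k) \<ominus>\<^bsub>Q\<^esub> cls a)"
        using Qtri s cls_closed[OF a] by blast
      ultimately show ?thesis using k0 pk by linarith
    qed
    moreover have "0 \<le> cnorm Q (s n \<ominus>\<^bsub>Q\<^esub> cls a)" for n
      using norm0 s cls_closed[OF a] Q.minus_closed by blast
    ultimately show "\<exists>no. \<forall>n\<ge>no. norm (cnorm Q (s n \<ominus>\<^bsub>Q\<^esub> cls a) - 0) < e" by auto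
  qed
  then show "\<exists>a\<in>carrier Q. (\<lambda>n. cnorm Q (s n \<ominus>\<^bsub>Q\<^esub> a)) \<longlonglongrightarrow> 0" using cls_closed[OF a] by blast
qed


lemma comp_closed:
  "a \<in> carrier P \<Longrightarrow> b \<in> carrier P \<Longrightarrow> (\<lambda>n. a n \<otimes>\<^bsub>A n\<^esub> b n) \<in> carrier P"
  "a \<in> carrier P \<Longrightarrow> b \<in> carrier P \<Longrightarrow> (\<lambda>n. a n \<oplus>\<^bsub>A n\<^esub> b n) \<in> carrier P"
  "a \<in> carrier P \<Longrightarrow> b \<in> carrier P \<Longrightarrow> (\<lambda>n. a n \<ominus>\<^bsub>A n\<^esub> b n) \<in> carrier P"
  "a \<in> carrier P \<Longrightarrow> (\<lambda>n. c \<odot>\<^bsub>A n\<^esub> a n) \<in> carrier P"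
  "a \<in> carrier P \<Longrightarrow> (\<lambda>n. star (A n) (a n)) \<in> carrier P"
  "(\<lambda>n. \<one>\<^bsub>A n\<^esub>) \<in> carrier P"
  "(\<lambda>n. \<zero>\<^bsub>A n\<^esub>) \<in> carrier P"
  using P_mult[of a b] P_add[of a b] P_minus_closed[of a b] P_minus[of a b] P_smult[of a c] P_star[of a]
    ring.ring_simprules(6)[OF ring_P] ring.ring_simprules(2)[OF ring_P]
  by simp_all

text \<open>Algebraic laws hold for representatives in each coordinate. Norm identities and
  inequalities are limits along \<open>U\<close> of those in the factors, since the quotient norm is
  such a limit.\<close>

theorem cstar_Q: "cstar_algebra Q"
proof (rule cstar_algebraI[OF ring_Q])
  show "c \<odot>\<^bsub>Q\<^esub> X \<in> carrier Q" if "X \<in> carrier Q" for c X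
    using that by (auto simp: carrier_Q Q_smult intro!: cls_closed comp_closed)
  show "(c + d) \<odot>\<^bsub>Q\<^esub> X = c \<odot>\<^bsub>Q\<^esub> X \<oplus>\<^bsub>Q\<^esub> d \<odot>\<^bsub>Q\<^esub> X" if X: "X \<in> carrier Q" for c d X
  proof -
    obtain x where x: "x \<in> carrier P" "X = cls x" using X carrier_Q by blast
    show ?thesis unfolding x(2)
      by (simp add: Q_smult Q_add x(1) comp_closed cstar_algebra.csmult_l_distr[OF cstar P_comp[OF x(1)]])
  qed
  show "c \<odot>\<^bsub>Q\<^esub> (X \<oplus>\<^bsub>Q\<^esub> Y) = c \<odot>\<^bsub>Q\<^esub> X \<oplus>\<^bsub>Q\<^esub> c \<odot>\<^bsub>Q\<^esub> Y" if XY: "X \<in> carrier Q" "Y \<in> carrier Q" for c X Y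
  proof -
    obtain x y where x: "x \<in> carrier P" "X = cls x" and y: "y \<in> carrier P" "Y = cls y" using XY carrier_Q by metis
    show ?thesis unfolding x(2) y(2)
      by (simp add: Q_smult Q_add x(1) y(1) comp_closed cstar_algebra.csmult_r_distr[OF cstar P_comp[OF x(1)] P_comp[OF y(1)]])
  qed
  show "(c * d) \<odot>\<^bsub>Q\<^esub> X = c \<odot>\<^bsub>Q\<^esub> (d \<odot>\<^bsub>Q\<^esub> X)" if X: "X \<in> carrier Q" for c d X
  proof -
    obtain x where x: "x \<in> carrier P" "X = cls x" using X carrier_Q by blast
    show ?thesis unfolding x(2)
      by (simp add: Q_smult x(1) comp_closed cstar_algebra.csmult_assoc[OF cstar P_comp[OF x(1)]])
  qed
  show "1 \<odot>\<^bsub>Q\<^esub> X = X" if X: "X \<in> carrier Q" for X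
  proof -
    obtain x where x: "x \<in> carrier P" "X = cls x" using X carrier_Q by blast
    show ?thesis unfolding x(2)
      by (simp add: Q_smult x(1) cstar_algebra.csmult_one[OF cstar P_comp[OF x(1)]])
  qed
  show "cstar_algebra_axioms Q"
  proof (unfold_locales)
    show "complete_in Q (cnorm Q) (carrier Q)" by (rule Q_complete)
    fix X assume X: "X \<in> carrier Q"
    then obtain x where x: "x \<in> carrier P" "X = cls x" using carrier_Q by blast
    note xn = P_comp[OF x(1)]
    note [simp] = x(1) comp_closed
    show "star Q X \<in> carrier Q" unfolding x(2) by (simp add: Q_star)
    show "star Q (star Q X) = X" unfolding x(2) by (simp add: Q_star cstar_algebra.star_star[OF cstar xn])
    show "star Q (c \<odot>\<^bsub>Q\<^esub> X) = cnj c \<odot>\<^bsub>Q\<^esub> star Q X" for c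
      unfolding x(2) by (simp add: Q_star Q_smult cstar_algebra.star_smult[OF cstar xn])
    show "0 \<le> cnorm Q X" unfolding x(2)
      by (rule tendsto_lowerbound[OF Q_norm_tendsto[OF x(1)] always_eventually U_nonbot])
         (use cstar_algebra.cnorm_nonneg[OF cstar xn] in blast)
    show "cnorm Q X = 0 \<longleftrightarrow> X = \<zero>\<^bsub>Q\<^esub>"
    proof -
      have "(\<lambda>n. cnorm (A n) (x n \<ominus>\<^bsub>A n\<^esub> \<zero>\<^bsub>A n\<^esub>)) = (\<lambda>n. cnorm (A n) (x n))"
        using xn by (simp add: fun_eq_iff ring.ring_simprules[OF cstar_algebra.ring_A[OF cstar]])
      then have "X = \<zero>\<^bsub>Q\<^esub> \<longleftrightarrow> ((\<lambda>n. cnorm (A n) (x n)) \<longlongrightarrow> 0) U"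
        using cls_eq[OF x(1) comp_closed(7)] by (simp add: Q_zero x(2))
      moreover have "((\<lambda>n. cnorm (A n) (x n)) \<longlongrightarrow> 0) U \<longleftrightarrow> cnorm Q X = 0"
      proof
        assume "((\<lambda>n. cnorm (A n) (x n)) \<longlongrightarrow> 0) U"
        from tendsto_unique[OF U_nonbot Q_norm_tendsto[OF x(1)] this] show "cnorm Q X = 0"
          by (simp only: x(2))
      next
        assume 0: "cnorm Q X = 0"
        show "((\<lambda>n. cnorm (A n) (x n)) \<longlongrightarrow> 0) U"
          using Q_norm_tendsto[OF x(1)] 0 by (simp only: x(2))
      qed
      ultimately show ?thesis by (simp only:)
    qed
    show "cnorm Q (c \<odot>\<^bsub>Q\<^esub> X) = cmod c * cnorm Q X" for c
    proof -
      have "((\<lambda>n. cmod c * cnorm (A n) (x n)) \<longlongrightarrow> cmod c * cnorm Q X) U"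
        unfolding x(2) by (intro tendsto_mult tendsto_const Q_norm_tendsto x)
      moreover have "((\<lambda>n. cmod c * cnorm (A n) (x n)) \<longlongrightarrow> cnorm Q (c \<odot>\<^bsub>Q\<^esub> X)) U"
        using Q_norm_tendsto[OF comp_closed(4)[OF x(1)], of c] cstar_algebra.cnorm_smult[OF cstar xn]
        unfolding x(2) by (simp add: Q_smult)
      ultimately show ?thesis by (rule tendsto_unique[OF U_nonbot, rotated])
    qed
    show "cnorm Q (star Q X \<otimes>\<^bsub>Q\<^esub> X) = (cnorm Q X)\<^sup>2"
    proof -
      have "((\<lambda>n. (cnorm (A n) (x n))\<^sup>2) \<longlongrightarrow> (cnorm Q X)\<^sup>2) U"
        unfolding x(2) by (intro tendsto_power Q_norm_tendsto x)
      moreover have "((\<lambda>n. (cnorm (A n) (x n))\<^sup>2) \<longlongrightarrow> cnorm Q (star Q X \<otimes>\<^bsub>Q\<^esub> X)) U"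
        using Q_norm_tendsto[OF comp_closed(1)[OF comp_closed(5)[OF x(1)] x(1)]] cstar_algebra.cstar_identity[OF cstar xn]
        unfolding x(2) by (simp add: Q_star Q_mult)
      ultimately show ?thesis by (rule tendsto_unique[OF U_nonbot, rotated])
    qed
    fix Y assume Y: "Y \<in> carrier Q"
    then obtain y where y: "y \<in> carrier P" "Y = cls y" using carrier_Q by blast
    note yn = P_comp[OF y(1)]
    note [simp] = y(1)
    show "(c \<odot>\<^bsub>Q\<^esub> X) \<otimes>\<^bsub>Q\<^esub> Y = c \<odot>\<^bsub>Q\<^esub> (X \<otimes>\<^bsub>Q\<^esub> Y)" for c
      unfolding x(2) y(2) by (simp add: Q_mult Q_smult cstar_algebra.smult_mult_left[OF cstar xn yn])
    show "X \<otimes>\<^bsub>Q\<^esub> (c \<odot>\<^bsub>Q\<^esub> Y) = c \<odot>\<^bsub>Q\<^esub> (X \<otimes>\<^bsub>Q\<^esub> Y)" for c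
      unfolding x(2) y(2) by (simp add: Q_mult Q_smult cstar_algebra.smult_mult_right[OF cstar xn yn])
    show "star Q (X \<oplus>\<^bsub>Q\<^esub> Y) = star Q X \<oplus>\<^bsub>Q\<^esub> star Q Y"
      unfolding x(2) y(2) by (simp add: Q_add Q_star cstar_algebra.star_add[OF cstar xn yn])
    show "star Q (X \<otimes>\<^bsub>Q\<^esub> Y) = star Q Y \<otimes>\<^bsub>Q\<^esub> star Q X"
      unfolding x(2) y(2) by (simp add: Q_mult Q_star cstar_algebra.star_mult[OF cstar xn yn])
    show "cnorm Q (X \<oplus>\<^bsub>Q\<^esub> Y) \<le> cnorm Q X + cnorm Q Y"
      unfolding x(2) y(2) Q_add[OF x(1) y(1)]
      by (rule tendsto_le[OF U_nonbot tendsto_add[OF Q_norm_tendsto Q_norm_tendsto] Q_norm_tendsto always_eventually])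
         (use cstar_algebra.cnorm_triangle[OF cstar xn yn] in \<open>auto simp del: bounded_product_simps\<close>)
    show "cnorm Q (X \<otimes>\<^bsub>Q\<^esub> Y) \<le> cnorm Q X * cnorm Q Y"
      unfolding x(2) y(2) Q_mult[OF x(1) y(1)]
      by (rule tendsto_le[OF U_nonbot tendsto_mult[OF Q_norm_tendsto Q_norm_tendsto] Q_norm_tendsto always_eventually])
         (use cstar_algebra.cnorm_mult[OF cstar xn yn] in \<open>auto simp del: bounded_product_simps\<close>)
  qed
qed

end

section \<open>Continuous functions and the ultracoproduct\<close>

lemma cfun_simps [simp]:
  "mult (cfun_algebra K) f g = (\<lambda>x. f x * g x)"
  "one (cfun_algebra K) = (\<lambda>x. if x \<in> topspace K then 1 else 0)"
  "\<zero>\<^bsub>cfun_algebra K\<^esub> = (\<lambda>x. 0)"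
  "add (cfun_algebra K) f g = (\<lambda>x. f x + g x)"
  "smult (cfun_algebra K) c f = (\<lambda>x. c * f x)"
  "star (cfun_algebra K) f = (\<lambda>x. cnj (f x))"
  "cnorm (cfun_algebra K) f = (SUP x. cmod (f x))"
  by (simp_all add: cfun_algebra_def)

lemma carrier_cfun:
  "f \<in> carrier (cfun_algebra K) \<longleftrightarrow> continuous_map K euclidean f \<and> (\<forall>x. x \<notin> topspace K \<longrightarrow> f x = 0)"
  by (simp add: cfun_algebra_def)

lemma cfun_bdd:
  assumes "compact_space K" "f \<in> carrier (cfun_algebra K)"
  shows "bdd_above (range (\<lambda>x. cmod (f x)))"
proof -
  have "compact (f ` topspace K)"
  proof -
    have "compactin K (topspace K)" using assms(1) by (simp add: compact_space_def)
    moreover have "continuous_map K euclidean f" using assms(2) by (simp add: carrier_cfun)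
    ultimately have "compactin euclidean (f ` topspace K)" by (rule image_compactin)
    then show ?thesis by simp
  qed
  then obtain B where B: "\<And>x. x \<in> topspace K \<Longrightarrow> cmod (f x) \<le> B"
    using compact_imp_bounded[of "f ` topspace K"] unfolding bounded_iff by blast
  have "cmod (f x) \<le> max B 0" for x
  proof (cases "x \<in> topspace K")
    case True then show ?thesis using B[OF True] by linarith
  next
    case False then show ?thesis using assms(2) by (simp add: carrier_cfun)
  qed
  then show ?thesis by (rule bdd_aboveI2)
qed

lemma cfun_norm_le:
  "compact_space K \<Longrightarrow> f \<in> carrier (cfun_algebra K) \<Longrightarrow> cmod (f x) \<le> cnorm (cfun_algebra K) f"
  using cSUP_upper[OF UNIV_I cfun_bdd] by simp

lemma cfun_norm_leI: "(\<And>x. cmod (f x) \<le> B) \<Longrightarrow> cnorm (cfun_algebra K) f \<le> B"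
  by (simp add: cSUP_least)

lemma cfun_norm_leI':
  "f \<in> carrier (cfun_algebra K) \<Longrightarrow> 0 \<le> B \<Longrightarrow> (\<And>x. x \<in> topspace K \<Longrightarrow> cmod (f x) \<le> B) \<Longrightarrow> cnorm (cfun_algebra K) f \<le> B"
proof (rule cfun_norm_leI)
  fix x
  assume "f \<in> carrier (cfun_algebra K)" "0 \<le> B" "\<And>x. x \<in> topspace K \<Longrightarrow> cmod (f x) \<le> B"
  then show "cmod (f x) \<le> B" by (cases "x \<in> topspace K") (auto simp: carrier_cfun)
qed

lemma continuous_map_complex_mult:
  fixes f g :: "'a \<Rightarrow> complex"
  assumes "continuous_map K euclidean f" "continuous_map K euclidean g"
  shows "continuous_map K euclidean (\<lambda>x. f x * g x)"
proof -
  have "continuous_map K (prod_topology euclidean euclidean) (\<lambda>x. (f x, g x))"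
    by (rule continuous_map_pairedI[OF assms])
  moreover have "continuous_on UNIV (\<lambda>p. fst p * snd p :: complex)"
    by (intro continuous_intros)
  then have "continuous_map (prod_topology euclidean euclidean) euclidean (\<lambda>p. fst p * snd p :: complex)"
    by simp
  ultimately show ?thesis
    using continuous_map_compose[of K _ "\<lambda>x. (f x, g x)" euclidean "\<lambda>p. fst p * snd p"]
    unfolding o_def fst_conv snd_conv by blast
qed

lemma cfun_closed:
  assumes "f \<in> carrier (cfun_algebra K)" "g \<in> carrier (cfun_algebra K)"
  shows "(\<lambda>x. f x * g x) \<in> carrier (cfun_algebra K)"
    "(\<lambda>x. f x + g x) \<in> carrier (cfun_algebra K)"
    "(\<lambda>x. f x - g x) \<in> carrier (cfun_algebra K)"
    "(\<lambda>x. c * f x) \<in> carrier (cfun_algebra K)"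
    "(\<lambda>x. cnj (f x)) \<in> carrier (cfun_algebra K)"
    "(\<lambda>x. if x \<in> topspace K then c else 0) \<in> carrier (cfun_algebra K)"
    "(\<lambda>x. 0) \<in> carrier (cfun_algebra K)"
    "(\<lambda>x. complex_of_real (cmod (f x))) \<in> carrier (cfun_algebra K)"
    "(\<lambda>x. complex_of_real (Re (f x))) \<in> carrier (cfun_algebra K)"
    "(\<lambda>x. complex_of_real (Im (f x))) \<in> carrier (cfun_algebra K)"
proof -
  have "continuous_map K euclidean (\<lambda>x. if x \<in> topspace K then c else 0)"
    by (rule continuous_map_eq[of K euclidean "\<lambda>_. c"]) auto
  moreover have "continuous_map K euclidean (\<lambda>x. cnj (f x))"
    and "continuous_map K euclidean (\<lambda>x. complex_of_real (Re (f x)))"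
    and "continuous_map K euclidean (\<lambda>x. complex_of_real (Im (f x)))"
    and "continuous_map K euclidean (\<lambda>x. complex_of_real (cmod (f x)))"
    using assms continuous_map_compose[of K euclidean f euclidean cnj]
      continuous_map_compose[of K euclidean f euclidean "\<lambda>z. complex_of_real (Re z)"]
      continuous_map_compose[of K euclidean f euclidean "\<lambda>z. complex_of_real (Im z)"]
      continuous_map_compose[of K euclidean f euclidean "\<lambda>z. complex_of_real (cmod z)"]
      continuous_on_Re[OF continuous_on_id, of UNIV] continuous_on_Im[OF continuous_on_id, of UNIV]
      continuous_on_norm[OF continuous_on_id, of UNIV]
    by (auto simp: carrier_cfun o_def intro!: continuous_intros)
  ultimately show "(\<lambda>x. f x * g x) \<in> carrier (cfun_algebra K)"
    "(\<lambda>x. f x + g x) \<in> carrier (cfun_algebra K)"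
    "(\<lambda>x. f x - g x) \<in> carrier (cfun_algebra K)"
    "(\<lambda>x. c * f x) \<in> carrier (cfun_algebra K)"
    "(\<lambda>x. cnj (f x)) \<in> carrier (cfun_algebra K)"
    "(\<lambda>x. if x \<in> topspace K then c else 0) \<in> carrier (cfun_algebra K)"
    "(\<lambda>x. 0) \<in> carrier (cfun_algebra K)"
    "(\<lambda>x. complex_of_real (cmod (f x))) \<in> carrier (cfun_algebra K)"
    "(\<lambda>x. complex_of_real (Re (f x))) \<in> carrier (cfun_algebra K)"
    "(\<lambda>x. complex_of_real (Im (f x))) \<in> carrier (cfun_algebra K)"
    using assms by (auto simp: carrier_cfun intro!: continuous_map_add continuous_map_diff continuous_map_complex_mult)
qed

lemma cfun_zero: "(\<lambda>x. 0) \<in> carrier (cfun_algebra K)"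
  by (simp add: carrier_cfun)

lemma cfun_one: "(\<lambda>x. if x \<in> topspace K then 1 else 0) \<in> carrier (cfun_algebra K)"
  using cfun_closed(6)[OF cfun_zero cfun_zero] .

lemma ring_cfun: "ring (cfun_algebra K)"
proof (rule ringI)
  show "abelian_group (cfun_algebra K)"
  proof (rule abelian_groupI)
    fix f assume f: "f \<in> carrier (cfun_algebra K)"
    show "\<exists>g\<in>carrier (cfun_algebra K). g \<oplus>\<^bsub>cfun_algebra K\<^esub> f = \<zero>\<^bsub>cfun_algebra K\<^esub>"
      by (rule bexI[of _ "\<lambda>x. (-1) * f x"]) (use cfun_closed(4)[OF f f, of "-1"] in simp_all)
  qed (simp_all add: cfun_closed(2) algebra_simps cfun_zero)
  show "monoid (cfun_algebra K)"
  proof (rule monoidI)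
    fix f assume "f \<in> carrier (cfun_algebra K)"
    then show "\<one>\<^bsub>cfun_algebra K\<^esub> \<otimes>\<^bsub>cfun_algebra K\<^esub> f = f" "f \<otimes>\<^bsub>cfun_algebra K\<^esub> \<one>\<^bsub>cfun_algebra K\<^esub> = f"
      by (auto simp: fun_eq_iff carrier_cfun)
  qed (simp_all add: cfun_closed(1) cfun_one algebra_simps)
qed (simp_all add: algebra_simps)

lemma cfun_minus:
  assumes "f \<in> carrier (cfun_algebra K)" "g \<in> carrier (cfun_algebra K)"
  shows "f \<ominus>\<^bsub>cfun_algebra K\<^esub> g = (\<lambda>x. f x - g x)"
proof -
  interpret ring "cfun_algebra K" by (rule ring_cfun)
  have m: "(\<lambda>x. (-1) * g x) \<in> carrier (cfun_algebra K)" using cfun_closed(4)[OF assms(2) assms(2)] .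
  have "\<ominus>\<^bsub>cfun_algebra K\<^esub> g = (\<lambda>x. (-1) * g x)"
    using minus_equality[OF _ assms(2) m] by simp
  then show ?thesis by (simp add: a_minus_def)
qed

theorem cstar_cfun:
  assumes K: "compact_space K"
  shows "cstar_algebra (cfun_algebra K)"
proof (rule cstar_algebraI[OF ring_cfun])
  let ?A = "cfun_algebra K"
  note le = cfun_norm_le[OF K]
  have nn: "0 \<le> cnorm ?A f" if "f \<in> carrier ?A" for f
    using le[OF that, of undefined] norm_ge_zero order_trans by blast
  have smult_le: "cnorm ?A (\<lambda>x. c * f x) = cmod c * cnorm ?A f" if f: "f \<in> carrier ?A" for c f
  proof (rule antisym)
    show "cnorm ?A (\<lambda>x. c * f x) \<le> cmod c * cnorm ?A f"
      by (rule cfun_norm_leI) (use le[OF f] in \<open>simp add: norm_mult mult_left_mono del: cfun_simps\<close>)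
    show "cmod c * cnorm ?A f \<le> cnorm ?A (\<lambda>x. c * f x)"
    proof (cases "c = 0")
      case False
      have "cnorm ?A f \<le> cnorm ?A (\<lambda>x. c * f x) / cmod c"
      proof (rule cfun_norm_leI)
        fix x show "cmod (f x) \<le> cnorm ?A (\<lambda>x. c * f x) / cmod c"
          using le[OF cfun_closed(4)[OF f f], of c x] False
          by (simp add: norm_mult pos_le_divide_eq mult.commute del: cfun_simps)
      qed
      then show ?thesis using False by (simp add: pos_le_divide_eq mult.commute del: cfun_simps)
    qed simp
  qed
  show "cstar_algebra_axioms ?A"
  proof (unfold_locales)
    show "complete_in ?A (cnorm ?A) (carrier ?A)"
      unfolding complete_in_def
    proof (intro allI impI, elim conjE)
      fix s :: "nat \<Rightarrow> 'a \<Rightarrow> complex"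
      assume s: "\<forall>k. s k \<in> carrier ?A"
        and Cau: "\<forall>e>0. \<exists>N. \<forall>m\<ge>N. \<forall>n\<ge>N. cnorm ?A (s m \<ominus>\<^bsub>?A\<^esub> s n) < e"
      have d: "cmod (s m x - s n x) \<le> cnorm ?A (s m \<ominus>\<^bsub>?A\<^esub> s n)" for m n x
        using le[OF cfun_closed(3), of "s m" "s n" x] s cfun_minus[of "s m" K "s n"] by simp
      have "\<forall>e>0. \<exists>N. \<forall>m n x. N \<le> m \<and> N \<le> n \<and> True \<longrightarrow> dist (s m x) (s n x) < e"
        using Cau d unfolding dist_norm by (meson order_le_less_trans)
      then have "\<exists>l. \<forall>e>0. \<exists>N. \<forall>n x. n \<ge> N \<longrightarrow> dist (s n x) (l x) < e"
        using uniformly_convergent_eq_cauchy[of "\<lambda>_. True" s] by auto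
      then obtain f where f: "\<And>e. e > 0 \<Longrightarrow> \<exists>N. \<forall>n x. n \<ge> N \<longrightarrow> dist (s n x) (f x) < e" by blast
      have "continuous_map K Met_TC.mtopology f"
      proof (rule Met_TC.continuous_map_uniform_limit[where F=sequentially and f=s])
        show "\<forall>\<^sub>F n in sequentially. continuous_map K Met_TC.mtopology (s n)"
          using s by (simp add: carrier_cfun)
        show "\<forall>\<^sub>F n in sequentially. \<forall>x\<in>topspace K. f x \<in> UNIV \<and> dist (s n x) (f x) < e" if "0 < e" for e
          using f[OF that] unfolding eventually_sequentially by blast
      qed simp
      moreover have "f x = 0" if "x \<notin> topspace K" for x
      proof -
        have s0: "s n x = 0" for n using s that by (simp add: carrier_cfun)
        have "cmod (f x) < e" if e: "e > 0" for e
        proof -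
          obtain N where "\<forall>n x. n \<ge> N \<longrightarrow> dist (s n x) (f x) < e" using f[OF e] by blast
          then have "dist (s N x) (f x) < e" by blast
          then show ?thesis by (simp add: s0)
        qed
        from this[of "cmod (f x)"] show ?thesis by (cases "f x = 0") auto
      qed
      ultimately have fc: "f \<in> carrier ?A" by (simp add: carrier_cfun)
      have "(\<lambda>n. cnorm ?A (s n \<ominus>\<^bsub>?A\<^esub> f)) \<longlonglongrightarrow> 0"
      proof (rule LIMSEQ_I)
        fix e :: real assume e: "0 < e"
        then obtain N where N: "\<forall>n x. n \<ge> N \<longrightarrow> dist (s n x) (f x) < e / 2" using f half_gt_zero by blast
        have "norm (cnorm ?A (s n \<ominus>\<^bsub>?A\<^esub> f) - 0) < e" if "n \<ge> N" for n
        proof -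
          have "cnorm ?A (s n \<ominus>\<^bsub>?A\<^esub> f) \<le> e / 2"
            using N that s fc by (intro cfun_norm_leI) (simp add: cfun_minus dist_norm less_imp_le del: cfun_simps)
          moreover have "0 \<le> cnorm ?A (s n \<ominus>\<^bsub>?A\<^esub> f)"
            using nn[OF cfun_closed(3), of "s n" f] s fc by (simp add: cfun_minus del: cfun_simps)
          ultimately show ?thesis using e by (simp del: cfun_simps)
        qed
        then show "\<exists>no. \<forall>n\<ge>no. norm (cnorm ?A (s n \<ominus>\<^bsub>?A\<^esub> f) - 0) < e" by blast
      qed
      then show "\<exists>a\<in>carrier ?A. (\<lambda>n. cnorm ?A (s n \<ominus>\<^bsub>?A\<^esub> a)) \<longlonglongrightarrow> 0" using fc by blast
    qed
    fix f assume f: "f \<in> carrier ?A"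
    show "star ?A f \<in> carrier ?A" using cfun_closed(5)[OF f f] by simp
    show "0 \<le> cnorm ?A f" by (rule nn[OF f])
    show "cnorm ?A (c \<odot>\<^bsub>?A\<^esub> f) = cmod c * cnorm ?A f" for c
      using smult_le[OF f] by (simp del: cfun_simps add: cfun_simps(5))
    show "cnorm ?A f = 0 \<longleftrightarrow> f = \<zero>\<^bsub>?A\<^esub>"
    proof
      assume "cnorm ?A f = 0"
      then have "cmod (f x) \<le> 0" for x using le[OF f, of x] by (simp del: cfun_simps)
      then show "f = \<zero>\<^bsub>?A\<^esub>" by (simp add: fun_eq_iff)
    qed simp
    show "cnorm ?A (star ?A f \<otimes>\<^bsub>?A\<^esub> f) = (cnorm ?A f)\<^sup>2"
    proof -
      have fc: "(\<lambda>x. cnj (f x) * f x) \<in> carrier ?A" using cfun_closed(1)[OF cfun_closed(5)[OF f f] f] .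
      have c: "cmod (cnj (f x) * f x) = (cmod (f x))\<^sup>2" for x
        by (simp add: norm_mult power2_eq_square)
      have "cnorm ?A (\<lambda>x. cnj (f x) * f x) \<le> (cnorm ?A f)\<^sup>2"
        by (rule cfun_norm_leI) (simp add: c power_mono le[OF f] del: cfun_simps)
      moreover have "cnorm ?A f \<le> sqrt (cnorm ?A (\<lambda>x. cnj (f x) * f x))"
      proof (rule cfun_norm_leI)
        fix x show "cmod (f x) \<le> sqrt (cnorm ?A (\<lambda>x. cnj (f x) * f x))"
          using le[OF fc, of x] by (intro real_le_rsqrt) (simp add: c del: cfun_simps)
      qed
      then have "(cnorm ?A f)\<^sup>2 \<le> cnorm ?A (\<lambda>x. cnj (f x) * f x)"
        using power_mono[OF _ nn[OF f], of "sqrt (cnorm ?A (\<lambda>x. cnj (f x) * f x))" 2] real_sqrt_pow2[OF nn[OF fc]] by simp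
      ultimately show ?thesis by (simp del: cfun_simps add: cfun_simps(1,6))
    qed
    fix g assume g: "g \<in> carrier ?A"
    show "cnorm ?A (f \<oplus>\<^bsub>?A\<^esub> g) \<le> cnorm ?A f + cnorm ?A g"
    proof (rule cfun_norm_leI)
      fix x show "cmod ((f \<oplus>\<^bsub>?A\<^esub> g) x) \<le> cnorm ?A f + cnorm ?A g"
        using norm_triangle_ineq[of "f x" "g x"] le[OF f, of x] le[OF g, of x] by (simp del: cfun_simps add: cfun_simps(4))
    qed
    show "cnorm ?A (f \<otimes>\<^bsub>?A\<^esub> g) \<le> cnorm ?A f * cnorm ?A g"
    proof (rule cfun_norm_leI)
      fix x show "cmod ((f \<otimes>\<^bsub>?A\<^esub> g) x) \<le> cnorm ?A f * cnorm ?A g"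
        using mult_mono[OF le[OF f, of x] le[OF g, of x] nn[OF f]] by (simp del: cfun_simps add: cfun_simps(1) norm_mult)
    qed
  qed (simp_all add: algebra_simps)
qed (simp_all add: algebra_simps cfun_closed(4))

section \<open>Characters of the ultraproduct of function algebras\<close>

locale cfun_ultra = ultra U for U +
  fixes K :: "nat \<Rightarrow> 'k topology"
  assumes compK: "compact_space (K n)" and neK: "topspace (K n) \<noteq> {}"
begin

sublocale C: cstar_ultra "\<lambda>n. cfun_algebra (K n)" U
  by (intro cstar_ultra.intro cstar_family.intro cstar_cfun[OF compK] ultra_axioms)

definition charsp :: "((nat \<Rightarrow> 'k \<Rightarrow> complex) set \<Rightarrow> complex) set" where
  "charsp = characters C.Q"

lemma Q_eq: "cfun_ultraproduct U K = C.Q"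
  by (simp add: cfun_ultraproduct_def)

lemma ultracoproduct_eq: "ultracoproduct U K = top_of_set charsp"
  by (simp add: ultracoproduct_def Q_eq charsp_def)

lemma char_hom:
  assumes "h \<in> charsp"
  shows "f \<in> carrier C.P \<Longrightarrow> g \<in> carrier C.P \<Longrightarrow> h (C.cls (\<lambda>n x. f n x * g n x)) = h (C.cls f) * h (C.cls g)"
    "f \<in> carrier C.P \<Longrightarrow> g \<in> carrier C.P \<Longrightarrow> h (C.cls (\<lambda>n x. f n x + g n x)) = h (C.cls f) + h (C.cls g)"
    "f \<in> carrier C.P \<Longrightarrow> h (C.cls (\<lambda>n x. c * f n x)) = c * h (C.cls f)"
    "h (C.cls (\<lambda>n x. if x \<in> topspace (K n) then 1 else 0)) = 1"
    "X \<notin> carrier C.Q \<Longrightarrow> h X = 0"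
proof -
  have r: "h \<in> ring_hom C.Q complex_ring"
    and s: "\<And>X c. X \<in> carrier C.Q \<Longrightarrow> h (c \<odot>\<^bsub>C.Q\<^esub> X) = c * h X"
    and z: "\<And>X. X \<notin> carrier C.Q \<Longrightarrow> h X = 0"
    using assms by (auto simp: charsp_def characters_def)
  show "f \<in> carrier C.P \<Longrightarrow> g \<in> carrier C.P \<Longrightarrow> h (C.cls (\<lambda>n x. f n x * g n x)) = h (C.cls f) * h (C.cls g)"
    using ring_hom_mult[OF r, of "C.cls f" "C.cls g"] C.Q_mult[of f g] by (simp add: C.cls_closed)
  show "f \<in> carrier C.P \<Longrightarrow> g \<in> carrier C.P \<Longrightarrow> h (C.cls (\<lambda>n x. f n x + g n x)) = h (C.cls f) + h (C.cls g)"
    using ring_hom_add[OF r, of "C.cls f" "C.cls g"] C.Q_add[of f g] by (simp add: C.cls_closed)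
  show "f \<in> carrier C.P \<Longrightarrow> h (C.cls (\<lambda>n x. c * f n x)) = c * h (C.cls f)"
    using s[of "C.cls f" c] C.Q_smult[of f c] by (simp add: C.cls_closed)
  show "h (C.cls (\<lambda>n x. if x \<in> topspace (K n) then 1 else 0)) = 1"
    using ring_hom_one[OF r] C.Q_one by simp
  show "X \<notin> carrier C.Q \<Longrightarrow> h X = 0" by (rule z)
qed

lemma QE:
  assumes "X \<in> carrier C.Q"
  obtains f where "f \<in> carrier C.P" "X = C.cls f"
  using assms unfolding C.carrier_Q by blast

lemma PC: "f \<in> carrier C.P \<Longrightarrow> f n \<in> carrier (cfun_algebra (K n))"
  by (rule C.P_comp)

lemma PC_norm: "f \<in> carrier C.P \<Longrightarrow> cmod (f n x) \<le> cnorm C.P f"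
  using cfun_norm_le[OF compK PC, of f n x] C.P_norm_le[of f n] by (meson order_trans)

lemma PC_I: "(\<And>n. f n \<in> carrier (cfun_algebra (K n))) \<Longrightarrow> (\<And>n x. cmod (f n x) \<le> B) \<Longrightarrow> f \<in> carrier C.P"
  by (rule C.PI[where B=B]) (auto intro: cfun_norm_leI simp del: cfun_simps)

lemma PC_closed:
  "f \<in> carrier C.P \<Longrightarrow> g \<in> carrier C.P \<Longrightarrow> (\<lambda>n x. f n x * g n x) \<in> carrier C.P"
  "f \<in> carrier C.P \<Longrightarrow> g \<in> carrier C.P \<Longrightarrow> (\<lambda>n x. f n x + g n x) \<in> carrier C.P"
  "f \<in> carrier C.P \<Longrightarrow> (\<lambda>n x. c * f n x) \<in> carrier C.P"
  "f \<in> carrier C.P \<Longrightarrow> (\<lambda>n x. cnj (f n x)) \<in> carrier C.P"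
  "(\<lambda>n x. if x \<in> topspace (K n) then c else 0) \<in> carrier C.P"
  "f \<in> carrier C.P \<Longrightarrow> (\<lambda>n x. complex_of_real (Re (f n x))) \<in> carrier C.P"
  "f \<in> carrier C.P \<Longrightarrow> (\<lambda>n x. complex_of_real (Im (f n x))) \<in> carrier C.P"
proof -
  show "f \<in> carrier C.P \<Longrightarrow> g \<in> carrier C.P \<Longrightarrow> (\<lambda>n x. f n x * g n x) \<in> carrier C.P"
    using C.comp_closed(1)[of f g] by simp
  show "f \<in> carrier C.P \<Longrightarrow> g \<in> carrier C.P \<Longrightarrow> (\<lambda>n x. f n x + g n x) \<in> carrier C.P"
    using C.comp_closed(2)[of f g] by simp
  show "f \<in> carrier C.P \<Longrightarrow> (\<lambda>n x. c * f n x) \<in> carrier C.P"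
    using C.comp_closed(4)[of f c] by simp
  show "f \<in> carrier C.P \<Longrightarrow> (\<lambda>n x. cnj (f n x)) \<in> carrier C.P"
    using C.comp_closed(5)[of f] by simp
  show "(\<lambda>n x. if x \<in> topspace (K n) then c else 0) \<in> carrier C.P"
    by (rule PC_I[where B="cmod c"]) (auto intro: cfun_closed(6)[OF cfun_zero cfun_zero])
  assume f: "f \<in> carrier C.P"
  show "(\<lambda>n x. complex_of_real (Re (f n x))) \<in> carrier C.P"
  proof (rule PC_I[where B="cnorm C.P f"])
    show "cmod (complex_of_real (Re (f n x))) \<le> cnorm C.P f" for n x
      using abs_Re_le_cmod[of "f n x"] PC_norm[OF f, of n x] unfolding norm_of_real by linarith
  qed (rule cfun_closed(9)[OF PC[OF f] PC[OF f]])
  show "(\<lambda>n x. complex_of_real (Im (f n x))) \<in> carrier C.P"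
  proof (rule PC_I[where B="cnorm C.P f"])
    show "cmod (complex_of_real (Im (f n x))) \<le> cnorm C.P f" for n x
      using abs_Im_le_cmod[of "f n x"] PC_norm[OF f, of n x] unfolding norm_of_real by linarith
  qed (rule cfun_closed(10)[OF PC[OF f] PC[OF f]])
qed

text \<open>A bounded sequence that is uniformly bounded away from \<open>0\<close> is invertible.\<close>

lemma char_nonzero:
  assumes h: "h \<in> charsp" and f: "f \<in> carrier C.P" and e: "e > 0"
    and ge: "\<And>n x. x \<in> topspace (K n) \<Longrightarrow> e \<le> cmod (f n x)"
  shows "h (C.cls f) \<noteq> 0"
proof -
  define g where "g n x = (if x \<in> topspace (K n) then inverse (f n x) else 0)" for n x
  have "g \<in> carrier C.P"
  proof (rule PC_I[where B="inverse e"])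
    fix n
    have "continuous_map (K n) euclidean (g n)"
    proof (rule continuous_map_eq)
      have f0: "f n \<in> topspace (K n) \<rightarrow> - {0}"
      proof
        fix x assume "x \<in> topspace (K n)"
        from ge[OF this] e show "f n x \<in> - {0}" by auto
      qed
      have fc: "continuous_map (K n) (top_of_set (- {0})) (f n)"
        using PC[OF f, of n] f0 by (auto simp: carrier_cfun continuous_map_in_subtopology Pi_iff)
      have "continuous_on (- {0}) (inverse :: complex \<Rightarrow> complex)"
        by (intro continuous_intros) auto
      then have "continuous_map (top_of_set (- {0::complex})) euclidean inverse" by simp
      from continuous_map_compose[OF fc this]
      show "continuous_map (K n) euclidean (\<lambda>x. inverse (f n x))" by (simp add: o_def)
    qed (simp add: g_def)
    then show "g n \<in> carrier (cfun_algebra (K n))" by (simp add: carrier_cfun g_def)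
    show "cmod (g n x) \<le> inverse e" for x
      using ge[of x n] e by (simp add: g_def norm_inverse le_imp_inverse_le)
  qed
  moreover have "(\<lambda>n x. f n x * g n x) = (\<lambda>n x. if x \<in> topspace (K n) then 1 else 0)"
  proof (intro ext)
    fix n x
    have "f n x \<noteq> 0" if "x \<in> topspace (K n)" using ge[OF that] e by auto
    then show "f n x * g n x = (if x \<in> topspace (K n) then 1 else 0)" by (simp add: g_def)
  qed
  ultimately have "h (C.cls f) * h (C.cls g) = 1"
    using char_hom(1)[OF h f, of g] char_hom(4)[OF h] by simp
  then show ?thesis by auto
qed

lemma char_const:
  assumes h: "h \<in> charsp"
  shows "h (C.cls (\<lambda>n x. if x \<in> topspace (K n) then c else 0)) = c"
proof -
  have "(\<lambda>n x. if x \<in> topspace (K n) then c else 0) = (\<lambda>n x. c * (if x \<in> topspace (K n) then 1 else 0))"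
    by (auto simp: fun_eq_iff)
  then show ?thesis using char_hom(3)[OF h PC_closed(5), of c 1] char_hom(4)[OF h] by simp
qed

text \<open>If the values of \<open>f\<close> stayed at distance \<open>e\<close> from
  \<open>h (C.cls f)\<close>, then \<open>f\<close> minus this constant would be invertible, yet
  \<open>h\<close> sends it to 0. The bound, the reality, the positivity and the compatibility of
  characters with conjugation all come from here.\<close>

lemma char_range:
  assumes h: "h \<in> charsp" and f: "f \<in> carrier C.P" and e: "e > 0"
  shows "\<exists>n. \<exists>x\<in>topspace (K n). cmod (f n x - h (C.cls f)) < e"
proof (rule ccontr)
  assume "\<not> ?thesis"
  then have ge: "e \<le> cmod (f n x - h (C.cls f))" if "x \<in> topspace (K n)" for n x
    using that not_less by blast
  define g where "g n x = f n x + (if x \<in> topspace (K n) then - h (C.cls f) else 0)" for n x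
  have "g \<in> carrier C.P" unfolding g_def by (intro PC_closed f)
  then have "h (C.cls g) \<noteq> 0"
    by (rule char_nonzero[OF h _ e]) (use ge in \<open>simp add: g_def\<close>)
  moreover have "h (C.cls g) = h (C.cls f) + - h (C.cls f)"
    unfolding g_def using char_hom(2)[OF h f PC_closed(5)] char_const[OF h] by simp
  ultimately show False by simp
qed

text \<open>A class of norm below \<open>cmod (h X)\<close> has a representative whose values all
  lie in a smaller disc, so they cannot come close to \<open>h X\<close>.\<close>

lemma char_bound:
  assumes h: "h \<in> charsp" and X: "X \<in> carrier C.Q"
  shows "cmod (h X) \<le> cnorm C.Q X"
proof (rule ccontr)
  assume "\<not> ?thesis"
  then obtain f where f: "f \<in> carrier C.P" "X = C.cls f" "cnorm C.P f < cmod (h X)"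
    using C.Q_norm_lift[OF X, of "cmod (h X)"] by (auto simp del: bounded_product_simps)
  obtain n x where "cmod (f n x - h (C.cls f)) < cmod (h X) - cnorm C.P f"
    using char_range[OF h f(1), of "cmod (h X) - cnorm C.P f"] f(3) by (auto simp del: bounded_product_simps)
  then show False
    using PC_norm[OF f(1), of n x] norm_triangle_ineq2[of "h X" "f n x"] f(2)
    by (simp add: norm_minus_commute del: bounded_product_simps)
qed

lemma char_real:
  assumes h: "h \<in> charsp" and f: "f \<in> carrier C.P" and re: "\<And>n x. Im (f n x) = 0"
  shows "Im (h (C.cls f)) = 0"
proof (rule ccontr)
  assume "Im (h (C.cls f)) \<noteq> 0"
  then obtain n x where "cmod (f n x - h (C.cls f)) < \<bar>Im (h (C.cls f))\<bar>"
    using char_range[OF h f, of "\<bar>Im (h (C.cls f))\<bar>"] by auto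
  then show False using abs_Im_le_cmod[of "f n x - h (C.cls f)"] re[of n x] by simp
qed

lemma char_decomp:
  assumes h: "h \<in> charsp" and f: "f \<in> carrier C.P"
  shows "h (C.cls f) = h (C.cls (\<lambda>n x. of_real (Re (f n x)))) + \<i> * h (C.cls (\<lambda>n x. of_real (Im (f n x))))"
proof -
  have "(\<lambda>n x. of_real (Re (f n x)) + \<i> * of_real (Im (f n x))) = f"
    by (simp add: fun_eq_iff complex_eq_iff)
  then show ?thesis
    using char_hom(2)[OF h PC_closed(6)[OF f] PC_closed(3)[OF PC_closed(7)[OF f]], of \<i>]
      char_hom(3)[OF h PC_closed(7)[OF f], of \<i>] by simp
qed

text \<open>Characters are not assumed to respect the involution. They do because they take real
  values on sequences of real functions, and real and imaginary parts determine the rest.\<close>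

lemma char_cnj:
  assumes h: "h \<in> charsp" and f: "f \<in> carrier C.P"
  shows "h (C.cls (\<lambda>n x. cnj (f n x))) = cnj (h (C.cls f))"
proof -
  let ?r = "\<lambda>n x. complex_of_real (Re (f n x))" and ?i = "\<lambda>n x. complex_of_real (Im (f n x))"
  have 1: "(\<lambda>n x. cnj (f n x)) = (\<lambda>n x. ?r n x + (- \<i>) * ?i n x)"
    by (simp add: fun_eq_iff complex_eq_iff)
  have r: "Im (h (C.cls ?r)) = 0" "Im (h (C.cls ?i)) = 0"
    by (intro char_real[OF h] PC_closed f; simp)+
  have "h (C.cls (\<lambda>n x. cnj (f n x))) = h (C.cls ?r) + (- \<i>) * h (C.cls ?i)"
    unfolding 1 using char_hom(2)[OF h PC_closed(6)[OF f] PC_closed(3)[OF PC_closed(7)[OF f]], of "- \<i>"]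
      char_hom(3)[OF h PC_closed(7)[OF f], of "- \<i>"] by simp
  then show ?thesis using char_decomp[OF h f] r by (simp add: complex_eq_iff)
qed

subsection \<open>Characters given by points\<close>

text \<open>The limit along \<open>U\<close> of evaluations at the points \<open>x n\<close>. The
  choice of a representative is immaterial by \<open>pchar_tendsto\<close>: two representatives
  differ by a sequence that tends to 0 uniformly.\<close>

definition pchar :: "(nat \<Rightarrow> 'k) \<Rightarrow> (nat \<Rightarrow> 'k \<Rightarrow> complex) set \<Rightarrow> complex" where
  "pchar x X = (if X \<in> carrier C.Q then ulim (\<lambda>n. (SOME f. f \<in> carrier C.P \<and> X = C.cls f) n (x n)) else 0)"

lemma point_limit: "f \<in> carrier C.P \<Longrightarrow> ((\<lambda>n. f n (x n)) \<longlongrightarrow> ulim (\<lambda>n. f n (x n))) U"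
proof (rule ulim_tendsto)
  assume f: "f \<in> carrier C.P"
  show "bounded (range (\<lambda>n. f n (x n)))"
    unfolding bounded_iff by (rule exI[of _ "cnorm C.P f"]) (use PC_norm[OF f] in blast)
qed

lemma pchar_tendsto:
  assumes f: "f \<in> carrier C.P"
  shows "((\<lambda>n. f n (x n)) \<longlongrightarrow> pchar x (C.cls f)) U"
proof -
  define g where "g = (SOME g. g \<in> carrier C.P \<and> C.cls f = C.cls g)"
  have "g \<in> carrier C.P \<and> C.cls f = C.cls g"
    unfolding g_def by (rule someI[of _ f]) (use f in simp)
  then have g: "g \<in> carrier C.P" "C.cls f = C.cls g" by auto
  then have lim: "((\<lambda>n. cnorm (cfun_algebra (K n)) (f n \<ominus>\<^bsub>cfun_algebra (K n)\<^esub> g n)) \<longlongrightarrow> 0) U"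
    using C.cls_eq[OF f g(1)] by simp
  have le: "cmod (f n (x n) - g n (x n)) \<le> cnorm (cfun_algebra (K n)) (f n \<ominus>\<^bsub>cfun_algebra (K n)\<^esub> g n)" for n
    using cfun_norm_le[OF compK cfun_closed(3)[OF PC[OF f] PC[OF g(1)]], of n "x n"]
    by (simp add: cfun_minus[OF PC[OF f] PC[OF g(1)]] del: cfun_simps)
  have "((\<lambda>n. f n (x n) - g n (x n)) \<longlongrightarrow> 0) U"
    by (rule Lim_null_comparison[OF always_eventually lim]) (use le in blast)
  from tendsto_add[OF this point_limit[OF g(1), of x]]
  have "((\<lambda>n. f n (x n)) \<longlongrightarrow> ulim (\<lambda>n. g n (x n))) U" by simp
  moreover have "pchar x (C.cls f) = ulim (\<lambda>n. g n (x n))"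
    using f by (simp add: pchar_def g_def C.cls_closed)
  ultimately show ?thesis by simp
qed

lemma pchar_eqI: "f \<in> carrier C.P \<Longrightarrow> ((\<lambda>n. f n (x n)) \<longlongrightarrow> l) U \<Longrightarrow> pchar x (C.cls f) = l"
  by (rule tendsto_unique[OF U_nonbot pchar_tendsto])

lemma pchar_char:
  assumes x: "\<And>n. x n \<in> topspace (K n)"
  shows "pchar x \<in> charsp"
proof -
  have "pchar x \<in> ring_hom C.Q complex_ring"
  proof (rule ring_hom_memI)
    show "pchar x \<one>\<^bsub>C.Q\<^esub> = \<one>\<^bsub>complex_ring\<^esub>"
      unfolding C.Q_one using x by (intro pchar_eqI C.comp_closed) simp
    fix X Y assume X: "X \<in> carrier C.Q" and Y: "Y \<in> carrier C.Q"
    obtain f where f: "f \<in> carrier C.P" "X = C.cls f" using X by (rule QE)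
    obtain g where g: "g \<in> carrier C.P" "Y = C.cls g" using Y by (rule QE)
    show "pchar x (X \<otimes>\<^bsub>C.Q\<^esub> Y) = pchar x X \<otimes>\<^bsub>complex_ring\<^esub> pchar x Y"
      unfolding f(2) g(2) C.Q_mult[OF f(1) g(1)]
      by (intro pchar_eqI C.comp_closed f g) (unfold cfun_simps complex_ring_simps, intro tendsto_mult pchar_tendsto f g)
    show "pchar x (X \<oplus>\<^bsub>C.Q\<^esub> Y) = pchar x X \<oplus>\<^bsub>complex_ring\<^esub> pchar x Y"
      unfolding f(2) g(2) C.Q_add[OF f(1) g(1)]
      by (intro pchar_eqI C.comp_closed f g) (unfold cfun_simps complex_ring_simps, intro tendsto_add pchar_tendsto f g)
  qed simp
  moreover have "pchar x (c \<odot>\<^bsub>C.Q\<^esub> X) = c * pchar x X" if X: "X \<in> carrier C.Q" for c X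
  proof -
    obtain f where f: "f \<in> carrier C.P" "X = C.cls f" using X by (rule QE)
    show ?thesis unfolding f(2) C.Q_smult[OF f(1)]
      by (intro pchar_eqI C.comp_closed f) (unfold cfun_simps, intro tendsto_mult tendsto_const pchar_tendsto f)
  qed
  moreover have "\<forall>X. X \<notin> carrier C.Q \<longrightarrow> pchar x X = 0" by (simp add: pchar_def)
  ultimately show ?thesis unfolding charsp_def characters_def by blast
qed

text \<open>Points \<open>x n\<close> at which \<open>f n\<close> almost attains its norm define a
  point character that almost attains the norm of the class. With this the Gelfand transform is
  isometric without any spectral theory.\<close>

lemma char_norm_attained:
  assumes X: "X \<in> carrier C.Q" and e: "e > 0"
  shows "\<exists>h\<in>charsp. cnorm C.Q X - e \<le> cmod (h X)"
proof -
  obtain f where f: "f \<in> carrier C.P" "X = C.cls f" using X by (rule QE)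
  have "\<exists>x. \<forall>n. x n \<in> topspace (K n) \<and> cnorm (cfun_algebra (K n)) (f n) - e \<le> cmod (f n (x n))"
  proof (rule choice, rule allI)
    fix n
    show "\<exists>x. x \<in> topspace (K n) \<and> cnorm (cfun_algebra (K n)) (f n) - e \<le> cmod (f n x)"
    proof (rule ccontr)
      assume neg: "\<not> ?thesis"
      \<comment> \<open>The supremum runs over the whole type, where \<open>f n\<close> is 0 off the
        space. A point of the space is needed to see that the bound
        \<open>cnorm (cfun_algebra (K n)) (f n) - e\<close> is nonnegative.\<close>
      obtain y where y: "y \<in> topspace (K n)" using neK by blast
      have lt: "cmod (f n x) < cnorm (cfun_algebra (K n)) (f n) - e" if "x \<in> topspace (K n)" for x
        using neg that not_le by blast
      have "0 \<le> cnorm (cfun_algebra (K n)) (f n) - e" using lt[OF y] norm_ge_zero[of "f n y"] by linarith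
      then have "cnorm (cfun_algebra (K n)) (f n) \<le> cnorm (cfun_algebra (K n)) (f n) - e"
        by (rule cfun_norm_leI'[OF PC[OF f(1)]]) (use lt less_imp_le in blast)
      then show False using e by simp
    qed
  qed
  then obtain x where x: "\<And>n. x n \<in> topspace (K n)"
    and le: "\<And>n. cnorm (cfun_algebra (K n)) (f n) - e \<le> cmod (f n (x n))" by blast
  have "cnorm C.Q X - e \<le> cmod (pchar x X)"
    unfolding f(2)
    by (rule tendsto_le[OF U_nonbot tendsto_norm[OF pchar_tendsto[OF f(1)]]
          tendsto_diff[OF C.Q_norm_tendsto[OF f(1)] tendsto_const] always_eventually])
       (use le in blast)
  then show ?thesis using pchar_char[OF x] by blast
qed

end

section \<open>Separation axioms for function types with the topology of pointwise
  convergence\<close>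

instance "fun" :: (type, t0_space) t0_space
proof
  fix f g :: "'a \<Rightarrow> 'b"
  assume "f \<noteq> g"
  then obtain x where x: "f x \<noteq> g x" by auto
  from t0_space_class.t0_space[OF x] obtain A where "open A" "(f x \<in> A) \<noteq> (g x \<in> A)" by auto
  then show "\<exists>U. open U \<and> \<not> (f \<in> U \<longleftrightarrow> g \<in> U)"
    using open_vimage[of A "\<lambda>h::'a \<Rightarrow> 'b. h x"] by (intro exI[of _ "(\<lambda>h. h x) -` A"]) simp
qed

instance "fun" :: (type, t1_space) t1_space
proof
  fix f g :: "'a \<Rightarrow> 'b"
  assume "f \<noteq> g"
  then obtain x where x: "f x \<noteq> g x" by auto
  from t1_space_class.t1_space[OF x] obtain A where "open A" "f x \<in> A" "g x \<notin> A" by auto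
  then show "\<exists>U. open U \<and> f \<in> U \<and> g \<notin> U"
    using open_vimage[of A "\<lambda>h::'a \<Rightarrow> 'b. h x"] by (intro exI[of _ "(\<lambda>h. h x) -` A"]) simp
qed

instance "fun" :: (type, t2_space) t2_space
proof
  fix f g :: "'a \<Rightarrow> 'b"
  assume "f \<noteq> g"
  then obtain x where x: "f x \<noteq> g x" by auto
  from hausdorff[OF x] obtain A B where AB: "open A" "open B" "f x \<in> A" "g x \<in> B" "A \<inter> B = {}"
    by auto
  have "open ((\<lambda>h. h x) -` C)" if "open C" for C :: "'b set"
    using open_vimage[OF that, of "\<lambda>h::'a \<Rightarrow> 'b. h x"] by simp
  then show "\<exists>U V. open U \<and> open V \<and> f \<in> U \<and> g \<in> V \<and> U \<inter> V = {}"
    using AB by (intro exI[of _ "(\<lambda>h. h x) -` A"] exI[of _ "(\<lambda>h. h x) -` B"]) auto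
qed

context cfun_ultra
begin

subsection \<open>The Gelfand transform\<close>

lemma charspI:
  assumes "\<And>X Y. X \<in> carrier C.Q \<Longrightarrow> Y \<in> carrier C.Q \<Longrightarrow> h (X \<otimes>\<^bsub>C.Q\<^esub> Y) = h X * h Y"
    "\<And>X Y. X \<in> carrier C.Q \<Longrightarrow> Y \<in> carrier C.Q \<Longrightarrow> h (X \<oplus>\<^bsub>C.Q\<^esub> Y) = h X + h Y"
    "\<And>X c. X \<in> carrier C.Q \<Longrightarrow> h (c \<odot>\<^bsub>C.Q\<^esub> X) = c * h X"
    "h \<one>\<^bsub>C.Q\<^esub> = 1" "\<And>X. X \<notin> carrier C.Q \<Longrightarrow> h X = 0"
  shows "h \<in> charsp"
  unfolding charsp_def characters_def using assms by (auto intro!: ring_hom_memI)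

lemma charspD:
  assumes "h \<in> charsp"
  shows "X \<in> carrier C.Q \<Longrightarrow> Y \<in> carrier C.Q \<Longrightarrow> h (X \<otimes>\<^bsub>C.Q\<^esub> Y) = h X * h Y"
    "X \<in> carrier C.Q \<Longrightarrow> Y \<in> carrier C.Q \<Longrightarrow> h (X \<oplus>\<^bsub>C.Q\<^esub> Y) = h X + h Y"
    "X \<in> carrier C.Q \<Longrightarrow> h (c \<odot>\<^bsub>C.Q\<^esub> X) = c * h X"
    "h \<one>\<^bsub>C.Q\<^esub> = 1" "X \<notin> carrier C.Q \<Longrightarrow> h X = 0"
proof -
  have r: "h \<in> ring_hom C.Q complex_ring" using assms unfolding charsp_def characters_def by blast
  show "X \<in> carrier C.Q \<Longrightarrow> Y \<in> carrier C.Q \<Longrightarrow> h (X \<otimes>\<^bsub>C.Q\<^esub> Y) = h X * h Y"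
    using ring_hom_mult[OF r, of X Y] by simp
  show "X \<in> carrier C.Q \<Longrightarrow> Y \<in> carrier C.Q \<Longrightarrow> h (X \<oplus>\<^bsub>C.Q\<^esub> Y) = h X + h Y"
    using ring_hom_add[OF r, of X Y] by simp
  show "h \<one>\<^bsub>C.Q\<^esub> = 1" using ring_hom_one[OF r] by simp
  show "X \<in> carrier C.Q \<Longrightarrow> h (c \<odot>\<^bsub>C.Q\<^esub> X) = c * h X" "X \<notin> carrier C.Q \<Longrightarrow> h X = 0"
    using assms unfolding charsp_def characters_def by blast+
qed

lemma char_minus:
  assumes h: "h \<in> charsp" and X: "X \<in> carrier C.Q" and Y: "Y \<in> carrier C.Q"
  shows "h (X \<ominus>\<^bsub>C.Q\<^esub> Y) = h X - h Y"
proof -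
  have "h (X \<ominus>\<^bsub>C.Q\<^esub> Y) + h Y = h X"
    using charspD(2)[OF h ring.ring_simprules(4)[OF C.ring_Q X Y] Y]
      cstar_algebra.minus_add_cancel[OF C.cstar_Q X Y] by simp
  then show ?thesis by (simp add: algebra_simps)
qed

text \<open>As in the Banach-Alaoglu theorem: norm bounds place the characters in a product of
  closed discs, which is compact by Tychonoff, and the algebraic conditions are closed because each
  involves finitely many coordinates.\<close>

lemma compact_charsp: "compact charsp"
proof -
  \<comment> \<open>The factor \<open>{0}\<close> outside the carrier encodes the normalisation of
    functionals, so that the product bounds every coordinate of the function type.\<close>
  define D where "D X = (if X \<in> carrier C.Q then cball 0 (cnorm C.Q X) else {0::complex})" for X
  have "compactin (product_topology (\<lambda>_. euclidean) UNIV) (PiE UNIV D)"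
    unfolding compactin_PiE by (auto simp: D_def)
  then have D: "compact (PiE UNIV D)" by (simp add: euclidean_product_topology)
  let ?S = "carrier C.Q"
  define E where "E = (\<Inter>X\<in>?S. \<Inter>Y\<in>?S. {h. h (X \<otimes>\<^bsub>C.Q\<^esub> Y) = h X * h Y} \<inter> {h. h (X \<oplus>\<^bsub>C.Q\<^esub> Y) = h X + h Y})
     \<inter> (\<Inter>X\<in>?S. \<Inter>c. {h. h (c \<odot>\<^bsub>C.Q\<^esub> X) = c * h X}) \<inter> {h. h \<one>\<^bsub>C.Q\<^esub> = (1::complex)}"
  have "closed E"
    unfolding E_def by (intro closed_Int closed_INT ballI closed_Collect_eq continuous_intros continuous_on_product_coordinates)
  have "charsp = PiE UNIV D \<inter> E"
  proof (intro equalityI subsetI IntI)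
    fix h assume h: "h \<in> charsp"
    show "h \<in> PiE UNIV D" using char_bound[OF h] charspD(5)[OF h] by (auto simp: D_def)
    show "h \<in> E" using charspD(1-4)[OF h] by (auto simp: E_def)
  next
    fix h assume h: "h \<in> PiE UNIV D \<inter> E"
    show "h \<in> charsp"
    proof (rule charspI)
      fix X assume "X \<notin> carrier C.Q"
      then have "D X = {0}" by (simp add: D_def)
      moreover have "h X \<in> D X" using h by blast
      ultimately show "h X = 0" by simp
    qed (use h in \<open>simp_all add: E_def\<close>)
  qed
  then show ?thesis using compact_Int_closed[OF D \<open>closed E\<close>] by simp
qed

lemma gelfand_simp: "gelfand C.Q X h = (if h \<in> charsp then h X else 0)"
  by (simp add: gelfand_def charsp_def)

definition "G = gelfand C.Q"
definition "CK = cfun_algebra (top_of_set charsp)"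

lemma G_simp: "G X h = (if h \<in> charsp then h X else 0)"
  by (simp add: G_def gelfand_simp)

lemma CK_carrier: "F \<in> carrier CK \<longleftrightarrow> continuous_on charsp F \<and> (\<forall>h. h \<notin> charsp \<longrightarrow> F h = 0)"
  by (simp add: CK_def carrier_cfun)

lemma compact_CK: "compact_space (top_of_set charsp)"
  using compact_charsp by (simp add: compact_space_subtopology)

lemma G_closed: "X \<in> carrier C.Q \<Longrightarrow> G X \<in> carrier CK"
proof -
  have "continuous_on charsp (\<lambda>h. h X)"
    by (rule continuous_on_subset[OF continuous_on_product_coordinates]) simp
  then have "continuous_on charsp (G X)"
    by (rule continuous_on_cong[THEN iffD1, rotated 2]) (simp_all add: G_simp)
  then show ?thesis by (simp add: CK_carrier G_simp)
qed

lemma G_norm: "X \<in> carrier C.Q \<Longrightarrow> cnorm CK (G X) = cnorm C.Q X"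
proof (rule antisym)
  assume X: "X \<in> carrier C.Q"
  have nn: "0 \<le> cnorm C.Q X" by (rule cstar_algebra.cnorm_nonneg[OF C.cstar_Q X])
  show "cnorm CK (G X) \<le> cnorm C.Q X"
    unfolding CK_def by (rule cfun_norm_leI) (use char_bound[OF _ X] nn in \<open>simp add: G_simp\<close>)
  show "cnorm C.Q X \<le> cnorm CK (G X)"
  proof (rule field_le_epsilon)
    fix e :: real assume "e > 0"
    from char_norm_attained[OF X this] obtain h where h: "h \<in> charsp" "cnorm C.Q X - e \<le> cmod (h X)" by blast
    have "cmod (G X h) \<le> cnorm CK (G X)"
      unfolding CK_def by (rule cfun_norm_le[OF compact_CK]) (use G_closed[OF X] in \<open>simp add: CK_def\<close>)
    then show "cnorm C.Q X \<le> cnorm CK (G X) + e" using h by (simp add: G_simp)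
  qed
qed

lemma G_mult: "X \<in> carrier C.Q \<Longrightarrow> Y \<in> carrier C.Q \<Longrightarrow> G (X \<otimes>\<^bsub>C.Q\<^esub> Y) = G X \<otimes>\<^bsub>CK\<^esub> G Y"
  by (simp add: fun_eq_iff G_simp CK_def charspD(1))

lemma G_add: "X \<in> carrier C.Q \<Longrightarrow> Y \<in> carrier C.Q \<Longrightarrow> G (X \<oplus>\<^bsub>C.Q\<^esub> Y) = G X \<oplus>\<^bsub>CK\<^esub> G Y"
  by (simp add: fun_eq_iff G_simp CK_def charspD(2))

lemma G_smult: "X \<in> carrier C.Q \<Longrightarrow> G (c \<odot>\<^bsub>C.Q\<^esub> X) = c \<odot>\<^bsub>CK\<^esub> G X"
  by (simp add: fun_eq_iff G_simp CK_def charspD(3))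

lemma G_one: "G \<one>\<^bsub>C.Q\<^esub> = \<one>\<^bsub>CK\<^esub>"
  by (simp add: fun_eq_iff G_simp CK_def charspD(4))

lemma G_star: "X \<in> carrier C.Q \<Longrightarrow> G (star C.Q X) = star CK (G X)"
proof -
  assume "X \<in> carrier C.Q"
  then obtain f where f: "f \<in> carrier C.P" "X = C.cls f" by (rule QE)
  have "h (star C.Q X) = cnj (h X)" if "h \<in> charsp" for h
    unfolding f(2) C.Q_star[OF f(1)] using char_cnj[OF that f(1)] by simp
  then show ?thesis by (simp add: fun_eq_iff G_simp CK_def)
qed

lemma G_minus: "X \<in> carrier C.Q \<Longrightarrow> Y \<in> carrier C.Q \<Longrightarrow> G (X \<ominus>\<^bsub>C.Q\<^esub> Y) = (\<lambda>h. G X h - G Y h)"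
  by (simp add: fun_eq_iff G_simp char_minus)

lemma G_inj: "inj_on G (carrier C.Q)"
proof (rule inj_onI)
  fix X Y assume X: "X \<in> carrier C.Q" and Y: "Y \<in> carrier C.Q" and eq: "G X = G Y"
  have XY: "X \<ominus>\<^bsub>C.Q\<^esub> Y \<in> carrier C.Q" by (rule ring.ring_simprules(4)[OF C.ring_Q X Y])
  have "cnorm C.Q (X \<ominus>\<^bsub>C.Q\<^esub> Y) = 0"
    using G_norm[OF XY] unfolding G_minus[OF X Y] eq by (simp add: CK_def)
  then show "X = Y"
    using cstar_algebra.cnorm_eq_0[OF C.cstar_Q XY] cstar_algebra.minus_eq_zero[OF C.cstar_Q X Y] by simp
qed

text \<open>Stone-Weierstrass for the transforms of sequences of real functions. They separate
  characters: two characters that agree on all such sequences agree on real and imaginary parts,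
  hence everywhere, including off the carrier, where both are 0.\<close>

lemma real_approx:
  fixes F :: "((nat \<Rightarrow> 'k \<Rightarrow> complex) set \<Rightarrow> complex) \<Rightarrow> real"
  assumes F: "continuous_on charsp F" and e: "e > 0"
  shows "\<exists>X\<in>carrier C.Q. \<forall>h\<in>charsp. cmod (of_real (F h) - h X) < e"
proof -
  \<comment> \<open>\<open>R g\<close> constrains \<open>g\<close> on \<open>charsp\<close> only, so
    a transform may be extended arbitrarily to the rest of the type, and it retains a representative
    with real values.\<close>
  define R where "R g \<longleftrightarrow> (\<exists>f\<in>carrier C.P. (\<forall>n x. Im (f n x) = 0) \<and> (\<forall>h\<in>charsp. h (C.cls f) = of_real (g h)))"
    for g :: "((nat \<Rightarrow> 'k \<Rightarrow> complex) set \<Rightarrow> complex) \<Rightarrow> real"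
  have "\<exists>g. R g \<and> (\<forall>h\<in>charsp. \<bar>F h - g h\<bar> < e)"
  proof (rule Stone_Weierstrass_HOL[OF compact_charsp])
    show "R (\<lambda>h. c)" for c
      unfolding R_def
      by (rule bexI[OF _ PC_closed(5)[of "complex_of_real c"]]) (simp add: char_const)
    show "continuous_on charsp g" if g: "R g" for g
    proof -
      obtain f where f: "f \<in> carrier C.P" "\<And>h. h \<in> charsp \<Longrightarrow> h (C.cls f) = of_real (g h)"
        using g unfolding R_def by blast
      have "continuous_on charsp (\<lambda>h. Re (h (C.cls f)))"
        by (intro continuous_intros continuous_on_subset[OF continuous_on_product_coordinates]) simp
      then show ?thesis
        by (rule continuous_on_cong[THEN iffD1, rotated 2]) (simp_all add: f(2))
    qed
    show "R (\<lambda>h. f h + g h)" if fg: "R f \<and> R g" for f g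
    proof -
      obtain a b where a: "a \<in> carrier C.P" "\<forall>n x. Im (a n x) = 0" "\<forall>h\<in>charsp. h (C.cls a) = of_real (f h)"
        and b: "b \<in> carrier C.P" "\<forall>n x. Im (b n x) = 0" "\<forall>h\<in>charsp. h (C.cls b) = of_real (g h)"
        using fg unfolding R_def by blast
      show ?thesis unfolding R_def
        by (rule bexI[OF _ PC_closed(2)[OF a(1) b(1)]]) (use a b char_hom(2)[OF _ a(1) b(1)] in simp)
    qed
    show "R (\<lambda>h. f h * g h)" if fg: "R f \<and> R g" for f g
    proof -
      obtain a b where a: "a \<in> carrier C.P" "\<forall>n x. Im (a n x) = 0" "\<forall>h\<in>charsp. h (C.cls a) = of_real (f h)"
        and b: "b \<in> carrier C.P" "\<forall>n x. Im (b n x) = 0" "\<forall>h\<in>charsp. h (C.cls b) = of_real (g h)"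
        using fg unfolding R_def by blast
      show ?thesis unfolding R_def
        by (rule bexI[OF _ PC_closed(1)[OF a(1) b(1)]]) (use a b char_hom(1)[OF _ a(1) b(1)] in simp)
    qed
    show "\<exists>g. R g \<and> g h \<noteq> g k" if hk: "h \<in> charsp \<and> k \<in> charsp \<and> h \<noteq> k" for h k
    proof (rule ccontr)
      assume no: "\<nexists>g. R g \<and> g h \<noteq> g k"
      have eq: "h (C.cls f) = k (C.cls f)" if f: "f \<in> carrier C.P" and re: "\<And>n x. Im (f n x) = 0" for f
      proof -
        have "R (\<lambda>h. Re (h (C.cls f)))" unfolding R_def
          by (rule bexI[OF _ f]) (use re char_real[OF _ f re] in \<open>simp add: complex_eq_iff\<close>)
        then have "Re (h (C.cls f)) = Re (k (C.cls f))" using no by blast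
        then show ?thesis using char_real[OF _ f re] hk by (simp add: complex_eq_iff)
      qed
      have "h X = k X" for X
      proof (cases "X \<in> carrier C.Q")
        case True
        then obtain f where f: "f \<in> carrier C.P" "X = C.cls f" by (rule QE)
        have "h (C.cls f) = k (C.cls f)"
          using char_decomp[OF _ f(1), of h] char_decomp[OF _ f(1), of k] hk
            eq[OF PC_closed(6)[OF f(1)]] eq[OF PC_closed(7)[OF f(1)]] by simp
        then show ?thesis by (simp add: f(2))
      next
        case False
        then show ?thesis using charspD(5) hk by metis
      qed
      then show False using hk by (metis ext)
    qed
  qed (use F e in auto)
  then obtain g f where f: "f \<in> carrier C.P" "\<forall>h\<in>charsp. h (C.cls f) = of_real (g h)"
    and g: "\<forall>h\<in>charsp. \<bar>F h - g h\<bar> < e" unfolding R_def by blast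
  have "cmod (of_real (F h) - h (C.cls f)) < e" if "h \<in> charsp" for h
    using f(2) g that by (metis norm_of_real of_real_diff)
  then show ?thesis using C.cls_closed[OF f(1)] by blast
qed

lemma complex_approx:
  assumes F: "F \<in> carrier CK" and e: "e > 0"
  shows "\<exists>X\<in>carrier C.Q. \<forall>h\<in>charsp. cmod (F h - h X) < e"
proof -
  have Fc: "continuous_on charsp F" using F by (simp add: CK_carrier)
  obtain X where X: "X \<in> carrier C.Q" "\<And>h. h \<in> charsp \<Longrightarrow> cmod (of_real (Re (F h)) - h X) < e/2"
    using real_approx[of "\<lambda>h. Re (F h)" "e/2"] Fc e by (auto intro!: continuous_intros)
  obtain Y where Y: "Y \<in> carrier C.Q" "\<And>h. h \<in> charsp \<Longrightarrow> cmod (of_real (Im (F h)) - h Y) < e/2"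
    using real_approx[of "\<lambda>h. Im (F h)" "e/2"] Fc e by (auto intro!: continuous_intros)
  interpret Q: cstar_algebra C.Q by (rule C.cstar_Q)
  have iY: "\<i> \<odot>\<^bsub>C.Q\<^esub> Y \<in> carrier C.Q" by (rule Q.csmult_closed[OF Y(1)])
  have "cmod (F h - h (X \<oplus>\<^bsub>C.Q\<^esub> \<i> \<odot>\<^bsub>C.Q\<^esub> Y)) < e" if h: "h \<in> charsp" for h
  proof -
    have "F h - h (X \<oplus>\<^bsub>C.Q\<^esub> \<i> \<odot>\<^bsub>C.Q\<^esub> Y) = (of_real (Re (F h)) - h X) + \<i> * (of_real (Im (F h)) - h Y)"
      using charspD(2)[OF h X(1) iY] charspD(3)[OF h Y(1)] by (simp add: algebra_simps complex_eq_iff)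
    also have "cmod \<dots> \<le> cmod (of_real (Re (F h)) - h X) + cmod (of_real (Im (F h)) - h Y)"
      by (rule order_trans[OF norm_triangle_ineq]) (simp add: norm_mult)
    finally show ?thesis using X(2)[OF h] Y(2)[OF h] by simp
  qed
  moreover have "X \<oplus>\<^bsub>C.Q\<^esub> \<i> \<odot>\<^bsub>C.Q\<^esub> Y \<in> carrier C.Q" by (rule ring.ring_simprules(1)[OF C.ring_Q X(1) iY])
  ultimately show ?thesis by blast
qed

text \<open>The range is dense by approximation, and it is closed because the transform is isometric
  on a complete algebra.\<close>

lemma G_surj: "F \<in> carrier CK \<Longrightarrow> \<exists>X\<in>carrier C.Q. G X = F"
proof -
  assume F: "F \<in> carrier CK"
  have "\<exists>X. \<forall>n. X n \<in> carrier C.Q \<and> (\<forall>h\<in>charsp. cmod (F h - h (X n)) < inverse (Suc n))"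
    by (rule choice, rule allI) (use complex_approx[OF F] in \<open>simp add: Bex_def\<close>)
  then obtain X where X: "\<And>n. X n \<in> carrier C.Q"
    and close: "\<And>n h. h \<in> charsp \<Longrightarrow> cmod (F h - h (X n)) < inverse (real (Suc n))" by blast
  have "\<forall>e>0. \<exists>N. \<forall>m\<ge>N. \<forall>n\<ge>N. cnorm C.Q (X m \<ominus>\<^bsub>C.Q\<^esub> X n) < e"
  proof (intro allI impI)
    fix e :: real assume e: "e > 0"
    then obtain N where N: "inverse (real (Suc N)) < e / 3" using reals_Archimedean[of "e/3"] by auto
    have "cnorm C.Q (X m \<ominus>\<^bsub>C.Q\<^esub> X n) < e" if mn: "m \<ge> N" "n \<ge> N" for m n
    proof -
      have XX: "X m \<ominus>\<^bsub>C.Q\<^esub> X n \<in> carrier C.Q" by (rule ring.ring_simprules(4)[OF C.ring_Q X X])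
      have inv: "inverse (real (Suc k)) < e / 3" if "k \<ge> N" for k
      proof -
        have "inverse (real (Suc k)) \<le> inverse (real (Suc N))" using that by (intro le_imp_inverse_le) auto
        then show ?thesis using N by linarith
      qed
      have "cmod (G (X m \<ominus>\<^bsub>C.Q\<^esub> X n) h) \<le> 2 * e / 3" for h
      proof (cases "h \<in> charsp")
        case True
        have "cmod (h (X m) - h (X n)) \<le> cmod (F h - h (X n)) + cmod (F h - h (X m))"
          using norm_triangle_ineq4[of "F h - h (X n)" "F h - h (X m)"] by simp
        then show ?thesis
          using True close[OF True, of m] close[OF True, of n] inv[OF mn(1)] inv[OF mn(2)] char_minus[OF True X X, of m n]
          by (simp add: G_simp)
      qed (use e in \<open>simp add: G_simp\<close>)
      then have "cnorm CK (G (X m \<ominus>\<^bsub>C.Q\<^esub> X n)) \<le> 2 * e / 3"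
        unfolding CK_def by (rule cfun_norm_leI)
      then show ?thesis using G_norm[OF XX] e by simp
    qed
    then show "\<exists>N. \<forall>m\<ge>N. \<forall>n\<ge>N. cnorm C.Q (X m \<ominus>\<^bsub>C.Q\<^esub> X n) < e" by blast
  qed
  then obtain Y where Y: "Y \<in> carrier C.Q" and lim: "(\<lambda>n. cnorm C.Q (X n \<ominus>\<^bsub>C.Q\<^esub> Y)) \<longlonglongrightarrow> 0"
    using C.Q_complete X unfolding complete_in_def by blast
  have "G Y h = F h" for h
  proof (cases "h \<in> charsp")
    case True
    have "(\<lambda>n. inverse (real (Suc n)) + cnorm C.Q (X n \<ominus>\<^bsub>C.Q\<^esub> Y)) \<longlonglongrightarrow> 0 + 0"
      by (intro tendsto_add lim LIMSEQ_inverse_real_of_nat)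
    moreover have "cmod (F h - h Y) \<le> inverse (real (Suc n)) + cnorm C.Q (X n \<ominus>\<^bsub>C.Q\<^esub> Y)" for n
    proof -
      have "cmod (h (X n) - h Y) \<le> cnorm C.Q (X n \<ominus>\<^bsub>C.Q\<^esub> Y)"
        using char_bound[OF True ring.ring_simprules(4)[OF C.ring_Q X Y], of n] char_minus[OF True X Y, of n] by simp
      moreover have "cmod (F h - h Y) \<le> cmod (F h - h (X n)) + cmod (h (X n) - h Y)"
        using norm_triangle_ineq[of "F h - h (X n)" "h (X n) - h Y"] by simp
      ultimately show ?thesis using close[OF True, of n] by linarith
    qed
    ultimately have "cmod (F h - h Y) \<le> 0 + 0"
      using tendsto_lowerbound[of _ "0 + 0" sequentially "cmod (F h - h Y)"] by (meson always_eventually trivial_limit_sequentially)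
    then show ?thesis using True by (simp add: G_simp)
  qed (use F in \<open>simp add: G_simp CK_carrier\<close>)
  then show ?thesis using Y by blast
qed

end

section \<open>W*-bundles whose uniform 2-norm is equivalent to the C*-norm\<close>

text \<open>With \<open>bound\<close> the two norms are equivalent. Faithfulness of \<open>E\<close>
  is then immediate, and completeness of the unit ball in the 2-norm reduces to completeness in the
  C*-norm together with closedness of the ball.\<close>

lemma wstar_bundleI:
  fixes M :: "('a, 'k) wbundle" and c :: real
  defines "A \<equiv> bundle_alg M" and "C \<equiv> cfun_algebra (base_space M)" and "E \<equiv> expect M"
  assumes A: "cstar_algebra A" and K: "compact_space (base_space M)" "Hausdorff_space (base_space M)"
    and emb: "star_hom C A (embed M)"
    and central: "\<And>f a. f \<in> carrier C \<Longrightarrow> a \<in> carrier A \<Longrightarrow> embed M f \<otimes>\<^bsub>A\<^esub> a = a \<otimes>\<^bsub>A\<^esub> embed M f"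
    and E_closed: "\<And>a. a \<in> carrier A \<Longrightarrow> E a \<in> carrier C"
    and E_add: "\<And>a b. a \<in> carrier A \<Longrightarrow> b \<in> carrier A \<Longrightarrow> E (a \<oplus>\<^bsub>A\<^esub> b) = E a \<oplus>\<^bsub>C\<^esub> E b"
    and E_smult: "\<And>a z. a \<in> carrier A \<Longrightarrow> E (z \<odot>\<^bsub>A\<^esub> a) = z \<odot>\<^bsub>C\<^esub> E a"
    and E_pos: "\<And>a x. a \<in> carrier A \<Longrightarrow> x \<in> topspace (base_space M) \<Longrightarrow> E (star A a \<otimes>\<^bsub>A\<^esub> a) x \<in> \<real>\<^sub>\<ge>\<^sub>0"
    and E_norm: "\<And>a. a \<in> carrier A \<Longrightarrow> cnorm C (E a) \<le> cnorm A a"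
    and E_emb: "\<And>f. f \<in> carrier C \<Longrightarrow> E (embed M f) = f"
    and E_mod: "\<And>f a. f \<in> carrier C \<Longrightarrow> a \<in> carrier A \<Longrightarrow> E (embed M f \<otimes>\<^bsub>A\<^esub> a) = f \<otimes>\<^bsub>C\<^esub> E a"
    and E_tr: "\<And>a b. a \<in> carrier A \<Longrightarrow> b \<in> carrier A \<Longrightarrow> E (a \<otimes>\<^bsub>A\<^esub> b) = E (b \<otimes>\<^bsub>A\<^esub> a)"
    and bound: "\<And>a. a \<in> carrier A \<Longrightarrow> cnorm A a \<le> c * two_norm M a"
  shows "wstar_bundle M"
proof -
  interpret A: cstar_algebra A by (rule A)
  interpret C: cstar_algebra C unfolding C_def by (rule cstar_cfun[OF K(1)])
  have emb_closed: "embed M f \<in> carrier A" if "f \<in> carrier C" for f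
    using emb that by (auto simp: star_hom_def dest: ring_hom_closed)
  have comm: "f \<otimes>\<^bsub>C\<^esub> g = g \<otimes>\<^bsub>C\<^esub> f" for f g by (simp add: C_def mult.commute)
  have saa: "star A a \<otimes>\<^bsub>A\<^esub> a \<in> carrier A" if "a \<in> carrier A" for a
    using A.A_simps(5)[OF A.star_closed[OF that] that] .
  have two: "two_norm M a = sqrt (cnorm C (E (star A a \<otimes>\<^bsub>A\<^esub> a)))" for a
    by (simp add: two_norm_def A_def C_def E_def)
  have two0: "0 \<le> two_norm M a" if "a \<in> carrier A" for a
    unfolding two by (simp add: C.cnorm_nonneg E_closed saa that)
  have two_le: "two_norm M a \<le> cnorm A a" if a: "a \<in> carrier A" for a
    unfolding two using E_norm[OF saa[OF a]] A.cstar_identity[OF a] A.cnorm_nonneg[OF a]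
    by (intro real_le_lsqrt) simp_all
  have "inj_on (embed M) (carrier C)"
    by (rule inj_on_inverseI[of _ E]) (rule E_emb)
  moreover have "conditional_expectation M"
    unfolding conditional_expectation_def Let_def A_def[symmetric] C_def[symmetric] E_def[symmetric]
    using E_closed E_add E_smult E_pos E_norm E_emb E_mod
    by (auto simp: central[symmetric] comm)
  moreover have "E \<one>\<^bsub>A\<^esub> = \<one>\<^bsub>C\<^esub>"
  proof -
    have "embed M \<in> ring_hom C A" using emb by (simp add: star_hom_def)
    then have "embed M \<one>\<^bsub>C\<^esub> = \<one>\<^bsub>A\<^esub>" by (rule ring_hom_one)
    then show ?thesis using E_emb[OF C.A_simps(6)] by simp
  qed
  moreover have "a = \<zero>\<^bsub>A\<^esub>" if a: "a \<in> carrier A" and 0: "E (star A a \<otimes>\<^bsub>A\<^esub> a) = \<zero>\<^bsub>C\<^esub>" for a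
  proof -
    have "cnorm A a \<le> 0" using bound[OF a] by (simp add: two 0)
    then show ?thesis using A.cnorm_nonneg[OF a] A.cnorm_eq_0[OF a] by linarith
  qed
  moreover have "complete_in A (two_norm M) {a \<in> carrier A. cnorm A a \<le> 1}"
    unfolding complete_in_def
  proof (intro allI impI, elim conjE)
    fix s :: "nat \<Rightarrow> 'a"
    assume s: "\<forall>n. s n \<in> {a \<in> carrier A. cnorm A a \<le> 1}"
      and Cau: "\<forall>e>0. \<exists>N. \<forall>m\<ge>N. \<forall>n\<ge>N. two_norm M (s m \<ominus>\<^bsub>A\<^esub> s n) < e"
    have sc: "s n \<in> carrier A" and s1: "cnorm A (s n) \<le> 1" for n using s by auto
    have mc: "s m \<ominus>\<^bsub>A\<^esub> s n \<in> carrier A" for m n by (rule A.A_simps(4)[OF sc sc])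
    have "\<forall>e>0. \<exists>N. \<forall>m\<ge>N. \<forall>n\<ge>N. cnorm A (s m \<ominus>\<^bsub>A\<^esub> s n) < e"
    proof (intro allI impI)
      fix e :: real assume e: "e > 0"
      \<comment> \<open>\<open>\<bar>c\<bar> + 1\<close> serves as a positive constant, as nothing
        is assumed about the sign of \<open>c\<close>.\<close>
      define d where "d = e / (\<bar>c\<bar> + 1)"
      have d: "d > 0" "\<bar>c\<bar> * d < e" using e by (simp_all add: d_def field_simps)
      obtain N where N: "\<forall>m\<ge>N. \<forall>n\<ge>N. two_norm M (s m \<ominus>\<^bsub>A\<^esub> s n) < d" using Cau d(1) by auto
      have "cnorm A (s m \<ominus>\<^bsub>A\<^esub> s n) < e" if "m \<ge> N" "n \<ge> N" for m n
      proof -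
        have "c * two_norm M (s m \<ominus>\<^bsub>A\<^esub> s n) \<le> \<bar>c\<bar> * two_norm M (s m \<ominus>\<^bsub>A\<^esub> s n)"
          using two0[OF mc, of m n] by (intro mult_right_mono) auto
        also have "\<dots> \<le> \<bar>c\<bar> * d" using N that by (intro mult_left_mono) (auto simp: less_imp_le)
        finally show ?thesis using bound[OF mc, of m n] d(2) by linarith
      qed
      then show "\<exists>N. \<forall>m\<ge>N. \<forall>n\<ge>N. cnorm A (s m \<ominus>\<^bsub>A\<^esub> s n) < e" by auto
    qed
    then obtain a where a: "a \<in> carrier A" and lim: "(\<lambda>n. cnorm A (s n \<ominus>\<^bsub>A\<^esub> a)) \<longlonglongrightarrow> 0"
      using A.complete[unfolded complete_in_def, rule_format, of s] sc by auto
    have sa: "s n \<ominus>\<^bsub>A\<^esub> a \<in> carrier A" for n by (rule A.A_simps(4)[OF sc a])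
    have "cnorm A a \<le> 1 + cnorm A (s n \<ominus>\<^bsub>A\<^esub> a)" for n
      using A.cnorm_triangle_minus[OF sc a, of n] s1[of n] by linarith
    moreover have "(\<lambda>n. 1 + cnorm A (s n \<ominus>\<^bsub>A\<^esub> a)) \<longlonglongrightarrow> 1 + 0" by (intro tendsto_add tendsto_const lim)
    ultimately have "cnorm A a \<le> 1 + 0"
      by (intro tendsto_lowerbound[OF _ always_eventually trivial_limit_sequentially]) auto
    moreover have "(\<lambda>n. two_norm M (s n \<ominus>\<^bsub>A\<^esub> a)) \<longlonglongrightarrow> 0"
      by (rule squeeze_0[OF lim two0[OF sa] two_le[OF sa]])
    ultimately show "\<exists>a\<in>{a \<in> carrier A. cnorm A a \<le> 1}. (\<lambda>n. two_norm M (s n \<ominus>\<^bsub>A\<^esub> a)) \<longlonglongrightarrow> 0"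
      using a by auto
  qed
  ultimately show ?thesis
    unfolding wstar_bundle_def Let_def A_def[symmetric] C_def[symmetric] E_def[symmetric]
    using A K emb central E_tr by auto
qed

context
  fixes M :: "('a, 'k) wbundle"
  assumes M: "wstar_bundle M"
begin

lemma wb_cstar: "cstar_algebra (bundle_alg M)"
  using M by (simp add: wstar_bundle_def Let_def)

lemma wb_space: "compact_space (base_space M)" "Hausdorff_space (base_space M)"
  using M by (simp_all add: wstar_bundle_def Let_def)

lemma wb_hom: "star_hom (cfun_algebra (base_space M)) (bundle_alg M) (embed M)"
  using M by (simp add: wstar_bundle_def Let_def)

lemma wb_emb:
  "f \<in> carrier (cfun_algebra (base_space M)) \<Longrightarrow> embed M f \<in> carrier (bundle_alg M)"
  "f \<in> carrier (cfun_algebra (base_space M)) \<Longrightarrow> g \<in> carrier (cfun_algebra (base_space M)) \<Longrightarrow>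
    embed M (f \<otimes>\<^bsub>cfun_algebra (base_space M)\<^esub> g) = embed M f \<otimes>\<^bsub>bundle_alg M\<^esub> embed M g"
  "f \<in> carrier (cfun_algebra (base_space M)) \<Longrightarrow> g \<in> carrier (cfun_algebra (base_space M)) \<Longrightarrow>
    embed M (f \<oplus>\<^bsub>cfun_algebra (base_space M)\<^esub> g) = embed M f \<oplus>\<^bsub>bundle_alg M\<^esub> embed M g"
  "embed M \<one>\<^bsub>cfun_algebra (base_space M)\<^esub> = \<one>\<^bsub>bundle_alg M\<^esub>"
  "f \<in> carrier (cfun_algebra (base_space M)) \<Longrightarrow>
    embed M (c \<odot>\<^bsub>cfun_algebra (base_space M)\<^esub> f) = c \<odot>\<^bsub>bundle_alg M\<^esub> embed M f"
  "f \<in> carrier (cfun_algebra (base_space M)) \<Longrightarrow>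
    embed M (star (cfun_algebra (base_space M)) f) = star (bundle_alg M) (embed M f)"
  "f \<in> carrier (cfun_algebra (base_space M)) \<Longrightarrow> a \<in> carrier (bundle_alg M) \<Longrightarrow>
    embed M f \<otimes>\<^bsub>bundle_alg M\<^esub> a = a \<otimes>\<^bsub>bundle_alg M\<^esub> embed M f"
proof -
  have r: "embed M \<in> ring_hom (cfun_algebra (base_space M)) (bundle_alg M)"
    using wb_hom by (simp add: star_hom_def)
  show "f \<in> carrier (cfun_algebra (base_space M)) \<Longrightarrow> embed M f \<in> carrier (bundle_alg M)"
    by (rule ring_hom_closed[OF r])
  show "f \<in> carrier (cfun_algebra (base_space M)) \<Longrightarrow> g \<in> carrier (cfun_algebra (base_space M)) \<Longrightarrow>
    embed M (f \<otimes>\<^bsub>cfun_algebra (base_space M)\<^esub> g) = embed M f \<otimes>\<^bsub>bundle_alg M\<^esub> embed M g"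
    by (rule ring_hom_mult[OF r])
  show "f \<in> carrier (cfun_algebra (base_space M)) \<Longrightarrow> g \<in> carrier (cfun_algebra (base_space M)) \<Longrightarrow>
    embed M (f \<oplus>\<^bsub>cfun_algebra (base_space M)\<^esub> g) = embed M f \<oplus>\<^bsub>bundle_alg M\<^esub> embed M g"
    by (rule ring_hom_add[OF r])
  show "embed M \<one>\<^bsub>cfun_algebra (base_space M)\<^esub> = \<one>\<^bsub>bundle_alg M\<^esub>"
    by (rule ring_hom_one[OF r])
  show "f \<in> carrier (cfun_algebra (base_space M)) \<Longrightarrow>
    embed M (c \<odot>\<^bsub>cfun_algebra (base_space M)\<^esub> f) = c \<odot>\<^bsub>bundle_alg M\<^esub> embed M f"
    using wb_hom unfolding star_hom_def by blast
  show "f \<in> carrier (cfun_algebra (base_space M)) \<Longrightarrow>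
    embed M (star (cfun_algebra (base_space M)) f) = star (bundle_alg M) (embed M f)"
    using wb_hom unfolding star_hom_def by blast
  show "f \<in> carrier (cfun_algebra (base_space M)) \<Longrightarrow> a \<in> carrier (bundle_alg M) \<Longrightarrow>
    embed M f \<otimes>\<^bsub>bundle_alg M\<^esub> a = a \<otimes>\<^bsub>bundle_alg M\<^esub> embed M f"
    using M unfolding wstar_bundle_def Let_def by blast
qed

lemma wb_E:
  "a \<in> carrier (bundle_alg M) \<Longrightarrow> expect M a \<in> carrier (cfun_algebra (base_space M))"
  "a \<in> carrier (bundle_alg M) \<Longrightarrow> b \<in> carrier (bundle_alg M) \<Longrightarrow>
    expect M (a \<oplus>\<^bsub>bundle_alg M\<^esub> b) = expect M a \<oplus>\<^bsub>cfun_algebra (base_space M)\<^esub> expect M b"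
  "a \<in> carrier (bundle_alg M) \<Longrightarrow> expect M (c \<odot>\<^bsub>bundle_alg M\<^esub> a) = c \<odot>\<^bsub>cfun_algebra (base_space M)\<^esub> expect M a"
  "a \<in> carrier (bundle_alg M) \<Longrightarrow> x \<in> topspace (base_space M) \<Longrightarrow>
    expect M (star (bundle_alg M) a \<otimes>\<^bsub>bundle_alg M\<^esub> a) x \<in> \<real>\<^sub>\<ge>\<^sub>0"
  "a \<in> carrier (bundle_alg M) \<Longrightarrow> cnorm (cfun_algebra (base_space M)) (expect M a) \<le> cnorm (bundle_alg M) a"
  "f \<in> carrier (cfun_algebra (base_space M)) \<Longrightarrow> expect M (embed M f) = f"
  "f \<in> carrier (cfun_algebra (base_space M)) \<Longrightarrow> a \<in> carrier (bundle_alg M) \<Longrightarrow>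
    expect M (embed M f \<otimes>\<^bsub>bundle_alg M\<^esub> a) = f \<otimes>\<^bsub>cfun_algebra (base_space M)\<^esub> expect M a"
  "a \<in> carrier (bundle_alg M) \<Longrightarrow> b \<in> carrier (bundle_alg M) \<Longrightarrow>
    expect M (a \<otimes>\<^bsub>bundle_alg M\<^esub> b) = expect M (b \<otimes>\<^bsub>bundle_alg M\<^esub> a)"
  "expect M \<one>\<^bsub>bundle_alg M\<^esub> = \<one>\<^bsub>cfun_algebra (base_space M)\<^esub>"
  using M unfolding wstar_bundle_def conditional_expectation_def Let_def by auto

lemma wb_E_minus:
  assumes a: "a \<in> carrier (bundle_alg M)" and b: "b \<in> carrier (bundle_alg M)"
  shows "expect M (a \<ominus>\<^bsub>bundle_alg M\<^esub> b) = (\<lambda>x. expect M a x - expect M b x)"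
proof -
  interpret A: cstar_algebra "bundle_alg M" by (rule wb_cstar)
  have "expect M ((a \<ominus>\<^bsub>bundle_alg M\<^esub> b) \<oplus>\<^bsub>bundle_alg M\<^esub> b) = (\<lambda>x. expect M (a \<ominus>\<^bsub>bundle_alg M\<^esub> b) x + expect M b x)"
    using wb_E(2)[OF A.A_simps(4)[OF a b] b] by simp
  then show ?thesis by (simp add: A.minus_add_cancel[OF a b] fun_eq_iff)
qed

lemma wb_emb_minus:
  assumes f: "f \<in> carrier (cfun_algebra (base_space M))" and g: "g \<in> carrier (cfun_algebra (base_space M))"
  shows "embed M (\<lambda>x. f x - g x) = embed M f \<ominus>\<^bsub>bundle_alg M\<^esub> embed M g"
proof -
  interpret A: cstar_algebra "bundle_alg M" by (rule wb_cstar)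
  have fg: "(\<lambda>x. f x - g x) \<in> carrier (cfun_algebra (base_space M))" by (rule cfun_closed(3)[OF f g])
  have "embed M f = embed M (\<lambda>x. f x - g x) \<oplus>\<^bsub>bundle_alg M\<^esub> embed M g"
    using wb_emb(3)[OF fg g] by simp
  then have "embed M f \<ominus>\<^bsub>bundle_alg M\<^esub> embed M g
      = (embed M (\<lambda>x. f x - g x) \<oplus>\<^bsub>bundle_alg M\<^esub> embed M g) \<ominus>\<^bsub>bundle_alg M\<^esub> embed M g" by simp
  also have "\<dots> = embed M (\<lambda>x. f x - g x)"
    using wb_emb(1)[OF fg] wb_emb(1)[OF g] by (simp add: A.A_simps)
  finally show ?thesis by simp
qed

lemma wb_two_norm_le:
  assumes a: "a \<in> carrier (bundle_alg M)"
  shows "0 \<le> two_norm M a" "two_norm M a \<le> cnorm (bundle_alg M) a"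
proof -
  interpret A: cstar_algebra "bundle_alg M" by (rule wb_cstar)
  interpret C: cstar_algebra "cfun_algebra (base_space M)" by (rule cstar_cfun[OF wb_space(1)])
  have saa: "star (bundle_alg M) a \<otimes>\<^bsub>bundle_alg M\<^esub> a \<in> carrier (bundle_alg M)"
    using A.A_simps(5)[OF A.star_closed[OF a] a] .
  show "0 \<le> two_norm M a"
    unfolding two_norm_def by (rule real_sqrt_ge_zero[OF C.cnorm_nonneg[OF wb_E(1)[OF saa]]])
  show "two_norm M a \<le> cnorm (bundle_alg M) a"
    unfolding two_norm_def using wb_E(5)[OF saa] A.cstar_identity[OF a] A.cnorm_nonneg[OF a]
    by (intro real_le_lsqrt) (simp_all del: cfun_simps)
qed

text \<open>On the copy of \<open>C(K)\<close> the expectation is the identity, so the 2-norm there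
  is the supremum norm. Combined with a bound of the C*-norm by the 2-norm, this controls the norm
  of the embedding.\<close>

lemma wb_two_norm_emb:
  assumes f: "f \<in> carrier (cfun_algebra (base_space M))"
  shows "two_norm M (embed M f) = cnorm (cfun_algebra (base_space M)) f"
proof -
  interpret C: cstar_algebra "cfun_algebra (base_space M)" by (rule cstar_cfun[OF wb_space(1)])
  have "star (bundle_alg M) (embed M f) \<otimes>\<^bsub>bundle_alg M\<^esub> embed M f
     = embed M (star (cfun_algebra (base_space M)) f \<otimes>\<^bsub>cfun_algebra (base_space M)\<^esub> f)"
    by (simp only: wb_emb(2)[OF C.star_closed[OF f] f] wb_emb(6)[OF f])
  then show ?thesis
    unfolding two_norm_def
    by (simp only: wb_E(6)[OF C.A_simps(5)[OF C.star_closed[OF f] f]] C.cstar_identity[OF f])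
       (rule real_sqrt_unique[OF refl C.cnorm_nonneg[OF f]])
qed

end

lemma (in cfun_ultra) char_nonneg:
  assumes h: "h \<in> charsp" and f: "f \<in> carrier C.P" and nn: "\<And>n x. f n x \<in> \<real>\<^sub>\<ge>\<^sub>0"
  shows "h (C.cls f) \<in> \<real>\<^sub>\<ge>\<^sub>0"
proof -
  have re: "0 \<le> Re (f n x)" "Im (f n x) = 0" for n x
    using nn[of n x] by (auto simp: complex_nonneg_Reals_iff)
  have im: "Im (h (C.cls f)) = 0" by (rule char_real[OF h f re(2)])
  have "0 \<le> Re (h (C.cls f))"
  proof (rule ccontr)
    assume neg: "\<not> 0 \<le> Re (h (C.cls f))"
    then obtain n x where "cmod (f n x - h (C.cls f)) < - Re (h (C.cls f))"
      using char_range[OF h f, of "- Re (h (C.cls f))"] by auto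
    then show False using abs_Re_le_cmod[of "f n x - h (C.cls f)"] re(1)[of n x] by simp
  qed
  then show ?thesis using im by (simp add: complex_nonneg_Reals_iff)
qed

lemma Hausdorff_space_t2: "Hausdorff_space (euclidean :: 'a::t2_space topology)"
  unfolding Hausdorff_space_def disjnt_def
proof (intro allI impI, elim conjE)
  fix x y :: 'a assume "x \<noteq> y"
  from hausdorff[OF this]
  show "\<exists>U V. openin euclidean U \<and> openin euclidean V \<and> x \<in> U \<and> y \<in> V \<and> U \<inter> V = {}"
    by (simp only: open_openin)
qed

text \<open>The constant \<open>c\<close> does not depend on \<open>n\<close>. This uniformity makes
  the tracially null sequences coincide with the norm-null ones, so that all results on norm
  ultraproducts apply to the tracial ultraproduct.\<close>

locale wb_ultra = ultra U for U +
  fixes M :: "nat \<Rightarrow> ('a, 'k) wbundle" and c :: real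
  assumes wb: "wstar_bundle (M n)" and ne: "topspace (base_space (M n)) \<noteq> {}"
    and bound: "a \<in> carrier (bundle_alg (M n)) \<Longrightarrow> cnorm (bundle_alg (M n)) a \<le> c * two_norm (M n) a"
begin

sublocale B: cstar_ultra "\<lambda>n. bundle_alg (M n)" U
  by (intro cstar_ultra.intro cstar_family.intro wb_cstar[OF wb] ultra_axioms)

sublocale K: cfun_ultra U "\<lambda>n. base_space (M n)"
  by (intro cfun_ultra.intro ultra_axioms cfun_ultra_axioms.intro wb_space[OF wb] ne)

definition "N = tracial_ultraproduct U M"

lemma tracial_null_eq: "tracial_null U M = B.J"
proof -
  have "((\<lambda>n. two_norm (M n) (a n)) \<longlongrightarrow> 0) U \<longleftrightarrow> ((\<lambda>n. cnorm (bundle_alg (M n)) (a n)) \<longlongrightarrow> 0) U"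
    if a: "a \<in> carrier B.P" for a
  proof
    assume "((\<lambda>n. two_norm (M n) (a n)) \<longlongrightarrow> 0) U"
    then have "((\<lambda>n. c * two_norm (M n) (a n)) \<longlongrightarrow> 0) U"
      using tendsto_mult[OF tendsto_const[of c U], of "\<lambda>n. two_norm (M n) (a n)" 0] by simp
    then show "((\<lambda>n. cnorm (bundle_alg (M n)) (a n)) \<longlongrightarrow> 0) U"
      by (rule squeeze_0) (use cstar_algebra.cnorm_nonneg[OF wb_cstar[OF wb] B.P_comp[OF a]] bound[OF B.P_comp[OF a]] in auto)
  next
    assume "((\<lambda>n. cnorm (bundle_alg (M n)) (a n)) \<longlongrightarrow> 0) U"
    then show "((\<lambda>n. two_norm (M n) (a n)) \<longlongrightarrow> 0) U"
      by (rule squeeze_0[OF _ wb_two_norm_le[OF wb B.P_comp[OF a]]])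
  qed
  then show ?thesis unfolding tracial_null_def norm_null_def by blast
qed

lemma N_alg: "bundle_alg N = B.Q"
  by (simp add: N_def tracial_ultraproduct_def Let_def tracial_null_eq norm_ultraproduct_def)

lemma N_space: "base_space N = top_of_set K.charsp"
  by (simp add: N_def tracial_ultraproduct_def Let_def K.ultracoproduct_eq)

lemma N_C: "cfun_algebra (base_space N) = K.CK"
  by (simp add: N_space K.CK_def)

lemma emb_norm: "f \<in> carrier (cfun_algebra (base_space (M n))) \<Longrightarrow>
    cnorm (bundle_alg (M n)) (embed (M n) f) \<le> c * cnorm (cfun_algebra (base_space (M n))) f"
  using bound[OF wb_emb(1)[OF wb], of f n] wb_two_norm_emb[OF wb, of f n] by simp

lemma emb_P: "f \<in> carrier K.C.P \<Longrightarrow> (\<lambda>n. embed (M n) (f n)) \<in> carrier B.P"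
proof (rule B.PI[where B="\<bar>c\<bar> * cnorm K.C.P f"])
  assume f: "f \<in> carrier K.C.P"
  show "embed (M n) (f n) \<in> carrier (bundle_alg (M n))" for n
    by (rule wb_emb(1)[OF wb K.PC[OF f]])
  show "cnorm (bundle_alg (M n)) (embed (M n) (f n)) \<le> \<bar>c\<bar> * cnorm K.C.P f" for n
  proof -
    have "c * cnorm (cfun_algebra (base_space (M n))) (f n) \<le> \<bar>c\<bar> * cnorm K.C.P f"
      by (intro mult_mono K.C.P_norm_le[OF f] cstar_algebra.cnorm_nonneg[OF K.C.cstar K.PC[OF f]]) auto
    then show ?thesis using emb_norm[OF K.PC[OF f], of n] by linarith
  qed
qed

lemma E_P: "a \<in> carrier B.P \<Longrightarrow> (\<lambda>n. expect (M n) (a n)) \<in> carrier K.C.P"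
proof (rule K.C.PI[where B="cnorm B.P a"])
  assume a: "a \<in> carrier B.P"
  show "expect (M n) (a n) \<in> carrier (cfun_algebra (base_space (M n)))" for n
    by (rule wb_E(1)[OF wb B.P_comp[OF a]])
  show "cnorm (cfun_algebra (base_space (M n))) (expect (M n) (a n)) \<le> cnorm B.P a" for n
    using wb_E(5)[OF wb B.P_comp[OF a]] B.P_norm_le[OF a, of n] by (rule order_trans)
qed

text \<open>The embedding is defined through the inverse Gelfand transform. It can be computed on
  any representative because the embeddings of the factors are bounded by the common constant
  \<open>c\<close> and so respect null sequences.\<close>

lemma N_embed:
  assumes f: "f \<in> carrier K.C.P"
  shows "embed N (K.G (K.C.cls f)) = B.cls (\<lambda>n. embed (M n) (f n))"
proof -
  have inv: "inv_into (carrier K.C.Q) K.G (K.G (K.C.cls f)) = K.C.cls f"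
    by (rule inv_into_f_f[OF K.G_inj K.C.cls_closed[OF f]])
  have "embed N (K.G (K.C.cls f)) = coset_map B.P B.J (\<lambda>g n. embed (M n) (g n)) (K.C.cls f)"
    using inv by (simp add: N_def tracial_ultraproduct_def Let_def tracial_null_eq K.Q_eq K.G_def)
  also have "\<dots> = B.cls (\<lambda>n. embed (M n) (f n))"
  proof (rule coset_map_coset)
    show "K.C.cls f \<noteq> {}" using K.C.cls_memI[OF f] by auto
    fix g assume "g \<in> K.C.cls f"
    then have g: "g \<in> carrier K.C.P"
      and lim: "((\<lambda>n. cnorm (cfun_algebra (base_space (M n))) (g n \<ominus>\<^bsub>cfun_algebra (base_space (M n))\<^esub> f n)) \<longlongrightarrow> 0) U"
      using K.C.cls_mem[OF f] by auto
    have lim': "((\<lambda>n. c * cnorm (cfun_algebra (base_space (M n))) (g n \<ominus>\<^bsub>cfun_algebra (base_space (M n))\<^esub> f n)) \<longlongrightarrow> 0) U"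
      using tendsto_mult[OF tendsto_const[of c U] lim] by simp
    have gf: "(\<lambda>x. g n x - f n x) \<in> carrier (cfun_algebra (base_space (M n)))" for n
      by (rule cfun_closed(3)[OF K.PC[OF g] K.PC[OF f]])
    have "((\<lambda>n. cnorm (bundle_alg (M n)) (embed (M n) (g n) \<ominus>\<^bsub>bundle_alg (M n)\<^esub> embed (M n) (f n))) \<longlongrightarrow> 0) U"
    proof (rule squeeze_0[OF lim'])
      fix n
      have eq: "embed (M n) (g n) \<ominus>\<^bsub>bundle_alg (M n)\<^esub> embed (M n) (f n) = embed (M n) (\<lambda>x. g n x - f n x)"
        by (rule wb_emb_minus[OF wb K.PC[OF g] K.PC[OF f], symmetric])
      show "0 \<le> cnorm (bundle_alg (M n)) (embed (M n) (g n) \<ominus>\<^bsub>bundle_alg (M n)\<^esub> embed (M n) (f n))"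
        unfolding eq by (rule cstar_algebra.cnorm_nonneg[OF wb_cstar[OF wb] wb_emb(1)[OF wb gf]])
      show "cnorm (bundle_alg (M n)) (embed (M n) (g n) \<ominus>\<^bsub>bundle_alg (M n)\<^esub> embed (M n) (f n))
         \<le> c * cnorm (cfun_algebra (base_space (M n))) (g n \<ominus>\<^bsub>cfun_algebra (base_space (M n))\<^esub> f n)"
        unfolding eq cfun_minus[OF K.PC[OF g] K.PC[OF f]] by (rule emb_norm[OF gf])
    qed
    then show "B.J +>\<^bsub>B.P\<^esub> (\<lambda>n. embed (M n) (g n)) = B.cls (\<lambda>n. embed (M n) (f n))"
      using B.cls_eq[OF emb_P[OF g] emb_P[OF f]] by (simp add: B.cls_def)
  qed
  finally show ?thesis .
qed

text \<open>The expectations of the factors are contractive, so norm-null differences are sent to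
  norm-null differences and any representative may be used.\<close>

lemma N_expect:
  assumes a: "a \<in> carrier B.P"
  shows "expect N (B.cls a) = K.G (K.C.cls (\<lambda>n. expect (M n) (a n)))"
proof -
  have "coset_map K.C.P K.C.J (\<lambda>a n. expect (M n) (a n)) (B.cls a) = K.C.cls (\<lambda>n. expect (M n) (a n))"
  proof (rule coset_map_coset)
    show "B.cls a \<noteq> {}" using B.cls_memI[OF a] by auto
    fix b assume "b \<in> B.cls a"
    then have b: "b \<in> carrier B.P"
      and lim: "((\<lambda>n. cnorm (bundle_alg (M n)) (b n \<ominus>\<^bsub>bundle_alg (M n)\<^esub> a n)) \<longlongrightarrow> 0) U"
      using B.cls_mem[OF a] by auto
    have "((\<lambda>n. cnorm (cfun_algebra (base_space (M n))) (expect (M n) (b n) \<ominus>\<^bsub>cfun_algebra (base_space (M n))\<^esub> expect (M n) (a n))) \<longlongrightarrow> 0) U"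
    proof (rule squeeze_0[OF lim])
      fix n
      have ba: "b n \<ominus>\<^bsub>bundle_alg (M n)\<^esub> a n \<in> carrier (bundle_alg (M n))"
        by (rule cstar_algebra.A_simps(4)[OF wb_cstar[OF wb] B.P_comp[OF b] B.P_comp[OF a]])
      have eq: "expect (M n) (b n) \<ominus>\<^bsub>cfun_algebra (base_space (M n))\<^esub> expect (M n) (a n) = expect (M n) (b n \<ominus>\<^bsub>bundle_alg (M n)\<^esub> a n)"
        using wb_E_minus[OF wb B.P_comp[OF b] B.P_comp[OF a], of n]
          cfun_minus[OF wb_E(1)[OF wb B.P_comp[OF b]] wb_E(1)[OF wb B.P_comp[OF a]], of n] by simp
      show "0 \<le> cnorm (cfun_algebra (base_space (M n))) (expect (M n) (b n) \<ominus>\<^bsub>cfun_algebra (base_space (M n))\<^esub> expect (M n) (a n))"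
        unfolding eq by (rule cstar_algebra.cnorm_nonneg[OF K.C.cstar wb_E(1)[OF wb ba]])
      show "cnorm (cfun_algebra (base_space (M n))) (expect (M n) (b n) \<ominus>\<^bsub>cfun_algebra (base_space (M n))\<^esub> expect (M n) (a n))
          \<le> cnorm (bundle_alg (M n)) (b n \<ominus>\<^bsub>bundle_alg (M n)\<^esub> a n)"
        unfolding eq by (rule wb_E(5)[OF wb ba])
    qed
    then show "K.C.J +>\<^bsub>K.C.P\<^esub> (\<lambda>n. expect (M n) (b n)) = K.C.cls (\<lambda>n. expect (M n) (a n))"
      using K.C.cls_eq[OF E_P[OF b] E_P[OF a]] by (simp add: K.C.cls_def)
  qed
  then show ?thesis
    by (simp add: N_def tracial_ultraproduct_def Let_def K.Q_eq K.G_def)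
qed

lemma CKE:
  assumes "F \<in> carrier K.CK"
  obtains f where "f \<in> carrier K.C.P" "F = K.G (K.C.cls f)"
  using K.G_surj[OF assms] K.C.carrier_Q by auto

lemma QE:
  assumes "X \<in> carrier B.Q"
  obtains a where "a \<in> carrier B.P" "X = B.cls a"
  using assms unfolding B.carrier_Q by auto

lemma K_ops:
  assumes "f \<in> carrier K.C.P" "g \<in> carrier K.C.P"
  shows "K.G (K.C.cls f) \<otimes>\<^bsub>K.CK\<^esub> K.G (K.C.cls g)
      = K.G (K.C.cls (\<lambda>n. f n \<otimes>\<^bsub>cfun_algebra (base_space (M n))\<^esub> g n))"
    "K.G (K.C.cls f) \<oplus>\<^bsub>K.CK\<^esub> K.G (K.C.cls g)
      = K.G (K.C.cls (\<lambda>n. f n \<oplus>\<^bsub>cfun_algebra (base_space (M n))\<^esub> g n))"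
    "z \<odot>\<^bsub>K.CK\<^esub> K.G (K.C.cls f)
      = K.G (K.C.cls (\<lambda>n. z \<odot>\<^bsub>cfun_algebra (base_space (M n))\<^esub> f n))"
    "star K.CK (K.G (K.C.cls f))
      = K.G (K.C.cls (\<lambda>n. star (cfun_algebra (base_space (M n))) (f n)))"
  using K.G_mult[OF K.C.cls_closed K.C.cls_closed, OF assms] K.C.Q_mult[OF assms]
    K.G_add[OF K.C.cls_closed K.C.cls_closed, OF assms] K.C.Q_add[OF assms]
    K.G_smult[OF K.C.cls_closed, OF assms(1), of z] K.C.Q_smult[OF assms(1), of z]
    K.G_star[OF K.C.cls_closed, OF assms(1)] K.C.Q_star[OF assms(1)]
  by simp_all

text \<open>The 2-norm of a class is the limit of the 2-norms in the factors, because the Gelfand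
  transform is isometric. Thus the estimate \<open>bound\<close> is inherited by \<open>N\<close>
  with the same constant.\<close>

lemma N_two_norm:
  assumes a: "a \<in> carrier B.P"
  shows "((\<lambda>n. two_norm (M n) (a n)) \<longlongrightarrow> two_norm N (B.cls a)) U"
proof -
  define b where "b n = star (bundle_alg (M n)) (a n) \<otimes>\<^bsub>bundle_alg (M n)\<^esub> a n" for n
  have b: "b \<in> carrier B.P" unfolding b_def by (intro B.comp_closed a)
  have "star B.Q (B.cls a) \<otimes>\<^bsub>B.Q\<^esub> B.cls a = B.cls b"
    unfolding b_def by (simp only: B.Q_star[OF a] B.Q_mult[OF B.comp_closed(5)[OF a] a])
  then have eq: "two_norm N (B.cls a) = sqrt (cnorm K.C.Q (K.C.cls (\<lambda>n. expect (M n) (b n))))"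
    by (simp add: two_norm_def N_alg N_C N_expect[OF b] K.G_norm[OF K.C.cls_closed[OF E_P[OF b]]])
  have "((\<lambda>n. sqrt (cnorm (cfun_algebra (base_space (M n))) (expect (M n) (b n))))
      \<longlongrightarrow> sqrt (cnorm K.C.Q (K.C.cls (\<lambda>n. expect (M n) (b n))))) U"
    by (intro tendsto_real_sqrt K.C.Q_norm_tendsto E_P b)
  moreover have "two_norm (M n) (a n) = sqrt (cnorm (cfun_algebra (base_space (M n))) (expect (M n) (b n)))" for n
    unfolding two_norm_def b_def ..
  ultimately show ?thesis unfolding eq by (simp only:)
qed

text \<open>All identities hold for representatives in each coordinate, and positivity at
  \<open>h\<close> follows from nonnegativity of the values of a representative. Since
  \<open>N\<close> inherits \<open>bound\<close>, the criterion used for the factors applies to it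
  as well.\<close>

theorem wstar_N: "wstar_bundle N"
proof (rule wstar_bundleI[where c=c]; (unfold N_alg N_C)?)
  show "cstar_algebra B.Q" by (rule B.cstar_Q)
  show "compact_space (base_space N)" "Hausdorff_space (base_space N)"
    unfolding N_space using K.compact_CK by (auto intro: Hausdorff_space_subtopology Hausdorff_space_t2)
  show "star_hom K.CK B.Q (embed N)"
    unfolding star_hom_def
  proof (intro conjI ring_hom_memI ballI allI)
    have "K.G (K.C.cls (\<lambda>n. \<one>\<^bsub>cfun_algebra (base_space (M n))\<^esub>)) = \<one>\<^bsub>K.CK\<^esub>"
      using K.G_one K.C.Q_one by simp
    then have "embed N \<one>\<^bsub>K.CK\<^esub> = B.cls (\<lambda>n. embed (M n) \<one>\<^bsub>cfun_algebra (base_space (M n))\<^esub>)"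
      using N_embed[OF K.C.comp_closed(6)] by simp
    then show "embed N \<one>\<^bsub>K.CK\<^esub> = \<one>\<^bsub>B.Q\<^esub>" by (simp only: wb_emb(4)[OF wb] B.Q_one)
    fix F assume "F \<in> carrier K.CK"
    then obtain f where f: "f \<in> carrier K.C.P" "F = K.G (K.C.cls f)" by (rule CKE)
    show "embed N F \<in> carrier B.Q" unfolding f(2) N_embed[OF f(1)] by (rule B.cls_closed[OF emb_P[OF f(1)]])
    show "embed N (z \<odot>\<^bsub>K.CK\<^esub> F) = z \<odot>\<^bsub>B.Q\<^esub> embed N F" for z
      unfolding f(2) K_ops(3)[OF f(1) f(1)] N_embed[OF f(1)] N_embed[OF K.C.comp_closed(4)[OF f(1)]]
        B.Q_smult[OF emb_P[OF f(1)]] wb_emb(5)[OF wb K.PC[OF f(1)]] ..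
    show "embed N (star K.CK F) = star B.Q (embed N F)"
      unfolding f(2) K_ops(4)[OF f(1) f(1)] N_embed[OF f(1)] N_embed[OF K.C.comp_closed(5)[OF f(1)]]
        B.Q_star[OF emb_P[OF f(1)]] wb_emb(6)[OF wb K.PC[OF f(1)]] ..
    fix F' assume "F' \<in> carrier K.CK"
    then obtain g where g: "g \<in> carrier K.C.P" "F' = K.G (K.C.cls g)" by (rule CKE)
    show "embed N (F \<otimes>\<^bsub>K.CK\<^esub> F') = embed N F \<otimes>\<^bsub>B.Q\<^esub> embed N F'"
      unfolding f(2) g(2) K_ops(1)[OF f(1) g(1)] N_embed[OF f(1)] N_embed[OF g(1)] N_embed[OF K.C.comp_closed(1)[OF f(1) g(1)]]
        B.Q_mult[OF emb_P[OF f(1)] emb_P[OF g(1)]] wb_emb(2)[OF wb K.PC[OF f(1)] K.PC[OF g(1)]] ..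
    show "embed N (F \<oplus>\<^bsub>K.CK\<^esub> F') = embed N F \<oplus>\<^bsub>B.Q\<^esub> embed N F'"
      unfolding f(2) g(2) K_ops(2)[OF f(1) g(1)] N_embed[OF f(1)] N_embed[OF g(1)] N_embed[OF K.C.comp_closed(2)[OF f(1) g(1)]]
        B.Q_add[OF emb_P[OF f(1)] emb_P[OF g(1)]] wb_emb(3)[OF wb K.PC[OF f(1)] K.PC[OF g(1)]] ..
  qed
  fix X assume "X \<in> carrier B.Q"
  then obtain a where a: "a \<in> carrier B.P" "X = B.cls a" by (rule QE)
  note an = B.P_comp[OF a(1)]
  show "expect N X \<in> carrier K.CK"
    unfolding a(2) N_expect[OF a(1)] by (rule K.G_closed[OF K.C.cls_closed[OF E_P[OF a(1)]]])
  show "expect N (z \<odot>\<^bsub>B.Q\<^esub> X) = z \<odot>\<^bsub>K.CK\<^esub> expect N X" for z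
    unfolding a(2) B.Q_smult[OF a(1)] N_expect[OF a(1)] N_expect[OF B.comp_closed(4)[OF a(1)]]
      K_ops(3)[OF E_P[OF a(1)] E_P[OF a(1)]] wb_E(3)[OF wb an] ..
  have saa: "(\<lambda>n. star (bundle_alg (M n)) (a n) \<otimes>\<^bsub>bundle_alg (M n)\<^esub> a n) \<in> carrier B.P"
    by (intro B.comp_closed a)
  show "expect N (star B.Q X \<otimes>\<^bsub>B.Q\<^esub> X) h \<in> \<real>\<^sub>\<ge>\<^sub>0" if "h \<in> topspace (base_space N)" for h
  proof -
    define f where "f n = expect (M n) (star (bundle_alg (M n)) (a n) \<otimes>\<^bsub>bundle_alg (M n)\<^esub> a n)" for n
    have f: "f \<in> carrier K.C.P" unfolding f_def by (rule E_P[OF saa])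
    have h: "h \<in> K.charsp" using that by (simp add: N_space)
    have nn: "f n x \<in> \<real>\<^sub>\<ge>\<^sub>0" for n x
    proof (cases "x \<in> topspace (base_space (M n))")
      case True then show ?thesis unfolding f_def by (rule wb_E(4)[OF wb an])
    next
      case False then show ?thesis using K.PC[OF f, of n] by (simp add: carrier_cfun)
    qed
    have "expect N (star B.Q X \<otimes>\<^bsub>B.Q\<^esub> X) = K.G (K.C.cls f)"
      unfolding a(2) B.Q_star[OF a(1)] B.Q_mult[OF B.comp_closed(5)[OF a(1)] a(1)] N_expect[OF saa] f_def ..
    moreover have "h (K.C.cls f) \<in> \<real>\<^sub>\<ge>\<^sub>0" by (rule K.char_nonneg[OF h f nn])
    ultimately show ?thesis using h by (simp add: K.G_simp)
  qed
  show "cnorm K.CK (expect N X) \<le> cnorm B.Q X"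
    unfolding a(2) N_expect[OF a(1)] K.G_norm[OF K.C.cls_closed[OF E_P[OF a(1)]]]
    by (rule tendsto_le[OF U_nonbot B.Q_norm_tendsto[OF a(1)] K.C.Q_norm_tendsto[OF E_P[OF a(1)]] always_eventually])
       (use wb_E(5)[OF wb an] in auto)
  show "cnorm B.Q X \<le> c * two_norm N X"
    unfolding a(2)
    by (rule tendsto_le[OF U_nonbot tendsto_mult[OF tendsto_const N_two_norm[OF a(1)]] B.Q_norm_tendsto[OF a(1)] always_eventually])
       (use bound[OF an] in auto)
  show "embed N F \<otimes>\<^bsub>B.Q\<^esub> X = X \<otimes>\<^bsub>B.Q\<^esub> embed N F"
    "expect N (embed N F \<otimes>\<^bsub>B.Q\<^esub> X) = F \<otimes>\<^bsub>K.CK\<^esub> expect N X"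
    if F: "F \<in> carrier K.CK" for F
  proof -
    obtain f where f: "f \<in> carrier K.C.P" "F = K.G (K.C.cls f)" using F by (rule CKE)
    show "embed N F \<otimes>\<^bsub>B.Q\<^esub> X = X \<otimes>\<^bsub>B.Q\<^esub> embed N F"
      unfolding f(2) a(2) N_embed[OF f(1)] B.Q_mult[OF emb_P[OF f(1)] a(1)] B.Q_mult[OF a(1) emb_P[OF f(1)]]
        wb_emb(7)[OF wb K.PC[OF f(1)] an] ..
    show "expect N (embed N F \<otimes>\<^bsub>B.Q\<^esub> X) = F \<otimes>\<^bsub>K.CK\<^esub> expect N X"
      unfolding f(2) a(2) N_embed[OF f(1)] B.Q_mult[OF emb_P[OF f(1)] a(1)] N_expect[OF a(1)]
        N_expect[OF B.comp_closed(1)[OF emb_P[OF f(1)] a(1)]] K_ops(1)[OF f(1) E_P[OF a(1)]]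
        wb_E(7)[OF wb K.PC[OF f(1)] an] ..
  qed
  fix Y assume "Y \<in> carrier B.Q"
  then obtain b where b: "b \<in> carrier B.P" "Y = B.cls b" by (rule QE)
  note bn = B.P_comp[OF b(1)]
  show "expect N (X \<oplus>\<^bsub>B.Q\<^esub> Y) = expect N X \<oplus>\<^bsub>K.CK\<^esub> expect N Y"
    unfolding a(2) b(2) B.Q_add[OF a(1) b(1)] N_expect[OF a(1)] N_expect[OF b(1)] N_expect[OF B.comp_closed(2)[OF a(1) b(1)]]
      K_ops(2)[OF E_P[OF a(1)] E_P[OF b(1)]] wb_E(2)[OF wb an bn] ..
  show "expect N (X \<otimes>\<^bsub>B.Q\<^esub> Y) = expect N (Y \<otimes>\<^bsub>B.Q\<^esub> X)"
    unfolding a(2) b(2) B.Q_mult[OF a(1) b(1)] B.Q_mult[OF b(1) a(1)] N_expect[OF B.comp_closed(1)[OF a(1) b(1)]]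
      N_expect[OF B.comp_closed(1)[OF b(1) a(1)]] wb_E(8)[OF wb an bn] ..
next
  fix F assume "F \<in> carrier K.CK"
  then obtain f where f: "f \<in> carrier K.C.P" "F = K.G (K.C.cls f)" by (rule CKE)
  show "expect N (embed N F) = F"
    unfolding f(2) N_embed[OF f(1)] N_expect[OF emb_P[OF f(1)]] wb_E(6)[OF wb K.PC[OF f(1)]] ..
qed

end

section \<open>The matrix bundle of a double cover\<close>

definition mop :: "(nat \<Rightarrow> nat \<Rightarrow> complex) \<Rightarrow> complex \<times> complex \<Rightarrow> complex \<times> complex" where
  "mop m p = (m 0 0 * fst p + m 0 1 * snd p, m 1 0 * fst p + m 1 1 * snd p)"

text \<open>Only entries with indices below 2 are seen; members of \<open>alg\<close> have zeros in
  all other places, so nothing is lost there.\<close>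

definition mnorm :: "(nat \<Rightarrow> nat \<Rightarrow> complex) \<Rightarrow> real" where
  "mnorm m = onorm (mop m)"

definition mmul :: "(nat \<Rightarrow> nat \<Rightarrow> complex) \<Rightarrow> (nat \<Rightarrow> nat \<Rightarrow> complex) \<Rightarrow> nat \<Rightarrow> nat \<Rightarrow> complex" where
  "mmul a b = (\<lambda>i j. a i 0 * b 0 j + a i 1 * b 1 j)"

definition mstar :: "(nat \<Rightarrow> nat \<Rightarrow> complex) \<Rightarrow> nat \<Rightarrow> nat \<Rightarrow> complex" where
  "mstar a = (\<lambda>i j. cnj (a j i))"

lemma bounded_linear_mop: "bounded_linear (mop m)"
proof -
  have "bounded_linear (\<lambda>p. (m 0 0 * fst p + m 0 1 * snd p, m 1 0 * fst p + m 1 1 * snd p))"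
    by (intro bounded_linear_Pair bounded_linear_add
        bounded_linear_compose[OF bounded_linear_mult_right bounded_linear_fst]
        bounded_linear_compose[OF bounded_linear_mult_right bounded_linear_snd])
  then show ?thesis by (simp add: mop_def[abs_def])
qed

lemma mop_le: "norm (mop m p) \<le> mnorm m * norm p"
  unfolding mnorm_def by (rule onorm[OF bounded_linear_mop])

lemma mnorm_nonneg: "0 \<le> mnorm m"
  unfolding mnorm_def by (rule onorm_pos_le[OF bounded_linear_mop])

lemma mnorm_leI: "(\<And>p. norm (mop m p) \<le> B * norm p) \<Longrightarrow> mnorm m \<le> B"
  unfolding mnorm_def by (rule onorm_le)

lemma mnorm_add: "mnorm (\<lambda>i j. a i j + b i j) \<le> mnorm a + mnorm b"
proof (rule mnorm_leI)
  fix p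
  have "mop (\<lambda>i j. a i j + b i j) p = mop a p + mop b p"
    by (simp add: mop_def algebra_simps)
  then have "norm (mop (\<lambda>i j. a i j + b i j) p) \<le> norm (mop a p) + norm (mop b p)"
    by (simp add: norm_triangle_ineq)
  also have "\<dots> \<le> (mnorm a + mnorm b) * norm p"
    using mop_le[of a p] mop_le[of b p] by (simp add: algebra_simps)
  finally show "norm (mop (\<lambda>i j. a i j + b i j) p) \<le> (mnorm a + mnorm b) * norm p" .
qed

lemma mnorm_mul: "mnorm (mmul a b) \<le> mnorm a * mnorm b"
proof (rule mnorm_leI)
  fix p
  have "mop (mmul a b) p = mop a (mop b p)"
    by (simp add: mop_def mmul_def algebra_simps)
  then have "norm (mop (mmul a b) p) \<le> mnorm a * norm (mop b p)" by (simp add: mop_le)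
  also have "\<dots> \<le> mnorm a * (mnorm b * norm p)"
    by (intro mult_left_mono mop_le mnorm_nonneg)
  finally show "norm (mop (mmul a b) p) \<le> mnorm a * mnorm b * norm p" by (simp add: mult.assoc)
qed

lemma norm_scaled_pair: "norm (c * x, c * y) = cmod c * norm (x, y :: complex)"
  unfolding norm_Pair by (simp add: norm_mult power_mult_distrib real_sqrt_mult flip: distrib_left)

lemma mnorm_scale: "mnorm (\<lambda>i j. c * m i j) = cmod c * mnorm m"
proof -
  have eq: "norm (mop (\<lambda>i j. c * m i j) p) = cmod c * norm (mop m p)" for c m p
    using norm_scaled_pair[of c "fst (mop m p)" "snd (mop m p)"] by (simp add: mop_def algebra_simps)
  have le: "mnorm (\<lambda>i j. c * m i j) \<le> cmod c * mnorm m" for c m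
    by (rule mnorm_leI) (simp add: eq mult.assoc mult_left_mono mop_le)
  show ?thesis
  proof (cases "c = 0")
    case True
    then show ?thesis using le[of c m] mnorm_nonneg[of "\<lambda>i j. c * m i j"] by simp
  next
    case False
    have "mnorm m \<le> cmod (inverse c) * mnorm (\<lambda>i j. c * m i j)"
      using le[of "inverse c" "\<lambda>i j. c * m i j"] False by (simp add: mult.assoc[symmetric])
    then have "cmod c * mnorm m \<le> mnorm (\<lambda>i j. c * m i j)"
      using False by (simp add: norm_divide field_simps)
    then show ?thesis using le[of c m] by simp
  qed
qed

text \<open>The inner product is the real one, that is, the real part of the Hermitian product. It
  suffices for the C*-identity, where only squared norms and the Cauchy-Schwarz inequality
  enter.\<close>

lemma mop_adjoint: "inner (mop m p) r = inner p (mop (mstar m) r)"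
  by (cases p; cases r) (simp add: mop_def mstar_def inner_complex_def algebra_simps)

text \<open>The squared length of \<open>mop a p\<close> is the inner product of \<open>p\<close>
  with its image under \<open>mmul (mstar a) a\<close>; Cauchy-Schwarz bounds it.\<close>

lemma mnorm_star_self_ge: "(mnorm a)\<^sup>2 \<le> mnorm (mmul (mstar a) a)"
proof -
  have "mnorm a \<le> sqrt (mnorm (mmul (mstar a) a))"
  proof (rule mnorm_leI)
    fix p
    have "(norm (mop a p))\<^sup>2 = inner p (mop (mstar a) (mop a p))"
      by (simp add: power2_norm_eq_inner mop_adjoint)
    also have "\<dots> = inner p (mop (mmul (mstar a) a) p)"
      by (simp add: mop_def mmul_def algebra_simps)
    also have "\<dots> \<le> norm p * norm (mop (mmul (mstar a) a) p)"
      using Cauchy_Schwarz_ineq2 abs_le_D1 by blast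
    also have "\<dots> \<le> norm p * (mnorm (mmul (mstar a) a) * norm p)"
      by (intro mult_left_mono mop_le) simp
    finally have "(norm (mop a p))\<^sup>2 \<le> (sqrt (mnorm (mmul (mstar a) a)) * norm p)\<^sup>2"
      by (simp add: power_mult_distrib mnorm_nonneg) (simp add: power2_eq_square mult_ac)
    then show "norm (mop a p) \<le> sqrt (mnorm (mmul (mstar a) a)) * norm p"
      by (rule power2_le_imp_le) (simp add: mnorm_nonneg)
  qed
  then show ?thesis using power_mono[OF _ mnorm_nonneg, of a _ 2] mnorm_nonneg[of "mmul (mstar a) a"] by fastforce
qed

lemma mnorm_mstar_le: "mnorm a \<le> mnorm (mstar a)"
proof (cases "mnorm a = 0")
  case False
  have "mnorm a * mnorm a \<le> mnorm (mstar a) * mnorm a"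
    using mnorm_star_self_ge[of a] mnorm_mul[of "mstar a" a] by (simp add: power2_eq_square)
  then show ?thesis using False mnorm_nonneg[of a] by (simp add: mult_le_cancel_right)
qed (simp add: mnorm_nonneg)

lemma mnorm_cstar: "mnorm (mmul (mstar a) a) = (mnorm a)\<^sup>2"
proof (rule antisym[OF _ mnorm_star_self_ge])
  have "mnorm (mstar a) \<le> mnorm (mstar (mstar a))" by (rule mnorm_mstar_le)
  then have "mnorm (mstar a) \<le> mnorm a" by (simp add: mstar_def)
  then have "mnorm (mstar a) * mnorm a \<le> mnorm a * mnorm a" by (intro mult_right_mono mnorm_nonneg)
  then show "mnorm (mmul (mstar a) a) \<le> (mnorm a)\<^sup>2"
    using mnorm_mul[of "mstar a" a] by (simp add: power2_eq_square)
qed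

lemma mnorm_entry:
  assumes "i < 2" "j < 2"
  shows "cmod (m i j) \<le> mnorm m"
proof -
  have c: "i = 0 \<or> i = 1" "j = 0 \<or> j = 1" using assms by auto
  have n: "norm (1::complex, 0::complex) = 1" "norm (0::complex, 1::complex) = 1" by (simp_all add: norm_Pair)
  have f: "cmod x \<le> norm (x, y)" "cmod y \<le> norm (x, y)" for x y :: complex
    unfolding norm_Pair by (simp_all add: real_le_rsqrt)
  have "norm (m 0 0, m 1 0) \<le> mnorm m" "norm (m 0 1, m 1 1) \<le> mnorm m"
    using mop_le[of m "(1,0)"] mop_le[of m "(0,1)"] by (simp_all add: n mop_def)
  then show ?thesis using c f by (metis order_trans)
qed

text \<open>Cauchy-Schwarz in each row. The right-hand side is the trace of
  \<open>mmul (mstar m) m\<close>, the quantity that the fibrewise expectation can see.\<close>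

lemma mnorm_frobenius:
  "(mnorm m)\<^sup>2 \<le> (cmod (m 0 0))\<^sup>2 + (cmod (m 0 1))\<^sup>2 + (cmod (m 1 0))\<^sup>2 + (cmod (m 1 1))\<^sup>2" (is "_ \<le> ?F")
proof -
  have cs: "(cmod (a * x + b * y))\<^sup>2 \<le> ((cmod a)\<^sup>2 + (cmod b)\<^sup>2) * ((cmod x)\<^sup>2 + (cmod y)\<^sup>2)" for a b x y
  proof -
    have "cmod (a * x + b * y) \<le> cmod a * cmod x + cmod b * cmod y"
      using norm_triangle_ineq[of "a * x" "b * y"] by (simp add: norm_mult)
    then have "(cmod (a * x + b * y))\<^sup>2 \<le> (cmod a * cmod x + cmod b * cmod y)\<^sup>2"
      by (rule power_mono) simp
    also have "\<dots> \<le> ((cmod a)\<^sup>2 + (cmod b)\<^sup>2) * ((cmod x)\<^sup>2 + (cmod y)\<^sup>2)"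
      using sum_squares_ge_zero[of "cmod a * cmod y - cmod b * cmod x" 0] by (simp add: power2_eq_square algebra_simps)
    finally show ?thesis .
  qed
  have "mnorm m \<le> sqrt ?F"
  proof (rule mnorm_leI)
    fix p :: "complex \<times> complex"
    obtain x y where p: "p = (x, y)" by (cases p)
    have "(norm (mop m p))\<^sup>2 = (cmod (m 0 0 * x + m 0 1 * y))\<^sup>2 + (cmod (m 1 0 * x + m 1 1 * y))\<^sup>2"
      by (simp add: p mop_def norm_Pair)
    also have "\<dots> \<le> ?F * ((cmod x)\<^sup>2 + (cmod y)\<^sup>2)"
      using cs[of "m 0 0" x "m 0 1" y] cs[of "m 1 0" x "m 1 1" y] by (simp add: algebra_simps)
    also have "\<dots> = (sqrt ?F * norm p)\<^sup>2"
      by (simp add: p norm_Pair power_mult_distrib)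
    finally show "norm (mop m p) \<le> sqrt ?F * norm p"
      by (rule power2_le_imp_le) simp
  qed
  then have "(mnorm m)\<^sup>2 \<le> (sqrt ?F)\<^sup>2" by (rule power_mono[OF _ mnorm_nonneg])
  then show ?thesis by simp
qed

lemma mnorm_sum:
  "mnorm m \<le> cmod (m 0 0) + cmod (m 0 1) + cmod (m 1 0) + cmod (m 1 1)" (is "_ \<le> ?F")
proof (rule power2_le_imp_le[OF order_trans[OF mnorm_frobenius]])
  show "(cmod (m 0 0))\<^sup>2 + (cmod (m 0 1))\<^sup>2 + (cmod (m 1 0))\<^sup>2 + (cmod (m 1 1))\<^sup>2 \<le> ?F\<^sup>2"
    by (simp add: power2_eq_square algebra_simps)
qed simp

lemma cnj_mult_self: "cnj z * z = complex_of_real ((cmod z)\<^sup>2)"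
  by (simp only: complex_norm_square mult.commute)

section \<open>Sections of a 2 x 2 matrix bundle twisted by a double cover\<close>

locale double_cover =
  fixes S :: "'s::t2_space set" and K :: "'k::t2_space set" and q :: "'s \<Rightarrow> 'k" and \<theta> :: "'s \<Rightarrow> 's"
  assumes compS: "compact S" and neS: "S \<noteq> {}" and qc: "continuous_on S q" and Kq: "K = q ` S"
    and \<theta>S: "x \<in> S \<Longrightarrow> \<theta> x \<in> S" and \<theta>\<theta>: "x \<in> S \<Longrightarrow> \<theta> (\<theta> x) = x"
    and q\<theta>: "x \<in> S \<Longrightarrow> q (\<theta> x) = q x" and fib: "x \<in> S \<Longrightarrow> y \<in> S \<Longrightarrow> q x = q y \<Longrightarrow> y = x \<or> y = \<theta> x"
begin

text \<open>The equivariance condition says that \<open>a\<close> descends to a section of \<open>End(1 + L)\<close>, where \<open>L\<close> is the line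
  bundle of the double cover \<open>q\<close>.\<close>

definition alg :: "('s \<Rightarrow> nat \<Rightarrow> nat \<Rightarrow> complex) cstar" where
  "alg = \<lparr>carrier = {a. (\<forall>i j. continuous_on S (\<lambda>x. a x i j)) \<and>
        (\<forall>x i j. x \<notin> S \<or> 2 \<le> i \<or> 2 \<le> j \<longrightarrow> a x i j = 0) \<and>
        (\<forall>x\<in>S. \<forall>i j. a (\<theta> x) i j = (-1) ^ (i + j) * a x i j)},
     mult = (\<lambda>a b x. mmul (a x) (b x)),
     one = (\<lambda>x i j. if x \<in> S \<and> i = j \<and> i < 2 then 1 else 0),
     ring.zero = (\<lambda>x i j. 0),
     add = (\<lambda>a b x i j. a x i j + b x i j),
     smult = (\<lambda>c a x i j. c * a x i j),
     star = (\<lambda>a x. mstar (a x)),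
     cnorm = (\<lambda>a. SUP x. mnorm (a x))\<rparr>"

lemma alg_simps [simp]:
  "mult alg a b = (\<lambda>x. mmul (a x) (b x))"
  "one alg = (\<lambda>x i j. if x \<in> S \<and> i = j \<and> i < 2 then 1 else 0)"
  "\<zero>\<^bsub>alg\<^esub> = (\<lambda>x i j. 0)"
  "add alg a b = (\<lambda>x i j. a x i j + b x i j)"
  "smult alg c a = (\<lambda>x i j. c * a x i j)"
  "star alg a = (\<lambda>x. mstar (a x))"
  "cnorm alg a = (SUP x. mnorm (a x))"
  by (simp_all add: alg_def)

lemma alg_carrier:
  "a \<in> carrier alg \<longleftrightarrow> (\<forall>i j. continuous_on S (\<lambda>x. a x i j)) \<and>
        (\<forall>x i j. x \<notin> S \<or> 2 \<le> i \<or> 2 \<le> j \<longrightarrow> a x i j = 0) \<and>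
        (\<forall>x\<in>S. \<forall>i j. a (\<theta> x) i j = (-1) ^ (i + j) * a x i j)"
  by (simp add: alg_def)

lemma algI:
  assumes "\<And>i j. continuous_on S (\<lambda>x. a x i j)" "\<And>x i j. x \<notin> S \<or> 2 \<le> i \<or> 2 \<le> j \<Longrightarrow> a x i j = 0"
    "\<And>x i j. x \<in> S \<Longrightarrow> a (\<theta> x) i j = (-1) ^ (i + j) * a x i j"
  shows "a \<in> carrier alg"
  unfolding alg_carrier using assms by blast

lemma algD:
  assumes "a \<in> carrier alg"
  shows "continuous_on S (\<lambda>x. a x i j)" "x \<notin> S \<or> 2 \<le> i \<or> 2 \<le> j \<Longrightarrow> a x i j = 0"
    "x \<in> S \<Longrightarrow> a (\<theta> x) i j = (-1) ^ (i + j) * a x i j"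
  using assms unfolding alg_carrier by blast+

definition "CS = cfun_algebra (top_of_set S)"

lemma compact_top_S: "compact_space (top_of_set S)"
  using compS by (simp add: compact_space_subtopology)

lemma entry: "a \<in> carrier alg \<Longrightarrow> (\<lambda>x. a x i j) \<in> carrier CS"
  using algD[of a] by (auto simp: CS_def carrier_cfun)

lemma alg_bdd: "a \<in> carrier alg \<Longrightarrow> bdd_above (range (\<lambda>x. mnorm (a x)))"
proof -
  assume a: "a \<in> carrier alg"
  note le = cfun_norm_le[OF compact_top_S entry[OF a, unfolded CS_def]]
  show ?thesis
  proof (rule bdd_aboveI2)
    fix x
    show "mnorm (a x) \<le> cnorm CS (\<lambda>x. a x 0 0) + cnorm CS (\<lambda>x. a x 0 1) + cnorm CS (\<lambda>x. a x 1 0) + cnorm CS (\<lambda>x. a x 1 1)"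
      unfolding CS_def by (rule order_trans[OF mnorm_sum]) (intro add_mono le)
  qed
qed

lemma alg_norm_le: "a \<in> carrier alg \<Longrightarrow> mnorm (a x) \<le> cnorm alg a"
  using cSUP_upper[OF UNIV_I alg_bdd, of a x] by simp

lemma alg_norm_leI: "(\<And>x. mnorm (a x) \<le> B) \<Longrightarrow> cnorm alg a \<le> B"
  by (simp add: cSUP_least)

lemma alg_norm_nonneg: "a \<in> carrier alg \<Longrightarrow> 0 \<le> cnorm alg a"
  using alg_norm_le[of a undefined] mnorm_nonneg[of "a undefined"] by linarith

lemma alg_entry_le: "a \<in> carrier alg \<Longrightarrow> cmod (a x i j) \<le> cnorm alg a"
proof (cases "i < 2 \<and> j < 2")
  case True
  then show "a \<in> carrier alg \<Longrightarrow> ?thesis" using mnorm_entry[of i j "a x"] alg_norm_le[of a x] by linarith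
next
  case False
  then show "a \<in> carrier alg \<Longrightarrow> ?thesis" using algD(2)[of a x i j] alg_norm_nonneg[of a] by (auto simp del: alg_simps)
qed

lemma alg_entry_norm_le: "a \<in> carrier alg \<Longrightarrow> cnorm CS (\<lambda>x. a x i j) \<le> cnorm alg a"
  unfolding CS_def by (rule cfun_norm_leI[OF alg_entry_le])

lemma alg_norm_sum: "a \<in> carrier alg \<Longrightarrow>
  cnorm alg a \<le> cnorm CS (\<lambda>x. a x 0 0) + cnorm CS (\<lambda>x. a x 0 1) + cnorm CS (\<lambda>x. a x 1 0) + cnorm CS (\<lambda>x. a x 1 1)"
proof (rule alg_norm_leI)
  fix x assume a: "a \<in> carrier alg"
  note le = cfun_norm_le[OF compact_top_S entry[OF a, unfolded CS_def]]
  show "mnorm (a x) \<le> cnorm CS (\<lambda>x. a x 0 0) + cnorm CS (\<lambda>x. a x 0 1) + cnorm CS (\<lambda>x. a x 1 0) + cnorm CS (\<lambda>x. a x 1 1)"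
    unfolding CS_def by (rule order_trans[OF mnorm_sum]) (intro add_mono le)
qed

lemma alg_closed:
  assumes a: "a \<in> carrier alg" and b: "b \<in> carrier alg"
  shows "(\<lambda>x. mmul (a x) (b x)) \<in> carrier alg"
    "(\<lambda>x i j. a x i j + b x i j) \<in> carrier alg"
    "(\<lambda>x i j. a x i j - b x i j) \<in> carrier alg"
    "(\<lambda>x i j. c * a x i j) \<in> carrier alg"
    "(\<lambda>x. mstar (a x)) \<in> carrier alg"
    "(\<lambda>x i j. if x \<in> S \<and> i = j \<and> i < 2 then 1 else 0) \<in> carrier alg"
    "(\<lambda>x i j. 0) \<in> carrier alg"
proof -
  note [simp] = algD(2)[OF a] algD(2)[OF b] algD(3)[OF a] algD(3)[OF b]
  show "(\<lambda>x. mmul (a x) (b x)) \<in> carrier alg"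
  proof (rule algI)
    show "mmul (a (\<theta> x)) (b (\<theta> x)) i j = (-1) ^ (i + j) * mmul (a x) (b x) i j" if "x \<in> S" for x i j
      using that by (simp add: mmul_def power_add algebra_simps)
  qed (auto simp: mmul_def intro!: continuous_intros algD(1)[OF a] algD(1)[OF b])
  show "(\<lambda>x i j. a x i j + b x i j) \<in> carrier alg"
    by (rule algI) (auto simp: algebra_simps intro!: continuous_intros algD(1)[OF a] algD(1)[OF b])
  show "(\<lambda>x i j. a x i j - b x i j) \<in> carrier alg"
    by (rule algI) (auto simp: algebra_simps intro!: continuous_intros algD(1)[OF a] algD(1)[OF b])
  show "(\<lambda>x i j. c * a x i j) \<in> carrier alg"
    by (rule algI) (auto intro!: continuous_intros algD(1)[OF a])
  show "(\<lambda>x. mstar (a x)) \<in> carrier alg"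
    by (rule algI) (auto simp: mstar_def add.commute intro!: continuous_intros algD(1)[OF a])
  show "(\<lambda>x i j. if x \<in> S \<and> i = j \<and> i < 2 then 1 else 0) \<in> carrier alg"
  proof (rule algI)
    show "continuous_on S (\<lambda>x. if x \<in> S \<and> i = j \<and> i < 2 then 1 else 0 :: complex)" for i j :: nat
      by (rule continuous_on_cong[THEN iffD1, OF refl _ continuous_on_const[of S "if i = j \<and> i < 2 then 1 else 0"]]) simp
  qed (auto simp: \<theta>S)
  show "(\<lambda>x i j. 0) \<in> carrier alg" by (rule algI) auto
qed

lemma mmul_one:
  assumes a: "a \<in> carrier alg"
  shows "mmul (\<lambda>i j. if x \<in> S \<and> i = j \<and> i < 2 then 1 else 0) (a x) = a x"
    "mmul (a x) (\<lambda>i j. if x \<in> S \<and> i = j \<and> i < 2 then 1 else 0) = a x"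
proof -
  have *: "i = 0 \<or> i = 1 \<or> 2 \<le> i" for i :: nat by linarith
  show "mmul (\<lambda>i j. if x \<in> S \<and> i = j \<and> i < 2 then 1 else 0) (a x) = a x"
  proof (intro ext)
    fix i j show "mmul (\<lambda>i j. if x \<in> S \<and> i = j \<and> i < 2 then 1 else 0) (a x) i j = a x i j"
      using *[of i] algD(2)[OF a, of x] by (auto simp: mmul_def)
  qed
  show "mmul (a x) (\<lambda>i j. if x \<in> S \<and> i = j \<and> i < 2 then 1 else 0) = a x"
  proof (intro ext)
    fix i j show "mmul (a x) (\<lambda>i j. if x \<in> S \<and> i = j \<and> i < 2 then 1 else 0) i j = a x i j"
      using *[of j] algD(2)[OF a, of x] by (auto simp: mmul_def)
  qed
qed

lemma ring_alg: "ring alg"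
proof (rule ringI)
  show "abelian_group alg"
  proof (rule abelian_groupI)
    fix a assume a: "a \<in> carrier alg"
    show "\<exists>b\<in>carrier alg. b \<oplus>\<^bsub>alg\<^esub> a = \<zero>\<^bsub>alg\<^esub>"
      by (rule bexI[OF _ alg_closed(4)[OF a a, of "-1"]]) simp
  next
    show "\<zero>\<^bsub>alg\<^esub> \<in> carrier alg" by simp (rule algI; simp)
  qed (simp_all add: alg_closed(2) algebra_simps)
  show "monoid alg"
  proof (rule monoidI)
    show "\<one>\<^bsub>alg\<^esub> \<in> carrier alg"
      using alg_closed(6)[of "\<lambda>x i j. 0" "\<lambda>x i j. 0"] by (simp add: alg_carrier)
  qed (simp_all add: alg_closed(1) mmul_one, simp add: mmul_def algebra_simps fun_eq_iff)
qed (simp_all add: mmul_def algebra_simps)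

lemma alg_minus:
  assumes "a \<in> carrier alg" "b \<in> carrier alg"
  shows "a \<ominus>\<^bsub>alg\<^esub> b = (\<lambda>x i j. a x i j - b x i j)"
proof -
  interpret ring alg by (rule ring_alg)
  have m: "(\<lambda>x i j. (-1) * b x i j) \<in> carrier alg" using alg_closed(4)[OF assms(2) assms(2)] .
  have "\<ominus>\<^bsub>alg\<^esub> b = (\<lambda>x i j. (-1) * b x i j)"
    using minus_equality[OF _ assms(2) m] by simp
  then show ?thesis by (simp add: a_minus_def)
qed


text \<open>The C*-identity is the fibrewise one, passed to suprema. Completeness reduces to that of
  \<open>C(S)\<close>: the norm dominates every entry and is dominated by the sum of the four
  entries, and the vanishing and equivariance conditions survive pointwise limits.\<close>

theorem cstar_alg: "cstar_algebra alg"
proof (rule cstar_algebraI[OF ring_alg])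
  have smult: "cnorm alg (\<lambda>x i j. c * a x i j) = cmod c * cnorm alg a" if a: "a \<in> carrier alg" for c a
  proof (rule antisym)
    show "cnorm alg (\<lambda>x i j. c * a x i j) \<le> cmod c * cnorm alg a"
      by (rule alg_norm_leI) (simp add: mnorm_scale mult_left_mono alg_norm_le[OF a] del: alg_simps)
    show "cmod c * cnorm alg a \<le> cnorm alg (\<lambda>x i j. c * a x i j)"
    proof (cases "c = 0")
      case False
      have "cnorm alg a \<le> cnorm alg (\<lambda>x i j. c * a x i j) / cmod c"
      proof (rule alg_norm_leI)
        fix x show "mnorm (a x) \<le> cnorm alg (\<lambda>x i j. c * a x i j) / cmod c"
          using alg_norm_le[OF alg_closed(4)[OF a a], of c x] False
          by (simp add: mnorm_scale pos_le_divide_eq mult.commute del: alg_simps)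
      qed
      then show ?thesis using False by (simp add: pos_le_divide_eq mult.commute del: alg_simps)
    qed (use alg_norm_nonneg[OF alg_closed(4)[OF a a], of c] in \<open>simp del: alg_simps\<close>)
  qed
  show "cstar_algebra_axioms alg"
  proof (unfold_locales)
    show "complete_in alg (cnorm alg) (carrier alg)"
      unfolding complete_in_def
    proof (intro allI impI, elim conjE)
      fix s :: "nat \<Rightarrow> 's \<Rightarrow> nat \<Rightarrow> nat \<Rightarrow> complex"
      assume s': "\<forall>n. s n \<in> carrier alg"
        and Cau: "\<forall>e>0. \<exists>N. \<forall>m\<ge>N. \<forall>n\<ge>N. cnorm alg (s m \<ominus>\<^bsub>alg\<^esub> s n) < e"
      have s: "s n \<in> carrier alg" for n using s' by simp
      have CS: "cstar_algebra CS" unfolding CS_def by (rule cstar_cfun[OF compact_top_S])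
      have CSm: "f \<ominus>\<^bsub>CS\<^esub> g = (\<lambda>x. f x - g x)" if "f \<in> carrier CS" "g \<in> carrier CS" for f g
        using that unfolding CS_def by (rule cfun_minus)
      have "\<exists>f\<in>carrier CS. (\<lambda>n. cnorm CS ((\<lambda>x. s n x i j) \<ominus>\<^bsub>CS\<^esub> f)) \<longlonglongrightarrow> 0" for i j
      proof -
        have "cnorm CS ((\<lambda>x. s m x i j) \<ominus>\<^bsub>CS\<^esub> (\<lambda>x. s n x i j)) \<le> cnorm alg (s m \<ominus>\<^bsub>alg\<^esub> s n)" for m n
          unfolding CSm[OF entry[OF s] entry[OF s]] alg_minus[OF s s]
          by (rule alg_entry_norm_le[OF alg_closed(3)[OF s s]])
        then have "\<forall>e>0. \<exists>N. \<forall>m\<ge>N. \<forall>n\<ge>N. cnorm CS ((\<lambda>x. s m x i j) \<ominus>\<^bsub>CS\<^esub> (\<lambda>x. s n x i j)) < e"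
          using Cau by (meson order_le_less_trans)
        then show ?thesis
          using cstar_algebra.complete[OF CS, unfolded complete_in_def, rule_format, of "\<lambda>n x. s n x i j"] entry[OF s]
          by simp
      qed
      then obtain f where f: "\<And>i j. f i j \<in> carrier CS"
        and lim: "\<And>i j. (\<lambda>n. cnorm CS ((\<lambda>x. s n x i j) \<ominus>\<^bsub>CS\<^esub> f i j)) \<longlonglongrightarrow> 0"
        by metis
      define a where "a x i j = f i j x" for x i j
      have ptw: "(\<lambda>n. s n x i j) \<longlonglongrightarrow> a x i j" for x i j
      proof -
        have "(\<lambda>n. s n x i j - a x i j) \<longlonglongrightarrow> 0"
        proof (rule Lim_null_comparison[OF always_eventually lim[of i j]], rule allI)
          fix n
          have "(\<lambda>x. s n x i j - f i j x) \<in> carrier (cfun_algebra (top_of_set S))"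
            using cfun_closed(3)[of _ "top_of_set S"] entry[OF s] f unfolding CS_def by simp
          from cfun_norm_le[OF compact_top_S this, of x]
          have "norm (s n x i j - a x i j) \<le> cnorm CS (\<lambda>x. s n x i j - f i j x)"
            unfolding a_def CS_def .
          then show "norm (s n x i j - a x i j) \<le> cnorm CS ((\<lambda>x. s n x i j) \<ominus>\<^bsub>CS\<^esub> f i j)"
            unfolding CSm[OF entry[OF s] f] .
        qed
        then show ?thesis by (simp add: LIM_zero_iff)
      qed
      have ac: "a \<in> carrier alg"
      proof (rule algI)
        show "continuous_on S (\<lambda>x. a x i j)" for i j
          using f[of i j] by (simp add: CS_def carrier_cfun a_def)
        show "a x i j = 0" if "x \<notin> S \<or> 2 \<le> i \<or> 2 \<le> j" for x i j
          using ptw[of x i j] algD(2)[OF s that] by (simp add: LIMSEQ_const_iff)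
        show "a (\<theta> x) i j = (-1) ^ (i + j) * a x i j" if "x \<in> S" for x i j
        proof (rule LIMSEQ_unique[OF ptw])
          show "(\<lambda>n. s n (\<theta> x) i j) \<longlonglongrightarrow> (-1) ^ (i + j) * a x i j"
            unfolding algD(3)[OF s that] by (intro tendsto_mult tendsto_const ptw)
        qed
      qed
      have sac: "(\<lambda>x i j. s n x i j - a x i j) \<in> carrier alg" for n
        by (rule alg_closed(3)[OF s ac])
      have "(\<lambda>n. cnorm CS ((\<lambda>x. s n x 0 0) \<ominus>\<^bsub>CS\<^esub> f 0 0) + cnorm CS ((\<lambda>x. s n x 0 1) \<ominus>\<^bsub>CS\<^esub> f 0 1)
          + cnorm CS ((\<lambda>x. s n x 1 0) \<ominus>\<^bsub>CS\<^esub> f 1 0) + cnorm CS ((\<lambda>x. s n x 1 1) \<ominus>\<^bsub>CS\<^esub> f 1 1)) \<longlonglongrightarrow> 0"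
        by (intro tendsto_add_zero lim)
      then have "(\<lambda>n. cnorm alg (s n \<ominus>\<^bsub>alg\<^esub> a)) \<longlonglongrightarrow> 0"
      proof (rule squeeze_0)
        fix n
        show "0 \<le> cnorm alg (s n \<ominus>\<^bsub>alg\<^esub> a)"
          unfolding alg_minus[OF s ac] by (rule alg_norm_nonneg[OF sac])
        show "cnorm alg (s n \<ominus>\<^bsub>alg\<^esub> a) \<le> cnorm CS ((\<lambda>x. s n x 0 0) \<ominus>\<^bsub>CS\<^esub> f 0 0) + cnorm CS ((\<lambda>x. s n x 0 1) \<ominus>\<^bsub>CS\<^esub> f 0 1)
          + cnorm CS ((\<lambda>x. s n x 1 0) \<ominus>\<^bsub>CS\<^esub> f 1 0) + cnorm CS ((\<lambda>x. s n x 1 1) \<ominus>\<^bsub>CS\<^esub> f 1 1)"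
          unfolding alg_minus[OF s ac] CSm[OF entry[OF s] f] using alg_norm_sum[OF sac, of n] unfolding a_def .
      qed
      then show "\<exists>a\<in>carrier alg. (\<lambda>n. cnorm alg (s n \<ominus>\<^bsub>alg\<^esub> a)) \<longlonglongrightarrow> 0" using ac by auto
    qed
    fix a assume a: "a \<in> carrier alg"
    show "star alg a \<in> carrier alg" using alg_closed(5)[OF a a] by simp
    show "star alg (star alg a) = a" by (simp add: mstar_def)
    show "star alg (c \<odot>\<^bsub>alg\<^esub> a) = cnj c \<odot>\<^bsub>alg\<^esub> star alg a" for c by (simp add: mstar_def)
    show "0 \<le> cnorm alg a" by (rule alg_norm_nonneg[OF a])
    show "cnorm alg (c \<odot>\<^bsub>alg\<^esub> a) = cmod c * cnorm alg a" for c
      using smult[OF a] by (simp del: alg_simps add: alg_simps(5))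
    show "cnorm alg a = 0 \<longleftrightarrow> a = \<zero>\<^bsub>alg\<^esub>"
    proof
      assume "cnorm alg a = 0"
      then have "cmod (a x i j) \<le> 0" for x i j using alg_entry_le[OF a, of x i j] by (simp del: alg_simps)
      then show "a = \<zero>\<^bsub>alg\<^esub>" by (simp add: fun_eq_iff)
    next
      have "mnorm (\<lambda>i j. 0) = 0" using mnorm_scale[of 0 "\<lambda>i j. 0"] by simp
      then show "a = \<zero>\<^bsub>alg\<^esub> \<Longrightarrow> cnorm alg a = 0" by simp
    qed
    show "cnorm alg (star alg a \<otimes>\<^bsub>alg\<^esub> a) = (cnorm alg a)\<^sup>2"
    proof -
      have fc: "(\<lambda>x. mmul (mstar (a x)) (a x)) \<in> carrier alg" using alg_closed(1)[OF alg_closed(5)[OF a a] a] .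
      have "cnorm alg (\<lambda>x. mmul (mstar (a x)) (a x)) \<le> (cnorm alg a)\<^sup>2"
        by (rule alg_norm_leI) (simp add: mnorm_cstar power_mono alg_norm_le[OF a] mnorm_nonneg del: alg_simps)
      moreover have "cnorm alg a \<le> sqrt (cnorm alg (\<lambda>x. mmul (mstar (a x)) (a x)))"
      proof (rule alg_norm_leI)
        fix x show "mnorm (a x) \<le> sqrt (cnorm alg (\<lambda>x. mmul (mstar (a x)) (a x)))"
          using alg_norm_le[OF fc, of x] by (intro real_le_rsqrt) (simp add: mnorm_cstar del: alg_simps)
      qed
      then have "(cnorm alg a)\<^sup>2 \<le> cnorm alg (\<lambda>x. mmul (mstar (a x)) (a x))"
        using power_mono[OF _ alg_norm_nonneg[OF a], of "sqrt (cnorm alg (\<lambda>x. mmul (mstar (a x)) (a x)))" 2]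
          real_sqrt_pow2[OF alg_norm_nonneg[OF fc]] by simp
      ultimately show ?thesis by (simp del: alg_simps add: alg_simps(1,6))
    qed
    fix b assume b: "b \<in> carrier alg"
    show "star alg (a \<oplus>\<^bsub>alg\<^esub> b) = star alg a \<oplus>\<^bsub>alg\<^esub> star alg b" by (simp add: mstar_def)
    show "star alg (a \<otimes>\<^bsub>alg\<^esub> b) = star alg b \<otimes>\<^bsub>alg\<^esub> star alg a" by (simp add: mstar_def mmul_def mult.commute)
    show "(c \<odot>\<^bsub>alg\<^esub> a) \<otimes>\<^bsub>alg\<^esub> b = c \<odot>\<^bsub>alg\<^esub> (a \<otimes>\<^bsub>alg\<^esub> b)" for c by (simp add: mmul_def algebra_simps)
    show "a \<otimes>\<^bsub>alg\<^esub> (c \<odot>\<^bsub>alg\<^esub> b) = c \<odot>\<^bsub>alg\<^esub> (a \<otimes>\<^bsub>alg\<^esub> b)" for c by (simp add: mmul_def algebra_simps)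
    show "cnorm alg (a \<oplus>\<^bsub>alg\<^esub> b) \<le> cnorm alg a + cnorm alg b"
    proof (rule alg_norm_leI)
      fix x show "mnorm ((a \<oplus>\<^bsub>alg\<^esub> b) x) \<le> cnorm alg a + cnorm alg b"
        using mnorm_add[of "a x" "b x"] alg_norm_le[OF a, of x] alg_norm_le[OF b, of x] by (simp del: alg_simps add: alg_simps(4))
    qed
    show "cnorm alg (a \<otimes>\<^bsub>alg\<^esub> b) \<le> cnorm alg a * cnorm alg b"
    proof (rule alg_norm_leI)
      fix x
      have "mnorm (a x) * mnorm (b x) \<le> cnorm alg a * cnorm alg b"
        by (intro mult_mono alg_norm_le a b alg_norm_nonneg mnorm_nonneg)
      then show "mnorm ((a \<otimes>\<^bsub>alg\<^esub> b) x) \<le> cnorm alg a * cnorm alg b"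
        using mnorm_mul[of "a x" "b x"] by (simp del: alg_simps add: alg_simps(1))
    qed
  qed
qed (simp_all add: algebra_simps alg_closed(4))

subsection \<open>The W*-bundle\<close>

text \<open>The factorisation of an invariant function through \<open>q\<close>. A fibre of
  \<open>q\<close> consists of \<open>x\<close> and \<open>\<theta> x\<close>, so the chosen
  preimage does not influence the value of such a function.\<close>

definition desc :: "('s \<Rightarrow> complex) \<Rightarrow> 'k \<Rightarrow> complex" where
  "desc f k = (if k \<in> K then f (SOME x. x \<in> S \<and> q x = k) else 0)"

lemma desc_q:
  assumes "\<And>x. x \<in> S \<Longrightarrow> f (\<theta> x) = f x" and x: "x \<in> S"
  shows "desc f (q x) = f x"
proof -
  define y where "y = (SOME y. y \<in> S \<and> q y = q x)"
  have "y \<in> S \<and> q y = q x" unfolding y_def by (rule someI[of _ x]) (simp add: x)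
  then have "y = x \<or> y = \<theta> x" using fib[OF x, of y] by simp
  then have "f y = f x" using assms by auto
  moreover have "q x \<in> K" using x unfolding Kq by (rule imageI)
  then have "desc f (q x) = f y" by (simp add: desc_def y_def)
  ultimately show ?thesis by simp
qed

lemma compact_K: "compact K"
  unfolding Kq by (rule compact_continuous_image[OF qc compS])

text \<open>A continuous map from a compact space onto a Hausdorff space is a quotient map, so
  continuity may be tested upstairs on \<open>S\<close>.\<close>

lemma desc_closed:
  assumes f: "continuous_on S f" and inv: "\<And>x. x \<in> S \<Longrightarrow> f (\<theta> x) = f x"
  shows "desc f \<in> carrier (cfun_algebra (top_of_set K))"
proof -
  have "quotient_map (top_of_set S) (top_of_set K) q"
  proof (rule continuous_imp_quotient_map)
    show "continuous_map (top_of_set S) (top_of_set K) q" using qc by (simp add: Kq)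
    show "Hausdorff_space (top_of_set K)" by (rule Hausdorff_space_subtopology[OF Hausdorff_space_t2])
  qed (use compact_top_S in \<open>simp_all add: Kq\<close>)
  moreover have "continuous_map (top_of_set S) euclidean (desc f \<circ> q)"
    using continuous_on_cong[OF refl, of S "desc f \<circ> q" f] desc_q[of f] inv f by simp
  ultimately have "continuous_map (top_of_set K) euclidean (desc f)"
    by (rule continuous_compose_quotient_map)
  then show ?thesis by (simp add: carrier_cfun desc_def)
qed

definition mbundle :: "('s \<Rightarrow> nat \<Rightarrow> nat \<Rightarrow> complex, 'k) wbundle" where
  "mbundle = \<lparr>bundle_alg = alg, base_space = top_of_set K,
    embed = (\<lambda>f x i j. if x \<in> S \<and> i = j \<and> i < 2 then f (q x) else 0),
    expect = (\<lambda>a. desc (\<lambda>x. (a x 0 0 + a x 1 1) / 2))\<rparr>"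

lemma mbundle_simps [simp]:
  "bundle_alg mbundle = alg" "base_space mbundle = top_of_set K"
  "embed mbundle f = (\<lambda>x i j. if x \<in> S \<and> i = j \<and> i < 2 then f (q x) else 0)"
  "expect mbundle a = desc (\<lambda>x. (a x 0 0 + a x 1 1) / 2)"
  by (simp_all add: mbundle_def)

lemma even_entry: "a \<in> carrier alg \<Longrightarrow> x \<in> S \<Longrightarrow> even (i + j) \<Longrightarrow> a (\<theta> x) i j = a x i j"
  by (simp add: algD(3))

lemma E_q: "a \<in> carrier alg \<Longrightarrow> x \<in> S \<Longrightarrow> expect mbundle a (q x) = (a x 0 0 + a x 1 1) / 2"
  by (simp add: desc_q even_entry)

lemma cfun_K_eqI:
  assumes "f \<in> carrier (cfun_algebra (top_of_set K))" "g \<in> carrier (cfun_algebra (top_of_set K))"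
    and "\<And>x. x \<in> S \<Longrightarrow> f (q x) = g (q x)"
  shows "f = g"
proof
  fix k show "f k = g k" using assms by (cases "k \<in> K") (auto simp: Kq carrier_cfun)
qed

lemma E_closed: "a \<in> carrier alg \<Longrightarrow> expect mbundle a \<in> carrier (cfun_algebra (top_of_set K))"
proof -
  assume a: "a \<in> carrier alg"
  show ?thesis unfolding mbundle_simps
  proof (rule desc_closed)
    show "continuous_on S (\<lambda>x. (a x 0 0 + a x 1 1) / 2)"
      by (intro continuous_intros algD(1)[OF a]) simp
  qed (simp add: even_entry[OF a])
qed

lemma emb_closed: "f \<in> carrier (cfun_algebra (top_of_set K)) \<Longrightarrow> embed mbundle f \<in> carrier alg"
proof -
  assume f: "f \<in> carrier (cfun_algebra (top_of_set K))"
  have fq: "continuous_on S (\<lambda>x. f (q x))"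
    using continuous_on_compose[OF qc, of f] f by (simp add: carrier_cfun Kq o_def)
  show ?thesis
    unfolding mbundle_simps
  proof (rule algI)
    fix i j :: nat
    show "continuous_on S (\<lambda>x. if x \<in> S \<and> i = j \<and> i < 2 then f (q x) else 0)"
    proof (cases "i = j \<and> i < 2")
      case True
      then show ?thesis using continuous_on_cong[OF refl, of S "\<lambda>x. if x \<in> S \<and> i = j \<and> i < 2 then f (q x) else 0" "\<lambda>x. f (q x)"] fq by simp
    next
      case False
      then have "(\<lambda>x. if x \<in> S \<and> i = j \<and> i < 2 then f (q x) else 0) = (\<lambda>x. 0)" by auto
      then show ?thesis by (simp only: continuous_on_const)
    qed
  qed (auto simp: \<theta>S q\<theta>)
qed

lemma cfun_K_closed: "f \<in> carrier (cfun_algebra (top_of_set K)) \<Longrightarrow> g \<in> carrier (cfun_algebra (top_of_set K)) \<Longrightarrow>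
   f \<otimes>\<^bsub>cfun_algebra (top_of_set K)\<^esub> g \<in> carrier (cfun_algebra (top_of_set K))"
  "f \<in> carrier (cfun_algebra (top_of_set K)) \<Longrightarrow> g \<in> carrier (cfun_algebra (top_of_set K)) \<Longrightarrow>
   f \<oplus>\<^bsub>cfun_algebra (top_of_set K)\<^esub> g \<in> carrier (cfun_algebra (top_of_set K))"
  "f \<in> carrier (cfun_algebra (top_of_set K)) \<Longrightarrow> c \<odot>\<^bsub>cfun_algebra (top_of_set K)\<^esub> f \<in> carrier (cfun_algebra (top_of_set K))"
  using cfun_closed(1,2,4)[of f "top_of_set K" g] cfun_closed(4)[of f "top_of_set K" f c] by simp_all

text \<open>At \<open>q x\<close> the expectation of \<open>star alg a\<close> times
  \<open>a\<close> is half the squared Frobenius norm of \<open>a x\<close>, which dominates half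
  the squared operator norm. The normalising factor 1/2 is the source of
  \<open>sqrt 2\<close>.\<close>

lemma two_norm_bound:
  assumes a: "a \<in> carrier alg"
  shows "cnorm alg a \<le> sqrt 2 * two_norm mbundle a"
proof (rule alg_norm_leI)
  fix x
  define b where "b = star alg a \<otimes>\<^bsub>alg\<^esub> a"
  have b: "b \<in> carrier alg" unfolding b_def using alg_closed(1)[OF alg_closed(5)[OF a a] a] by simp
  have nn: "0 \<le> cnorm (cfun_algebra (top_of_set K)) (expect mbundle b)"
    using cstar_algebra.cnorm_nonneg[OF cstar_cfun E_closed[OF b]] compact_K by (simp add: compact_space_subtopology)
  have "(mnorm (a x))\<^sup>2 \<le> 2 * cnorm (cfun_algebra (top_of_set K)) (expect mbundle b)"
  proof (cases "x \<in> S")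
    case True
    let ?F = "(cmod (a x 0 0))\<^sup>2 + (cmod (a x 0 1))\<^sup>2 + (cmod (a x 1 0))\<^sup>2 + (cmod (a x 1 1))\<^sup>2"
    have "expect mbundle b (q x) = (b x 0 0 + b x 1 1) / 2" by (rule E_q[OF b True])
    also have "b x 0 0 + b x 1 1 = complex_of_real ?F"
      by (simp add: b_def mmul_def mstar_def cnj_mult_self)
    finally have "cmod (expect mbundle b (q x)) = ?F / 2"
      by (simp only: norm_divide norm_of_real) simp
    moreover have "cmod (expect mbundle b (q x)) \<le> cnorm (cfun_algebra (top_of_set K)) (expect mbundle b)"
      using cfun_norm_le[OF _ E_closed[OF b]] compact_K by (simp add: compact_space_subtopology del: cfun_simps mbundle_simps)
    ultimately have "?F \<le> 2 * cnorm (cfun_algebra (top_of_set K)) (expect mbundle b)"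
      by (simp del: cfun_simps mbundle_simps)
    then show ?thesis by (rule order_trans[OF mnorm_frobenius])
  next
    case False
    then have "a x = (\<lambda>i j. 0)" by (simp add: fun_eq_iff algD(2)[OF a])
    then show ?thesis using mnorm_scale[of 0 "\<lambda>i j. 0"] nn by (simp del: cfun_simps mbundle_simps)
  qed
  then have "mnorm (a x) \<le> sqrt (2 * cnorm (cfun_algebra (top_of_set K)) (expect mbundle b))"
    by (rule real_le_rsqrt)
  then show "mnorm (a x) \<le> sqrt 2 * two_norm mbundle a"
    by (simp add: two_norm_def b_def real_sqrt_mult del: cfun_simps)
qed

theorem wstar_mbundle: "wstar_bundle mbundle"
proof (rule wstar_bundleI[where c="sqrt 2"]; (unfold mbundle_simps(1,2))?)
  let ?C = "cfun_algebra (top_of_set K)"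
  show "cstar_algebra alg" by (rule cstar_alg)
  show "compact_space (top_of_set K)" using compact_K by (simp add: compact_space_subtopology)
  show "Hausdorff_space (top_of_set K)" by (rule Hausdorff_space_subtopology[OF Hausdorff_space_t2])
  have qK: "x \<in> S \<Longrightarrow> q x \<in> K" for x by (simp add: Kq)
  show "star_hom ?C alg (embed mbundle)"
    unfolding star_hom_def
    by (intro conjI ring_hom_memI ballI allI emb_closed)
       (auto simp: fun_eq_iff mmul_def mstar_def qK)
  fix a assume a: "a \<in> carrier alg"
  show "expect mbundle a \<in> carrier ?C" by (rule E_closed[OF a])
  show "expect mbundle (z \<odot>\<^bsub>alg\<^esub> a) = z \<odot>\<^bsub>?C\<^esub> expect mbundle a" for z
  proof (rule cfun_K_eqI)
    have za: "z \<odot>\<^bsub>alg\<^esub> a \<in> carrier alg" using alg_closed(4)[OF a a] by simp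
    show "expect mbundle (z \<odot>\<^bsub>alg\<^esub> a) \<in> carrier ?C" by (rule E_closed[OF za])
    show "z \<odot>\<^bsub>?C\<^esub> expect mbundle a \<in> carrier ?C" by (rule cfun_K_closed(3)[OF E_closed[OF a]])
    show "expect mbundle (z \<odot>\<^bsub>alg\<^esub> a) (q x) = (z \<odot>\<^bsub>?C\<^esub> expect mbundle a) (q x)" if "x \<in> S" for x
      unfolding E_q[OF za that] using E_q[OF a that] by (simp add: algebra_simps del: mbundle_simps)
  qed
  have saa: "star alg a \<otimes>\<^bsub>alg\<^esub> a \<in> carrier alg"
    using alg_closed(1)[OF alg_closed(5)[OF a a] a] by simp
  show "expect mbundle (star alg a \<otimes>\<^bsub>alg\<^esub> a) k \<in> \<real>\<^sub>\<ge>\<^sub>0" if k: "k \<in> topspace (top_of_set K)" for k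
  proof -
    obtain x where x: "x \<in> S" "k = q x" using k by (auto simp: Kq)
    have "(star alg a \<otimes>\<^bsub>alg\<^esub> a) x 0 0 + (star alg a \<otimes>\<^bsub>alg\<^esub> a) x 1 1
       = complex_of_real ((cmod (a x 0 0))\<^sup>2 + (cmod (a x 0 1))\<^sup>2 + (cmod (a x 1 0))\<^sup>2 + (cmod (a x 1 1))\<^sup>2)"
      by (simp add: mmul_def mstar_def cnj_mult_self)
    then show ?thesis unfolding x(2) E_q[OF saa x(1)] by (simp add: complex_nonneg_Reals_iff)
  qed
  show "cnorm ?C (expect mbundle a) \<le> cnorm alg a"
  proof (rule cfun_norm_leI'[OF E_closed[OF a] alg_norm_nonneg[OF a]])
    fix k assume "k \<in> topspace (top_of_set K)"
    then obtain x where x: "x \<in> S" "k = q x" by (auto simp: Kq)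
    have "cmod (a x 0 0 + a x 1 1) \<le> cnorm alg a + cnorm alg a"
      by (rule order_trans[OF norm_triangle_ineq]) (intro add_mono alg_entry_le a)
    then show "cmod (expect mbundle a k) \<le> cnorm alg a"
      unfolding x(2) E_q[OF a x(1)] by (simp add: norm_divide del: alg_simps)
  qed
  show "cnorm alg a \<le> sqrt 2 * two_norm mbundle a" by (rule two_norm_bound[OF a])
  show "embed mbundle f \<otimes>\<^bsub>alg\<^esub> a = a \<otimes>\<^bsub>alg\<^esub> embed mbundle f"
    "expect mbundle (embed mbundle f \<otimes>\<^bsub>alg\<^esub> a) = f \<otimes>\<^bsub>?C\<^esub> expect mbundle a"
    if f: "f \<in> carrier ?C" for f
  proof -
    have *: "i = 0 \<or> i = 1 \<or> 2 \<le> i" for i :: nat by linarith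
    show "embed mbundle f \<otimes>\<^bsub>alg\<^esub> a = a \<otimes>\<^bsub>alg\<^esub> embed mbundle f"
    proof (intro ext)
      fix x i j
      show "(embed mbundle f \<otimes>\<^bsub>alg\<^esub> a) x i j = (a \<otimes>\<^bsub>alg\<^esub> embed mbundle f) x i j"
        using *[of i] *[of j] algD(2)[OF a, of x] by (auto simp: mmul_def)
    qed
    have fa: "embed mbundle f \<otimes>\<^bsub>alg\<^esub> a \<in> carrier alg"
      using alg_closed(1)[OF emb_closed[OF f] a] by (simp del: mbundle_simps)
    show "expect mbundle (embed mbundle f \<otimes>\<^bsub>alg\<^esub> a) = f \<otimes>\<^bsub>?C\<^esub> expect mbundle a"
    proof (rule cfun_K_eqI[OF E_closed[OF fa] cfun_K_closed(1)[OF f E_closed[OF a]]])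
      fix x assume "x \<in> S"
      then show "expect mbundle (embed mbundle f \<otimes>\<^bsub>alg\<^esub> a) (q x) = (f \<otimes>\<^bsub>?C\<^esub> expect mbundle a) (q x)"
        unfolding E_q[OF fa \<open>x \<in> S\<close>]
        by (simp add: mmul_def E_q[OF a \<open>x \<in> S\<close>] add_divide_distrib distrib_left del: mbundle_simps(4))
    qed
  qed
  fix b assume b: "b \<in> carrier alg"
  have ab: "a \<oplus>\<^bsub>alg\<^esub> b \<in> carrier alg" "a \<otimes>\<^bsub>alg\<^esub> b \<in> carrier alg" "b \<otimes>\<^bsub>alg\<^esub> a \<in> carrier alg"
    using alg_closed(1,2)[OF a b] alg_closed(1)[OF b a] by simp_all
  show "expect mbundle (a \<oplus>\<^bsub>alg\<^esub> b) = expect mbundle a \<oplus>\<^bsub>?C\<^esub> expect mbundle b"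
  proof (rule cfun_K_eqI[OF E_closed[OF ab(1)] cfun_K_closed(2)[OF E_closed[OF a] E_closed[OF b]]])
    fix x assume "x \<in> S"
    then show "expect mbundle (a \<oplus>\<^bsub>alg\<^esub> b) (q x) = (expect mbundle a \<oplus>\<^bsub>?C\<^esub> expect mbundle b) (q x)"
      unfolding E_q[OF ab(1) \<open>x \<in> S\<close>] using E_q[OF a, of x] E_q[OF b, of x] by (simp add: add_divide_distrib del: mbundle_simps(4))
  qed
  show "expect mbundle (a \<otimes>\<^bsub>alg\<^esub> b) = expect mbundle (b \<otimes>\<^bsub>alg\<^esub> a)"
  proof (rule cfun_K_eqI[OF E_closed[OF ab(2)] E_closed[OF ab(3)]])
    fix x assume "x \<in> S"
    then show "expect mbundle (a \<otimes>\<^bsub>alg\<^esub> b) (q x) = expect mbundle (b \<otimes>\<^bsub>alg\<^esub> a) (q x)"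
      unfolding E_q[OF ab(2) \<open>x \<in> S\<close>] E_q[OF ab(3) \<open>x \<in> S\<close>] by (simp add: mmul_def algebra_simps)
  qed
next
  fix f assume f: "f \<in> carrier (cfun_algebra (top_of_set K))"
  show "expect mbundle (embed mbundle f) = f"
  proof (rule cfun_K_eqI[OF E_closed[OF emb_closed[OF f]] f])
    fix x assume "x \<in> S"
    then show "expect mbundle (embed mbundle f) (q x) = f (q x)"
      using E_q[OF emb_closed[OF f], of x] by (simp del: mbundle_simps(4))
  qed
qed

end

section \<open>Positive functionals are integrals\<close>

text \<open>The intervals may be arranged in any order, possibly accumulating, so no telescoping is
  available; countable additivity of Lebesgue measure does the work.\<close>

lemma sums_of_intervals:
  fixes a b :: "nat \<Rightarrow> real"
  assumes le: "\<And>i. a i \<le> b i" "c \<le> d" and disj: "disjoint_family (\<lambda>i. {a i..<b i})"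
    and un: "(\<Union>i. {a i..<b i}) = {c..<d}"
  shows "(\<lambda>i. b i - a i) sums (d - c)"
proof -
  have "suminf (\<lambda>i. emeasure lborel {a i..<b i}) = emeasure lborel (\<Union>i. {a i..<b i})"
    by (rule suminf_emeasure[OF _ disj]) auto
  then have eq: "suminf (\<lambda>i. ennreal (b i - a i)) = ennreal (d - c)"
    using le by (simp add: un)
  have nn: "\<And>i. 0 \<le> b i - a i" using le by simp
  have nt: "(suminf (\<lambda>i. ennreal (b i - a i))) \<noteq> \<top>" by (simp add: eq)
  have s: "summable (\<lambda>i. b i - a i)" by (rule summable_suminf_not_top[OF nn nt])
  have "ennreal (suminf (\<lambda>i. b i - a i)) = ennreal (d - c)"
    using suminf_ennreal[OF nn nt] eq by simp
  moreover have "0 \<le> suminf (\<lambda>i. b i - a i)" by (rule suminf_nonneg[OF s nn])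
  ultimately have "suminf (\<lambda>i. b i - a i) = d - c" using le by (simp add: ennreal_inj)
  then show ?thesis using s by (simp add: sums_iff)
qed

locale positive_functional =
  fixes K :: "'k::metric_space set" and \<Lambda> :: "('k \<Rightarrow> real) \<Rightarrow> real"
  assumes cK: "compact K"
    and add: "continuous_on K f \<Longrightarrow> continuous_on K g \<Longrightarrow> \<Lambda> (\<lambda>x. f x + g x) = \<Lambda> f + \<Lambda> g"
    and scale: "continuous_on K f \<Longrightarrow> \<Lambda> (\<lambda>x. c * f x) = c * \<Lambda> f"
    and pos: "continuous_on K f \<Longrightarrow> (\<And>x. x \<in> K \<Longrightarrow> 0 \<le> f x) \<Longrightarrow> 0 \<le> \<Lambda> f"
    and one: "\<Lambda> (\<lambda>x. 1) = 1"
begin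

lemma diff: "continuous_on K f \<Longrightarrow> continuous_on K g \<Longrightarrow> \<Lambda> (\<lambda>x. f x - g x) = \<Lambda> f - \<Lambda> g"
  using add[of f "\<lambda>x. (-1) * g x"] scale[of g "-1"] by (simp add: continuous_intros)

lemma mono: "continuous_on K f \<Longrightarrow> continuous_on K g \<Longrightarrow> (\<And>x. x \<in> K \<Longrightarrow> f x \<le> g x) \<Longrightarrow> \<Lambda> f \<le> \<Lambda> g"
  using pos[of "\<lambda>x. g x - f x"] diff[of g f] by (simp add: continuous_intros)

lemma cong: "continuous_on K f \<Longrightarrow> continuous_on K g \<Longrightarrow> (\<And>x. x \<in> K \<Longrightarrow> f x = g x) \<Longrightarrow> \<Lambda> f = \<Lambda> g"
  by (intro antisym mono) auto

lemma const: "\<Lambda> (\<lambda>x. c) = c"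
  using scale[of "\<lambda>x. 1" c] one by simp

lemma sum: "finite I \<Longrightarrow> (\<And>i. i \<in> I \<Longrightarrow> continuous_on K (f i)) \<Longrightarrow> \<Lambda> (\<lambda>x. \<Sum>i\<in>I. f i x) = (\<Sum>i\<in>I. \<Lambda> (f i))"
proof (induction I rule: finite_induct)
  case empty then show ?case using const[of 0] by simp
next
  case (insert i I)
  have "continuous_on K (\<lambda>x. \<Sum>i\<in>I. f i x)" using insert by (intro continuous_intros) auto
  then show ?case using insert add[of "f i" "\<lambda>x. \<Sum>i\<in>I. f i x"] by simp
qed

text \<open>The half-open regions between the graphs of two continuous functions form a semiring, on which
  \<open>\<Lambda> (g - f)\<close> is countably additive by Dini's theorem.\<close>

definition idx :: "(('k \<Rightarrow> real) \<times> ('k \<Rightarrow> real)) set" where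
  "idx = {(f, g). continuous_on K f \<and> continuous_on K g \<and> (\<forall>x\<in>K. f x \<le> g x)}"

definition strip :: "('k \<Rightarrow> real) \<times> ('k \<Rightarrow> real) \<Rightarrow> ('k \<times> real) set" where
  "strip i = {(x, t). x \<in> K \<and> fst i x \<le> t \<and> t < snd i x}"

definition wt :: "('k \<Rightarrow> real) \<times> ('k \<Rightarrow> real) \<Rightarrow> ennreal" where
  "wt i = ennreal (\<Lambda> (\<lambda>x. snd i x - fst i x))"

lemma idxD: "i \<in> idx \<Longrightarrow> continuous_on K (fst i)" "i \<in> idx \<Longrightarrow> continuous_on K (snd i)"
  "i \<in> idx \<Longrightarrow> x \<in> K \<Longrightarrow> fst i x \<le> snd i x"
  by (auto simp: idx_def)

lemma strip_fibre: "x \<in> K \<Longrightarrow> {t. (x, t) \<in> strip i} = {fst i x..<snd i x}"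
  by (auto simp: strip_def)

text \<open>A strip does not determine its pair of functions: where they coincide the fibre is
  empty. It does determine the lengths of the fibres, and the weight depends on nothing
  else.\<close>

lemma wt_eq:
  assumes i: "i \<in> idx" and j: "j \<in> idx" and eq: "strip i = strip j"
  shows "wt i = wt j"
proof -
  have "\<Lambda> (\<lambda>x. snd i x - fst i x) = \<Lambda> (\<lambda>x. snd j x - fst j x)"
  proof (rule cong)
    fix x assume x: "x \<in> K"
    have "{fst i x..<snd i x} = {fst j x..<snd j x}" using strip_fibre[OF x, of i] strip_fibre[OF x, of j] eq by simp
    then have "measure lborel {fst i x..<snd i x} = measure lborel {fst j x..<snd j x}" by simp
    then show "snd i x - fst i x = snd j x - fst j x" using idxD(3)[OF i x] idxD(3)[OF j x] by simp
  qed (intro continuous_intros idxD i j)+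
  then show ?thesis by (simp add: wt_def)
qed

lemma semiring: "semiring_of_sets (K \<times> UNIV) (strip ` idx)"
proof
  show "strip ` idx \<subseteq> Pow (K \<times> UNIV)" by (auto simp: strip_def)
  have "strip (\<lambda>x. 0, \<lambda>x. 0) = {}" by (auto simp: strip_def)
  moreover have "(\<lambda>x. 0, \<lambda>x. 0) \<in> idx" by (auto simp: idx_def)
  ultimately show "{} \<in> strip ` idx" by (intro image_eqI[of _ _ "(\<lambda>x. 0, \<lambda>x. 0)"]) simp_all
  fix a b assume "a \<in> strip ` idx" "b \<in> strip ` idx"
  then obtain i j where i: "i \<in> idx" "a = strip i" and j: "j \<in> idx" "b = strip j" by blast
  note c = idxD(1,2)[OF i(1)] idxD(1,2)[OF j(1)]
  let ?f = "fst i" and ?g = "snd i" and ?f' = "fst j" and ?g' = "snd j"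
  \<comment> \<open>\<open>u\<close> and \<open>v\<close> are the bounds of the second strip clamped
    to the first. The intersection lies between them, and the difference consists of the part below
    \<open>u\<close> and the part above \<open>v\<close>; where the strips are disjoint,
    \<open>u\<close> and \<open>v\<close> coincide.\<close>
  define u where "u x = min (?g x) (max (?f x) (?f' x))" for x
  define v where "v x = min (?g x) (max (?f x) (?g' x))" for x
  have uv: "continuous_on K u" "continuous_on K v"
    unfolding u_def v_def by (intro continuous_intros c)+
  have ord: "?f x \<le> u x" "u x \<le> v x" "v x \<le> ?g x" if "x \<in> K" for x
    using idxD(3)[OF i(1) that] idxD(3)[OF j(1) that] by (auto simp: u_def v_def)
  have I: "(u, v) \<in> idx" "(?f, u) \<in> idx" "(v, ?g) \<in> idx"
    using uv c ord by (auto simp: idx_def)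
  have cases: "t \<in> {?f x..<?g x} \<inter> {?f' x..<?g' x} \<longleftrightarrow> t \<in> {u x..<v x}"
    "t \<in> {?f x..<?g x} - {?f' x..<?g' x} \<longleftrightarrow> t \<in> {?f x..<u x} \<union> {v x..<?g x}" if "x \<in> K" for x t
    using idxD(3)[OF i(1) that] idxD(3)[OF j(1) that] unfolding u_def v_def min_def max_def by auto
  have fibre: "(x, t) \<in> strip i \<longleftrightarrow> x \<in> K \<and> t \<in> {fst i x..<snd i x}" for x t i
    by (auto simp: strip_def)
  have "a \<inter> b = strip (u, v)"
  proof (subst set_eq_iff, rule allI)
    fix p show "p \<in> a \<inter> b \<longleftrightarrow> p \<in> strip (u, v)"
      using cases(1)[of "fst p" "snd p"] fibre[of "fst p" "snd p"] unfolding i(2) j(2) by auto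
  qed
  then show "a \<inter> b \<in> strip ` idx" using I by blast
  have ab: "a - b = strip (?f, u) \<union> strip (v, ?g)"
  proof (subst set_eq_iff, rule allI)
    fix p show "p \<in> a - b \<longleftrightarrow> p \<in> strip (?f, u) \<union> strip (v, ?g)"
      using cases(2)[of "fst p" "snd p"] fibre[of "fst p" "snd p"] unfolding i(2) j(2) by auto
  qed
  have dis: "strip (?f, u) \<inter> strip (v, ?g) = {}"
  proof -
    have "\<not> (t < u x \<and> v x \<le> t)" if "x \<in> K" for x t using ord(2)[OF that] by linarith
    then show ?thesis by (auto simp: strip_def)
  qed
  show "\<exists>C\<subseteq>strip ` idx. finite C \<and> disjoint C \<and> a - b = \<Union>C"
    by (rule exI[of _ "{strip (?f, u), strip (v, ?g)}"])
       (use I ab dis in \<open>auto simp: disjoint_def Int_commute\<close>)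
qed

lemma wt_additive:
  assumes A: "\<And>n. A n \<in> idx" and j: "j \<in> idx"
    and disj: "disjoint_family (\<lambda>n::nat. strip (A n))" and un: "(\<Union>n. strip (A n)) = strip j"
  shows "suminf (\<lambda>n. wt (A n)) = wt j"
proof -
  define h where "h n x = snd (A n) x - fst (A n) x" for n x
  define H where "H x = snd j x - fst j x" for x
  have hc: "continuous_on K (h n)" for n unfolding h_def by (intro continuous_intros idxD A)
  have Hc: "continuous_on K H" unfolding H_def by (intro continuous_intros idxD j)
  have h0: "0 \<le> h n x" if "x \<in> K" for n x using idxD(3)[OF A that] by (simp add: h_def)
  have sums: "(\<lambda>n. h n x) sums H x" if x: "x \<in> K" for x
    unfolding h_def H_def
  proof (rule sums_of_intervals)
    have f: "{fst (A n) x..<snd (A n) x} = {t. (x, t) \<in> strip (A n)}" for n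
      by (rule strip_fibre[OF x, symmetric])
    have f': "{fst j x..<snd j x} = {t. (x, t) \<in> strip j}"
      by (rule strip_fibre[OF x, symmetric])
    show "disjoint_family (\<lambda>n. {fst (A n) x..<snd (A n) x})"
      unfolding f using disj by (auto simp: disjoint_family_on_def)
    show "(\<Union>n. {fst (A n) x..<snd (A n) x}) = {fst j x..<snd j x}"
      unfolding f f' un[symmetric] by auto
  qed (use idxD(3)[OF A x] idxD(3)[OF j x] in auto)
  \<comment> \<open>The remainders are continuous, nonnegative and decrease pointwise to 0. Uniform
    convergence turns this, by positivity, into convergence of \<open>\<Lambda> (R n)\<close> to
    0.\<close>
  define R where "R n x = H x - (\<Sum>i<n. h i x)" for n x
  have Rc: "continuous_on K (R n)" for n unfolding R_def by (intro continuous_intros Hc hc)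
  have R0: "0 \<le> R n x" if "x \<in> K" for n x
    using sum_le_suminf[of "\<lambda>n. h n x" "{..<n}"] sums[OF that] h0[OF that] by (simp add: R_def sums_iff)
  have Rdec: "R n x \<le> R m x" if "x \<in> K" "m \<le> n" for x m n
    unfolding R_def using sum_mono2[of "{..<n}" "{..<m}" "\<lambda>i. h i x"] h0[OF that(1)] that(2) by simp
  have Rlim: "(\<lambda>n. R n x) \<longlonglongrightarrow> 0" if "x \<in> K" for x
    using tendsto_diff[OF tendsto_const[of "H x"], of "\<lambda>n. \<Sum>i<n. h i x" "H x"] sums[OF that]
    by (simp add: R_def sums_def)
  \<comment> \<open>Points where \<open>R n\<close> is still at least \<open>e\<close> accumulate at
    some \<open>l\<close>. Fixing \<open>m\<close> with \<open>R m l < e\<close>, continuity of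
    \<open>R m\<close> and monotonicity in the index contradict this along the subsequence.\<close>
  have Dini: "\<exists>n. \<forall>x\<in>K. R n x < e" if e: "e > 0" for e
  proof (rule ccontr)
    assume "\<not> ?thesis"
    then have no: "\<not> (\<forall>x\<in>K. R n x < e)" for n by simp
    have "\<exists>x. \<forall>n. x n \<in> K \<and> e \<le> R n (x n)"
    proof (rule choice, rule allI)
      fix n show "\<exists>x. x \<in> K \<and> e \<le> R n x" using no[of n] by (auto simp: not_less)
    qed
    then obtain x where x: "\<And>n. x n \<in> K" "\<And>n. e \<le> R n (x n)" by blast
    obtain l r where l: "l \<in> K" and r: "strict_mono (r :: nat \<Rightarrow> nat)" and lim: "(x \<circ> r) \<longlonglongrightarrow> l"
      using compact_imp_seq_compact[OF cK] x(1) by (auto elim!: seq_compactE)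
    have "eventually (\<lambda>n. R n l < e) sequentially"
      using order_tendstoD(2)[OF Rlim[OF l] e] .
    then obtain m where m: "R m l < e" unfolding eventually_sequentially by auto
    have "(\<lambda>n. R m ((x \<circ> r) n)) \<longlonglongrightarrow> R m l"
      by (rule continuous_on_tendsto_compose[OF Rc lim l]) (simp add: x)
    then have "eventually (\<lambda>n. R m ((x \<circ> r) n) < e) sequentially" using m by (rule order_tendstoD(2))
    then obtain n0 where n0: "\<And>n. n \<ge> n0 \<Longrightarrow> R m (x (r n)) < e" unfolding eventually_sequentially by auto
    let ?n = "max n0 m"
    have "m \<le> r ?n" using seq_suble[OF r, of ?n] by linarith
    then have "R (r ?n) (x (r ?n)) \<le> R m (x (r ?n))" by (rule Rdec[OF x(1)])
    then show False using n0[of ?n] x(2)[of "r ?n"] by simp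
  qed
  have \<Lambda>R: "\<Lambda> (R n) = \<Lambda> H - (\<Sum>i<n. \<Lambda> (h i))" for n
    unfolding R_def using diff[OF Hc, of "\<lambda>x. \<Sum>i<n. h i x"] sum[of "{..<n}" h] hc
    by (simp add: continuous_intros)
  have S: "(\<lambda>n. \<Lambda> (h n)) sums \<Lambda> H"
    unfolding sums_def
  proof (rule LIMSEQ_I)
    fix e :: real assume e: "e > 0"
    then obtain n0 where n0: "\<And>x. x \<in> K \<Longrightarrow> R n0 x < e / 2" using Dini[of "e/2"] by auto
    have "norm ((\<Sum>i<n. \<Lambda> (h i)) - \<Lambda> H) < e" if n: "n \<ge> n0" for n
    proof -
      have "\<Lambda> (R n) \<le> \<Lambda> (\<lambda>x. e / 2)"
      proof (rule mono[OF Rc continuous_on_const])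
        fix x assume "x \<in> K"
        then show "R n x \<le> e / 2" using Rdec[of x n0 n] n n0[of x] by simp
      qed
      moreover have "0 \<le> \<Lambda> (R n)" by (rule pos[OF Rc R0])
      ultimately show ?thesis using \<Lambda>R[of n] const[of "e/2"] e by simp
    qed
    then show "\<exists>no. \<forall>n\<ge>no. norm ((\<Sum>i<n. \<Lambda> (h i)) - \<Lambda> H) < e" by auto
  qed
  have nn: "0 \<le> \<Lambda> (h n)" for n
    by (rule pos[OF hc h0])
  have "suminf (\<lambda>n. ennreal (\<Lambda> (h n))) = ennreal (\<Lambda> H)"
    by (rule suminf_ennreal_eq[OF nn S])
  moreover have "wt (A n) = ennreal (\<Lambda> (h n))" for n
    unfolding wt_def h_def[abs_def] ..
  moreover have "wt j = ennreal (\<Lambda> H)"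
    unfolding wt_def H_def[abs_def] ..
  ultimately show ?thesis by (simp only:)
qed

section \<open>The measure generated by the strips, and its projection to \<open>K\<close>\<close>

definition m where "m = extend_measure (K \<times> UNIV) idx strip wt"

lemma space_m: "space m = K \<times> UNIV"
  unfolding m_def by (rule space_extend_measure) (auto simp: strip_def)

lemma strip_sets: "i \<in> idx \<Longrightarrow> strip i \<in> sets m"
  unfolding m_def by (subst sets_extend_measure) (auto simp: strip_def)

lemma emeasure_strip: "i \<in> idx \<Longrightarrow> emeasure m (strip i) = wt i"
proof (rule extend_measure_caratheodory[OF m_def _ semiring])
  show "wt i = 0" if "i \<in> idx" "strip i = {}" for i
  proof -
    have z: "(\<lambda>x. 0, \<lambda>x. 0) \<in> idx" "strip (\<lambda>x. 0, \<lambda>x. 0) = {}" by (auto simp: idx_def strip_def)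
    then have "wt i = wt (\<lambda>x. 0, \<lambda>x. 0)" using wt_eq[OF that(1) z(1)] that(2) by simp
    then show ?thesis using const[of 0] by (simp add: wt_def)
  qed
  show "suminf (\<lambda>n. wt (A n)) = wt j"
    if "A \<in> UNIV \<rightarrow> idx" "j \<in> idx" "disjoint_family (strip \<circ> A)" "(\<Union>i. strip (A i)) = strip j" for A :: "nat \<Rightarrow> _" and j
    using wt_additive[of A j] that by (auto simp: o_def)
qed (auto intro: wt_eq)

definition \<Omega> where "\<Omega> = strip (\<lambda>x. 0, \<lambda>x. 1)"

lemma \<Omega>_eq: "\<Omega> = K \<times> {0..<1}"
  by (auto simp: \<Omega>_def strip_def)

lemma \<Omega>_sets: "\<Omega> \<in> sets m" and emeasure_\<Omega>: "emeasure m \<Omega> = 1"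
proof -
  have I: "(\<lambda>x. 0, \<lambda>x. 1) \<in> idx" by (auto simp: idx_def)
  show "\<Omega> \<in> sets m" unfolding \<Omega>_def by (rule strip_sets[OF I])
  show "emeasure m \<Omega> = 1" unfolding \<Omega>_def emeasure_strip[OF I] using one by (simp add: wt_def)
qed

text \<open>A set \<open>B\<close> is measured by the cylinder over it of height 1; total mass 1
  comes from \<open>\<Lambda> (\<lambda>x. 1) = 1\<close>.\<close>

definition \<mu> where "\<mu> = distr (restrict_space m \<Omega>) (restrict_space borel K) fst"

text \<open>The cylinder over an open set is a countable union of strips: those below
  \<open>min 1 (n * h)\<close>, with \<open>h\<close> the distance to the complement.\<close>

lemma fst_measurable: "fst \<in> measurable (restrict_space m \<Omega>) (restrict_space borel K)"
proof (rule measurable_restrict_space2)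
  have sp: "space (restrict_space m \<Omega>) = K \<times> {0..<1}"
    using \<Omega>_sets sets.sets_into_space[OF \<Omega>_sets] by (auto simp: space_restrict_space \<Omega>_eq space_m)
  then show "fst \<in> space (restrict_space m \<Omega>) \<rightarrow> K" by auto
  show "fst \<in> borel_measurable (restrict_space m \<Omega>)"
  proof (rule borel_measurableI)
    fix V :: "'k set" assume V: "open V"
    \<comment> \<open>The full set is treated apart because \<open>infdist\<close> to the empty set
      is 0.\<close>
    define h where "h x = (if - V = {} then 1 else infdist x (- V))" for x
    have hc: "continuous_on K h"
      unfolding h_def by (cases "- V = {}") (auto intro!: continuous_intros)
    have hV: "0 < h x \<longleftrightarrow> x \<in> V" "0 \<le> h x" for x
    proof -
      have "infdist x (- V) = 0 \<longleftrightarrow> x \<in> - V" if "- V \<noteq> {}"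
        using in_closed_iff_infdist_zero[of "- V" x] V that by (simp add: closed_def)
      moreover have "0 \<le> infdist x (- V)" by (rule infdist_nonneg)
      ultimately show "0 < h x \<longleftrightarrow> x \<in> V" "0 \<le> h x"
        unfolding h_def by (cases "- V = {}"; force)+
    qed
    have I: "(\<lambda>x. 0, \<lambda>x. min 1 (real n * h x)) \<in> idx" for n
      unfolding idx_def using hV(2) by (auto intro!: continuous_intros hc)
    have "fst -` V \<inter> space (restrict_space m \<Omega>) = (\<Union>n. strip (\<lambda>x. 0, \<lambda>x. min 1 (real n * h x)))"
    proof (intro equalityI subsetI)
      fix p assume p: "p \<in> fst -` V \<inter> space (restrict_space m \<Omega>)"
      obtain x t where xt: "p = (x, t)" by (cases p)
      have x: "x \<in> K" "x \<in> V" "0 \<le> t" "t < 1" using p by (auto simp: xt sp)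
      then obtain n where "t < real n * h x"
        using reals_Archimedean3[of "h x"] hV(1)[of x] by auto
      then show "p \<in> (\<Union>n. strip (\<lambda>x. 0, \<lambda>x. min 1 (real n * h x)))"
        using x by (auto simp: xt strip_def)
    next
      fix p assume "p \<in> (\<Union>n. strip (\<lambda>x. 0, \<lambda>x. min 1 (real n * h x)))"
      then obtain n x t where xt: "p = (x, t)" "x \<in> K" "0 \<le> t" "t < 1" "t < real n * h x"
        by (auto simp: strip_def)
      then have "0 < real n * h x" by linarith
      then have "0 < h x" using hV(2)[of x] by (simp add: zero_less_mult_iff)
      then show "p \<in> fst -` V \<inter> space (restrict_space m \<Omega>)" using xt hV(1)[of x] by (auto simp: sp)
    qed
    moreover have "(\<Union>n. strip (\<lambda>x. 0, \<lambda>x. min 1 (real n * h x))) \<in> sets (restrict_space m \<Omega>)"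
    proof -
      have "(\<Union>n. strip (\<lambda>x. 0, \<lambda>x. min 1 (real n * h x))) \<in> sets m"
        using strip_sets[OF I] by (intro sets.countable_UN) auto
      moreover have "(\<Union>n. strip (\<lambda>x. 0, \<lambda>x. min 1 (real n * h x))) \<subseteq> \<Omega>"
        by (auto simp: strip_def \<Omega>_eq)
      ultimately show ?thesis using \<Omega>_sets by (subst sets_restrict_space_iff) auto
    qed
    ultimately show "fst -` V \<inter> space (restrict_space m \<Omega>) \<in> sets (restrict_space m \<Omega>)" by simp
  qed
qed

lemma space_\<mu>: "space \<mu> = K" and sets_\<mu>: "sets \<mu> = sets (restrict_space borel K)"
  by (simp_all add: \<mu>_def space_restrict_space)

lemma emeasure_\<mu>:
  assumes "B \<in> sets \<mu>"
  shows "emeasure \<mu> B = emeasure m (B \<times> {0..<1})" "B \<times> {0..<1} \<in> sets m"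
proof -
  have B: "B \<in> sets (restrict_space borel K)" "B \<subseteq> K" using assms sets.sets_into_space[OF assms] by (auto simp: sets_\<mu> space_\<mu>)
  have sp: "space (restrict_space m \<Omega>) = K \<times> {0..<1}"
    using \<Omega>_sets sets.sets_into_space[OF \<Omega>_sets] by (auto simp: space_restrict_space \<Omega>_eq space_m)
  have pre: "fst -` B \<inter> space (restrict_space m \<Omega>) = B \<times> {0..<1}" using B(2) by (auto simp: sp)
  have "B \<times> {0..<1} \<in> sets (restrict_space m \<Omega>)"
    using measurable_sets[OF fst_measurable B(1)] pre by simp
  then show "B \<times> {0..<1} \<in> sets m"
    using \<Omega>_sets by (subst (asm) sets_restrict_space_iff) (auto simp: Int_absorb1 sets.sets_into_space)
  have "emeasure \<mu> B = emeasure (restrict_space m \<Omega>) (B \<times> {0..<1})"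
    unfolding \<mu>_def by (subst emeasure_distr[OF fst_measurable B(1)]) (simp only: pre)
  also have "\<dots> = emeasure m (B \<times> {0..<1})"
    by (rule emeasure_restrict_space)
       (use \<Omega>_sets B(2) in \<open>simp_all only: sets.Int_space_eq2\<close>, auto simp: \<Omega>_eq)
  finally show "emeasure \<mu> B = emeasure m (B \<times> {0..<1})" .
qed

lemma prob_\<mu>: "prob_space \<mu>"
proof
  have "emeasure \<mu> K = emeasure m (K \<times> {0..<1})"
    by (rule emeasure_\<mu>(1)) (metis sets.top space_\<mu>)
  then show "emeasure \<mu> (space \<mu>) = 1" using emeasure_\<Omega> by (simp add: space_\<mu> \<Omega>_eq)
qed

lemma meas: "continuous_on K f \<Longrightarrow> f \<in> borel_measurable \<mu>" for f :: "'k \<Rightarrow> real"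
  using borel_measurable_continuous_on_restrict[of K f] measurable_cong_sets[OF sets_\<mu> refl, of borel] by blast

lemma bounded_on:
  fixes f :: "'k \<Rightarrow> real"
  assumes "continuous_on K f"
  obtains B where "B > 0" "\<And>x. x \<in> K \<Longrightarrow> \<bar>f x\<bar> \<le> B"
  using compact_imp_bounded[OF compact_continuous_image[OF assms cK]] unfolding bounded_pos by auto

lemma integrable: 
  fixes f :: "'k \<Rightarrow> real"
  assumes "continuous_on K f"
  shows "integrable \<mu> f"
proof -
  interpret prob_space \<mu> by (rule prob_\<mu>)
  obtain B where "\<And>x. x \<in> K \<Longrightarrow> \<bar>f x\<bar> \<le> B" using bounded_on[OF assms] by auto
  then show ?thesis
    by (intro integrable_const_bound[of _ B] meas assms) (auto simp: space_\<mu>)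
qed

text \<open>\<open>\<Lambda> g\<close> is the measure of the region below the graph of
  \<open>g\<close>, which is contained in the cylinder over the set where \<open>g\<close> is
  positive.\<close>

lemma \<Lambda>_le_measure:
  assumes g: "continuous_on K g" and g01: "\<And>x. x \<in> K \<Longrightarrow> 0 \<le> g x \<and> g x \<le> 1"
  shows "\<Lambda> g \<le> measure \<mu> {x \<in> K. 0 < g x}"
proof -
  interpret prob_space \<mu> by (rule prob_\<mu>)
  have I: "(\<lambda>x. 0, g) \<in> idx" using g g01 by (auto simp: idx_def)
  have B: "{x \<in> K. 0 < g x} \<in> sets \<mu>"
    using meas[OF g] by (simp add: borel_measurable_iff_greater space_\<mu>)
  have "ennreal (\<Lambda> g) = emeasure m (strip (\<lambda>x. 0, g))"
    by (simp add: emeasure_strip[OF I] wt_def)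
  also have "\<dots> \<le> emeasure m ({x \<in> K. 0 < g x} \<times> {0..<1})"
  proof (rule emeasure_mono[OF _ emeasure_\<mu>(2)[OF B]])
    show "strip (\<lambda>x. 0, g) \<subseteq> {x \<in> K. 0 < g x} \<times> {0..<1}"
      using g01 by (auto simp: strip_def) (meson less_le_trans le_less_trans)+
  qed
  also have "\<dots> = ennreal (measure \<mu> {x \<in> K. 0 < g x})"
    by (simp add: emeasure_\<mu>(1)[OF B, symmetric] emeasure_eq_measure)
  finally show ?thesis by simp
qed

lemma clamp_sum: "(\<Sum>k<n. min 1 (max 0 (y - real k))) = min (real n) (max 0 y)"
  by (induction n) (auto simp: min_def max_def)

text \<open>A layer-cake argument: \<open>N * f\<close> is cut into \<open>N\<close> slices
  \<open>g k\<close> of height 1. Where \<open>g (Suc k)\<close> is positive, \<open>g k\<close>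
  equals 1, so \<open>\<Lambda> (g (Suc k))\<close> is at most the integral of \<open>g k\<close>.
  Shifting the index costs only the bottom slice, at most 1, that is, an error \<open>1 / N\<close>
  after division.\<close>

lemma \<Lambda>_le_integral:
  assumes f: "continuous_on K f" and f01: "\<And>x. x \<in> K \<Longrightarrow> 0 \<le> f x \<and> f x \<le> 1"
  shows "\<Lambda> f \<le> (LINT x|\<mu>. f x)"
proof (rule field_le_epsilon)
  interpret prob_space \<mu> by (rule prob_\<mu>)
  fix e :: real assume "e > 0"
  then obtain N0 where N0: "inverse (real (Suc N0)) < e" using reals_Archimedean by auto
  define N where "N = Suc N0"
  define g where "g k x = min 1 (max 0 (real N * f x - real k))" for k x
  have gc: "continuous_on K (g k)" for k unfolding g_def by (intro continuous_intros f)
  have g01: "0 \<le> g k x \<and> g k x \<le> 1" for k x by (simp add: g_def)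
  have gsum: "(\<Sum>k<N. g k x) = real N * f x" if "x \<in> K" for x
    using f01[OF that] unfolding g_def clamp_sum by (simp add: mult_left_le)
  have step: "\<Lambda> (g (Suc k)) \<le> (LINT x|\<mu>. g k x)" for k
  proof -
    have B: "{x \<in> K. 0 < g (Suc k) x} \<in> sets \<mu>"
      using meas[OF gc] by (simp add: borel_measurable_iff_greater space_\<mu>)
    have "\<Lambda> (g (Suc k)) \<le> measure \<mu> {x \<in> K. 0 < g (Suc k) x}"
      by (rule \<Lambda>_le_measure[OF gc g01])
    also have "\<dots> = (LINT x|\<mu>. indicator {x \<in> K. 0 < g (Suc k) x} x)" using B by simp
    also have "\<dots> \<le> (LINT x|\<mu>. g k x)"
    proof (rule integral_mono)
      show "integrable \<mu> (indicator {x \<in> K. 0 < g (Suc k) x} :: 'k \<Rightarrow> real)"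
        using B by (simp add: emeasure_eq_measure)
      show "indicator {x \<in> K. 0 < g (Suc k) x} x \<le> g k x" for x
        using g01[of k x] by (auto simp: indicator_def g_def min_def max_def split: if_splits)
    qed (rule integrable[OF gc])
    finally show ?thesis .
  qed
  have "real N * \<Lambda> f = \<Lambda> (\<lambda>x. real N * f x)" by (rule scale[OF f, symmetric])
  also have "\<dots> = \<Lambda> (\<lambda>x. \<Sum>k<N. g k x)"
    by (rule cong) (auto simp: gsum intro!: continuous_intros f gc)
  also have "\<dots> = (\<Sum>k<N. \<Lambda> (g k))" by (rule sum) (auto intro: gc)
  also have "\<dots> = \<Lambda> (g 0) + (\<Sum>k<N0. \<Lambda> (g (Suc k)))"
    unfolding N_def by (rule sum.lessThan_Suc_shift)
  also have "\<dots> \<le> 1 + (\<Sum>k<N0. LINT x|\<mu>. g k x)"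
  proof (intro add_mono sum_mono step)
    have "\<Lambda> (g 0) \<le> \<Lambda> (\<lambda>x. 1)" by (rule mono[OF gc]) (use g01 in auto)
    then show "\<Lambda> (g 0) \<le> 1" by (simp add: one)
  qed
  also have "(\<Sum>k<N0. LINT x|\<mu>. g k x) \<le> (\<Sum>k<N. LINT x|\<mu>. g k x)"
    unfolding N_def using g01 by (simp add: integral_nonneg)
  also have "(\<Sum>k<N. LINT x|\<mu>. g k x) = (LINT x|\<mu>. (\<Sum>k<N. g k x))"
    by (rule Bochner_Integration.integral_sum[symmetric]) (rule integrable[OF gc])
  also have "\<dots> = (LINT x|\<mu>. real N * f x)"
    by (rule Bochner_Integration.integral_cong) (auto simp: gsum space_\<mu>)
  also have "\<dots> = real N * (LINT x|\<mu>. f x)" by simp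
  finally have "real N * \<Lambda> f \<le> 1 + real N * (LINT x|\<mu>. f x)" by simp
  then have "\<Lambda> f \<le> (LINT x|\<mu>. f x) + inverse (real N)"
    by (simp add: N_def field_simps)
  then show "\<Lambda> f \<le> (LINT x|\<mu>. f x) + e" using N0 by (simp add: N_def)
qed

text \<open>For functions with values between 0 and 1 the one-sided estimate is applied to
  \<open>g\<close> and to \<open>1 - g\<close>. The general case follows by an affine
  change.\<close>

theorem integral_eq:
  assumes f: "continuous_on K f"
  shows "(LINT x|\<mu>. f x) = \<Lambda> f"
proof -
  interpret prob_space \<mu> by (rule prob_\<mu>)
  have eq01: "(LINT x|\<mu>. g x) = \<Lambda> g" if g: "continuous_on K g" and g01: "\<And>x. x \<in> K \<Longrightarrow> 0 \<le> g x \<and> g x \<le> 1" for g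
  proof (rule antisym)
    have "\<Lambda> (\<lambda>x. 1 - g x) \<le> (LINT x|\<mu>. 1 - g x)"
      by (rule \<Lambda>_le_integral) (use g01 in \<open>auto intro!: continuous_intros g\<close>)
    also have "\<dots> = 1 - (LINT x|\<mu>. g x)"
      using integrable[OF g] prob_space by (simp add: Bochner_Integration.integral_diff)
    also have "\<Lambda> (\<lambda>x. 1 - g x) = 1 - \<Lambda> g" using diff[OF continuous_on_const g] one by simp
    finally show "(LINT x|\<mu>. g x) \<le> \<Lambda> g" by simp
  qed (rule \<Lambda>_le_integral[OF g g01])
  obtain B where B: "B > 0" "\<And>x. x \<in> K \<Longrightarrow> \<bar>f x\<bar> \<le> B" using bounded_on[OF f] by auto
  \<comment> \<open>The affine map from the interval from \<open>- B\<close> to \<open>B\<close>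
    onto the unit interval.\<close>
  define g where "g x = f x / (2 * B) + 1 / 2" for x
  have gc: "continuous_on K g" unfolding g_def by (intro continuous_intros f) (use B in auto)
  have gI: "(LINT x|\<mu>. g x) = \<Lambda> g"
  proof (rule eq01[OF gc])
    fix x assume "x \<in> K"
    then show "0 \<le> g x \<and> g x \<le> 1" using B(2)[of x] B(1) by (simp add: g_def field_simps abs_le_iff)
  qed
  have fg: "f = (\<lambda>x. 2 * B * g x - B)" using B(1) by (simp add: g_def fun_eq_iff field_simps)
  have "(LINT x|\<mu>. f x) = (LINT x|\<mu>. 2 * B * g x - B)" by (subst fg) (rule refl)
  also have "\<dots> = 2 * B * (LINT x|\<mu>. g x) - B"
    using integrable[OF gc] prob_space by (simp add: Bochner_Integration.integral_diff)
  also have "\<dots> = \<Lambda> (\<lambda>x. 2 * B * g x - B)"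
    unfolding gI
    using diff[of "\<lambda>x. 2 * B * g x" "\<lambda>x. B"] scale[OF gc, of "2 * B"] const[of B] by (simp add: continuous_intros gc)
  also have "\<dots> = \<Lambda> f" by (subst fg) (rule refl)
  finally show ?thesis .
qed


end

text \<open>The measure has been constructed above; what remains is its regularity, for which the
  point type is Polish: finite Borel measures on Polish spaces are inner regular by compact sets and
  outer regular by open sets.\<close>

theorem Riesz_representation:
  fixes K :: "'k::polish_space set"
  assumes "positive_functional K \<Lambda>"
  shows "\<exists>\<mu>\<in>regular_prob_measures (top_of_set K). \<forall>f. continuous_on K f \<longrightarrow> (LINT x|\<mu>. f x) = \<Lambda> f"
proof -
  interpret positive_functional K \<Lambda> by (rule assms)
  interpret prob_space \<mu> by (rule prob_\<mu>)
  have Kb: "K \<in> sets borel" using compact_imp_closed[OF cK] by simp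
  have sets_iff: "B \<in> sets \<mu> \<longleftrightarrow> B \<in> sets borel \<and> B \<subseteq> K" for B
    using Kb by (simp add: sets_\<mu> sets_restrict_space_iff) blast
  have sets_eq: "sets \<mu> = sigma_sets K {V. openin (top_of_set K) V}"
  proof -
    have "sets \<mu> = (\<inter>) K ` sigma_sets UNIV {V. open V}"
      by (simp add: sets_\<mu> sets_restrict_space borel_def)
    also have "\<dots> = sigma_sets K ((\<inter>) K ` {V. open V})"
      by (rule sigma_sets_Int) (use Kb in \<open>auto simp: borel_def\<close>)
    also have "(\<inter>) K ` {V. open V} = {V. openin (top_of_set K) V}"
      by (auto simp: openin_open)
    finally show ?thesis .
  qed
  \<comment> \<open>The regularity theorems concern Borel measures on the whole type, so
    \<open>\<mu>\<close> is extended by 0 outside \<open>K\<close>; compact sets inside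
    \<open>B\<close> are the same, and open sets correspond by intersection with
    \<open>K\<close>.\<close>
  define \<nu> where "\<nu> = distr \<mu> borel (\<lambda>x. x)"
  have idm: "(\<lambda>x. x) \<in> measurable \<mu> borel"
    by (rule measurableI) (use Kb in \<open>auto simp: sets_iff space_\<mu>\<close>)
  have \<nu>: "emeasure \<nu> B = emeasure \<mu> (B \<inter> K)" if "B \<in> sets borel" for B
    unfolding \<nu>_def by (subst emeasure_distr[OF idm that]) (simp add: space_\<mu>)
  have sets\<nu>: "sets \<nu> = sets borel" by (simp add: \<nu>_def)
  have fin: "emeasure \<nu> (space \<nu>) \<noteq> \<infinity>"
    using \<nu>[of UNIV] by (simp add: \<nu>_def emeasure_eq_measure)
  have reg: "emeasure \<mu> B = (SUP L\<in>{L. L \<subseteq> B \<and> compactin (top_of_set K) L \<and> L \<in> sets \<mu>}. emeasure \<mu> L)"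
    "emeasure \<mu> B = (INF V\<in>{V. B \<subseteq> V \<and> openin (top_of_set K) V}. emeasure \<mu> V)" if B: "B \<in> sets \<mu>" for B
  proof -
    have Bb: "B \<in> sets borel" "B \<subseteq> K" using B sets_iff by auto
    have "emeasure \<mu> B = emeasure \<nu> B" using \<nu>[OF Bb(1)] Bb(2) by (simp add: Int_absorb2)
    also have "\<dots> = (SUP L\<in>{L. L \<subseteq> B \<and> compact L}. emeasure \<nu> L)"
      by (rule inner_regular[OF sets\<nu> fin Bb(1)])
    also have "\<dots> = (SUP L\<in>{L. L \<subseteq> B \<and> compactin (top_of_set K) L \<and> L \<in> sets \<mu>}. emeasure \<mu> L)"
    proof (rule SUP_cong)
      show "{L. L \<subseteq> B \<and> compact L} = {L. L \<subseteq> B \<and> compactin (top_of_set K) L \<and> L \<in> sets \<mu>}"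
        using Bb(2) by (auto simp: compactin_subtopology sets_iff compact_imp_closed)
      fix L assume "L \<in> {L. L \<subseteq> B \<and> compactin (top_of_set K) L \<and> L \<in> sets \<mu>}"
      then have "L \<in> sets borel" "L \<inter> K = L" using sets_iff by auto
      then show "emeasure \<nu> L = emeasure \<mu> L" using \<nu> by simp
    qed
    finally show "emeasure \<mu> B = (SUP L\<in>{L. L \<subseteq> B \<and> compactin (top_of_set K) L \<and> L \<in> sets \<mu>}. emeasure \<mu> L)" .
    have "emeasure \<mu> B = emeasure \<nu> B" using \<nu>[OF Bb(1)] Bb(2) by (simp add: Int_absorb2)
    also have "\<dots> = (INF V\<in>{V. B \<subseteq> V \<and> open V}. emeasure \<nu> V)"
      by (rule outer_regular[OF sets\<nu> fin Bb(1)])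
    also have "emeasure \<nu> ` {V. B \<subseteq> V \<and> open V} = emeasure \<mu> ` {V. B \<subseteq> V \<and> openin (top_of_set K) V}"
    proof (intro equalityI subsetI)
      fix y assume "y \<in> emeasure \<nu> ` {V. B \<subseteq> V \<and> open V}"
      then obtain V where V: "B \<subseteq> V" "open V" "y = emeasure \<nu> V" by auto
      have "y = emeasure \<mu> (K \<inter> V)" using \<nu>[of V] V by (simp add: Int_commute)
      moreover have "openin (top_of_set K) (K \<inter> V)" using V(2) by (auto simp: openin_open)
      ultimately show "y \<in> emeasure \<mu> ` {V. B \<subseteq> V \<and> openin (top_of_set K) V}" using V(1) Bb(2) by auto
    next
      fix y assume "y \<in> emeasure \<mu> ` {V. B \<subseteq> V \<and> openin (top_of_set K) V}"
      then obtain V where V: "B \<subseteq> V" "openin (top_of_set K) V" "y = emeasure \<mu> V" by auto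
      then obtain W where W: "open W" "V = K \<inter> W" by (auto simp: openin_open)
      have "y = emeasure \<nu> W" using \<nu>[of W] V W by (simp add: Int_commute)
      then show "y \<in> emeasure \<nu> ` {V. B \<subseteq> V \<and> open V}" using V(1) W by auto
    qed
    finally show "emeasure \<mu> B = (INF V\<in>{V. B \<subseteq> V \<and> openin (top_of_set K) V}. emeasure \<mu> V)" .
  qed
  have "\<mu> \<in> regular_prob_measures (top_of_set K)"
    unfolding regular_prob_measures_def mem_Collect_eq topspace_euclidean_subtopology
    by (intro conjI ballI reg prob_\<mu> space_\<mu> sets_eq)
  then show ?thesis using integral_eq by blast
qed

section \<open>Tracial states of W*-bundles\<close>

lemma regularD:
  assumes "\<mu> \<in> regular_prob_measures X"
  shows "prob_space \<mu>" "space \<mu> = topspace X" "sets \<mu> = sigma_sets (topspace X) {V. openin X V}"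
  using assms by (simp_all add: regular_prob_measures_def)

lemma regular_measurable:
  assumes \<mu>: "\<mu> \<in> regular_prob_measures X" and f: "continuous_map X euclidean f"
  shows "f \<in> borel_measurable \<mu>"
proof (rule borel_measurableI)
  fix V :: "'b::topological_space set" assume "open V"
  then have "openin X {x \<in> topspace X. f x \<in> V}"
    using openin_continuous_map_preimage[OF f, of V] by simp
  moreover have "f -` V \<inter> space \<mu> = {x \<in> topspace X. f x \<in> V}"
    using regularD(2)[OF \<mu>] by auto
  ultimately show "f -` V \<inter> space \<mu> \<in> sets \<mu>"
    using regularD(3)[OF \<mu>] by (auto intro: sigma_sets.Basic)
qed

lemma regular_integrable:
  assumes \<mu>: "\<mu> \<in> regular_prob_measures X" and X: "compact_space X" and f: "f \<in> carrier (cfun_algebra X)"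
  shows "integrable \<mu> f"
proof -
  interpret prob_space \<mu> by (rule regularD(1)[OF \<mu>])
  show ?thesis
    by (rule integrable_const_bound[of _ "cnorm (cfun_algebra X) f"])
       (use cfun_norm_le[OF X f] regular_measurable[OF \<mu>, of f] f in \<open>auto simp: carrier_cfun simp del: cfun_simps\<close>)
qed

lemma bundle_trace_in: "a \<in> carrier (bundle_alg M) \<Longrightarrow> bundle_trace M \<mu> a = (LINT x|\<mu>. expect M a x)"
  by (simp add: bundle_trace_def)

lemma bundle_trace_state:
  assumes M: "wstar_bundle M" and \<mu>: "\<mu> \<in> regular_prob_measures (base_space M)"
  shows "bundle_trace M \<mu> \<in> tracial_states (bundle_alg M)"
proof -
  interpret A: cstar_algebra "bundle_alg M" by (rule wb_cstar[OF M])
  interpret prob_space \<mu> by (rule regularD(1)[OF \<mu>])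
  have int: "integrable \<mu> (expect M a)" if "a \<in> carrier (bundle_alg M)" for a
    by (rule regular_integrable[OF \<mu> wb_space(1)[OF M] wb_E(1)[OF M that]])
  show ?thesis
    unfolding tracial_states_def mem_Collect_eq
  proof (intro conjI allI ballI impI)
    show "bundle_trace M \<mu> a = 0" if "a \<notin> carrier (bundle_alg M)" for a
      using that by (simp add: bundle_trace_def)
    have "bundle_trace M \<mu> \<one>\<^bsub>bundle_alg M\<^esub> = (LINT x|\<mu>. 1)"
      unfolding bundle_trace_in[OF A.A_simps(6)] wb_E(9)[OF M]
      by (rule Bochner_Integration.integral_cong) (simp_all add: regularD(2)[OF \<mu>])
    then show "bundle_trace M \<mu> \<one>\<^bsub>bundle_alg M\<^esub> = 1" using prob_space by simp
    fix a assume a: "a \<in> carrier (bundle_alg M)"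
    show "bundle_trace M \<mu> (c \<odot>\<^bsub>bundle_alg M\<^esub> a) = c * bundle_trace M \<mu> a" for c
      using a by (simp add: bundle_trace_in A.csmult_closed wb_E(3)[OF M])
    show "bundle_trace M \<mu> (star (bundle_alg M) a \<otimes>\<^bsub>bundle_alg M\<^esub> a) \<in> \<real>\<^sub>\<ge>\<^sub>0"
    proof -
      define b where "b = star (bundle_alg M) a \<otimes>\<^bsub>bundle_alg M\<^esub> a"
      have b: "b \<in> carrier (bundle_alg M)" unfolding b_def by (rule A.A_simps(5)[OF A.star_closed[OF a] a])
      have nn: "0 \<le> Re (expect M b x)" "Im (expect M b x) = 0" if "x \<in> space \<mu>" for x
        using wb_E(4)[OF M a, of x] that by (simp_all add: b_def regularD(2)[OF \<mu>] complex_nonneg_Reals_iff)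
      have "Re (LINT x|\<mu>. expect M b x) = (LINT x|\<mu>. Re (expect M b x))"
        using integral_Re[OF int[OF b]] by simp
      moreover have "0 \<le> (LINT x|\<mu>. Re (expect M b x))"
        by (rule integral_nonneg_AE) (use nn(1) in auto)
      moreover have "Im (LINT x|\<mu>. expect M b x) = (LINT x|\<mu>. Im (expect M b x))"
        using integral_Im[OF int[OF b]] by simp
      moreover have "(LINT x|\<mu>. Im (expect M b x)) = (LINT x|\<mu>. 0)"
        by (rule Bochner_Integration.integral_cong) (simp_all add: nn(2))
      ultimately show ?thesis
        unfolding b_def[symmetric] bundle_trace_in[OF b] by (simp add: complex_nonneg_Reals_iff)
    qed
    fix b assume b: "b \<in> carrier (bundle_alg M)"
    have "(LINT x|\<mu>. expect M a x + expect M b x) = (LINT x|\<mu>. expect M a x) + (LINT x|\<mu>. expect M b x)"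
      by (rule Bochner_Integration.integral_add[OF int[OF a] int[OF b]])
    then show "bundle_trace M \<mu> (a \<oplus>\<^bsub>bundle_alg M\<^esub> b) = bundle_trace M \<mu> a + bundle_trace M \<mu> b"
      using bundle_trace_in[OF A.A_simps(1)[OF a b]] bundle_trace_in[OF a] bundle_trace_in[OF b] wb_E(2)[OF M a b] by simp
    show "bundle_trace M \<mu> (a \<otimes>\<^bsub>bundle_alg M\<^esub> b) = bundle_trace M \<mu> (b \<otimes>\<^bsub>bundle_alg M\<^esub> a)"
      unfolding bundle_trace_in[OF A.A_simps(5)[OF a b]] bundle_trace_in[OF A.A_simps(5)[OF b a]] wb_E(8)[OF M a b] ..
  qed
qed

lemma stateD:
  assumes "\<tau> \<in> tracial_states A"
  shows "a \<notin> carrier A \<Longrightarrow> \<tau> a = 0"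
    "a \<in> carrier A \<Longrightarrow> b \<in> carrier A \<Longrightarrow> \<tau> (a \<oplus>\<^bsub>A\<^esub> b) = \<tau> a + \<tau> b"
    "a \<in> carrier A \<Longrightarrow> \<tau> (c \<odot>\<^bsub>A\<^esub> a) = c * \<tau> a"
    "a \<in> carrier A \<Longrightarrow> \<tau> (star A a \<otimes>\<^bsub>A\<^esub> a) \<in> \<real>\<^sub>\<ge>\<^sub>0"
    "\<tau> \<one>\<^bsub>A\<^esub> = 1"
    "a \<in> carrier A \<Longrightarrow> b \<in> carrier A \<Longrightarrow> \<tau> (a \<otimes>\<^bsub>A\<^esub> b) = \<tau> (b \<otimes>\<^bsub>A\<^esub> a)"
  using assms unfolding tracial_states_def by simp_all

lemma stateI:
  assumes "\<And>a. a \<notin> carrier A \<Longrightarrow> \<tau> a = 0"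
    "\<And>a b. a \<in> carrier A \<Longrightarrow> b \<in> carrier A \<Longrightarrow> \<tau> (a \<oplus>\<^bsub>A\<^esub> b) = \<tau> a + \<tau> b"
    "\<And>a c. a \<in> carrier A \<Longrightarrow> \<tau> (c \<odot>\<^bsub>A\<^esub> a) = c * \<tau> a"
    "\<And>a. a \<in> carrier A \<Longrightarrow> \<tau> (star A a \<otimes>\<^bsub>A\<^esub> a) \<in> \<real>\<^sub>\<ge>\<^sub>0"
    "\<tau> \<one>\<^bsub>A\<^esub> = 1"
    "\<And>a b. a \<in> carrier A \<Longrightarrow> b \<in> carrier A \<Longrightarrow> \<tau> (a \<otimes>\<^bsub>A\<^esub> b) = \<tau> (b \<otimes>\<^bsub>A\<^esub> a)"
  shows "\<tau> \<in> tracial_states A"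
  using assms unfolding tracial_states_def by simp

lemma mix_state:
  assumes s: "\<sigma> \<in> tracial_states A" and r: "\<rho> \<in> tracial_states A" and t: "0 \<le> t" "t \<le> 1"
  shows "mix t \<sigma> \<rho> \<in> tracial_states A"
proof (rule stateI)
  fix a assume a: "a \<in> carrier A"
  have "complex_of_real t \<in> \<real>\<^sub>\<ge>\<^sub>0" "complex_of_real (1 - t) \<in> \<real>\<^sub>\<ge>\<^sub>0"
    using t by (simp_all only: nonneg_Reals_of_real_iff diff_ge_0_iff_ge)
  then show "mix t \<sigma> \<rho> (star A a \<otimes>\<^bsub>A\<^esub> a) \<in> \<real>\<^sub>\<ge>\<^sub>0"
    unfolding mix_def by (intro nonneg_Reals_add_I nonneg_Reals_mult_I stateD(4)[OF s a] stateD(4)[OF r a])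
qed (simp_all add: mix_def stateD[OF s] stateD[OF r] algebra_simps)

text \<open>If every tracial state is an integral of \<open>E\<close>, then the set of integrals is
  the whole space of tracial states, which is a closed face of itself.\<close>

lemma factorial_bundleI:
  assumes M: "wstar_bundle M"
    and sub: "\<And>\<tau>. \<tau> \<in> tracial_states (bundle_alg M) \<Longrightarrow> \<exists>\<mu>\<in>regular_prob_measures (base_space M). \<tau> = bundle_trace M \<mu>"
  shows "factorial_bundle M"
proof -
  have eq: "bundle_trace M ` regular_prob_measures (base_space M) = tracial_states (bundle_alg M)"
    using bundle_trace_state[OF M] sub by auto
  have "is_face (tracial_states (bundle_alg M)) (tracial_states (bundle_alg M))"
    unfolding is_face_def using mix_state by auto
  then show ?thesis
    unfolding factorial_bundle_def Let_def eq by simp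
qed

subsection \<open>The matrix bundles are factorial\<close>

text \<open>The \<open>s i\<close> are odd, thus sections of the line bundle, and the sum of their
  squares is 1, so they have no common zero. Their number \<open>m\<close> is fixed for one cover
  but has no uniform bound along a sequence of covers.\<close>

locale sphere_cover = double_cover S K q \<theta>
  for S :: "'s::t2_space set" and K :: "'k::polish_space set" and q :: "'s \<Rightarrow> 'k" and \<theta> :: "'s \<Rightarrow> 's" +
  fixes s :: "nat \<Rightarrow> 's \<Rightarrow> real" and m :: nat
  assumes s_cont: "i < m \<Longrightarrow> continuous_on S (s i)"
    and s_odd: "i < m \<Longrightarrow> x \<in> S \<Longrightarrow> s i (\<theta> x) = - s i x"
    and s_one: "x \<in> S \<Longrightarrow> (\<Sum>i<m. (s i x)\<^sup>2) = 1"
begin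

text \<open>Sections of the \<open>p\<close>-th tensor power of the complexified line bundle, so
  only the parity of \<open>p\<close> matters. Entry \<open>(i, j)\<close> of an element of
  \<open>alg\<close> belongs to \<open>sec (i + j)\<close>.\<close>

definition sec :: "nat \<Rightarrow> ('s \<Rightarrow> complex) set" where
  "sec p = {f. continuous_on S f \<and> (\<forall>x. x \<notin> S \<longrightarrow> f x = 0) \<and> (\<forall>x\<in>S. f (\<theta> x) = (-1) ^ p * f x)}"

definition unit :: "nat \<Rightarrow> nat \<Rightarrow> ('s \<Rightarrow> complex) \<Rightarrow> 's \<Rightarrow> nat \<Rightarrow> nat \<Rightarrow> complex" where
  "unit i j f = (\<lambda>x i' j'. if i' = i \<and> j' = j then f x else 0)"

lemma unit_carrier:
  assumes "f \<in> sec (i + j)" "i < 2" "j < 2"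
  shows "unit i j f \<in> carrier alg"
proof (rule algI)
  show "continuous_on S (\<lambda>x. unit i j f x i' j')" for i' j'
    using assms(1) by (cases "i' = i \<and> j' = j") (auto simp: unit_def sec_def)
qed (use assms in \<open>auto simp: unit_def sec_def\<close>)

lemma entry_sec: "a \<in> carrier alg \<Longrightarrow> (\<lambda>x. a x i j) \<in> sec (i + j)"
  using algD[of a] by (simp add: sec_def)

lemma sec_add: "f \<in> sec p \<Longrightarrow> g \<in> sec p \<Longrightarrow> (\<lambda>x. f x + g x) \<in> sec p"
  by (auto simp: sec_def algebra_simps intro!: continuous_intros)

lemma sec_smult: "f \<in> sec p \<Longrightarrow> (\<lambda>x. c * f x) \<in> sec p"
  by (auto simp: sec_def intro!: continuous_intros)

lemma sec_real: "i < m \<Longrightarrow> (\<lambda>x. if x \<in> S then complex_of_real (s i x) else 0) \<in> sec 1"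
  using continuous_on_cong[OF refl, of S "\<lambda>x. if x \<in> S then complex_of_real (s i x) else 0" "\<lambda>x. complex_of_real (s i x)"]
    s_cont[of i] s_odd[of i] by (auto simp: sec_def \<theta>S intro!: continuous_intros)

lemma sec_mult: "f \<in> sec p \<Longrightarrow> g \<in> sec r \<Longrightarrow> (\<lambda>x. f x * g x) \<in> sec (p + r)"
  by (auto simp: sec_def power_add intro!: continuous_intros)

lemma sec_cong: "p mod 2 = r mod 2 \<Longrightarrow> sec p = sec r"
  unfolding sec_def by (auto simp: minus_one_power_iff even_iff_mod_2_eq_zero)

context
  fixes \<tau> assumes \<tau>: "\<tau> \<in> tracial_states alg"
begin

lemma \<tau>_unit_add:
  assumes "f \<in> sec (i + j)" "g \<in> sec (i + j)" "i < 2" "j < 2"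
  shows "\<tau> (unit i j (\<lambda>x. f x + g x)) = \<tau> (unit i j f) + \<tau> (unit i j g)"
proof -
  have "unit i j (\<lambda>x. f x + g x) = unit i j f \<oplus>\<^bsub>alg\<^esub> unit i j g" by (auto simp: unit_def fun_eq_iff)
  then show ?thesis using stateD(2)[OF \<tau> unit_carrier unit_carrier] assms by simp
qed

lemma \<tau>_zero: "\<tau> (\<lambda>x i j. 0) = 0"
proof -
  have "(\<lambda>x i j. 0) \<in> carrier alg" by (rule algI) auto
  from stateD(3)[OF \<tau> this, of 0] show ?thesis by simp
qed

text \<open>The off-diagonal unit is reproduced by multiplication with the diagonal projection on
  one side and annihilated on the other, and a trace does not distinguish the sides.\<close>

lemma \<tau>_off_diagonal:
  assumes f: "f \<in> sec 1"
  shows "\<tau> (unit 0 1 f) = 0" "\<tau> (unit 1 0 f) = 0"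
proof -
  have "(\<lambda>x. if x \<in> S then 1 else 0) \<in> sec (0 + 0)"
    using continuous_on_cong[OF refl, of S "\<lambda>x. if x \<in> S then 1 else 0::complex" "\<lambda>x. 1"] by (simp add: sec_def \<theta>S)
  then have p: "unit 0 0 (\<lambda>x. if x \<in> S then 1 else 0) \<in> carrier alg" (is "?p \<in> _") by (rule unit_carrier) simp_all
  have z: "x \<notin> S \<Longrightarrow> f x = 0" for x using f by (simp add: sec_def)
  have u: "unit 0 1 f \<in> carrier alg" "unit 1 0 f \<in> carrier alg" using f by (auto intro!: unit_carrier)
  have "unit 0 1 f = ?p \<otimes>\<^bsub>alg\<^esub> unit 0 1 f" "unit 0 1 f \<otimes>\<^bsub>alg\<^esub> ?p = (\<lambda>x i j. 0)"
    by (auto simp: unit_def mmul_def fun_eq_iff z)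
  then show "\<tau> (unit 0 1 f) = 0" using stateD(6)[OF \<tau> p u(1)] \<tau>_zero by metis
  have "unit 1 0 f = unit 1 0 f \<otimes>\<^bsub>alg\<^esub> ?p" "?p \<otimes>\<^bsub>alg\<^esub> unit 1 0 f = (\<lambda>x i j. 0)"
    by (auto simp: unit_def mmul_def fun_eq_iff z)
  then show "\<tau> (unit 1 0 f) = 0" using stateD(6)[OF \<tau> u(2) p] \<tau>_zero by metis
qed

text \<open>The two diagonal corners are exchanged by the commutators of the odd functions \<open>s i\<close>.\<close>

lemma \<tau>_diagonal:
  assumes g: "g \<in> sec 0"
  shows "\<tau> (unit 0 0 g) = \<tau> (unit 1 1 g)"
proof -
  define w where "w i x = (if x \<in> S then complex_of_real (s i x) else 0)" for i x
  have wg: "(\<lambda>x. w i x * (w i x * g x)) \<in> sec 0" if "i < m" for i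
    using sec_mult[OF sec_real[OF that] sec_mult[OF sec_real[OF that] g]] sec_cong[of "1 + (1 + 0)" 0] by (simp add: w_def)
  have step: "\<tau> (unit 0 0 (\<lambda>x. w i x * (w i x * g x))) = \<tau> (unit 1 1 (\<lambda>x. w i x * (w i x * g x)))" if i: "i < m" for i
  proof -
    have "(\<lambda>x. w i x * g x) \<in> sec (1 + 0)" unfolding w_def by (rule sec_mult[OF sec_real[OF i] g])
    then have X: "unit 0 1 (\<lambda>x. w i x * g x) \<in> carrier alg" by (intro unit_carrier) simp_all
    have Y: "unit 1 0 (w i) \<in> carrier alg" using sec_real[OF i] by (intro unit_carrier) (simp_all add: w_def[abs_def])
    have "unit 0 1 (\<lambda>x. w i x * g x) \<otimes>\<^bsub>alg\<^esub> unit 1 0 (w i) = unit 0 0 (\<lambda>x. w i x * (w i x * g x))"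
      "unit 1 0 (w i) \<otimes>\<^bsub>alg\<^esub> unit 0 1 (\<lambda>x. w i x * g x) = unit 1 1 (\<lambda>x. w i x * (w i x * g x))"
      by (auto simp: unit_def mmul_def fun_eq_iff)
    then show ?thesis using stateD(6)[OF \<tau> X Y] by simp
  qed
  \<comment> \<open>Partial sums of \<open>(s i)\<^sup>2 * g\<close>: additivity of
    \<open>\<tau>\<close> extends the exchange from one index to all, and the full sum is
    \<open>g\<close>.\<close>
  define F where "F n x = (\<Sum>i<n. w i x * (w i x * g x))" for n x
  have F: "F n \<in> sec 0 \<and> \<tau> (unit 0 0 (F n)) = \<tau> (unit 1 1 (F n))" if "n \<le> m" for n
    using that
  proof (induction n)
    case 0
    have "unit i j (F 0) = (\<lambda>x i j. 0)" for i j by (auto simp: unit_def F_def fun_eq_iff)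
    moreover have "F 0 \<in> sec 0" by (simp add: F_def[abs_def] sec_def)
    ultimately show ?case by simp
  next
    case (Suc n)
    have eq: "F (Suc n) = (\<lambda>x. F n x + w n x * (w n x * g x))" by (simp add: F_def fun_eq_iff)
    have s2: "sec (1 + 1) = sec 0" by (rule sec_cong) simp
    have F: "F n \<in> sec 0" and eqn: "\<tau> (unit 0 0 (F n)) = \<tau> (unit 1 1 (F n))" using Suc by auto
    have wn: "(\<lambda>x. w n x * (w n x * g x)) \<in> sec 0" using wg[of n] Suc.prems by simp
    have "\<tau> (unit 0 0 (F (Suc n))) = \<tau> (unit 0 0 (F n)) + \<tau> (unit 0 0 (\<lambda>x. w n x * (w n x * g x)))"
      unfolding eq by (rule \<tau>_unit_add) (use F wn in simp_all)
    moreover have "\<tau> (unit 1 1 (F (Suc n))) = \<tau> (unit 1 1 (F n)) + \<tau> (unit 1 1 (\<lambda>x. w n x * (w n x * g x)))"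
      unfolding eq by (rule \<tau>_unit_add) (use F wn s2 in simp_all)
    moreover have "F (Suc n) \<in> sec 0" unfolding eq by (rule sec_add[OF F wn])
    ultimately show ?case using eqn step[of n] Suc.prems by simp
  qed
  have "F m = g"
  proof
    fix x
    show "F m x = g x"
    proof (cases "x \<in> S")
      case True
      have "F m x = (\<Sum>i<m. complex_of_real ((s i x)\<^sup>2)) * g x"
        using True by (simp add: F_def w_def power2_eq_square sum_distrib_right mult.assoc)
      also have "(\<Sum>i<m. complex_of_real ((s i x)\<^sup>2)) = 1"
        using s_one[OF True] by (metis of_real_1 of_real_sum)
      finally show ?thesis by simp
    next
      case False
      then show ?thesis using g by (simp add: F_def w_def sec_def)
    qed
  qed
  then show ?thesis using F[of m] by simp
qed

lemma \<tau>_expect: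
  assumes a: "a \<in> carrier alg"
  shows "\<tau> a = \<tau> (embed mbundle (expect mbundle a))"
proof -
  have s2: "sec (1 + 1) = sec 0" by (rule sec_cong) simp
  let ?u = "\<lambda>i j. unit i j (\<lambda>x. a x i j)"
  have sec: "(\<lambda>x. a x 0 0) \<in> sec 0" "(\<lambda>x. a x 1 1) \<in> sec 0" "(\<lambda>x. a x 0 1) \<in> sec 1" "(\<lambda>x. a x 1 0) \<in> sec 1"
    using entry_sec[OF a, of 0 0] entry_sec[OF a, of 1 1] entry_sec[OF a, of 0 1] entry_sec[OF a, of 1 0] s2 by simp_all
  have half: "(\<lambda>x. (1/2) * (a x 0 0 + a x 1 1)) \<in> sec 0"
    by (rule sec_smult[OF sec_add[OF sec(1,2)]])
  have c: "?u 0 0 \<in> carrier alg" "?u 1 1 \<in> carrier alg" "?u 0 1 \<in> carrier alg" "?u 1 0 \<in> carrier alg"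
    by (rule unit_carrier[OF entry_sec[OF a]]; simp)+
  have i2: "i = 0 \<or> i = 1 \<or> 2 \<le> i" for i :: nat by linarith
  have dec: "a = ((?u 0 0 \<oplus>\<^bsub>alg\<^esub> ?u 1 1) \<oplus>\<^bsub>alg\<^esub> ?u 0 1) \<oplus>\<^bsub>alg\<^esub> ?u 1 0"
  proof (intro ext)
    fix x i j
    show "a x i j = (((?u 0 0 \<oplus>\<^bsub>alg\<^esub> ?u 1 1) \<oplus>\<^bsub>alg\<^esub> ?u 0 1) \<oplus>\<^bsub>alg\<^esub> ?u 1 0) x i j"
      using i2[of i] i2[of j] algD(2)[OF a, of x i j] by (auto simp: unit_def)
  qed
  note cl = ring.ring_simprules(1)[OF ring_alg]
  have "\<tau> a = \<tau> (?u 0 0) + \<tau> (?u 1 1) + \<tau> (?u 0 1) + \<tau> (?u 1 0)"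
    by (subst dec) (simp only: stateD(2)[OF \<tau>] cl c)
  also have "\<dots> = \<tau> (unit 0 0 (\<lambda>x. a x 0 0)) + \<tau> (unit 0 0 (\<lambda>x. a x 1 1))"
    using \<tau>_off_diagonal(1)[OF sec(3)] \<tau>_off_diagonal(2)[OF sec(4)] \<tau>_diagonal[OF sec(2)] by simp
  also have "\<dots> = \<tau> (unit 0 0 (\<lambda>x. a x 0 0 + a x 1 1))"
    using \<tau>_unit_add[of "\<lambda>x. a x 0 0" 0 0 "\<lambda>x. a x 1 1"] sec by simp
  \<comment> \<open>The sum of the diagonal entries is split into two equal halves; one of them is
    moved to the other corner, which produces the scalar matrix with the expectation on its
    diagonal.\<close>
  also have "\<dots> = \<tau> (unit 0 0 (\<lambda>x. (1/2) * (a x 0 0 + a x 1 1) + (1/2) * (a x 0 0 + a x 1 1)))" by simp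
  also have "\<dots> = \<tau> (unit 0 0 (\<lambda>x. (1/2) * (a x 0 0 + a x 1 1))) + \<tau> (unit 0 0 (\<lambda>x. (1/2) * (a x 0 0 + a x 1 1)))"
    by (rule \<tau>_unit_add[where i=0 and j=0]) (simp_all only: add_0 half)
  also have "\<dots> = \<tau> (unit 0 0 (\<lambda>x. (1/2) * (a x 0 0 + a x 1 1))) + \<tau> (unit 1 1 (\<lambda>x. (1/2) * (a x 0 0 + a x 1 1)))"
    by (simp only: \<tau>_diagonal[OF half])
  also have "\<dots> = \<tau> (unit 0 0 (\<lambda>x. (1/2) * (a x 0 0 + a x 1 1)) \<oplus>\<^bsub>alg\<^esub> unit 1 1 (\<lambda>x. (1/2) * (a x 0 0 + a x 1 1)))"
    by (rule stateD(2)[OF \<tau>, symmetric]; rule unit_carrier) (simp_all only: add_0 s2 half)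
  also have "unit 0 0 (\<lambda>x. (1/2) * (a x 0 0 + a x 1 1)) \<oplus>\<^bsub>alg\<^esub> unit 1 1 (\<lambda>x. (1/2) * (a x 0 0 + a x 1 1))
     = embed mbundle (expect mbundle a)"
  proof (intro ext)
    fix x i j
    show "(unit 0 0 (\<lambda>x. (1/2) * (a x 0 0 + a x 1 1)) \<oplus>\<^bsub>alg\<^esub> unit 1 1 (\<lambda>x. (1/2) * (a x 0 0 + a x 1 1))) x i j
     = embed mbundle (expect mbundle a) x i j"
      using i2[of i] i2[of j] algD(2)[OF a, of x] E_q[OF a, of x]
      by (cases "x \<in> S") (auto simp: unit_def simp del: mbundle_simps(4))
  qed
  finally show ?thesis .
qed

definition remb :: "('k \<Rightarrow> real) \<Rightarrow> 's \<Rightarrow> nat \<Rightarrow> nat \<Rightarrow> complex" where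
  "remb f = embed mbundle (\<lambda>k. if k \<in> K then complex_of_real (f k) else 0)"

lemma real_cfun: "continuous_on K f \<Longrightarrow> (\<lambda>k. if k \<in> K then complex_of_real (f k) else 0) \<in> carrier (cfun_algebra (top_of_set K))"
  using continuous_on_cong[OF refl, of K "\<lambda>k. if k \<in> K then complex_of_real (f k) else 0" "\<lambda>k. complex_of_real (f k)"]
  by (simp add: carrier_cfun continuous_intros)

lemma remb_carrier: "continuous_on K f \<Longrightarrow> remb f \<in> carrier alg"
  unfolding remb_def by (rule emb_closed[OF real_cfun])

lemma q_in: "x \<in> S \<Longrightarrow> q x \<in> K"
  unfolding Kq by (rule imageI)

lemma remb_add: "remb (\<lambda>k. f k + g k) = remb f \<oplus>\<^bsub>alg\<^esub> remb g"
  by (auto simp: remb_def fun_eq_iff q_in)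

lemma remb_scale: "remb (\<lambda>k. c * f k) = complex_of_real c \<odot>\<^bsub>alg\<^esub> remb f"
  by (auto simp: remb_def fun_eq_iff q_in)

lemma remb_one: "remb (\<lambda>k. 1) = \<one>\<^bsub>alg\<^esub>"
  by (auto simp: remb_def fun_eq_iff q_in)

lemma \<tau>_nonneg:
  assumes f: "continuous_on K f" and f0: "\<And>k. k \<in> K \<Longrightarrow> 0 \<le> f k"
  shows "\<tau> (remb f) \<in> \<real>\<^sub>\<ge>\<^sub>0"
proof -
  have r: "remb (\<lambda>k. sqrt (f k)) \<in> carrier alg"
    by (rule remb_carrier) (intro continuous_intros f)
  have "remb f = star alg (remb (\<lambda>k. sqrt (f k))) \<otimes>\<^bsub>alg\<^esub> remb (\<lambda>k. sqrt (f k))"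
  proof (intro ext)
    fix x and i j :: nat
    have "complex_of_real (sqrt (f (q x))) * complex_of_real (sqrt (f (q x))) = complex_of_real (f (q x))" if "x \<in> S"
      using f0[OF q_in[OF that]] by (simp flip: of_real_mult)
    moreover have "i = 0 \<or> i = 1 \<or> 2 \<le> i" by linarith
    ultimately show "remb f x i j = (star alg (remb (\<lambda>k. sqrt (f k))) \<otimes>\<^bsub>alg\<^esub> remb (\<lambda>k. sqrt (f k))) x i j"
      by (auto simp: remb_def mmul_def mstar_def q_in)
  qed
  then show ?thesis using stateD(4)[OF \<tau> r] by simp
qed

text \<open>Adding a large constant makes \<open>f\<close> nonnegative, so \<open>\<tau>\<close>
  takes a nonnegative value minus a real constant. The constant is written \<open>B * 1\<close> so
  that \<open>remb_scale\<close> and \<open>remb_one\<close> can evaluate it.\<close>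

lemma \<tau>_real:
  assumes f: "continuous_on K f"
  shows "\<tau> (remb f) = complex_of_real (Re (\<tau> (remb f)))"
proof -
  obtain B where B: "\<And>k. k \<in> K \<Longrightarrow> \<bar>f k\<bar> \<le> B"
    using compact_imp_bounded[OF compact_continuous_image[OF f compact_K]] unfolding bounded_iff by auto
  have "\<tau> (remb (\<lambda>k. f k + B * 1)) \<in> \<real>\<^sub>\<ge>\<^sub>0"
  proof (rule \<tau>_nonneg)
    show "0 \<le> f k + B * 1" if "k \<in> K" for k using B[OF that] by linarith
  qed (intro continuous_intros f)
  moreover have "\<tau> (remb (\<lambda>k. f k + B * 1)) = \<tau> (remb f) + complex_of_real B"
  proof -
    have c1: "continuous_on K (\<lambda>k. 1::real)" "continuous_on K (\<lambda>k. B * 1)" by simp_all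
    show ?thesis
      using stateD(2)[OF \<tau> remb_carrier[OF f] remb_carrier[OF c1(2)]] stateD(3)[OF \<tau> remb_carrier[OF c1(1)], of "complex_of_real B"]
        remb_scale[of B "\<lambda>k. 1"] remb_add[of f "\<lambda>k. B * 1"] stateD(5)[OF \<tau>] by (simp only: remb_one mult_1_right)
  qed
  ultimately have "Im (\<tau> (remb f)) = 0" by (simp add: complex_nonneg_Reals_iff)
  then show ?thesis by (simp add: complex_eq_iff)
qed

text \<open>Restricted to the embedded real functions, \<open>\<tau>\<close> is a positive
  functional, hence an integral. Complex functions follow by real and imaginary parts, and general
  elements because \<open>\<tau>\<close> factors through \<open>E\<close>.\<close>

lemma \<tau>_represented:
  "\<exists>\<mu>\<in>regular_prob_measures (base_space mbundle). \<tau> = bundle_trace mbundle \<mu>"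
proof -
  have "positive_functional K (\<lambda>f. Re (\<tau> (remb f)))"
  proof
    show "compact K" by (rule compact_K)
    show "Re (\<tau> (remb (\<lambda>x. 1))) = 1" using stateD(5)[OF \<tau>] by (simp add: remb_one)
    fix f :: "'k \<Rightarrow> real" assume f: "continuous_on K f"
    show "Re (\<tau> (remb (\<lambda>x. c * f x))) = c * Re (\<tau> (remb f))" for c
      unfolding remb_scale stateD(3)[OF \<tau> remb_carrier[OF f]] by simp
    show "0 \<le> Re (\<tau> (remb f))" if "\<And>x. x \<in> K \<Longrightarrow> 0 \<le> f x"
      using \<tau>_nonneg[OF f that] by (simp add: complex_nonneg_Reals_iff)
    fix g :: "'k \<Rightarrow> real" assume g: "continuous_on K g"
    show "Re (\<tau> (remb (\<lambda>x. f x + g x))) = Re (\<tau> (remb f)) + Re (\<tau> (remb g))"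
      unfolding remb_add stateD(2)[OF \<tau> remb_carrier[OF f] remb_carrier[OF g]] by simp
  qed
  from Riesz_representation[OF this]
  obtain \<mu> where \<mu>: "\<mu> \<in> regular_prob_measures (top_of_set K)"
    and int: "\<And>f. continuous_on K f \<Longrightarrow> (LINT x|\<mu>. f x) = Re (\<tau> (remb f))" by blast
  have cK: "compact_space (top_of_set K)" using compact_K by (simp add: compact_space_subtopology)
  have emb: "\<tau> (embed mbundle F) = (LINT x|\<mu>. F x)" if F: "F \<in> carrier (cfun_algebra (top_of_set K))" for F
  proof -
    have Fc: "continuous_on K F" using F by (simp add: carrier_cfun)
    have rc: "continuous_on K (\<lambda>k. Re (F k))" "continuous_on K (\<lambda>k. Im (F k))"
      by (intro continuous_intros Fc)+
    have "embed mbundle F = remb (\<lambda>k. Re (F k)) \<oplus>\<^bsub>alg\<^esub> (\<i> \<odot>\<^bsub>alg\<^esub> remb (\<lambda>k. Im (F k)))"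
      by (auto simp: remb_def fun_eq_iff q_in complex_eq_iff)
    then have "\<tau> (embed mbundle F) = \<tau> (remb (\<lambda>k. Re (F k))) + \<i> * \<tau> (remb (\<lambda>k. Im (F k)))"
      using stateD(2)[OF \<tau> remb_carrier[OF rc(1)] cstar_algebra.csmult_closed[OF cstar_alg remb_carrier[OF rc(2)]], of \<i>]
        stateD(3)[OF \<tau> remb_carrier[OF rc(2)], of \<i>] by (simp only:)
    also have "\<dots> = complex_of_real (LINT x|\<mu>. Re (F x)) + \<i> * complex_of_real (LINT x|\<mu>. Im (F x))"
      using \<tau>_real[OF rc(1)] \<tau>_real[OF rc(2)] by (simp only: int[OF rc(1)] int[OF rc(2)])
    also have "\<dots> = (LINT x|\<mu>. F x)"
      using integral_Re[OF regular_integrable[OF \<mu> cK F]] integral_Im[OF regular_integrable[OF \<mu> cK F]]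
      by (simp add: complex_eq_iff)
    finally show ?thesis .
  qed
  have "\<tau> = bundle_trace mbundle \<mu>"
  proof
    fix a show "\<tau> a = bundle_trace mbundle \<mu> a"
    proof (cases "a \<in> carrier alg")
      case True
      then show ?thesis
        using \<tau>_expect[OF True] emb[OF E_closed[OF True]] by (simp add: bundle_trace_def del: mbundle_simps(3,4))
    next
      case False
      then show ?thesis using stateD(1)[OF \<tau> False] by (simp add: bundle_trace_def)
    qed
  qed
  then show ?thesis using \<mu> by auto
qed

end

theorem factorial_mbundle: "factorial_bundle mbundle"
  by (rule factorial_bundleI[OF wstar_mbundle]) (simp only: mbundle_simps(1) \<tau>_represented)

end

section \<open>A criterion for failing to be factorial\<close>

definition point_mass :: "'k topology \<Rightarrow> 'k \<Rightarrow> 'k measure" where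
  "point_mass X h = return (sigma (topspace X) {V. openin X V}) h"

text \<open>Singletons are compact and their complements open. If \<open>h\<close> lies in
  \<open>B\<close>, the set \<open>{h}\<close> attains the inner supremum; otherwise the complement
  of \<open>h\<close> attains the outer infimum.\<close>

lemma point_mass_regular:
  assumes X: "Hausdorff_space X" and h: "h \<in> topspace X"
  shows "point_mass X h \<in> regular_prob_measures X"
proof -
  let ?\<mu> = "point_mass X h"
  have sub: "{V. openin X V} \<subseteq> Pow (topspace X)" using openin_subset by blast
  have sp: "space ?\<mu> = topspace X" by (simp add: point_mass_def space_measure_of[OF sub])
  have st: "sets ?\<mu> = sigma_sets (topspace X) {V. openin X V}"
    by (simp add: point_mass_def sets_measure_of[OF sub])
  have op: "openin X (topspace X - {h})"
    using closedin_Hausdorff_singleton[OF X h] by blast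
  have V: "V \<in> sets ?\<mu>" if "openin X V" for V
    unfolding st by (rule sigma_sets.Basic) (simp add: that)
  have "topspace X - (topspace X - {h}) \<in> sets ?\<mu>"
    unfolding st by (rule sigma_sets.Compl, rule sigma_sets.Basic) (simp add: op)
  moreover have "topspace X - (topspace X - {h}) = {h}" using h by blast
  ultimately have sing: "{h} \<in> sets ?\<mu>" by simp
  have em: "emeasure ?\<mu> B = indicator B h" if "B \<in> sets ?\<mu>" for B
    using emeasure_return[of B "sigma (topspace X) {V. openin X V}" h] that by (simp add: point_mass_def)
  show ?thesis
    unfolding regular_prob_measures_def mem_Collect_eq
  proof (intro conjI ballI)
    show "prob_space ?\<mu>" unfolding point_mass_def
      by (rule prob_space_return) (simp add: space_measure_of[OF sub] h)
    show "space ?\<mu> = topspace X" by (rule sp)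
    show "sets ?\<mu> = sigma_sets (topspace X) {V. openin X V}" by (rule st)
    fix B assume B: "B \<in> sets ?\<mu>"
    have BX: "B \<subseteq> topspace X" using sets.sets_into_space[OF B] sp by simp
    let ?L = "{L. L \<subseteq> B \<and> compactin X L \<and> L \<in> sets ?\<mu>}"
    show "emeasure ?\<mu> B = (SUP L\<in>?L. emeasure ?\<mu> L)"
    proof (rule antisym)
      show "(SUP L\<in>?L. emeasure ?\<mu> L) \<le> emeasure ?\<mu> B"
        by (rule SUP_least) (use emeasure_mono[OF _ B] in blast)
      show "emeasure ?\<mu> B \<le> (SUP L\<in>?L. emeasure ?\<mu> L)"
      proof (cases "h \<in> B")
        case True
        then have "{h} \<in> ?L" using sing h by simp
        then have "emeasure ?\<mu> {h} \<le> (SUP L\<in>?L. emeasure ?\<mu> L)" by (rule SUP_upper)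
        then show ?thesis using True em[OF B] em[OF sing] by simp
      qed (simp add: em[OF B])
    qed
    let ?V = "{V. B \<subseteq> V \<and> openin X V}"
    show "emeasure ?\<mu> B = (INF V\<in>?V. emeasure ?\<mu> V)"
    proof (rule antisym)
      show "emeasure ?\<mu> B \<le> (INF V\<in>?V. emeasure ?\<mu> V)"
        by (rule INF_greatest) (use emeasure_mono[OF _ V] in blast)
      show "(INF V\<in>?V. emeasure ?\<mu> V) \<le> emeasure ?\<mu> B"
      proof (cases "h \<in> B")
        case True
        have "(INF V\<in>?V. emeasure ?\<mu> V) \<le> emeasure ?\<mu> (topspace X)" by (rule INF_lower) (simp add: BX)
        also have "\<dots> \<le> 1" using em[OF V[OF openin_topspace]] by (simp add: indicator_def)
        finally show ?thesis using True em[OF B] by simp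
      next
        case False
        have "(INF V\<in>?V. emeasure ?\<mu> V) \<le> emeasure ?\<mu> (topspace X - {h})"
          by (rule INF_lower) (use BX False op in auto)
        then show ?thesis using em[OF V[OF op]] by simp
      qed
    qed
  qed
qed

lemma bundle_trace_point_mass:
  assumes M: "wstar_bundle M" and h: "h \<in> topspace (base_space M)" and a: "a \<in> carrier (bundle_alg M)"
  shows "bundle_trace M (point_mass (base_space M) h) a = expect M a h"
proof -
  let ?\<mu> = "point_mass (base_space M) h"
  have \<mu>: "?\<mu> \<in> regular_prob_measures (base_space M)" by (rule point_mass_regular[OF wb_space(2)[OF M] h])
  have "expect M a \<in> borel_measurable ?\<mu>"
    using regular_measurable[OF \<mu>, of "expect M a"] wb_E(1)[OF M a] by (simp add: carrier_cfun)
  then have me: "expect M a \<in> borel_measurable (sigma (topspace (base_space M)) {V. openin (base_space M) V})"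
    by (simp add: point_mass_def measurable_return1)
  have "{V. openin (base_space M) V} \<subseteq> Pow (topspace (base_space M))" using openin_subset by blast
  then show ?thesis
    unfolding bundle_trace_in[OF a] point_mass_def
    by (intro integral_return me) (simp add: space_measure_of h)
qed

lemma is_faceD:
  assumes "is_face T F" "\<sigma> \<in> T" "\<rho> \<in> T" "0 < t" "t < 1" "mix t \<sigma> \<rho> \<in> F"
  shows "\<sigma> \<in> F"
  using assms unfolding is_face_def by blast

text \<open>Compression to the corner satisfies: \<open>p a b p\<close> is
  \<open>(p a p) (p b p)\<close> plus \<open>(p a r) (r b p)\<close>. The second term has
  expectation 0 at \<open>h\<close> by \<open>off\<close>, so traciality of \<open>E\<close> on
  compressed elements becomes traciality of the functional. The factor 2 normalises
  \<open>E p h = 1 / 2\<close>.\<close>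

lemma corner_state:
  assumes M: "wstar_bundle M" and h: "h \<in> topspace (base_space M)"
    and p: "p \<in> carrier (bundle_alg M)" and r: "r \<in> carrier (bundle_alg M)"
    and pp: "p \<otimes>\<^bsub>bundle_alg M\<^esub> p = p" and rr: "r \<otimes>\<^bsub>bundle_alg M\<^esub> r = r"
    and ps: "star (bundle_alg M) p = p" and pr: "p \<oplus>\<^bsub>bundle_alg M\<^esub> r = \<one>\<^bsub>bundle_alg M\<^esub>"
    and Ep: "expect M p h = 1 / 2"
    and off: "\<And>a b. a \<in> carrier (bundle_alg M) \<Longrightarrow> b \<in> carrier (bundle_alg M) \<Longrightarrow>
      expect M ((p \<otimes>\<^bsub>bundle_alg M\<^esub> a \<otimes>\<^bsub>bundle_alg M\<^esub> r) \<otimes>\<^bsub>bundle_alg M\<^esub> (r \<otimes>\<^bsub>bundle_alg M\<^esub> b \<otimes>\<^bsub>bundle_alg M\<^esub> p)) h = 0"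
  shows "(\<lambda>a. if a \<in> carrier (bundle_alg M)
      then 2 * expect M (p \<otimes>\<^bsub>bundle_alg M\<^esub> a \<otimes>\<^bsub>bundle_alg M\<^esub> p) h else 0) \<in> tracial_states (bundle_alg M)"
    (is "?\<sigma> \<in> _")
proof -
  interpret A: cstar_algebra "bundle_alg M" by (rule wb_cstar[OF M])
  note m = A.A_simps(5)
  note rg = cstar_algebra.axioms(1)[OF wb_cstar[OF M]]
  note assoc = ring.ring_simprules(11)[OF rg] and ld = ring.ring_simprules(13)[OF rg] and rd = ring.ring_simprules(23)[OF rg]
  let ?c = "\<lambda>a. p \<otimes>\<^bsub>bundle_alg M\<^esub> a \<otimes>\<^bsub>bundle_alg M\<^esub> p"
  have c: "?c a \<in> carrier (bundle_alg M)" if "a \<in> carrier (bundle_alg M)" for a by (intro m p that)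
  have split: "expect M (?c (a \<otimes>\<^bsub>bundle_alg M\<^esub> b)) h = expect M (?c a \<otimes>\<^bsub>bundle_alg M\<^esub> ?c b) h"
    if a: "a \<in> carrier (bundle_alg M)" and b: "b \<in> carrier (bundle_alg M)" for a b
  proof -
    let ?d = "(p \<otimes>\<^bsub>bundle_alg M\<^esub> a \<otimes>\<^bsub>bundle_alg M\<^esub> r) \<otimes>\<^bsub>bundle_alg M\<^esub> (r \<otimes>\<^bsub>bundle_alg M\<^esub> b \<otimes>\<^bsub>bundle_alg M\<^esub> p)"
    have d: "?d \<in> carrier (bundle_alg M)" by (intro m p r a b)
    have e1: "(p \<otimes>\<^bsub>bundle_alg M\<^esub> a) \<otimes>\<^bsub>bundle_alg M\<^esub> (p \<oplus>\<^bsub>bundle_alg M\<^esub> r) \<otimes>\<^bsub>bundle_alg M\<^esub> (b \<otimes>\<^bsub>bundle_alg M\<^esub> p)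
      = ?c (a \<otimes>\<^bsub>bundle_alg M\<^esub> b)"
      unfolding pr using p a b by (simp add: assoc)
    have qq: "(p \<otimes>\<^bsub>bundle_alg M\<^esub> a) \<otimes>\<^bsub>bundle_alg M\<^esub> t \<otimes>\<^bsub>bundle_alg M\<^esub> (b \<otimes>\<^bsub>bundle_alg M\<^esub> p)
      = (p \<otimes>\<^bsub>bundle_alg M\<^esub> a \<otimes>\<^bsub>bundle_alg M\<^esub> t) \<otimes>\<^bsub>bundle_alg M\<^esub> (t \<otimes>\<^bsub>bundle_alg M\<^esub> b \<otimes>\<^bsub>bundle_alg M\<^esub> p)"
      if t: "t \<in> carrier (bundle_alg M)" and tt: "t \<otimes>\<^bsub>bundle_alg M\<^esub> t = t" for t
    proof -
      have "t \<otimes>\<^bsub>bundle_alg M\<^esub> (t \<otimes>\<^bsub>bundle_alg M\<^esub> z) = t \<otimes>\<^bsub>bundle_alg M\<^esub> z" if "z \<in> carrier (bundle_alg M)" for z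
        using assoc[OF t t that] tt by simp
      then show ?thesis using p a b t by (simp add: assoc)
    qed
    have e2: "(p \<otimes>\<^bsub>bundle_alg M\<^esub> a) \<otimes>\<^bsub>bundle_alg M\<^esub> (p \<oplus>\<^bsub>bundle_alg M\<^esub> r) \<otimes>\<^bsub>bundle_alg M\<^esub> (b \<otimes>\<^bsub>bundle_alg M\<^esub> p)
      = (?c a \<otimes>\<^bsub>bundle_alg M\<^esub> ?c b) \<oplus>\<^bsub>bundle_alg M\<^esub> ?d"
      unfolding qq[OF p pp, symmetric] qq[OF r rr, symmetric]
      by (simp only: rd[OF p r m[OF p a]] ld[OF m[OF m[OF p a] p] m[OF m[OF p a] r] m[OF b p]])
    have "expect M (?c (a \<otimes>\<^bsub>bundle_alg M\<^esub> b)) = (\<lambda>x. expect M (?c a \<otimes>\<^bsub>bundle_alg M\<^esub> ?c b) x + expect M ?d x)"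
      unfolding e1[symmetric] e2 by (subst wb_E(2)[OF M m[OF c[OF a] c[OF b]] d]) simp
    then show ?thesis using off[OF a b] by simp
  qed
  show ?thesis
  proof (rule stateI)
    fix a b assume a: "a \<in> carrier (bundle_alg M)" and b: "b \<in> carrier (bundle_alg M)"
    have "?c (a \<oplus>\<^bsub>bundle_alg M\<^esub> b) = ?c a \<oplus>\<^bsub>bundle_alg M\<^esub> ?c b"
      by (simp only: rd[OF a b p] ld[OF m[OF p a] m[OF p b] p])
    then have "expect M (?c (a \<oplus>\<^bsub>bundle_alg M\<^esub> b)) = (\<lambda>x. expect M (?c a) x + expect M (?c b) x)"
      using wb_E(2)[OF M c[OF a] c[OF b]] by simp
    then show "?\<sigma> (a \<oplus>\<^bsub>bundle_alg M\<^esub> b) = ?\<sigma> a + ?\<sigma> b"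
      using a b A.A_simps(1)[OF a b] by (simp add: algebra_simps)
    have "expect M (?c a \<otimes>\<^bsub>bundle_alg M\<^esub> ?c b) = expect M (?c b \<otimes>\<^bsub>bundle_alg M\<^esub> ?c a)"
      by (rule wb_E(8)[OF M c[OF a] c[OF b]])
    then show "?\<sigma> (a \<otimes>\<^bsub>bundle_alg M\<^esub> b) = ?\<sigma> (b \<otimes>\<^bsub>bundle_alg M\<^esub> a)"
      using split[OF a b] split[OF b a] m[OF a b] m[OF b a] by simp
  next
    fix a z assume a: "a \<in> carrier (bundle_alg M)"
    have "?c (z \<odot>\<^bsub>bundle_alg M\<^esub> a) = z \<odot>\<^bsub>bundle_alg M\<^esub> ?c a"
      by (simp only: A.smult_mult_right[OF p a] A.smult_mult_left[OF m[OF p a] p])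
    then show "?\<sigma> (z \<odot>\<^bsub>bundle_alg M\<^esub> a) = z * ?\<sigma> a"
      using a A.csmult_closed[OF a, of z] wb_E(3)[OF M c[OF a], of z] by simp
  next
    fix a assume a: "a \<in> carrier (bundle_alg M)"
    have sa: "star (bundle_alg M) a \<in> carrier (bundle_alg M)" by (rule A.star_closed[OF a])
    have "star (bundle_alg M) (a \<otimes>\<^bsub>bundle_alg M\<^esub> p) \<otimes>\<^bsub>bundle_alg M\<^esub> (a \<otimes>\<^bsub>bundle_alg M\<^esub> p)
      = ?c (star (bundle_alg M) a \<otimes>\<^bsub>bundle_alg M\<^esub> a)"
      using a p sa by (simp add: A.star_mult ps assoc)
    then have "expect M (?c (star (bundle_alg M) a \<otimes>\<^bsub>bundle_alg M\<^esub> a)) h \<in> \<real>\<^sub>\<ge>\<^sub>0"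
      using wb_E(4)[OF M m[OF a p] h] by simp
    then show "?\<sigma> (star (bundle_alg M) a \<otimes>\<^bsub>bundle_alg M\<^esub> a) \<in> \<real>\<^sub>\<ge>\<^sub>0"
      using m[OF sa a] nonneg_Reals_mult_I[of 2] by simp
  next
    show "?\<sigma> \<one>\<^bsub>bundle_alg M\<^esub> = 1" using p pp Ep by (simp add: field_simps)
  qed simp
qed

text \<open>The point mass at \<open>h\<close> gives the midpoint of the two corner traces, so a
  face would contain them. But any integral of \<open>E\<close> takes the value 1/2 at
  \<open>p\<close>, since \<open>E p\<close> is constant, whereas the corner trace of
  \<open>p\<close> takes the value 1.\<close>

lemma not_factorial:
  assumes M: "wstar_bundle M" and h: "h \<in> topspace (base_space M)"
    and p: "p \<in> carrier (bundle_alg M)" and r: "r \<in> carrier (bundle_alg M)"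
    and pp: "p \<otimes>\<^bsub>bundle_alg M\<^esub> p = p" and rr: "r \<otimes>\<^bsub>bundle_alg M\<^esub> r = r"
    and ps: "star (bundle_alg M) p = p" and rs: "star (bundle_alg M) r = r"
    and pr: "p \<oplus>\<^bsub>bundle_alg M\<^esub> r = \<one>\<^bsub>bundle_alg M\<^esub>"
    and Ep: "\<And>x. x \<in> topspace (base_space M) \<Longrightarrow> expect M p x = 1 / 2"
    and off: "\<And>a b. a \<in> carrier (bundle_alg M) \<Longrightarrow> b \<in> carrier (bundle_alg M) \<Longrightarrow>
      expect M ((p \<otimes>\<^bsub>bundle_alg M\<^esub> a \<otimes>\<^bsub>bundle_alg M\<^esub> r) \<otimes>\<^bsub>bundle_alg M\<^esub> (r \<otimes>\<^bsub>bundle_alg M\<^esub> b \<otimes>\<^bsub>bundle_alg M\<^esub> p)) h = 0"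
  shows "\<not> factorial_bundle M"
proof
  assume fac: "factorial_bundle M"
  interpret A: cstar_algebra "bundle_alg M" by (rule wb_cstar[OF M])
  note m = A.A_simps(5)
  note rg = cstar_algebra.axioms(1)[OF wb_cstar[OF M]]
  note assoc = ring.ring_simprules(11)[OF rg] and ld = ring.ring_simprules(13)[OF rg] and rd = ring.ring_simprules(23)[OF rg]
  define \<sigma> where "\<sigma> p a = (if a \<in> carrier (bundle_alg M)
      then 2 * expect M (p \<otimes>\<^bsub>bundle_alg M\<^esub> a \<otimes>\<^bsub>bundle_alg M\<^esub> p) h else 0)" for p a
  have Er: "expect M p h + expect M r h = 1"
    using fun_cong[OF wb_E(2)[OF M p r], of h] fun_cong[OF wb_E(9)[OF M], of h] h by (simp add: pr)
  have \<sigma>p: "\<sigma> p \<in> tracial_states (bundle_alg M)"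
    unfolding \<sigma>_def[abs_def] by (rule corner_state[OF M h p r pp rr ps pr Ep[OF h] off])
  have \<sigma>r: "\<sigma> r \<in> tracial_states (bundle_alg M)"
    unfolding \<sigma>_def[abs_def]
  proof (rule corner_state[OF M h r p rr pp rs])
    show "r \<oplus>\<^bsub>bundle_alg M\<^esub> p = \<one>\<^bsub>bundle_alg M\<^esub>" using ring.ring_simprules(10)[OF rg r p] pr by simp
    show "expect M r h = 1 / 2" using Er Ep[OF h] by (simp add: field_simps)
    fix a b assume a: "a \<in> carrier (bundle_alg M)" and b: "b \<in> carrier (bundle_alg M)"
    show "expect M ((r \<otimes>\<^bsub>bundle_alg M\<^esub> a \<otimes>\<^bsub>bundle_alg M\<^esub> p) \<otimes>\<^bsub>bundle_alg M\<^esub> (p \<otimes>\<^bsub>bundle_alg M\<^esub> b \<otimes>\<^bsub>bundle_alg M\<^esub> r)) h = 0"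
      using wb_E(8)[OF M m[OF m[OF r a] p] m[OF m[OF p b] r]] off[OF b a] by simp
  qed
  have "mix (1/2) (\<sigma> p) (\<sigma> r) = bundle_trace M (point_mass (base_space M) h)"
  proof
    fix a
    show "mix (1/2) (\<sigma> p) (\<sigma> r) a = bundle_trace M (point_mass (base_space M) h) a"
    proof (cases "a \<in> carrier (bundle_alg M)")
      case True
      \<comment> \<open>By traciality one of the two outer factors can be moved across and absorbed;
        then the expectations of the two corners add up to that of \<open>a\<close>.\<close>
      have e: "expect M (t \<otimes>\<^bsub>bundle_alg M\<^esub> a \<otimes>\<^bsub>bundle_alg M\<^esub> t) = expect M (t \<otimes>\<^bsub>bundle_alg M\<^esub> a)"
        if t: "t \<in> carrier (bundle_alg M)" and tt: "t \<otimes>\<^bsub>bundle_alg M\<^esub> t = t" for t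
        using wb_E(8)[OF M m[OF t True] t] assoc[OF t t True] tt by simp
      have "p \<otimes>\<^bsub>bundle_alg M\<^esub> a \<oplus>\<^bsub>bundle_alg M\<^esub> r \<otimes>\<^bsub>bundle_alg M\<^esub> a = a"
        using ld[OF p r True] pr True by simp
      then have "expect M a = (\<lambda>x. expect M (p \<otimes>\<^bsub>bundle_alg M\<^esub> a) x + expect M (r \<otimes>\<^bsub>bundle_alg M\<^esub> a) x)"
        using wb_E(2)[OF M m[OF p True] m[OF r True]] by simp
      then show ?thesis
        using True bundle_trace_point_mass[OF M h True]
        by (simp add: mix_def \<sigma>_def e[OF p pp] e[OF r rr])
    qed (simp add: mix_def \<sigma>_def bundle_trace_def)
  qed
  then have "mix (1/2) (\<sigma> p) (\<sigma> r) \<in> bundle_trace M ` regular_prob_measures (base_space M)"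
    using point_mass_regular[OF wb_space(2)[OF M] h] by simp
  moreover have "is_face (tracial_states (bundle_alg M)) (bundle_trace M ` regular_prob_measures (base_space M))"
    using fac by (simp add: factorial_bundle_def Let_def)
  ultimately have "\<sigma> p \<in> bundle_trace M ` regular_prob_measures (base_space M)"
    using is_faceD[OF _ \<sigma>p \<sigma>r, of _ "1/2"] by simp
  then obtain \<mu> where \<mu>: "\<mu> \<in> regular_prob_measures (base_space M)" "\<sigma> p = bundle_trace M \<mu>" by blast
  interpret prob_space \<mu> by (rule regularD(1)[OF \<mu>(1)])
  have "bundle_trace M \<mu> p = (LINT x|\<mu>. 1 / 2)"
    unfolding bundle_trace_in[OF p]
    by (rule Bochner_Integration.integral_cong) (simp_all add: regularD(2)[OF \<mu>(1)] Ep)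
  also have "\<dots> = 1 / 2" using prob_space by simp
  finally have "\<sigma> p p = 1 / 2" using \<mu>(2) by simp
  moreover have "\<sigma> p p = 1" using p pp Ep[OF h] by (simp add: \<sigma>_def field_simps)
  ultimately show False by simp
qed

section \<open>Ultraproducts of matrix bundles without enough sections\<close>

text \<open>The bound \<open>2 * card F\<close> is the number of real odd functions in a family of \<open>card F\<close> complex ones.\<close>

locale cover_sequence = ultra U for U +
  fixes S :: "nat \<Rightarrow> 's::t2_space set" and K :: "nat \<Rightarrow> 'k::t2_space set" and q :: "'s \<Rightarrow> 'k" and \<theta> :: "'s \<Rightarrow> 's"
  assumes cover: "double_cover (S n) (K n) q \<theta>"
    and zeros: "finite F \<Longrightarrow> 2 * card F \<le> n \<Longrightarrow> (\<And>f. f \<in> F \<Longrightarrow> continuous_on (S n) f) \<Longrightarrow>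
      (\<And>f x. f \<in> F \<Longrightarrow> x \<in> S n \<Longrightarrow> f (\<theta> x) = - f x) \<Longrightarrow> \<exists>x\<in>S n. \<forall>f\<in>F. f x = (0 :: complex)"
begin

sublocale D: double_cover "S n" "K n" q \<theta> for n by (rule cover)

lemma space_K: "topspace (base_space (D.mbundle n)) = K n"
  by simp

sublocale wb_ultra U D.mbundle "sqrt 2"
proof unfold_locales
  fix n a
  show "wstar_bundle (D.mbundle n)" by (rule D.wstar_mbundle)
  show "topspace (base_space (D.mbundle n)) \<noteq> {}" by (simp only: space_K) (simp only: D.Kq D.neS image_is_empty not_False_eq_True)
  show "cnorm (bundle_alg (D.mbundle n)) a \<le> sqrt 2 * two_norm (D.mbundle n) a"
    if "a \<in> carrier (bundle_alg (D.mbundle n))"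
    using that D.two_norm_bound[of a n] by (simp del: D.alg_simps)
qed

text \<open>The projections onto the two summands of the bundle, constant in \<open>x\<close>: the
  diagonal matrix units with index \<open>k\<close>. They have no relation to the vertices of
  simplices.\<close>

definition vert :: "nat \<Rightarrow> nat \<Rightarrow> 's \<Rightarrow> nat \<Rightarrow> nat \<Rightarrow> complex" where
  "vert k n = (\<lambda>x i j. if x \<in> S n \<and> i = k \<and> j = k then 1 else 0)"

lemma vert_alg: "k < 2 \<Longrightarrow> vert k n \<in> carrier (D.alg n)"
proof (rule D.algI)
  fix i j
  show "continuous_on (S n) (\<lambda>x. vert k n x i j)"
    using continuous_on_cong[OF refl, of "S n" "\<lambda>x. vert k n x i j" "\<lambda>x. if i = k \<and> j = k then 1 else 0"]
    by (simp add: vert_def)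
qed (auto simp: vert_def D.\<theta>S)

lemma vert_P: "k < 2 \<Longrightarrow> vert k \<in> carrier B.P"
proof (rule B.PI[where B=1])
  fix n assume k: "k < 2"
  show "vert k n \<in> carrier (bundle_alg (D.mbundle n))" using vert_alg[OF k] by simp
  have "mnorm (vert k n x) \<le> 1" for x
  proof (rule mnorm_leI)
    fix z
    have "k = 0 \<or> k = 1" using k by linarith
    then show "norm (mop (vert k n x) z) \<le> 1 * norm z"
      by (cases z) (auto simp: mop_def vert_def norm_Pair intro!: real_sqrt_le_mono)
  qed
  then show "cnorm (bundle_alg (D.mbundle n)) (vert k n) \<le> 1"
    using D.alg_norm_leI[of "vert k n" 1 n] by (simp del: D.alg_simps)
qed

text \<open>The obstruction to multiplicativity of the upper corner. Its only nonzero entry is a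
  product with the entry \<open>(0, 1)\<close> of \<open>a\<close>, a section of the line bundle, as
  a factor.\<close>

definition corner :: "(nat \<Rightarrow> 's \<Rightarrow> nat \<Rightarrow> nat \<Rightarrow> complex) \<Rightarrow> (nat \<Rightarrow> 's \<Rightarrow> nat \<Rightarrow> nat \<Rightarrow> complex)
    \<Rightarrow> nat \<Rightarrow> 's \<Rightarrow> nat \<Rightarrow> nat \<Rightarrow> complex" where
  "corner a b n = (vert 0 n \<otimes>\<^bsub>D.alg n\<^esub> a n \<otimes>\<^bsub>D.alg n\<^esub> vert 1 n) \<otimes>\<^bsub>D.alg n\<^esub>
     (vert 1 n \<otimes>\<^bsub>D.alg n\<^esub> b n \<otimes>\<^bsub>D.alg n\<^esub> vert 0 n)"

lemma corner_entries: "x \<in> S n \<Longrightarrow> corner a b n x i j = (if i = 0 \<and> j = 0 then a n x 0 1 * b n x 1 0 else 0)"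
  by (simp add: corner_def mmul_def vert_def)

lemma corner_P: "a \<in> carrier B.P \<Longrightarrow> b \<in> carrier B.P \<Longrightarrow> corner a b \<in> carrier B.P"
  using B.comp_closed(1)[OF B.comp_closed(1)[OF B.comp_closed(1)[OF vert_P[of 0]] vert_P[of 1]]
      B.comp_closed(1)[OF B.comp_closed(1)[OF vert_P[of 1]] vert_P[of 0]], of a b]
  by (simp add: corner_def[abs_def] del: D.alg_simps)

definition "Ecorner a b = K.C.cls (\<lambda>n. expect (D.mbundle n) (corner a b n))"

text \<open>Each condition is closed in the compact character space, so finitely many suffice. The
  entries \<open>(0, 1)\<close> of finitely many \<open>a\<close> have a common zero
  \<open>x n\<close> for all large \<open>n\<close>, and the limit of evaluations at
  \<open>q (x n)\<close> kills every corner product, whatever \<open>b\<close> is.\<close>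

lemma degenerate_character:
  "\<exists>h\<in>K.charsp. \<forall>a\<in>carrier B.P. \<forall>b\<in>carrier B.P. h (Ecorner a b) = 0"
proof -
  let ?I = "carrier B.P \<times> carrier B.P"
  let ?Z = "\<lambda>ab. {h. h (Ecorner (fst ab) (snd ab)) = (0::complex)}"
  have "K.charsp \<inter> (\<Inter>ab\<in>?I. ?Z ab) \<noteq> {}"
  proof (rule compact_imp_fip_image[OF K.compact_charsp])
    show "closed (?Z ab)" for ab
      by (intro closed_Collect_eq continuous_on_product_coordinates continuous_intros)
    fix I' assume fin: "finite I'" and sub: "I' \<subseteq> ?I"
    let ?F = "\<lambda>n. (\<lambda>ab x. fst ab n x 0 1) ` I'"
    \<comment> \<open>Below \<open>2 * card I'\<close> no common zero is promised and any point
      serves, because a free ultrafilter ignores finitely many \<open>n\<close>.\<close>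
    have ex: "\<exists>x\<in>S n. 2 * card I' \<le> n \<longrightarrow> (\<forall>ab\<in>I'. fst ab n x 0 1 = 0)" for n
    proof (cases "2 * card I' \<le> n")
      case True
      have mem: "a n \<in> carrier (D.alg n)" if "(a, b) \<in> I'" for a b
      proof -
        have "a \<in> carrier B.P" using that sub by blast
        from B.P_comp[OF this, of n] show ?thesis by (simp only: D.mbundle_simps)
      qed
      have "\<exists>x\<in>S n. \<forall>f\<in>?F n. f x = 0"
      proof (rule zeros)
        show "finite (?F n)" using fin by simp
        show "2 * card (?F n) \<le> n" using card_image_le[OF fin, of "\<lambda>ab x. fst ab n x 0 1"] True by linarith
        show "continuous_on (S n) f" if f: "f \<in> ?F n" for f
        proof -
          obtain ab where ab: "ab \<in> I'" "f = (\<lambda>x. fst ab n x 0 1)" using f by blast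
          then have "(fst ab, snd ab) \<in> I'" by simp
          from D.algD(1)[OF mem[OF this], of 0 1] show ?thesis by (simp only: ab(2))
        qed
        show "f (\<theta> x) = - f x" if f: "f \<in> ?F n" and x: "x \<in> S n" for f x
        proof -
          obtain ab where ab: "ab \<in> I'" "f = (\<lambda>x. fst ab n x 0 1)" using f by blast
          then have "(fst ab, snd ab) \<in> I'" by simp
          from D.algD(3)[OF mem[OF this] x, of 0 1] show ?thesis by (simp add: ab(2))
        qed
      qed
      then show ?thesis by auto
    qed (use D.neS[of n] in blast)
    have "\<exists>x. \<forall>n. x n \<in> S n \<and> (2 * card I' \<le> n \<longrightarrow> (\<forall>ab\<in>I'. fst ab n (x n) 0 1 = 0))"
      by (rule choice) (use ex in blast)
    then obtain x where x': "\<forall>n. x n \<in> S n \<and> (2 * card I' \<le> n \<longrightarrow> (\<forall>ab\<in>I'. fst ab n (x n) 0 1 = 0))" ..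
    have x: "x n \<in> S n" "2 * card I' \<le> n \<Longrightarrow> ab \<in> I' \<Longrightarrow> fst ab n (x n) 0 1 = 0" for n ab
      using spec[OF x', of n] by blast+
    have "K.pchar (\<lambda>n. q (x n)) \<in> K.charsp"
      by (rule K.pchar_char) (simp only: space_K, simp only: D.Kq imageI x(1))
    moreover have "K.pchar (\<lambda>n. q (x n)) \<in> ?Z ab" if ab: "ab \<in> I'" for ab
    proof -
      have P: "corner (fst ab) (snd ab) \<in> carrier B.P"
        using subsetD[OF sub ab] unfolding mem_Times_iff by (elim conjE) (rule corner_P)
      have ev: "expect (D.mbundle n) (corner (fst ab) (snd ab) n) (q (x n)) = 0" if "2 * card I' \<le> n" for n
      proof -
        have "corner (fst ab) (snd ab) n \<in> carrier (D.alg n)" using B.P_comp[OF P, of n] by (simp only: D.mbundle_simps)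
        from D.E_q[OF this x(1)] show ?thesis
          using x(2)[OF that ab] by (simp only: corner_entries[OF x(1)]) simp
      qed
      have "((\<lambda>n. expect (D.mbundle n) (corner (fst ab) (snd ab) n) (q (x n))) \<longlongrightarrow> 0) U"
        by (rule tendsto_eventually, rule eventually_mono[OF U_ge[of "2 * card I'"]]) (rule ev)
      from K.pchar_eqI[OF E_P[OF P] this] show ?thesis unfolding Ecorner_def mem_Collect_eq .
    qed
    ultimately show "K.charsp \<inter> (\<Inter>ab\<in>I'. ?Z ab) \<noteq> {}" by blast
  qed
  then obtain h where h: "h \<in> K.charsp" "h \<in> (\<Inter>ab\<in>?I. ?Z ab)" by blast
  have "h (Ecorner a b) = 0" if "a \<in> carrier B.P" "b \<in> carrier B.P" for a b
    using INT_D[OF h(2), of "(a, b)"] that by (simp only: mem_Collect_eq fst_conv snd_conv mem_Sigma_iff simp_thms)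
  then show ?thesis using h(1) by blast
qed

lemma not_factorial_N: "\<not> factorial_bundle N"
proof -
  obtain h where h: "h \<in> K.charsp" "\<And>a b. a \<in> carrier B.P \<Longrightarrow> b \<in> carrier B.P \<Longrightarrow> h (Ecorner a b) = 0"
    using degenerate_character by blast
  have mulc: "B.cls a \<otimes>\<^bsub>B.Q\<^esub> B.cls b = B.cls (\<lambda>n. a n \<otimes>\<^bsub>D.alg n\<^esub> b n)"
    if "a \<in> carrier B.P" "b \<in> carrier B.P" for a b
    using B.Q_mult[OF that] by (simp only: D.mbundle_simps)
  have mc: "(\<lambda>n. a n \<otimes>\<^bsub>D.alg n\<^esub> b n) \<in> carrier B.P"
    if "a \<in> carrier B.P" "b \<in> carrier B.P" for a b
    using B.comp_closed(1)[OF that] by (simp only: D.mbundle_simps)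
  have k2: "(0::nat) < 2" "(1::nat) < 2" by simp_all
  have idem: "B.cls (vert k) \<otimes>\<^bsub>B.Q\<^esub> B.cls (vert k) = B.cls (vert k)" if "k < 2" for k
  proof -
    have "k = 0 \<or> k = 1" using that by linarith
    then have "(vert k n \<otimes>\<^bsub>D.alg n\<^esub> vert k n) x i j = vert k n x i j" for n x i j
      by (elim disjE) (simp_all add: mmul_def vert_def)
    then have eq: "(\<lambda>n. vert k n \<otimes>\<^bsub>D.alg n\<^esub> vert k n) = vert k" by (intro ext)
    show ?thesis unfolding mulc[OF vert_P[OF that] vert_P[OF that]] eq ..
  qed
  have sa: "star B.Q (B.cls (vert k)) = B.cls (vert k)" if "k < 2" for k
  proof -
    have "star (bundle_alg (D.mbundle n)) (vert k n) x i j = vert k n x i j" for n x i j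
      by (simp add: mstar_def vert_def)
    then have eq: "(\<lambda>n. star (bundle_alg (D.mbundle n)) (vert k n)) = vert k" by (intro ext)
    show ?thesis unfolding B.Q_star[OF vert_P[OF that]] eq ..
  qed
  show ?thesis
  proof (rule not_factorial[OF wstar_N, of h "B.cls (vert 0)" "B.cls (vert 1)", unfolded N_alg])
    show "h \<in> topspace (base_space N)" using h(1) by (simp add: N_space)
    show "B.cls (vert 0) \<in> carrier B.Q" "B.cls (vert 1) \<in> carrier B.Q"
      by (rule B.cls_closed[OF vert_P[OF k2(1)]], rule B.cls_closed[OF vert_P[OF k2(2)]])
    show "B.cls (vert 0) \<otimes>\<^bsub>B.Q\<^esub> B.cls (vert 0) = B.cls (vert 0)" "B.cls (vert 1) \<otimes>\<^bsub>B.Q\<^esub> B.cls (vert 1) = B.cls (vert 1)"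
      by (rule idem[OF k2(1)], rule idem[OF k2(2)])
    show "star B.Q (B.cls (vert 0)) = B.cls (vert 0)" "star B.Q (B.cls (vert 1)) = B.cls (vert 1)"
      by (rule sa[OF k2(1)], rule sa[OF k2(2)])
    have "(vert 0 n \<oplus>\<^bsub>bundle_alg (D.mbundle n)\<^esub> vert 1 n) x i j = \<one>\<^bsub>bundle_alg (D.mbundle n)\<^esub> x i j" for n x i j
      by (auto simp: vert_def less_2_cases_iff)
    then have eq: "(\<lambda>n. vert 0 n \<oplus>\<^bsub>bundle_alg (D.mbundle n)\<^esub> vert 1 n) = (\<lambda>n. \<one>\<^bsub>bundle_alg (D.mbundle n)\<^esub>)"
      by (intro ext)
    show "B.cls (vert 0) \<oplus>\<^bsub>B.Q\<^esub> B.cls (vert 1) = \<one>\<^bsub>B.Q\<^esub>"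
      unfolding B.Q_one B.Q_add[OF vert_P[OF k2(1)] vert_P[OF k2(2)]] eq ..
    show "expect N (B.cls (vert 0)) g = 1 / 2" if "g \<in> topspace (base_space N)" for g
    proof -
      have g: "g \<in> K.charsp" using that by (simp add: N_space)
      have eq: "(\<lambda>n. expect (D.mbundle n) (vert 0 n)) = (\<lambda>n x. if x \<in> topspace (base_space (D.mbundle n)) then 1 / 2 else 0)"
      proof (intro ext)
        fix n k
        show "expect (D.mbundle n) (vert 0 n) k = (if k \<in> topspace (base_space (D.mbundle n)) then 1 / 2 else 0)"
        proof (cases "k \<in> K n")
          case True
          then obtain x where x: "x \<in> S n" "k = q x" using D.Kq by blast
          have "expect (D.mbundle n) (vert 0 n) k = 1 / 2"
            unfolding x(2) D.E_q[OF vert_alg[OF k2(1)] x(1)] using x(1) by (simp add: vert_def)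
          then show ?thesis using True by (simp only: space_K if_True)
        qed (simp add: D.desc_def)
      qed
      show ?thesis
        unfolding N_expect[OF vert_P[OF k2(1)]] eq K.G_simp
        using K.char_const[OF g, of "1 / 2"] g by (simp only: if_True)
    qed
    fix X Y assume X: "X \<in> carrier B.Q" and Y: "Y \<in> carrier B.Q"
    obtain a where a: "a \<in> carrier B.P" "X = B.cls a" using X by (rule QE)
    obtain b where b: "b \<in> carrier B.P" "Y = B.cls b" using Y by (rule QE)
    note v = vert_P[OF k2(1)] vert_P[OF k2(2)]
    have eq: "(B.cls (vert 0) \<otimes>\<^bsub>B.Q\<^esub> X \<otimes>\<^bsub>B.Q\<^esub> B.cls (vert 1)) \<otimes>\<^bsub>B.Q\<^esub> (B.cls (vert 1) \<otimes>\<^bsub>B.Q\<^esub> Y \<otimes>\<^bsub>B.Q\<^esub> B.cls (vert 0))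
       = B.cls (corner a b)"
      unfolding a(2) b(2) corner_def[abs_def] mulc[OF v(1) a(1)] mulc[OF mc[OF v(1) a(1)] v(2)]
        mulc[OF v(2) b(1)] mulc[OF mc[OF v(2) b(1)] v(1)]
        mulc[OF mc[OF mc[OF v(1) a(1)] v(2)] mc[OF mc[OF v(2) b(1)] v(1)]] ..
    show "expect N ((B.cls (vert 0) \<otimes>\<^bsub>B.Q\<^esub> X \<otimes>\<^bsub>B.Q\<^esub> B.cls (vert 1)) \<otimes>\<^bsub>B.Q\<^esub>
        (B.cls (vert 1) \<otimes>\<^bsub>B.Q\<^esub> Y \<otimes>\<^bsub>B.Q\<^esub> B.cls (vert 0))) h = 0"
      unfolding eq N_expect[OF corner_P[OF a(1) b(1)]] K.G_simp
      using h(2)[OF a(1) b(1)] h(1) unfolding Ecorner_def by (simp only: if_True)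
  qed
qed

end

section \<open>Spheres and projective spaces\<close>

definition sphere_points :: "nat \<Rightarrow> (nat \<Rightarrow> real) set" where
  "sphere_points n = {x. (\<Sum>i\<le>n. (x i)\<^sup>2) = 1 \<and> (\<forall>i>n. x i = 0)}"

lemma nsphere_top: "nsphere n = top_of_set (sphere_points n)"
  by (simp add: nsphere sphere_points_def euclidean_product_topology)

lemma compact_sphere_points: "compact (sphere_points n)"
proof -
  have "compactin (product_topology (\<lambda>_. euclidean) UNIV) (PiE UNIV (\<lambda>_. {-1..1::real}))"
    unfolding compactin_PiE by auto
  then have c: "compact (PiE UNIV (\<lambda>_::nat. {-1..1::real}))" by (simp add: euclidean_product_topology)
  have eq: "sphere_points n = {x. (\<Sum>i\<le>n. (x i)\<^sup>2) = 1} \<inter> (\<Inter>i\<in>{n<..}. {x. x i = 0})"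
    by (auto simp: sphere_points_def)
  have "closed (sphere_points n)"
    unfolding eq
    by (intro closed_Int closed_INT closed_Collect_eq ballI continuous_intros continuous_on_product_coordinates)
  moreover have "sphere_points n \<subseteq> PiE UNIV (\<lambda>_. {-1..1})"
  proof
    fix x assume "x \<in> sphere_points n"
    then have "(x i)\<^sup>2 \<le> 1" for i using topspace_nsphere_1[of x n i] by (simp add: nsphere_top)
    then have "\<bar>x i\<bar> \<le> 1" for i by (simp only: abs_square_le_1)
    then have "x i \<in> {-1..1}" for i using abs_le_D1[of "x i" 1] abs_le_D2[of "x i" 1] by simp
    then show "x \<in> PiE UNIV (\<lambda>_. {-1..1})" by (simp add: PiE_UNIV_domain)
  qed
  ultimately show ?thesis using compact_Int_closed[OF c, of "sphere_points n"] by (simp add: Int_absorb1)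
qed

text \<open>Only the first column of a matrix in \<open>point\<close> is used for the sphere, so that
  \<open>proj x\<close> is the matrix of the orthogonal projection onto the line through \<open>x\<close>.\<close>

definition column :: "(nat \<Rightarrow> real) \<Rightarrow> point" where
  "column x = (\<lambda>i j. if j = 0 then of_real (x i) else 0)"

definition antipode :: "point \<Rightarrow> point" where
  "antipode z = (\<lambda>i j. - z i j)"

definition proj :: "point \<Rightarrow> point" where
  "proj z = (\<lambda>i j. z i 0 * z j 0)"

lemma continuous_on_point:
  fixes f :: "'a::topological_space \<Rightarrow> point"
  shows "(\<And>i j. continuous_on A (\<lambda>x. f x i j)) \<Longrightarrow> continuous_on A f"
  by (intro continuous_on_coordinatewise_then_product)

lemma continuous_on_coordinate:
  fixes f :: "'a::topological_space \<Rightarrow> nat \<Rightarrow> 'b::topological_space"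
  assumes "continuous_on A f" shows "continuous_on A (\<lambda>x. f x i)"
  by (rule continuous_on_product_then_coordinatewise[OF assms])

lemma antipode_column: "antipode (column x) = column (\<lambda>i. - x i)"
  by (simp add: antipode_def column_def fun_eq_iff)

lemma sphere_points_minus: "x \<in> sphere_points n \<Longrightarrow> (\<lambda>i. - x i) \<in> sphere_points n"
  by (simp add: sphere_points_def)

lemma sphere_points_nonempty: "sphere_points n \<noteq> {}"
  using in_topspace_nsphere[of n] by (auto simp: nsphere_top)

lemma continuous_column: "continuous_on A column"
  proof (rule continuous_on_point)
  fix i j
  have "continuous_on A (\<lambda>x. complex_of_real (x i))"
    by (rule continuous_on_of_real[OF continuous_on_coordinate[OF continuous_on_id]])
  then show "continuous_on A (\<lambda>x. column x i j)" by (cases "j = 0") (simp_all add: column_def)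
qed

text \<open>One nonzero coordinate fixes the relative sign, and its products with the other
  coordinates determine them. So the projection onto a line determines a unit vector up to
  sign.\<close>

lemma equal_squares:
  assumes x: "x \<in> sphere_points n" and eq: "\<And>i j. x i * x j = y i * y j"
  shows "y = x \<or> y = (\<lambda>i. - x i)"
proof -
  have "\<exists>k. x k \<noteq> 0"
  proof (rule ccontr)
    assume "\<nexists>k. x k \<noteq> 0"
    then show False using x by (simp add: sphere_points_def)
  qed
  then obtain k where k: "x k \<noteq> 0" by blast
  have "(x k)\<^sup>2 = (y k)\<^sup>2" using eq[of k k] by (simp add: power2_eq_square)
  then consider "y k = x k" | "y k = - x k" by (metis power2_eq_iff)
  then show ?thesis
  proof cases
    case 1
    have "y i = x i" for i using eq[of i k] k 1 by simp
    then show ?thesis by auto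
  next
    case 2
    have "y i = - x i" for i
    proof -
      have "(y i + x i) * x k = 0" using eq[of i k] 2 by (simp add: distrib_right)
      then show ?thesis using k by (simp add: eq_neg_iff_add_eq_0)
    qed
    then show ?thesis by auto
  qed
qed

text \<open>The odd functions are the coordinates, \<open>Suc n\<close> in number because a sphere
  of dimension \<open>n\<close> lives in dimension \<open>n + 1\<close>.\<close>

lemma sphere_cover:
  "sphere_cover (column ` sphere_points n) (proj ` column ` sphere_points n) proj antipode (\<lambda>i z. Re (z i 0)) (Suc n)"
proof
  show "compact (column ` sphere_points n)"
    by (rule compact_continuous_image[OF continuous_column compact_sphere_points])
  show "column ` sphere_points n \<noteq> {}" using sphere_points_nonempty by simp
  have co: "continuous_on A (\<lambda>z::point. z i j)" for A i j
    using continuous_on_coordinate[OF continuous_on_coordinate[OF continuous_on_id, of A i], of j] by simp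
  show "continuous_on (column ` sphere_points n) proj"
    unfolding proj_def[abs_def] by (rule continuous_on_point) (intro continuous_on_mult co)
  show "continuous_on (column ` sphere_points n) (\<lambda>z. Re (z i 0))" for i
    by (intro continuous_on_Re co)
  show "proj ` column ` sphere_points n = proj ` column ` sphere_points n" ..
  fix z assume "z \<in> column ` sphere_points n"
  then obtain x where x: "x \<in> sphere_points n" "z = column x" by blast
  show "antipode z \<in> column ` sphere_points n"
    using sphere_points_minus[OF x(1)] by (auto simp: x(2) antipode_column)
  show "antipode (antipode z) = z" "proj (antipode z) = proj z" "Re (antipode z i 0) = - Re (z i 0)" for i
    by (simp_all add: antipode_def proj_def)
  show "(\<Sum>i<Suc n. (Re (z i 0))\<^sup>2) = 1"
    using x(1) by (simp add: x(2) column_def sphere_points_def lessThan_Suc_atMost)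
  fix w assume "w \<in> column ` sphere_points n" and eq: "proj z = proj w"
  then obtain y where y: "w = column y" by blast
  have "x i * x j = y i * y j" for i j
    using fun_cong[OF fun_cong[OF eq], of i j] unfolding x(2) y proj_def column_def
    by (simp flip: of_real_mult)
  from equal_squares[OF x(1) this] show "w = z \<or> w = antipode z"
    by (auto simp: x(2) y antipode_column)
qed

text \<open>Real and imaginary parts give \<open>2 * card F\<close> real odd functions, and the
  reduced homology of the \<open>n\<close>-sphere vanishes in all degrees below this number since it
  is at most \<open>n\<close>.\<close>

lemma sphere_common_zero:
  fixes F :: "(point \<Rightarrow> complex) set"
  assumes fin: "finite F" and card: "2 * card F \<le> n"
    and cont: "\<And>f. f \<in> F \<Longrightarrow> continuous_on (column ` sphere_points n) f"
    and odd: "\<And>f z. f \<in> F \<Longrightarrow> z \<in> column ` sphere_points n \<Longrightarrow> f (antipode z) = - f z"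
  shows "\<exists>z\<in>column ` sphere_points n. \<forall>f\<in>F. f z = 0"
proof -
  obtain e where e: "bij_betw e {0..<card F} F" using ex_bij_betw_nat_finite[OF fin] by blast
  \<comment> \<open>Even indices list the real parts, odd indices the imaginary parts.\<close>
  define g where "g i x = (if even i then Re (e (i div 2) (column x)) else Im (e (i div 2) (column x)))" for i x
  have mem: "e (i div 2) \<in> F" if "i < 2 * card F" for i
    using bij_betwE[OF e] that by simp
  have "\<exists>x\<in>topspace (nsphere n). \<forall>i<2 * card F. g i x = 0"
  proof (rule odd_functions_common_zero)
    show "continuous_map (nsphere n) (nsphere n) (\<lambda>x i. - x i)"
      unfolding nsphere_top continuous_map_in_subtopology
      by (auto simp: sphere_points_minus intro!: continuous_on_coordinatewise_then_product continuous_on_minus continuous_on_coordinate[OF continuous_on_id])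
    show "topspace (nsphere n) \<noteq> {}" using in_topspace_nsphere by blast
    show "trivial_group (reduced_homology_group (int p) (nsphere n))" if "p < 2 * card F" for p
      using trivial_reduced_homology_group_nsphere[of "int p" n] that card by simp
    fix i assume i: "i < 2 * card F"
    have c: "continuous_on (sphere_points n) (\<lambda>x. e (i div 2) (column x))"
      using continuous_on_compose[OF continuous_column cont[OF mem[OF i]]] by (simp add: o_def)
    show "continuous_map (nsphere n) euclideanreal (g i)"
      using c by (cases "even i") (auto simp: nsphere_top g_def[abs_def] intro: continuous_on_Re continuous_on_Im)
    show "g i (\<lambda>j. - x j) = - g i x" if "x \<in> topspace (nsphere n)" for x
      using odd[OF mem[OF i], of "column x"] that by (simp add: g_def nsphere_top antipode_column)
  qed simp
  then obtain x where x: "x \<in> sphere_points n" "\<And>i. i < 2 * card F \<Longrightarrow> g i x = 0"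
    by (auto simp: nsphere_top)
  have "f (column x) = 0" if f: "f \<in> F" for f
  proof -
    have "f \<in> e ` {0..<card F}" using f bij_betw_imp_surj_on[OF e] by simp
    then obtain k where k: "k < card F" "f = e k" by auto
    show ?thesis
      using x(2)[of "2 * k"] x(2)[of "2 * k + 1"] k by (simp add: g_def complex_eq_iff)
  qed
  then show ?thesis using x(1) by blast
qed

lemma sphere_cover_sequence:
  assumes "free_ultrafilter U"
  shows "cover_sequence U (\<lambda>n. column ` sphere_points n) (\<lambda>n. proj ` column ` sphere_points n) proj antipode"
proof (intro cover_sequence.intro cover_sequence_axioms.intro)
  show "ultra U" using assms by (rule ultra.intro)
  show "double_cover (column ` sphere_points n) (proj ` column ` sphere_points n) proj antipode" for n
    by (rule sphere_cover.axioms(1)[OF sphere_cover])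
qed (rule sphere_common_zero)

theorem theorem1p4:
  fixes U :: "nat filter"
  assumes "free_ultrafilter U"
  shows "\<exists>M :: nat \<Rightarrow> (element, point) wbundle.
    (\<forall>n. wstar_bundle (M n) \<and> factorial_bundle (M n)) \<and>
    wstar_bundle (tracial_ultraproduct U M) \<and>
    \<not> factorial_bundle (tracial_ultraproduct U M)"
proof -
  interpret cover_sequence U "\<lambda>n. column ` sphere_points n" "\<lambda>n. proj ` column ` sphere_points n" proj antipode
    by (rule sphere_cover_sequence[OF assms])
  show ?thesis
  proof (intro exI[of _ D.mbundle] conjI allI)
    show "wstar_bundle (D.mbundle n)" for n by (rule D.wstar_mbundle)
    show "factorial_bundle (D.mbundle n)" for n by (rule sphere_cover.factorial_mbundle[OF sphere_cover])
    show "wstar_bundle (tracial_ultraproduct U D.mbundle)" by (rule wstar_N[unfolded N_def])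
    show "\<not> factorial_bundle (tracial_ultraproduct U D.mbundle)" by (rule not_factorial_N[unfolded N_def])
  qed
qed

end
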